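(* Let $G$ be a matching covered graph and let $\mathcal{C}$ be a maximal family of nested tight cuts in $G$. Let $\kappa_{\mathcal{C}}$ be the map sending each torso $\mathcal{S}$ of $\mathcal{C}$ to the unique torsoid $\mathcal{T}$ in $G$ such that $\mathcal{S}$ cleaves $\mathcal{T}$. Then the $\kappa_{\mathcal{C}}$-pre-image of a noncyclic torsoid in $G$ consists of exactly one non-$C_4$-torso, and the $\kappa_{\mathcal{C}}$-pre-image of a cyclic torsoid $(H,\varepsilon)$ in $G$ with $n=|V(H)|$ vertices consists of exactly $\tfrac{n}{2}-1$ torsos, all of which are $C_4$-torsos.
   Context: Graphs may be infinite. For $X\subseteq V(G)$, $\partial(X)$ is the set of edges of $G$ with exactly one endpoint in $X$. For a perfect matching $M$ of $G$, $\mathrm{Perf}(G,M)$ is the set of perfect matchings of $G$ with finite symmetric difference to $M$. $G$ is matching covered with respect to $M$ if $G$ is connected and every edge of $G$ lies in some member of $\mathrm{Perf}(G,M)$; it is matching covered if this holds for some $M$. For each matching covered graph such an $M$ is arbitrary but fixed, and all notions below refer to it. Tight sets: $X\subseteq V(G)$ is tight if every $M'\in\mathrm{Perf}(G,M)$ has exactly one edge in $\partial(X)$; then $\partial(X)$ is a tight cut. A tight set $X$ is trivial if $|X|=1$ or $|V(G)\setminus X|=1$. Tight cuts $C_1,C_2$ are nested if there are disjoint $X_1,X_2\subset V(G)$ with $C_i=\partial(X_i)$. A maximal family of nested tight cuts is an inclusion-maximal set of pairwise nested tight cuts. A BoB ("brick or brace") is a matching covered graph with no non-trivial tight sets. Tight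 set partitions: a partition $\mathcal{P}$ of $V(G)$ into tight sets is a tight set partition. Its collapse is the graph with vertex set $\mathcal{P}$ in which distinct $P,Q$ are adjacent iff $G$ has an edge between $P$ and $Q$. The collapse is matching covered with respect to the perfect matching consisting of all pairs $\{P,Q\}$ of distinct classes joined by an edge of $M$, and this is its fixed matching. Torsos: a maximal star of $\mathcal{C}$ is a tight set partition $\mathcal{P}$ with at least $4$ elements such that its collapse is a BoB and $\partial(P)\in\mathcal{C}$ for every $P\in\mathcal{P}$; its collapse is then called a torso of $\mathcal{C}$ (so the vertices of a torso are subsets of $V(G)$). It is a $C_4$-torso if it is a cycle of length $4$, and a non-$C_4$-torso otherwise. Passable sets: a set $S\subseteq V(G)$ is passable for a set $P$ if $P\setminus S$ and $P\cup S$ are tight. Torsoids: a torsoid in $G$ is a pair $(H,\varepsilon)$ such that: (T1) $H$ is a matching covered graph on at least $4$ vertices that is a BoB or a cycle; (T2) the elements of $V(H)$ are tight sets of $G$; (T3) $\varepsilon\colon E(H)\to 2^{V(G)}$; (T4) the vertices of $H$ together with the sets $\varepsilon(e)$, $e\in E(H)$, form a near partition of $V(G)$ (they are pairwise disjoint with union $V(G)$; empty sets are allowed); (T5) for $vw\in E(H)$ there is an edge of $G$ from $v\cup\varepsilon(vw)$ to $w$, and $\varepsilon(vw)$ is the largest among all subsets of $v\cup\varepsilon(vw)\cup w$ that are passable for both $v$ and $w$; (T6) for distinct $v,w\in V(H)$ with $vw\notin E(H)$ there is no edge of $G$ from $v$ to $w$; (T7) if $H$ is a cycle and $v$ is a vertex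 of $H$ with neighbours $u$ and $w$, then there is no partition of $\varepsilon(uv)\cup v\cup\varepsilon(vw)$ into tight sets $P_1,P_2,P_3$ such that both $u\cup P_1\cup P_2$ and $P_2\cup P_3\cup w$ are tight. The torsoid is cyclic if $H$ is a cycle and noncyclic otherwise. Cleaving: a torso $\mathcal{S}$ cleaves a torsoid $(H,\varepsilon)$ if every vertex of $\mathcal{S}$ (a subset of $V(G)$) contains as a subset some vertex of $H$. Every torso in $G$ cleaves exactly one torsoid in $G$, so $\kappa_{\mathcal{C}}$ is well-defined. *)

theory Defs
  imports Complex_Main "HOL-Library.FuncSet" "HOL-Library.Disjoint_Sets"
begin

section \<open>Graphs and matching covered graphs\<close>

datatype 'a graph = Graph (verts: "'a set") (edges: "'a set set")

definition simple_graph :: "'a graph \<Rightarrow> bool" where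
  "simple_graph G \<longleftrightarrow> (\<forall>e \<in> edges G. e \<subseteq> verts G \<and> card e = 2)"

definition connected_graph :: "'a graph \<Rightarrow> bool" where
  "connected_graph G \<longleftrightarrow> verts G \<noteq> {} \<and>
     (\<forall>u \<in> verts G. \<forall>v \<in> verts G. (u, v) \<in> {(x, y). {x, y} \<in> edges G}\<^sup>*)"

definition is_cycle :: "'a graph \<Rightarrow> bool" where
  "is_cycle G \<longleftrightarrow> (\<exists>xs. distinct xs \<and> 3 \<le> length xs \<and> verts G = set xs \<and>
     edges G = {{xs ! i, xs ! (Suc i mod length xs)} | i. i < length xs})"

definition joined :: "'a set set \<Rightarrow> 'a set \<Rightarrow> 'a set \<Rightarrow> bool" where
  "joined F X Y \<longleftrightarrow> (\<exists>x \<in> X. \<exists>y \<in> Y. {x, y} \<in> F)"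

definition cut :: "'a graph \<Rightarrow> 'a set \<Rightarrow> 'a set set" where
  "cut G X = {e \<in> edges G. card (e \<inter> X) = 1}"

definition perfect_matching :: "'a graph \<Rightarrow> 'a set set \<Rightarrow> bool" where
  "perfect_matching G M \<longleftrightarrow> M \<subseteq> edges G \<and> (\<forall>v \<in> verts G. \<exists>!e. e \<in> M \<and> v \<in> e)"

definition Perf :: "'a graph \<Rightarrow> 'a set set \<Rightarrow> 'a set set set" where
  "Perf G M = {M'. perfect_matching G M' \<and> finite ((M - M') \<union> (M' - M))}"

text \<open>The fixed perfect matching of a matching covered graph is an explicit argument throughout.\<close>

definition matching_covered :: "'a graph \<Rightarrow> 'a set set \<Rightarrow> bool" where
  "matching_covered G M \<longleftrightarrow> simple_graph G \<and> perfect_matching G M \<and> connected_graph G \<and>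
     (\<forall>e \<in> edges G. \<exists>M' \<in> Perf G M. e \<in> M')"


section \<open>Tight sets and tight cuts\<close>

definition tight :: "'a graph \<Rightarrow> 'a set set \<Rightarrow> 'a set \<Rightarrow> bool" where
  "tight G M X \<longleftrightarrow> X \<subseteq> verts G \<and> (\<forall>M' \<in> Perf G M. card (M' \<inter> cut G X) = 1)"

definition trivial_set :: "'a graph \<Rightarrow> 'a set \<Rightarrow> bool" where
  "trivial_set G X \<longleftrightarrow> card X = 1 \<or> card (verts G - X) = 1"

definition bob :: "'a graph \<Rightarrow> 'a set set \<Rightarrow> bool" where
  "bob G M \<longleftrightarrow> matching_covered G M \<and> (\<forall>X. tight G M X \<longrightarrow> trivial_set G X)"

definition tight_cut :: "'a graph \<Rightarrow> 'a set set \<Rightarrow> 'a set set \<Rightarrow> bool" where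
  "tight_cut G M C \<longleftrightarrow> (\<exists>X. tight G M X \<and> C = cut G X)"

definition nested :: "'a graph \<Rightarrow> 'a set set \<Rightarrow> 'a set set \<Rightarrow> bool" where
  "nested G C1 C2 \<longleftrightarrow> (\<exists>X1 X2. X1 \<subseteq> verts G \<and> X2 \<subseteq> verts G \<and> X1 \<inter> X2 = {} \<and>
     C1 = cut G X1 \<and> C2 = cut G X2)"

definition nested_tight_cuts :: "'a graph \<Rightarrow> 'a set set \<Rightarrow> 'a set set set \<Rightarrow> bool" where
  "nested_tight_cuts G M \<C> \<longleftrightarrow> (\<forall>C \<in> \<C>. tight_cut G M C) \<and> pairwise (nested G) \<C>"

definition maximal_nested_tight_cuts :: "'a graph \<Rightarrow> 'a set set \<Rightarrow> 'a set set set \<Rightarrow> bool" where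
  "maximal_nested_tight_cuts G M \<C> \<longleftrightarrow> nested_tight_cuts G M \<C> \<and>
     (\<forall>\<D>. nested_tight_cuts G M \<D> \<and> \<C> \<subseteq> \<D> \<longrightarrow> \<D> = \<C>)"


section \<open>Collapses and torsos\<close>

definition tight_set_partition :: "'a graph \<Rightarrow> 'a set set \<Rightarrow> 'a set set \<Rightarrow> bool" where
  "tight_set_partition G M \<P> \<longleftrightarrow> partition_on (verts G) \<P> \<and> (\<forall>P \<in> \<P>. tight G M P)"

definition joined_pairs :: "'a set set \<Rightarrow> 'a set set \<Rightarrow> 'a set set set" where
  "joined_pairs F \<P> = {{P, Q} | P Q. P \<in> \<P> \<and> Q \<in> \<P> \<and> P \<noteq> Q \<and> joined F P Q}"

definition collapse :: "'a graph \<Rightarrow> 'a set set \<Rightarrow> 'a set graph" where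
  "collapse G \<P> = Graph \<P> (joined_pairs (edges G) \<P>)"

definition collapse_matching :: "'a set set \<Rightarrow> 'a set set \<Rightarrow> 'a set set set" where
  "collapse_matching M \<P> = joined_pairs M \<P>"

definition at_least_four :: "'a set \<Rightarrow> bool" where
  "at_least_four A \<longleftrightarrow> infinite A \<or> 4 \<le> card A"

definition maximal_star ::
  "'a graph \<Rightarrow> 'a set set \<Rightarrow> 'a set set set \<Rightarrow> 'a set set \<Rightarrow> bool" where
  "maximal_star G M \<C> \<P> \<longleftrightarrow> tight_set_partition G M \<P> \<and> at_least_four \<P> \<and>
     bob (collapse G \<P>) (collapse_matching M \<P>) \<and> (\<forall>P \<in> \<P>. cut G P \<in> \<C>)"

definition torsos :: "'a graph \<Rightarrow> 'a set set \<Rightarrow> 'a set set set \<Rightarrow> 'a set graph set" where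
  "torsos G M \<C> = {collapse G \<P> | \<P>. maximal_star G M \<C> \<P>}"

definition is_C4 :: "'a graph \<Rightarrow> bool" where
  "is_C4 S \<longleftrightarrow> is_cycle S \<and> card (verts S) = 4"


section \<open>Torsoids\<close>

definition passable :: "'a graph \<Rightarrow> 'a set set \<Rightarrow> 'a set \<Rightarrow> 'a set \<Rightarrow> bool" where
  "passable G M S P \<longleftrightarrow> S \<subseteq> verts G \<and> tight G M (P - S) \<and> tight G M (P \<union> S)"

type_synonym 'a torsoid = "'a set graph \<times> ('a set set \<Rightarrow> 'a set)"

text \<open>
  The fixed matching of the graph \<open>H\<close> of a torsoid is the one induced by \<open>M\<close>. If all sets
  \<open>\<epsilon> e\<close> are empty, then \<open>H\<close> is a collapse of \<open>G\<close> and this is its collapse matching. In general,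
  (T2) and (T4)--(T6) already force it to be a perfect matching of \<open>H\<close>; the choice matters only
  for infinite \<open>H\<close>, as the perfect matchings of a finite graph all determine the same \<open>Perf\<close>.
\<close>

definition torsoid_matching ::
  "'a set set \<Rightarrow> 'a set graph \<Rightarrow> ('a set set \<Rightarrow> 'a set) \<Rightarrow> 'a set set set" where
  "torsoid_matching M H \<epsilon> = {{v, w} | v w. {v, w} \<in> edges H \<and> joined M (v \<union> \<epsilon> {v, w}) w}"

definition torsoid_T1 :: "'a set set \<Rightarrow> 'a torsoid \<Rightarrow> bool" where
  "torsoid_T1 M = (\<lambda>(H, \<epsilon>).
     matching_covered H (torsoid_matching M H \<epsilon>) \<and> at_least_four (verts H) \<and>
     (bob H (torsoid_matching M H \<epsilon>) \<or> is_cycle H))"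

definition torsoid_T2 :: "'a graph \<Rightarrow> 'a set set \<Rightarrow> 'a torsoid \<Rightarrow> bool" where
  "torsoid_T2 G M = (\<lambda>(H, \<epsilon>). \<forall>v \<in> verts H. tight G M v)"

text \<open>The extensional function space makes torsoids with the same values on \<open>E(H)\<close> equal.\<close>

definition torsoid_T3 :: "'a graph \<Rightarrow> 'a torsoid \<Rightarrow> bool" where
  "torsoid_T3 G = (\<lambda>(H, \<epsilon>). \<epsilon> \<in> edges H \<rightarrow>\<^sub>E Pow (verts G))"

definition torsoid_T4 :: "'a graph \<Rightarrow> 'a torsoid \<Rightarrow> bool" where
  "torsoid_T4 G = (\<lambda>(H, \<epsilon>).
     disjoint (verts H) \<and> disjoint_family_on \<epsilon> (edges H) \<and>
     (\<forall>v \<in> verts H. \<forall>e \<in> edges H. v \<inter> \<epsilon> e = {}) \<and>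
     \<Union>(verts H) \<union> \<Union>(\<epsilon> ` edges H) = verts G)"

definition torsoid_T5 :: "'a graph \<Rightarrow> 'a set set \<Rightarrow> 'a torsoid \<Rightarrow> bool" where
  "torsoid_T5 G M = (\<lambda>(H, \<epsilon>). \<forall>v w. {v, w} \<in> edges H \<longrightarrow>
     joined (edges G) (v \<union> \<epsilon> {v, w}) w \<and>
     passable G M (\<epsilon> {v, w}) v \<and> passable G M (\<epsilon> {v, w}) w \<and>
     (\<forall>S. S \<subseteq> v \<union> \<epsilon> {v, w} \<union> w \<and> passable G M S v \<and> passable G M S w \<longrightarrow> S \<subseteq> \<epsilon> {v, w}))"

definition torsoid_T6 :: "'a graph \<Rightarrow> 'a torsoid \<Rightarrow> bool" where
  "torsoid_T6 G = (\<lambda>(H, \<epsilon>). \<forall>v \<in> verts H. \<forall>w \<in> verts H.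
     v \<noteq> w \<and> {v, w} \<notin> edges H \<longrightarrow> \<not> joined (edges G) v w)"

definition torsoid_T7 :: "'a graph \<Rightarrow> 'a set set \<Rightarrow> 'a torsoid \<Rightarrow> bool" where
  "torsoid_T7 G M = (\<lambda>(H, \<epsilon>). is_cycle H \<longrightarrow>
     (\<forall>u v w. {u, v} \<in> edges H \<and> {v, w} \<in> edges H \<and> u \<noteq> w \<longrightarrow>
       \<not> (\<exists>P1 P2 P3. tight G M P1 \<and> tight G M P2 \<and> tight G M P3 \<and>
            P1 \<inter> P2 = {} \<and> P1 \<inter> P3 = {} \<and> P2 \<inter> P3 = {} \<and>
            P1 \<union> P2 \<union> P3 = \<epsilon> {u, v} \<union> v \<union> \<epsilon> {v, w} \<and>
            tight G M (u \<union> P1 \<union> P2) \<and> tight G M (P2 \<union> P3 \<union> w))))"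

definition torsoids :: "'a graph \<Rightarrow> 'a set set \<Rightarrow> 'a torsoid set" where
  "torsoids G M = {T. torsoid_T1 M T \<and> torsoid_T2 G M T \<and> torsoid_T3 G T \<and> torsoid_T4 G T \<and>
     torsoid_T5 G M T \<and> torsoid_T6 G T \<and> torsoid_T7 G M T}"

definition cyclic_torsoid :: "'a torsoid \<Rightarrow> bool" where
  "cyclic_torsoid T \<longleftrightarrow> is_cycle (fst T)"

definition cleaves :: "'a set graph \<Rightarrow> 'a torsoid \<Rightarrow> bool" where
  "cleaves S T \<longleftrightarrow> (\<forall>P \<in> verts S. \<exists>v \<in> verts (fst T). v \<subseteq> P)"

text \<open>
  The map of the theorem is the restriction of \<open>kappa G M\<close> to the torsos of the given family of
  cuts; the preimage of a torsoid \<open>T\<close> is taken under this restriction.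
\<close>

definition kappa :: "'a graph \<Rightarrow> 'a set set \<Rightarrow> 'a set graph \<Rightarrow> 'a torsoid" where
  "kappa G M S = (THE T. T \<in> torsoids G M \<and> cleaves S T)"

definition kappa_preimage ::
  "'a graph \<Rightarrow> 'a set set \<Rightarrow> 'a set set set \<Rightarrow> 'a torsoid \<Rightarrow> 'a set graph set" where
  "kappa_preimage G M \<C> T = {S \<in> torsos G M \<C>. kappa G M S = T}"

end

theory Submission imports Defs begin

text \<open>
Perfect matchings that differ finitely from \<open>M\<close> are handled through their mate functions, so that a
set \<open>X\<close> is tight iff under every mate function exactly one point of \<open>X\<close> has its mate outside \<open>X\<close>.
Whether the number of such points is odd depends only on \<open>X\<close> (\<open>leave_parity\<close>). Hence a
tight set is recognized by having at most one such point (\<open>mtightI\<close>), and two tight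
sets uncross: either intersection and union, or both differences, are tight.

Tight set partitions and torsoids are two cases of one structure, a \<open>frame\<close>: tight vertices \<open>N i\<close> and
sets \<open>E i j\<close> that a mate function either preserves or joins to both \<open>N i\<close> and \<open>N j\<close>. Distributing
every \<open>E i j\<close> among its two ends turns a frame into a tight set partition, a \<open>subres\<close>, called a
resolution below, and all these partitions have the same collapse. So a torso cleaves a torsoid if it
is one of its resolutions, or, for a cycle, a resolution of a coarsening of the cycle into four arcs.

The heart of the proof locates an arbitrary tight set \<open>X\<close> in a torsoid: \<open>X\<close> or its complement lies in
a single \<open>E i j\<close>, or it lies around one vertex (\<open>bob_loc\<close>), or, in a cycle, around an odd arc
(\<open>ring_loc\<close>). Round \<open>X\<close> to the union of those classes of a resolution that it meets oddly; this is tight again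
(\<open>odd_union\<close>). For a BoB the rounded set is trivial, for a cycle it is an odd arc. What is changed
by rounding lies in the sets \<open>E i j\<close>: otherwise it would enlarge some \<open>E i j\<close>, against the maximality
in (T5), or split a vertex of a cycle into three, against (T7).

Noncyclic torsoids. Join \<open>N i\<close> and all members of the maximal nested family that lie around \<open>i\<close>. These unions
are disjoint, and distributing what remains of the sets \<open>E i j\<close> gives a resolution, whose classes
belong to the family by maximality (\<open>star_ex\<close>). Two such resolutions coincide (\<open>star_unique\<close>), which gives the unique torso.

Cyclic torsoids. An odd arc of a cycle with \<open>n\<close> vertices is a chord of an \<open>n\<close>-gon with ends of
different parity. The arcs of the members of the family form an inclusion-maximal
non-crossing set of such chords. Therefore they cut the polygon into \<open>n/2 - 1\<close> quadrilaterals
(\<open>S_count\<close>), and the argument for stars, applied to the coarsening of the cycle to four arcs,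
yields exactly one torso for every quadrilateral (\<open>Tor_card\<close>).

It remains to see that each torso cleaves exactly one torsoid. If no vertex of the torso has degree two,
a torsoid is obtained by cutting off from every class the largest pieces that can be moved to a neighbour
(\<open>deg3_B_disj\<close>, \<open>split_free\<close>). Otherwise the torso is a cycle of length four; then the same is done for a longest
ring of tight classes that refines it, where maximal length gives (T7) (\<open>ring_exists\<close>, \<open>split_seven\<close>).
Uniqueness follows by locating the vertices of two torsoids in each other (\<open>frame_pair\<close>).
\<close>

notation iff (infixr "<->" 25)

section \<open>Mate functions and tight sets\<close>

lemma even_card_involution:
 assumes "finite K" "!!x. x:K ==> f x:K" "!!x. x:K ==> f (f x) = x" "!!x. x:K ==> f x~=x"
 shows "even (card K)"
 using assms
proof (induction "card K" arbitrary: K rule: less_induct)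
 case less
 show ?case
 proof (cases "K = {}")
  case False
  then obtain x where x: "x:K" by blast
  let ?K = "K - {x, f x}"
  have fx: "f x:K" "f x~=x" using less.prems x by auto
  have K: "K = insert x (insert (f x) ?K)" using x fx by blast
  have c: "card K = Suc (Suc (card ?K))"
   using fx less.prems(1) by (subst K) auto
  have "even (card ?K)"
  proof (rule less.hyps)
   show "card ?K < card K" using c by simp
   show "finite ?K" using less.prems(1) by simp
   fix y assume y: "y:?K"
   have "f (f y) = y" "f (f x) = x" "f y:K" using y x less.prems(2,3) by auto
   thus "f y:?K" using y by auto
   show "f (f y) = y" "f y~=y" using y less.prems(3,4) by auto
  qed
  thus ?thesis using c by simp
 qed simp
qed

lemma subset_doubleton:
 assumes "L<={a, b}" "odd (card L)" shows "x:L ==> y:L ==> x = y"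
proof -
 have "card L<=2" using assms(1) card_mono[of "{a, b}" L] by (simp add: card_insert_if split: if_splits)
 hence "card L = 1" using assms(2) by (cases "card L = 0 | card L = 2") auto
 thus "x:L ==> y:L ==> x = y" by (auto simp: card_1_singleton_iff)
qed

text \<open>The functions in \<open>Mt\<close> play the role of the mate functions of the members of \<open>Perf G M\<close>. The last
assumption is what remains of connectivity: every edge lies in some matching, so a set without
leaving edges is one that all mate functions preserve. No edges are mentioned from here on.\<close>

locale mate_system =
 fixes V :: "'a set" and Mt :: "('a => 'a) set"
 assumes Mt_ne: "Mt~={}"
  and mate_in: "m:Mt ==> x:V ==> m x:V"
  and mate_mate: "m:Mt ==> x:V ==> m (m x) = x"
  and mate_neq: "m:Mt ==> x:V ==> m x~=x"
  and mate_fin: "m:Mt ==> m':Mt ==> finite {x:V. m x~=m' x}"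
  and mate_conn: "D<=V ==> D~={} ==> (!!m x. m:Mt ==> x:D ==> m x:D) ==> D = V"
begin

definition leave :: "('a => 'a) => 'a set => 'a set" where
 "leave m X = {x:X. m x~:X}"

definition mtight :: "'a set => bool" where
 "mtight X <-> X<=V & (ALL m:Mt. EX! x. x:X & m x~:X)"

definition fcut :: "'a set => bool" where
 "fcut X <-> X<=V & (ALL m:Mt. finite (leave m X))"

text \<open>The parity is the same for all mate functions (\<open>par_iff\<close>), so that one of them may be chosen. The value
is meaningless outside \<open>fcut\<close>.\<close>

definition par :: "'a set => bool" where
 "par X <-> odd (card (leave (SOME m. m:Mt) X))"

text \<open>The form in which connectivity is used: to show that a proper subset is empty, show that no mate
function leaves it.\<close>

lemma closed_empty:
 assumes "D<=V" "D~=V" "!!m x. m:Mt ==> x:D ==> m x:D"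
 shows "D = {}"
 using mate_conn[of D] assms by blast

text \<open>\<open>m\<close> and \<open>m'\<close> differ at finitely many points. Among the points of \<open>X\<close> where they differ, \<open>m\<close> pairs up those
that it matches inside \<open>X\<close>, and so does \<open>m'\<close>. So both leave \<open>X\<close> at an equal number of these points modulo two.\<close>

lemma leave_parity:
 assumes m: "m:Mt" "m':Mt" and X: "X<=V" and fin: "finite (leave m X)"
 shows "finite (leave m' X) & even (card (leave m' X)) = even (card (leave m X))"
proof -
 let ?D = "{x:V. m x~=m' x}"
 have fD: "finite ?D" by (rule mate_fin[OF m])
 have *: "even (card (leave k X Int ?D)) = even (card (X Int ?D))"
  if k: "k:{m, m'}" for k proof -
  let ?K = "{x:X Int ?D. k x:X}"
  have inv: "k x:?D" if x: "x:?D" for x proof -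
   have 1: "m x:V" "m' x:V" "m (m x) = x" "m' (m' x) = x" "m x~=m' x"
    using x mate_in[OF m(1), of x] mate_in[OF m(2), of x] mate_mate[OF m(1), of x] mate_mate[OF m(2), of x] by auto
   have "m' (m' (m x)) = m x" "m (m (m' x)) = m' x" using 1(1,2) mate_mate[OF m(2)] mate_mate[OF m(1)] by blast+
   hence "m' (m x)~=x" "m (m' x)~=x" using 1(5) by auto
   thus ?thesis using k 1 by auto
  qed
  have "even (card ?K)"
  proof (rule even_card_involution[where f = k])
   show "finite ?K" by (rule finite_subset[OF _ fD]) blast
   fix x assume x: "x:?K"
   hence "x:V" "k:Mt" using k m by auto
   thus "k (k x) = x" "k x~=x" using mate_mate mate_neq by auto
   thus "k x:?K" using x inv[of x] by auto
  qed
  moreover have "card (X Int ?D) = card (leave k X Int ?D) + card ?K" proof -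
   have "finite (leave k X Int ?D)" "finite ?K" by (rule finite_subset[OF _ fD], blast)+
   moreover have "(leave k X Int ?D) Int ?K = {}" by (auto simp: leave_def)
   ultimately have e2: "card ((leave k X Int ?D) Un ?K) = card (leave k X Int ?D) + card ?K"
    by (rule card_Un_disjoint)
   have e1: "X Int ?D = (leave k X Int ?D) Un ?K" by (auto simp: leave_def)
   show ?thesis by (rule trans[OF arg_cong[where f = card, OF e1] e2])
  qed
  ultimately show ?thesis by simp
 qed
 have eq: "leave m X - ?D = leave m' X - ?D" using X by (auto simp: leave_def)
 have f': "finite (leave m' X)" proof -
  have "leave m' X<=(leave m' X - ?D) Un ?D" by blast
  moreover have "finite ((leave m' X - ?D) Un ?D)" unfolding eq[symmetric] using fin fD by blast
  ultimately show ?thesis by (rule finite_subset)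
 qed
 have c: "card (leave k X) = card (leave k X Int ?D) + card (leave k X - ?D)"
  if "finite (leave k X)" for k proof -
  have "leave k X = (leave k X Int ?D) Un (leave k X - ?D)" by blast
  thus ?thesis using that card_Un_disjoint[of "leave k X Int ?D" "leave k X - ?D"] by auto
 qed
 show ?thesis using c[OF fin] c[OF f'] *[of m] *[of m'] eq f' by simp
qed

lemma par_iff:
 assumes "fcut X" "m:Mt" shows "par X <-> odd (card (leave m X))"
proof -
 have "(SOME m. m:Mt):Mt" using Mt_ne by (simp add: some_in_eq)
 thus ?thesis unfolding par_def using leave_parity[of m "SOME m. m:Mt" X] assms
  by (auto simp: fcut_def)
qed

lemma fcutI:
 assumes "m:Mt" "X<=V" "finite (leave m X)" shows "fcut X"
 using leave_parity[OF assms(1) _ assms(2,3)] assms(2) by (auto simp: fcut_def)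

lemma fcut_sub: "fcut X ==> X<=V" by (simp add: fcut_def)

lemma fcut_Un [intro, simp]:
 assumes "fcut A" "fcut B" shows "fcut (A Un B)"
proof -
 have "leave m (A Un B)<=leave m A Un leave m B" for m by (auto simp: leave_def)
 thus ?thesis using assms by (meson Un_least fcut_def finite_UnI finite_subset)
qed

lemma fcut_Int [intro, simp]:
 assumes "fcut A" "fcut B" shows "fcut (A Int B)"
proof -
 have "leave m (A Int B)<=leave m A Un leave m B" for m by (auto simp: leave_def)
 thus ?thesis using assms by (meson fcut_def finite_UnI finite_subset le_infI1)
qed

lemma leave_compl:
 assumes "m:Mt" "X<=V" shows "leave m (V - X) = m ` leave m X"
proof (intro equalityI subsetI)
 fix x assume x: "x:leave m (V - X)"
 hence "m x:X" "x:V" "x~:X" using assms mate_in by (auto simp: leave_def)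
 hence "m x:leave m X" "x = m (m x)" using mate_mate[OF assms(1)] by (auto simp: leave_def)
 thus "x:m ` leave m X" by blast
next fix x assume "x:m ` leave m X"
 then obtain y where y: "x = m y" "y:X" "m y~:X" "y:V" using assms(2) by (auto simp: leave_def)
 thus "x:leave m (V - X)" using mate_in[OF assms(1) y(4)] mate_mate[OF assms(1) y(4)]
  by (auto simp: leave_def)
qed

lemma fcut_compl [intro, simp]: "fcut A ==> fcut (V - A)"
 unfolding fcut_def using leave_compl by auto

lemma fcut_Diff [intro, simp]:
 assumes "fcut A" "fcut B" shows "fcut (A - B)"
proof -
 have "A - B = A Int (V - B)" using assms by (auto simp: fcut_def)
 thus ?thesis using assms by auto
qed

lemma par_Un:
 assumes "fcut A" "fcut B" "A Int B = {}"
 shows "par (A Un B) <-> (par A~=par B)"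
proof -
 obtain m where m: "m:Mt" using Mt_ne by blast
 let ?J = "{x:A. m x:B}" and ?J' = "{x:B. m x:A}"
 have V: "A<=V" "B<=V" using assms by (auto simp: fcut_def)
 have fin: "finite (leave m A)" "finite (leave m B)" using assms m by (auto simp: fcut_def)
 have J': "?J' = m ` ?J"
 proof (intro equalityI subsetI)
  fix x assume x: "x:?J'"
  thus "x:m ` ?J" using V mate_mate[OF m] x by force 
 qed (use V mate_mate[OF m] in auto)
 have inj: "inj_on m ?J" by (rule inj_on_inverseI[of _ m]) (use V mate_mate[OF m] in blast)
 have c1: "leave m A = {x:A. m x~:A Un B} Un ?J" "leave m B = {x:B. m x~:A Un B} Un ?J'"
  using assms(3) by (auto simp: leave_def)
 have c2: "leave m (A Un B) = {x:A. m x~:A Un B} Un {x:B. m x~:A Un B}"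
  by (auto simp: leave_def)
 have f: "finite {x:A. m x~:A Un B}" "finite {x:B. m x~:A Un B}" "finite ?J" "finite ?J'"
  using fin c1 by auto
 have "card (leave m A) = card {x:A. m x~:A Un B} + card ?J"
  unfolding c1 using f by (subst card_Un_disjoint) auto
 moreover have "card (leave m B) = card {x:B. m x~:A Un B} + card ?J'"
  unfolding c1 using f by (subst card_Un_disjoint) auto
 moreover have "card ?J' = card ?J" unfolding J' by (rule card_image[OF inj])
 moreover have "card (leave m (A Un B)) = card {x:A. m x~:A Un B} + card {x:B. m x~:A Un B}"
  unfolding c2 using f assms(3) by (subst card_Un_disjoint) auto
 ultimately show ?thesis using par_iff[OF assms(1) m] par_iff[OF assms(2) m] par_iff[OF fcut_Un[OF assms(1,2)] m]
  by auto
qed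

lemma par_split:
 assumes "fcut A" "fcut B" shows "par A <-> (par (A Int B)~=par (A - B))"
 using par_Un[of "A Int B" "A - B"] assms by (auto simp: Int_Diff_Un Int_Diff_disjoint)

lemma par_Diff:
 assumes "fcut A" "fcut B" "B<=A" shows "par (A - B) <-> (par A~=par B)"
 using par_split[OF assms(1,2)] assms(3) by (auto simp: Int_absorb1)

lemma par_empty [simp]: "~ par {}" by (simp add: par_def leave_def)

lemma fcut_empty [simp]: "fcut {}" by (simp add: fcut_def leave_def)

lemma mtight_sub: "mtight X ==> X<=V" by (simp add: mtight_def)

lemma mtight_ex: "mtight X ==> m:Mt ==> EX x. x:X & m x~:X"
 unfolding mtight_def by blast

lemma mtight_un: "mtight X ==> m:Mt ==> x:X ==> m x~:X ==> y:X ==> m y~:X ==> x = y"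
 unfolding mtight_def by blast

lemma mtight_un_in:
 assumes "mtight X" "m:Mt" "x:V - X" "m x:X" "y:V - X" "m y:X" shows "x = y"
proof -
 have mm: "m (m x) = x" "m (m y) = y" using assms(3,5) mate_mate[OF assms(2)] by auto
 have "m x = m y" by (rule mtight_un[OF assms(1,2)]) (use assms(3-6) mm in simp_all)
 thus ?thesis using mm by metis
qed

lemma mtight_leave: "mtight X ==> m:Mt ==> EX x. leave m X = {x}"
 unfolding mtight_def leave_def by blast

lemma mtight_ne: "mtight X ==> X~={}" using Mt_ne mtight_ex by blast

lemma mtight_neV: "mtight X ==> X~=V" using Mt_ne mtight_ex mate_in by blast

lemma mtight_fcut [intro, simp]: "mtight X ==> fcut X"
 unfolding fcut_def using mtight_leave mtight_sub by fastforce

lemma mtight_par [intro, simp]: "mtight X ==> par X"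
 using Mt_ne mtight_leave par_iff mtight_fcut by fastforce

lemma mtight_compl [intro]:
 assumes "mtight X" shows "mtight (V - X)"
 unfolding mtight_def
proof (intro conjI ballI)
 fix m assume m: "m:Mt"
 obtain x where x: "x:X" "m x~:X" using mtight_ex[OF assms m] by blast
 show "EX! x. x:V - X & m x~:V - X"
 proof
  have xV: "x:V" "m x:V" "m (m x) = x" using x m mate_in mate_mate mtight_sub[OF assms] by auto
  thus "m x:V - X & m (m x)~:V - X" using x by simp
  fix y assume y: "y:V - X & m y~:V - X"
  hence "m y:X" using mate_in[OF m] y by blast
  thus "y = m x" using x y xV by (intro mtight_un_in[OF assms m]) auto
 qed
qed auto

lemma npar_closed:
 assumes "m:Mt" "X<=V" "!!x. x:X ==> m x:X"
 shows "fcut X & ~ par X"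
proof -
 have "leave m X = {}" using assms by (auto simp: leave_def)
 thus ?thesis using fcutI[OF assms(1,2)] par_iff[of X m] assms(1) by auto
qed

text \<open>At most one leaver in every matching already gives tightness, provided the set is odd.\<close>

lemma one_leaver:
 assumes "X<=V" "!!x y. x:X ==> m x~:X ==> y:X ==> m y~:X ==> x = y"
 shows "leave m X = {} | (EX x. leave m X = {x})"
proof (cases "leave m X = {}")
 case False
 then obtain x where "x:X" "m x~:X" by (auto simp: leave_def)
 hence "leave m X = {x}" using assms(2) by (auto simp: leave_def)
 thus ?thesis by blast
qed simp

lemma mtightI_par:
 assumes X: "X<=V" "par X"
  and un: "!!m x y. m:Mt ==> x:X ==> m x~:X ==> y:X ==> m y~:X ==> x = y"
 shows "mtight X"
proof -
 have *: "leave m X = {} | (EX x. leave m X = {x})" if "m:Mt" for m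
  using one_leaver[OF X(1)] un[OF that] by blast
 have fc: "fcut X" using * X(1) by (metis fcut_def finite.emptyI finite_insert)
 show ?thesis unfolding mtight_def
 proof (intro conjI ballI X)
  fix m assume m: "m:Mt"
  then obtain x where "leave m X = {x}" using * X(2) par_iff[OF fc m] by fastforce
  hence "y:leave m X <-> y = x" for y by simp
  thus "EX! x. x:X & m x~:X" by (simp add: leave_def)
 qed
qed

text \<open>One of the mate functions leaves \<open>X\<close>, as otherwise \<open>X\<close> would be empty or everything. So the number of leaving points
is one for this mate function, hence odd for all of them.\<close>

lemma mtightI:
 assumes X: "X<=V" "X~={}" "X~=V"
  and un: "!!m x y. m:Mt ==> x:X ==> m x~:X ==> y:X ==> m y~:X ==> x = y"
 shows "mtight X"
proof (rule mtightI_par[OF X(1) _ un])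
 have *: "leave m X = {} | (EX x. leave m X = {x})" if "m:Mt" for m
  using one_leaver[OF X(1)] un[OF that] by blast
 have fc: "fcut X" using * X(1) by (metis fcut_def finite.emptyI finite_insert)
 obtain m x where "m:Mt" "x:X" "m x~:X" using closed_empty[OF X(1,3)] X(2) by blast
 hence "leave m X~={}" by (auto simp: leave_def)
 hence "card (leave m X) = 1" using *[OF `m:Mt`] by auto
 thus "par X" using par_iff[OF fc `m:Mt`] by simp
qed

text \<open>Uncrossing. A mate function leaves \<open>X \<inter> Y\<close> and \<open>X \<union> Y\<close> together at most as often as \<open>X\<close> and \<open>Y\<close>
together, which is twice; and both numbers are odd.\<close>

lemma mtight_Int_Un:
 assumes X: "mtight X" and Y: "mtight Y" and p: "par (X Int Y)"
 shows "mtight (X Int Y)" "mtight (X Un Y)"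
proof -
 have *: "mtight Z" if Z: "Z = X Int Y | Z = X Un Y" "par Z" for Z
 proof (rule mtightI_par[OF _ Z(2)])
  show "Z<=V" using Z mtight_sub[OF X] mtight_sub[OF Y] by auto
  fix m x y assume m: "m:Mt" and xy: "x:Z" "m x~:Z" "y:Z" "m y~:Z"
  obtain a where a: "leave m X = {a}" using mtight_leave[OF X m] by blast
  obtain b where b: "leave m Y = {b}" using mtight_leave[OF Y m] by blast
  have "leave m Z<={a, b}" using a b Z(1) unfolding leave_def by auto
  moreover have "odd (card (leave m Z))" using Z X Y par_iff m Z(2) by blast
  moreover have *: "x:leave m Z" "y:leave m Z" using xy by (auto simp: leave_def)
  ultimately show "x = y" using subset_doubleton[of "leave m Z" a b x y] by blast
 qed
 show "mtight (X Int Y)" using * p by blast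
 have "par (Y - X) = False" using par_split[of Y X] X Y p by (auto simp: Int_commute)
 hence "par (X Un (Y - X))" using par_Un[of X "Y - X"] X Y by auto
 thus "mtight (X Un Y)" using * by simp
qed

lemma mtight_Diff:
 assumes X: "mtight X" and Y: "mtight Y" and p: "~ par (X Int Y)"
 shows "mtight (X - Y)" "mtight (Y - X)"
proof -
 have *: "mtight (X - Y)" if X: "mtight X" and Y: "mtight Y" and p: "~ par (X Int Y)" for X Y proof -
  have "par (X - Y)" using par_split[of X Y] X Y p by auto
  moreover have "X - Y = X Int (V - Y)" using mtight_sub[OF X] by auto
  ultimately show ?thesis using mtight_Int_Un(1)[OF X mtight_compl[OF Y]] by simp
 qed
 show "mtight (X - Y)" "mtight (Y - X)" using *[OF X Y p] *[OF Y X] p by (auto simp: Int_commute)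
qed

lemma mtight_Un_sub:
 assumes "mtight X" "mtight Y" "X Int Y = Z" "mtight Z" shows "mtight (X Un Y)"
 using mtight_Int_Un(2)[of X Y] assms by auto

lemma mtight_disj3:
 assumes "mtight X" "mtight Y" "X Int Y = {}" shows "~ mtight (X Un Y)"
 using par_Un[of X Y] assms by auto

text \<open>The behaviour of a set between two tight sets to each of which it may be added: a matching either
stays inside \<open>D\<close> or connects it by one edge to either side. This is how the sets \<open>\<epsilon>\<close> of a torsoid occur.\<close>

definition bridge :: "'a set => 'a set => 'a set => bool" where
 "bridge A D B <-> (ALL m:Mt. (ALL x:D. m x:D) |
   (EX x:D. EX y:D. m x:A & m y:B & (ALL z:D. z~=x --> z~=y --> m z:D)))"

lemma bridgeI:
 assumes A: "mtight A" and B: "mtight B" and AD: "mtight (A Un D)" and BD: "mtight (B Un D)"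
  and dj: "A Int D = {}" "B Int D = {}" "A Int B = {}"
 shows "bridge A D B"
 unfolding bridge_def
proof
 fix m assume m: "m:Mt"
 have V: "A<=V" "B<=V" "D<=V" using mtight_sub AD BD by auto
 show "(ALL x:D. m x:D) |
   (EX x:D. EX y:D. m x:A & m y:B & (ALL z:D. z~=x --> z~=y --> m z:D))"
 proof (cases "ALL x:D. m x:D")
  case False
  have A1: "EX x:D. m x:A"
  proof (rule ccontr)
   assume n: "~ ?thesis"
   obtain a where a: "a:A" "m a~:A" using mtight_ex[OF A m] by blast
   have "m a~:D" using mate_mate[OF m, of a] a V n a(1) by fastforce
   moreover obtain x where "x:D" "m x~:D" using False by blast
   ultimately have "x = a" by (intro mtight_un[OF AD m, of x a]) (use a n in auto)
   thus False using `x:D` a dj by auto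
  qed
  have B1: "EX x:D. m x:B"
  proof (rule ccontr)
   assume n: "~ ?thesis"
   obtain a where a: "a:B" "m a~:B" using mtight_ex[OF B m] by blast
   have "m a~:D" using mate_mate[OF m, of a] a V n a(1) by fastforce
   moreover obtain x where "x:D" "m x~:D" using False by blast
   ultimately have "x = a" by (intro mtight_un[OF BD m, of x a]) (use a n in auto)
   thus False using `x:D` a dj by auto
  qed
  obtain x y where xy: "x:D" "m x:A" "y:D" "m y:B" using A1 B1 by blast
  have "m z:D" if z: "z:D" "z~=x" "z~=y" for z
  proof (rule ccontr)
   assume nz: "m z~:D"
   have "m z~:A" using mtight_un_in[OF A m, of z x] z xy V dj by blast
   moreover have "m y~:A" "m y~:D" using xy dj by auto
   ultimately have "z = y" by (intro mtight_un[OF AD m, of z y]) (use z xy nz in auto)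
   thus False using z by simp
  qed
  thus ?thesis using xy by blast
 qed simp
qed

lemma bridge_in: "bridge A D B ==> m:Mt ==> x:D ==> m x:A Un B Un D"
 unfolding bridge_def by (metis Un_iff)

lemma bridge_sym: "bridge A D B ==> bridge B D A"
 unfolding bridge_def by blast

lemma bridge_open:
 assumes "bridge A D B" "m:Mt" "x:D" "m x~:D"
 shows "EX x:D. m x:A" "EX x:D. m x:B"
 using assms unfolding bridge_def by metis+

lemma bridge_tight:
 assumes A: "mtight A" and b: "bridge A D B" and dj: "A Int D = {}" "B Int D = {}" "A Int B = {}" and D: "D<=V"
 shows "mtight (A Un D)"
 unfolding mtight_def
proof (intro conjI ballI)
 show "A Un D<=V" using D mtight_sub[OF A] by auto
 fix m assume m: "m:Mt"
 obtain a where a: "a:A" "m a~:A" using mtight_ex[OF A m] by blast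
 have aV: "a:V" "m (m a) = a" using a mtight_sub[OF A] mate_mate[OF m] by auto
 consider "ALL x:D. m x:D" | x y where "x:D" "y:D" "m x:A" "m y:B"
  "ALL z:D. z~=x --> z~=y --> m z:D"
  using b m unfolding bridge_def by metis
 thus "EX! x. x:A Un D & m x~:A Un D"
 proof cases
  case 1
  hence "a:A Un D & m a~:A Un D" using aV a dj a by fastforce
  moreover have "z = a" if "z:A Un D & m z~:A Un D" for z
   using that 1 mtight_un[OF A m, of z a] a by blast
  ultimately show ?thesis by blast
 next case 2
  have "m x:V" "m (m x) = x" using 2 D mate_in[OF m] mate_mate[OF m] by auto
  moreover have "m x = a" by (intro mtight_un[OF A m, of "m x" a]) (use a 2 dj calculation in auto)
  ultimately have ma: "m a = x" by simp
  have y: "y:A Un D & m y~:A Un D" using 2 dj by auto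
  moreover have "z = y" if z: "z:A Un D & m z~:A Un D" for z proof -
   have "z~=a" "z~=x" using z ma 2 by auto
   moreover have "z = a" if "z:A" using mtight_un[OF A m that _ a] z by blast
   ultimately show ?thesis using z 2(5) by blast
  qed
  ultimately show ?thesis by blast
 qed
qed

lemma bridge_npar:
 assumes A: "mtight A" and AD: "mtight (A Un D)" and dj: "A Int D = {}"
 shows "fcut D & ~ par D"
proof -
 have "D = (A Un D) - A" using dj by auto
 thus ?thesis using par_Diff[of "A Un D" A] A AD fcut_Diff[of "A Un D" A] by auto
qed

end

section \<open>Partitions into tight sets, frames and resolutions\<close>

context mate_system
begin

definition tfam :: "'i set => ('i => 'a set) => bool" where
 "tfam I Q <-> (ALL i:I. mtight (Q i)) & (ALL i:I. ALL j:I. i~=j --> Q i Int Q j = {}) &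
   (UN i:I. Q i) = V"

text \<open>Tight sets of the collapse are tight unions of classes (\<open>tight_quotient\<close>), so this says that the
collapse is a BoB.\<close>

definition bobfam :: "'i set => ('i => 'a set) => bool" where
 "bobfam I Q <-> (ALL A<=I. mtight (UN i:A. Q i) --> (EX i:I. A = {i} | A = I - {i}))"

text \<open>Suppose that \<open>X\<close> meets every class evenly. Then classes can be subtracted from \<open>X\<close> without losing tightness. For a fixed
matching, subtracting the class \<open>Q c\<close> of the point that leaves \<open>X\<close> makes another point \<open>y\<close> leave, matched into \<open>Q c\<close>.
Subtracting the class of \<open>y\<close> as well makes a third point leave, which is impossible: \<open>Q c\<close> or the class of \<open>y\<close>
would be left by two edges of the matching. This works for infinitely many classes, where parities cannot be summed.\<close>

lemma odd_class_ex:
 assumes X: "mtight X" and Q: "tfam I Q"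
 shows "EX i:I. par (X Int Q i)"
proof (rule ccontr)
 assume "~ ?thesis"
 hence np: "~ par (X Int Q i)" if "i:I" for i using that by blast
 have Qt: "mtight (Q i)" if "i:I" for i using that Q by (simp add: tfam_def)
 have Qd: "Q i Int Q j = {}" if "i:I" "j:I" "i~=j" for i j using that Q by (simp add: tfam_def)
 have Qc: "EX i:I. x:Q i" if "x:V" for x using that Q unfolding tfam_def by blast
 have XV: "X<=V" using X by (rule mtight_sub)
 obtain m where m: "m:Mt" using Mt_ne by blast
 obtain x where x: "x:X" "m x~:X" using mtight_ex[OF X m] by blast
 obtain c where c: "c:I" "x:Q c" using Qc x XV by blast
 have t1: "mtight (X - Q c)" using mtight_Diff(1)[OF X Qt[OF c(1)] np[OF c(1)]] .
 obtain y where y: "y:X" "y~:Q c" "m y~:X - Q c" using mtight_ex[OF t1 m] by blast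
 have my: "m y:Q c" using mtight_un[OF X m x y(1)] c y y by fastforce
 obtain d where d: "d:I" "y:Q d" using Qc y XV by blast
 have cd: "c~=d" using d y by blast
 hence "(X - Q c) Int Q d = X Int Q d" using Qd[OF c(1) d(1)] by blast
 hence t2: "mtight (X - Q c - Q d)" using mtight_Diff(1)[OF t1 Qt[OF d(1)]] np[OF d(1)] by simp
 obtain z where z: "z:X" "z~:Q c" "z~:Q d" "m z~:X - Q c - Q d" using mtight_ex[OF t2 m] by blast
 have zV: "z:V" "y:V" using z y XV by auto
 have "m z:X" using mtight_un[OF X m x z(1)] c z by blast
 then consider "m z:Q c" | "m z:Q d" using z by blast
 thus False
 proof cases
  case 1
  hence "z = y" using mtight_un_in[OF Qt[OF c(1)] m, of z y] zV z y my by blast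
  thus False using z d by blast
 next case 2
  have "m (m z) = z" using mate_mate[OF m zV(1)] .
  moreover have "m y~:Q d" using my Qd[OF c(1) d(1) cd] by blast
  ultimately have "m z = y" by (intro mtight_un[OF Qt[OF d(1)] m]) (use 2 d z in simp_all)
  hence "z = m y" using mate_mate[OF m zV(1)] by simp
  thus False using my z by simp
 qed
qed

lemma finite_round:
 assumes X: "mtight X" and Q: "tfam I Q" and K: "finite K" "K<=I"
 shows "EX Y. mtight Y & (ALL i:K. Y Int Q i = (if par (X Int Q i) then Q i else {})) &
  (ALL i:I - K. Y Int Q i = X Int Q i)"
 using K
proof (induction K rule: finite_induct)
 case empty
 thus ?case using X by (intro exI[of _ X]) auto
next case (insert k K)
 then obtain Y where Y: "mtight Y" "ALL i:K. Y Int Q i = (if par (X Int Q i) then Q i else {})"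
  "ALL i:I - K. Y Int Q i = X Int Q i" by blast
 have k: "k:I" "mtight (Q k)" using insert Q by (auto simp: tfam_def)
 have Qd: "Q k Int Q j = {}" if "j:I" "j~=k" for j using that k Q by (auto simp: tfam_def)
 have Yk: "Y Int Q k = X Int Q k" using Y(3) insert k by blast
 define W where "W = (if par (X Int Q k) then Y Un Q k else Y - Q k)"
 have "mtight W" unfolding W_def using mtight_Int_Un(2)[OF Y(1) k(2)] mtight_Diff(1)[OF Y(1) k(2)] Yk by simp
 moreover have Wk: "W Int Q k = (if par (X Int Q k) then Q k else {})" unfolding W_def by auto
 moreover have Wi: "W Int Q i = Y Int Q i" if "i:I" "i~=k" for i
  unfolding W_def using Qd[OF that] by auto
 moreover have "W Int Q i = (if par (X Int Q i) then Q i else {})" if "i:insert k K" for i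
 proof (cases "i = k")
  case False hence "i:K" "i:I" using that insert by auto
  thus ?thesis using Y(2) Wi False by simp
 qed (use Wk in simp)
 moreover have "W Int Q i = X Int Q i" if "i:I - insert k K" for i
  using that Wi[of i] Y(3) by simp
 ultimately show ?case by blast
qed

text \<open>Rounding. Tightness of \<open>Z\<close> concerns two edges of one matching at a time, hence at most four classes, and
finitely many classes can be rounded one after the other by uncrossing (\<open>finite_round\<close>).\<close>

lemma odd_union:
 fixes I F :: "'i set"
 assumes X: "mtight X" and Q: "tfam I Q"
 defines "Z \<equiv> {z:V. EX i:I. z:Q i & (if i:F then z:X else par (X Int Q i))}"
 shows "mtight Z"
proof -
 have Qt: "mtight (Q i)" if "i:I" for i using that Q by (simp add: tfam_def)
 have Qd: "i = j" if "i:I" "j:I" "z:Q i" "z:Q j" for i j z using that Q by (auto simp: tfam_def)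
 have Qc: "EX i:I. x:Q i" if "x:V" for x using that Q unfolding tfam_def by blast
 have QV: "Q i<=V" if "i:I" for i using mtight_sub[OF Qt[OF that]] .
 have Zi: "z:Z <-> (if i:F then z:X else par (X Int Q i))" if "i:I" "z:Q i" for z i
  using that Qd[OF _ that(1) _ that(2)] QV[OF that(1)] unfolding Z_def by blast
 show ?thesis
 proof (rule mtightI)
  show "Z<=V" unfolding Z_def by blast
  obtain i where i: "i:I" "par (X Int Q i)" using odd_class_ex[OF X Q] by blast
  have "X Int Q i~={}" using i(2) par_empty by metis
  then obtain w where "w:X" "w:Q i" by blast
  hence "w:Z" using Zi[OF i(1)] i(2) by simp
  thus "Z~={}" by blast
  obtain j where j: "j:I" "par ((V - X) Int Q j)" using odd_class_ex[OF mtight_compl[OF X] Q] by blast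
  have e: "(V - X) Int Q j = Q j - X" using QV[OF j(1)] by blast
  have ne: "Q j - X~={}" using j(2) par_empty e by metis
  have np: "~ par (X Int Q j)" using par_split[of "Q j" X] X Qt[OF j(1)] j(2) e by (simp add: Int_commute)
  obtain z where "z:Q j" "z~:X" using ne by blast
  hence "z~:Z" using Zi[OF j(1)] np by simp
  thus "Z~=V" using `z:Q j` QV[OF j(1)] by blast
 next fix m x y assume m: "m:Mt" and x: "x:Z" "m x~:Z" and y: "y:Z" "m y~:Z"
  have V: "x:V" "y:V" "m x:V" "m y:V" using x y mate_in[OF m] unfolding Z_def by auto
  obtain a b c d where abcd: "a:I" "x:Q a" "b:I" "m x:Q b" "c:I" "y:Q c" "d:I" "m y:Q d"
   using Qc V by metis
  have K: "finite ({a, b, c, d} - F)" "{a, b, c, d} - F<=I" using abcd by auto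
  obtain Y where Y: "mtight Y" "ALL i:{a, b, c, d} - F. Y Int Q i = (if par (X Int Q i) then Q i else {})"
   "ALL i:I - ({a, b, c, d} - F). Y Int Q i = X Int Q i"
   using finite_round[OF X Q K] by (elim exE conjE)
  have eq: "z:Y <-> z:Z" if "i:{a, b, c, d}" "z:Q i" for i z proof -
   have iI: "i:I" using that abcd by blast
   show ?thesis
   proof (cases "i:F")
    case True thus ?thesis using Y(3) iI Zi[OF iI that(2)] True that(2) by auto
   next case False hence "Y Int Q i = (if par (X Int Q i) then Q i else {})" using Y(2) that(1) by blast
    thus ?thesis using Zi[OF iI that(2)] False that(2) by (auto split: if_splits)
   qed
  qed
  have "x:Y" "m x~:Y" "y:Y" "m y~:Y"
   using eq[of a x] eq[of b "m x"] eq[of c y] eq[of d "m y"] abcd x y by simp_all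
  thus "x = y" by (rule mtight_un[OF Y(1) m])
 qed
qed

text \<open>Infinitely many enlargements of a tight set can be performed simultaneously: two leaving points already
occur in an enlargement by two of the \<open>D j\<close>, which is tight by uncrossing.\<close>

lemma star_union:
 assumes A: "mtight A" and D: "!!j. j:J ==> mtight (A Un D j)"
  and dj: "!!i j. i:J ==> j:J ==> i~=j ==> D i Int D j = {}"
  and ne: "A Un (UN j:J. D j)~=V"
 shows "mtight (A Un (UN j:J. D j))"
proof (rule mtightI[OF _ _ ne])
 show "A Un (UN j:J. D j)<=V" using mtight_sub[OF A] mtight_sub[OF D] by blast
 show "A Un (UN j:J. D j)~={}" using mtight_ne[OF A] by blast
 let ?Z = "A Un (UN j:J. D j)"
 fix m x y assume m: "m:Mt" and x: "x:?Z" "m x~:?Z" and y: "y:?Z" "m y~:?Z"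
 have two: "mtight (A Un D i Un D j)" if "i:J" "j:J" for i j
 proof (cases "i = j")
  case False
  have "mtight ((A Un D i) Un (A Un D j))"
   by (rule mtight_Un_sub[OF D[OF that(1)] D[OF that(2)] _ A]) (use dj[OF that False] in blast)
  moreover have "(A Un D i) Un (A Un D j) = A Un D i Un D j" by blast
  ultimately show ?thesis by simp
 qed (use D that in simp)
 show "x = y"
 proof (cases "J = {}")
  case True thus ?thesis using mtight_un[OF A m] x y by simp
 next case False
  then obtain i j where "i:J" "j:J" "x:A Un D i" "y:A Un D j" using x y by blast
  thus ?thesis using x y by (intro mtight_un[OF two[of i j] m]) auto
 qed
qed

definition nest :: "'a set => 'a set => bool" where
 "nest X Y <-> X Int Y = {} | X<=Y | Y<=X | X Un Y = V"

text \<open>The maximal nested families of tight cuts, given by the family of all sides of their cuts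
(\<open>maximal_mnf\<close>).\<close>

definition mnf :: "'a set set => bool" where
 "mnf \<X> <-> (ALL X:\<X>. mtight X) & (ALL X:\<X>. V - X:\<X>) & (ALL X:\<X>. ALL Y:\<X>. nest X Y) &
   (ALL Y. mtight Y --> (ALL X:\<X>. nest X Y) --> Y:\<X>)"

lemma nest_compl: "X<=V ==> Y<=V ==> nest (V - X) Y <-> nest X Y"
 unfolding nest_def by blast

lemma nest_sym: "nest X Y ==> nest Y X"
 unfolding nest_def by blast

end

text \<open>Common generalization of tight set partitions (all \<open>E i j\<close> empty) and of torsoids (\<open>N\<close> the identity on
the vertices, \<open>E v w\<close> the set \<open>\<epsilon>\<close> of an edge \<open>vw\<close>, and empty for nonadjacent \<open>v\<close>, \<open>w\<close>). The index type leaves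
room for cycles, which are indexed by \<open>{..<n}\<close>.\<close>

locale frame = mate_system V Mt for V :: "'a set" and Mt +
 fixes I :: "'i set" and N :: "'i => 'a set" and E :: "'i => 'i => 'a set"
 assumes N_tight: "i:I ==> mtight (N i)"
  and N_disj: "i:I ==> j:I ==> i~=j ==> N i Int N j = {}"
  and E_sym: "i:I ==> j:I ==> E i j = E j i"
  and E_refl: "E i i = {}"
  and NE_disj: "i:I ==> j:I ==> k:I ==> N k Int E i j = {}"
  and E_disj: "i:I ==> j:I ==> k:I ==> l:I ==> {i, j}~={k, l} ==> E i j Int E k l = {}"
  and NE_tight: "i:I ==> j:I ==> i~=j ==> mtight (N i Un E i j)"
  and cover: "V = (UN i:I. N i) Un (UN i:I. UN j:I. E i j)"
  and two: "EX i:I. EX j:I. i~=j"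
begin

definition U :: "'i => 'a set" where "U i = N i Un (UN j:I. E i j)"

text \<open>\<open>m\<close> matches \<open>N i\<close> towards \<open>N j\<close>, possibly through \<open>E i j\<close>. These pairs form a perfect matching of the
index set (\<open>lk_un\<close>, \<open>lk_sym\<close>, \<open>lk_ex\<close>).\<close>

definition lk :: "('a => 'a) => 'i => 'i => bool" where
 "lk m i j <-> i~=j & (EX x:N i. m x:N j Un E i j)"

definition adj :: "'i => 'i => bool" where
 "adj i j <-> (EX m:Mt. lk m i j)"

lemma N_V: "i:I ==> N i<=V" using N_tight mtight_sub by blast

lemma N_ne: "i:I ==> N i~={}" using N_tight mtight_ne by blast

lemma E_V: "i:I ==> j:I ==> E i j<=V"
 using NE_tight[of i j] mtight_sub[of "N i Un E i j"] E_refl by (cases "i = j") auto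

lemma E_fcut: "i:I ==> j:I ==> fcut (E i j) & ~ par (E i j)"
 using bridge_npar[OF N_tight NE_tight, of i j] NE_disj[of i j i] E_refl[of i] by (cases "i = j") auto

lemma br: "i:I ==> j:I ==> i~=j ==> bridge (N i) (E i j) (N j)"
 using NE_tight[of i j] NE_tight[of j i] E_sym[of i j] NE_disj[of i j i] NE_disj[of i j j] N_disj[of i j]
 by (intro bridgeI N_tight) auto

lemma E_in:
 assumes "i:I" "j:I" "m:Mt" "x:E i j" shows "m x:N i Un N j Un E i j"
 using bridge_in[OF br[OF assms(1,2)] assms(3,4)] E_refl[of i] assms(4) by (cases "i = j") auto

lemma lk_leaver:
 assumes "i:I" "j:I" "m:Mt" "lk m i j" "x:N i" "m x~:N i"
 shows "m x:N j Un E i j"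
proof -
 obtain y where y: "y:N i" "m y:N j Un E i j" and ij: "i~=j" using assms(4) unfolding lk_def by blast
 show ?thesis using y NE_disj[OF assms(1,2,1)] N_disj[OF assms(1,2) ij] mtight_un[OF N_tight[OF assms(1)] assms(3) y(1) _ assms(5,6)] y by blast
qed

lemma lk_un:
 assumes i: "i:I" "j:I" "k:I" and m: "m:Mt" and l: "lk m i j" "lk m i k" shows "j = k"
proof (rule ccontr)
 assume jk: "j~=k"
 obtain y where y: "y:N i" "m y:N j Un E i j" using l(1) unfolding lk_def by blast
 have ij: "i~=j" "i~=k" using l unfolding lk_def by auto
 have "m y:N k Un E i k" using y NE_disj[OF i(1,2,1)] N_disj[OF i(1,2) ij(1)] lk_leaver[OF i(1,3) m l(2) y(1)] by blast
 moreover have "{i, j}~={i, k}" using jk by (auto simp: doubleton_eq_iff)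
 hence "E i j Int E i k = {}" using E_disj[OF i(1,2,1,3)] by blast
 ultimately show False using y N_disj[OF i(2,3) jk] NE_disj[OF i(1,2,3)] NE_disj[OF i(1,3,2)] by blast
qed

lemma lk_sym:
 assumes i: "i:I" "j:I" and m: "m:Mt" and l: "lk m i j" shows "lk m j i"
proof -
 obtain x where x: "x:N i" "m x:N j Un E i j" and ij: "i~=j" using l unfolding lk_def by blast
 have mm: "m (m x) = x" using mate_mate[OF m] x N_V[OF i(1)] by blast
 show ?thesis
 proof (cases "m x:N j")
  case True thus ?thesis unfolding lk_def using mm x ij by (intro conjI bexI[of _ "m x"]) auto
 next case False hence "m x:E i j" "m (m x)~:E i j" using x mm NE_disj[OF i(1,2,1)] by auto
  then obtain y where y: "y:E i j" "m y:N j" using bridge_open(2)[OF br[OF i ij] m] by blast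
  have "m (m y) = y" using mate_mate[OF m] y E_V[OF i] by blast
  thus ?thesis unfolding lk_def using y ij E_sym[OF i] by (intro conjI bexI[of _ "m y"]) auto
 qed
qed

lemma nlk_closed:
 assumes i: "i:I" "j:I" and m: "m:Mt" and l: "~ lk m i j" and x: "x:E i j" shows "m x:E i j"
proof (rule ccontr)
 assume n: "m x~:E i j"
 have ij: "i~=j" using x E_refl by auto
 obtain y where y: "y:E i j" "m y:N i" using bridge_open(1)[OF br[OF i ij] m x n] by blast
 have "m (m y) = y" using mate_mate[OF m] y E_V[OF i] by blast
 hence "lk m i j" unfolding lk_def using y ij by (intro conjI bexI[of _ "m y"]) auto
 thus False using l by simp
qed

lemma lk_closed:
 assumes i: "i:I" "j:I" and m: "m:Mt" and l: "lk m i j" and x: "x:N i Un E i j Un N j"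
 shows "m x:N i Un E i j Un N j"
 using x E_in[OF i m] lk_leaver[OF i m l] lk_leaver[OF i(2,1) m lk_sym[OF i m l]] E_sym[OF i] by blast

lemma lk_ex:
 assumes i: "i:I" and m: "m:Mt" shows "EX j:I. lk m i j"
proof -
 obtain x where x: "x:N i" "m x~:N i" using mtight_ex[OF N_tight[OF i] m] by blast
 have xV: "m x:V" "m (m x) = x" using x N_V[OF i] mate_in[OF m] mate_mate[OF m] by blast+
 then consider j where "j:I" "m x:N j" | a b where "a:I" "b:I" "m x:E a b" using cover by blast
 thus ?thesis
 proof cases
  case 1
  hence "lk m i j" unfolding lk_def using x by blast
  thus ?thesis using 1 by blast
 next case 2
  have "x:N a Un N b" using E_in[OF 2(1,2) m 2(3)] xV NE_disj[OF 2(1,2) i] x by auto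
  hence "i = a | i = b" using N_disj[OF i] 2 x by blast
  moreover have "a~=b" using 2 E_refl by auto
  ultimately have "lk m i a | lk m i b" unfolding lk_def using x 2 E_sym[OF 2(1,2)] by blast
  thus ?thesis using 2 by blast
 qed
qed

lemma adj_sym: "i:I ==> j:I ==> adj i j ==> adj j i"
 unfolding adj_def using lk_sym by blast

lemma nadj_E:
 assumes "i:I" "j:I" "~ adj i j" shows "E i j = {}"
proof (rule closed_empty)
 show "E i j<=V" by (rule E_V[OF assms(1,2)])
 show "E i j~=V" using NE_disj[OF assms(1,2,1)] N_V[OF assms(1)] N_ne[OF assms(1)] by blast
 fix m x assume "m:Mt" "x:E i j"
 thus "m x:E i j" using nlk_closed[OF assms(1,2)] assms(3) unfolding adj_def by blast
qed

lemma N_sub_U: "N i<=U i" unfolding U_def by blast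

lemma E_sub_U: "j:I ==> E i j<=U i" unfolding U_def by blast

lemma N_Int_U: "i:I ==> j:I ==> i~=j ==> N j Int U i = {}"
 unfolding U_def using N_disj[of i j] NE_disj[of i _ j] by blast

lemma U_V: "i:I ==> U i<=V" unfolding U_def using N_V E_V by blast

lemma E_Int_E:
 assumes "i:I" "j:I" "k:I" "j~=k" shows "E i j Int E i k = {}"
 using E_disj[OF assms(1,2,1,3)] assms(4) by (auto simp: doubleton_eq_iff)

lemma U_Int_U:
 assumes "i:I" "j:I" "i~=j" shows "U i Int U j = E i j"
proof
 show "E i j<=U i Int U j" using E_sub_U[OF assms(2), of i] E_sub_U[OF assms(1), of j] E_sym[OF assms(1,2)] by auto
 show "U i Int U j<=E i j"
 proof
  fix x assume x: "x:U i Int U j"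
  hence "x~:N i" "x~:N j" using N_Int_U[OF assms] N_Int_U[OF assms(2,1)] assms(3) by auto
  then obtain k l where kl: "k:I" "l:I" "x:E i k" "x:E j l" using x unfolding U_def by blast
  thus "x:E i j" using E_disj[OF assms(1) kl(1) assms(2) kl(2)] kl assms(3) by fast
 qed
qed

lemma E_Int_U:
 assumes "i:I" "a:I" "b:I" "i~=a" "i~=b" shows "E a b Int U i = {}"
proof -
 have "E a b Int E i j = {}" if "j:I" for j
  using E_disj[OF assms(2,3,1) that] assms(4,5) by (auto simp: doubleton_eq_iff)
 thus ?thesis unfolding U_def using NE_disj[OF assms(2,3,1)] by blast
qed

text \<open>Otherwise \<open>N i \<union> E i j \<union> N j\<close> would be closed under all mate functions.\<close>

lemma not_only_nbr:
 assumes i: "i:I" "j:I" "k:I" and d: "i~=j" "k~=i" "k~=j"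
 shows "EX m:Mt. ~ lk m i j"
proof (rule ccontr)
 assume "~ ?thesis"
 hence *: "lk m i j" if "m:Mt" for m using that by blast
 have "N i Un E i j Un N j = V"
 proof (rule mate_conn)
  show "N i Un E i j Un N j<=V" using N_V E_V i by blast
  show "N i Un E i j Un N j~={}" using N_ne[OF i(1)] by blast
  fix m x assume "m:Mt" "x:N i Un E i j Un N j"
  thus "m x:N i Un E i j Un N j" using lk_closed[OF i(1,2)] * by blast
 qed
 hence "N k<=N i Un E i j Un N j" using N_V[OF i(3)] by blast
 thus False using N_ne[OF i(3)] N_disj[OF i(3,1)] N_disj[OF i(3,2)] NE_disj[OF i] d by blast
qed

text \<open>A resolution: a tight set partition that arises by dividing each \<open>E i j\<close> between its two ends.\<close>

definition subres :: "('i => 'a set) => bool" where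
 "subres Q <-> (ALL i:I. N i<=Q i & Q i<=U i) & (ALL i:I. ALL j:I. i~=j --> Q i Int Q j = {}) &
   (UN i:I. Q i) = V & (ALL i:I. ALL j:I. i~=j --> mtight (N i Un (Q i Int E i j)))"

lemma star_tight:
 assumes i: "i:I" and Q: "N i<=Q" "Q<=U i"
  and t: "!!j. j:I ==> j~=i ==> mtight (N i Un (Q Int E i j))"
 shows "mtight Q"
proof -
 let ?J = "I - {i}"
 have eq: "Q = N i Un (UN j:?J. Q Int E i j)" using Q E_refl unfolding U_def by fastforce
 obtain j where j: "j:I" "j~=i" using two by metis
 have "mtight (N i Un (UN j:?J. Q Int E i j))"
 proof (rule star_union[OF N_tight[OF i]])
  show "mtight (N i Un (Q Int E i j))" if "j:?J" for j using t that by blast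
  show "(Q Int E i k) Int (Q Int E i l) = {}" if "k:?J" "l:?J" "k~=l" for k l
   using E_Int_E[OF i, of k l] that by blast
  show "N i Un (UN j:?J. Q Int E i j)~=V"
   using eq Q N_Int_U[OF i j(1)] j N_ne[OF j(1)] N_V[OF j(1)] by blast
 qed
 thus ?thesis using eq by simp
qed

lemma subresD:
 assumes "subres Q"
 shows "i:I ==> N i<=Q i" "i:I ==> Q i<=U i" "i:I ==> j:I ==> i~=j ==> Q i Int Q j = {}"
  "(UN i:I. Q i) = V" "i:I ==> j:I ==> i~=j ==> mtight (N i Un (Q i Int E i j))"
  "i:I ==> mtight (Q i)"
proof -
 show "i:I ==> mtight (Q i)" by (rule star_tight) (use assms in \<open>auto simp: subres_def\<close>)
qed (use assms in \<open>simp_all add: subres_def\<close>)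

lemma subres_tfam: "subres Q ==> tfam I Q"
 unfolding tfam_def using subresD(3,6)[of Q] subresD(4)[of Q] by simp

lemma subres_E:
 assumes Q: "subres Q" and i: "i:I" "j:I" shows "E i j<=Q i Un Q j"
proof
 fix x assume x: "x:E i j"
 obtain k where k: "k:I" "x:Q k" using subresD(4)[OF Q] E_V[OF i] x by blast
 thus "x:Q i Un Q j" using subresD(2)[OF Q k(1)] E_Int_U[OF k(1) i] x k by fast
qed

lemma subres_N:
 assumes Q: "subres Q" and i: "i:I" "j:I" "i~=j" shows "N j Int Q i = {}"
 using subresD(1)[OF Q i(2)] subresD(3)[OF Q i] by blast

lemma subres_lk:
 assumes Q: "subres Q" and i: "i:I" "j:I" and m: "m:Mt"
 shows "lk m i j <-> i~=j & (EX x:Q i. m x:Q j)"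
proof -
 have *: "k~=i & (EX x:Q i. m x:Q k)" if k: "k:I" and l: "lk m i k" for k proof -
  have ik: "i~=k" using l unfolding lk_def by blast
  obtain a where a: "a:N i" "m a~:N i" using mtight_ex[OF N_tight[OF i(1)] m] by blast
  have ma: "m a:N k Un E i k" using lk_leaver[OF i(1) k m l a] .
  have sub: "N i<=Q i" "N k<=Q k" "E i k<=Q i Un Q k"
   using subresD(1)[OF Q] subres_E[OF Q i(1) k] i k by auto
  show ?thesis
  proof (cases "m a:Q k")
   case True thus ?thesis using a sub ik by blast
  next case False hence "m a:Q i Int E i k" using ma sub by blast
   moreover obtain z where z: "z:N i Un (Q i Int E i k)" "m z~:N i Un (Q i Int E i k)"
    using mtight_ex[OF subresD(5)[OF Q i(1) k ik] m] by blast
   ultimately have "z~:N i" using mtight_un[OF N_tight[OF i(1)] m a, of z] z by blast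
   hence "z:E i k" "z:Q i" using z by auto
   hence "m z:Q k" using E_in[OF i(1) k m] z sub by blast
   thus ?thesis using `z:Q i` ik by blast
  qed
 qed
 show ?thesis
 proof
  show "lk m i j ==> i~=j & (EX x:Q i. m x:Q j)" using *[OF i(2)] by blast
  assume r: "i~=j & (EX x:Q i. m x:Q j)"
  then obtain x where x: "x:Q i" "m x:Q j" by blast
  obtain k where k: "k:I" "lk m i k" using lk_ex[OF i(1) m] by blast
  obtain y where y: "y:Q i" "m y:Q k" "k~=i" using *[OF k] by blast
  have "m x~:Q i" "m y~:Q i" using x y r subresD(3)[OF Q i] subresD(3)[OF Q i(1) k(1)] by auto
  hence "j = k" using mtight_un[OF subresD(6)[OF Q i(1)] m] x y x y subresD(3)[OF Q i(2) k(1)] by auto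
  thus "lk m i j" using k by simp
 qed
qed

text \<open>A tournament chooses an end for each \<open>E i j\<close>; \<open>res\<close> is the resolution in which every \<open>E i j\<close>
goes to one end as a whole.\<close>

definition tour :: "('i => 'i => bool) => bool" where
 "tour h <-> (ALL i j. i~=j --> h i j = (~ h j i))"

definition res :: "('i => 'i => bool) => 'i => 'a set" where
 "res h i = N i Un (UN j:{j:I. h i j}. E i j)"

lemma tour_ex: "EX h. tour h"
proof -
 from well_order_on[of "UNIV :: 'i set"] obtain r where r: "well_order_on (UNIV :: 'i set) r" ..
 hence "total_on UNIV r" "antisym r"
  by (simp_all add: well_order_on_def linear_order_on_def partial_order_on_def)
 hence "tour (%i j. (i, j):r)"
  unfolding tour_def total_on_def antisym_def by blast
 thus ?thesis by blast
qed

lemma res_Int_E: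
 assumes i: "i:I" "j:I" shows "res h i Int E i j = (if h i j then E i j else {})"
proof -
 have "E i k Int E i j = {}" if "k:I" "k~=j" for k using E_Int_E[OF i(1) that(1) i(2) that(2)] .
 hence dis: "res h i Int E i j = {}" if "~ h i j"
  unfolding res_def using NE_disj[OF i i(1)] that by blast
 have "E i j<=res h i" if "h i j" unfolding res_def using i that by blast
 thus ?thesis using dis by (simp add: Int_absorb1)
qed

lemma subres_res:
 assumes h: "tour h" shows "subres (res h)"
 unfolding subres_def
proof (intro conjI ballI impI)
 fix i assume i: "i:I"
 show "N i<=res h i" unfolding res_def by blast
 show U: "res h i<=U i" unfolding res_def U_def by blast
 fix j assume j: "j:I" and ij: "i~=j"
 have "x~:res h j" if x: "x:res h i" for x
 proof
  assume xj: "x:res h j"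
  hence "x:U i Int U j" using x unfolding res_def U_def by blast
  hence "x:E i j" using U_Int_U[OF i j ij] by blast
  hence "res h i Int E i j~={}" "res h j Int E j i~={}" using x xj E_sym[OF i j] by auto
  hence "h i j" "h j i" using res_Int_E[OF i j, of h] res_Int_E[OF j i, of h] by metis+
  thus False using h ij unfolding tour_def by blast
 qed
 thus "res h i Int res h j = {}" by blast
 show "mtight (N i Un (res h i Int E i j))"
  using res_Int_E[OF i j, of h] NE_tight[OF i j ij] N_tight[OF i] by simp
next show "(UN i:I. res h i) = V"
 proof
  show "(UN i:I. res h i)<=V" unfolding res_def using N_V E_V by blast
  show "V<=(UN i:I. res h i)"
  proof
   fix x assume "x:V"
   then consider i where "i:I" "x:N i" | i j where "i:I" "j:I" "x:E i j" using cover by blast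
   thus "x:(UN i:I. res h i)"
   proof cases
    case 2
    hence "i~=j" using E_refl by auto
    hence "h i j | h j i" using h unfolding tour_def by blast
    thus ?thesis using 2 E_sym[OF 2(1,2)] unfolding res_def by blast
   qed (auto simp: res_def)
  qed
 qed
qed

end

section \<open>Perfect matchings of graphs and of their collapses\<close>

definition mate :: "'a set set => 'a => 'a" where
 "mate K v = (THE u. {v, u}:K)"

definition mates :: "'a graph => 'a set set => ('a => 'a) set" where
 "mates G M = mate ` Perf G M"

lemma mate_props:
 assumes G: "simple_graph G" and K: "perfect_matching G K" and v: "v:verts G"
 shows "{v, mate K v}:K" "mate K v:verts G" "mate K v~=v" "{v, u}:K ==> u = mate K v"
proof -
 obtain e where e: "e:K" "v:e" and un: "!!e'. e':K ==> v:e' ==> e' = e"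
  using K v unfolding perfect_matching_def by metis
 have eG: "e<=verts G" "card e = 2" using e K G unfolding perfect_matching_def simple_graph_def by auto
 obtain a b where ab: "e = {a, b}" "a~=b" using eG(2) by (auto simp: card_2_iff)
 define w where "w = (if v = a then b else a)"
 have w: "e = {v, w}" "w~=v" using ab e(2) unfolding w_def by auto
 have u: "u = w" if "{v, u}:K" for u proof -
  show ?thesis using un[OF that] w(1) w(2) by blast
 qed
 have "{v, w}:K" using e(1) w(1) by simp
 hence m: "mate K v = w" unfolding mate_def by (rule the_equality) (rule u)
 show "{v, mate K v}:K" "mate K v:verts G" "mate K v~=v" using m w e eG by auto
 show "{v, u}:K ==> u = mate K v" using u m by simp
qed

lemma mate_invol:
 assumes "simple_graph G" "perfect_matching G K" "v:verts G"
 shows "mate K (mate K v) = v"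
proof -
 have "{mate K v, v}:K" using mate_props(1)[OF assms] by (simp add: insert_commute)
 thus ?thesis using mate_props(4)[OF assms(1,2) mate_props(2)[OF assms]] by metis
qed

lemma PerfD: "K:Perf G M ==> perfect_matching G K"
 unfolding Perf_def by blast

lemma Perf_self: "perfect_matching G M ==> M:Perf G M"
 unfolding Perf_def by simp

lemma simple_edge:
 assumes "simple_graph G" "{x, y}:edges G" shows "x:verts G" "y:verts G" "x~=y"
 using assms unfolding simple_graph_def by force+

lemma simple_edgeE:
 assumes "simple_graph G" "e:edges G" obtains x y where "e = {x, y}" "x~=y" "x:verts G" "y:verts G"
proof -
 have "card e = 2" "e<=verts G" using assms unfolding simple_graph_def by auto
 thus ?thesis using that by (auto simp: card_2_iff)
qed

lemma mc_simple: "matching_covered G M ==> simple_graph G"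
 and mc_pm: "matching_covered G M ==> perfect_matching G M"
 and mc_conn: "matching_covered G M ==> connected_graph G"
 unfolding matching_covered_def by auto

lemma edge_mate:
 assumes "matching_covered G M" "{x, y}:edges G" shows "EX K:Perf G M. {x, y}:K & mate K x = y"
proof -
 obtain K where K: "K:Perf G M" "{x, y}:K" using assms unfolding matching_covered_def by blast
 have "mate K x = y"
  by (rule mate_props(4)[OF mc_simple[OF assms(1)] PerfD[OF K(1)] simple_edge(1)[OF mc_simple[OF assms(1)] assms(2)] K(2), symmetric])
 thus ?thesis using K by blast
qed

lemma mate_edge:
 assumes "matching_covered G M" "m:mates G M" "x:verts G" shows "{x, m x}:edges G"
proof -
 obtain K where K: "K:Perf G M" "m = mate K" using assms(2) unfolding mates_def by blast
 have "{x, mate K x}:K" by (rule mate_props(1)[OF mc_simple[OF assms(1)] PerfD[OF K(1)] assms(3)])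
 moreover have "K<=edges G" using PerfD[OF K(1)] unfolding perfect_matching_def by simp
 ultimately show ?thesis using K(2) by blast
qed

lemma finite_Perf_diff:
 assumes "K:Perf G M" "K':Perf G M" shows "finite (K - K')"
proof -
 have "finite ((M - K') Un (K - M))" using assms unfolding Perf_def by auto
 thus ?thesis by (rule rev_finite_subset) blast
qed

lemma mates_fin:
 assumes mc: "matching_covered G M" and K: "K:Perf G M" "K':Perf G M"
 shows "finite {x:verts G. mate K x~=mate K' x}"
proof (rule finite_subset)
 note sg = mc_simple[OF mc]
 show "{x:verts G. mate K x~=mate K' x}<=\<Union>(K - K')"
 proof
  fix x assume "x:{x:verts G. mate K x~=mate K' x}"
  hence x: "x:verts G" "mate K x~=mate K' x" by auto
  have "{x, mate K x}:K" using mate_props(1)[OF sg PerfD[OF K(1)] x(1)] .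
  moreover have "{x, mate K x}~:K'" using mate_props(4)[OF sg PerfD[OF K(2)] x(1)] x(2) by blast
  ultimately show "x:\<Union>(K - K')" by blast
 qed
 have "finite e" if "e:K - K'" for e proof -
  have "card e = 2" using that sg PerfD[OF K(1)] unfolding perfect_matching_def simple_graph_def by blast
  thus ?thesis using card.infinite by fastforce
 qed
 thus "finite (\<Union>(K - K'))" using finite_Perf_diff[OF K] by blast
qed

lemma mates_system:
 assumes mc: "matching_covered G M" shows "mate_system (verts G) (mates G M)"
proof
 note sg = mc_simple[OF mc]
 show "mates G M~={}" unfolding mates_def using Perf_self[OF mc_pm[OF mc]] by blast
 fix m x assume m: "m:mates G M" and x: "x:verts G"
 then obtain K where K: "perfect_matching G K" "m = mate K" unfolding mates_def using PerfD by blast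
 show "m x:verts G" unfolding K(2) by (rule mate_props(2)[OF sg K(1) x])
 show "m (m x) = x" unfolding K(2) by (rule mate_invol[OF sg K(1) x])
 show "m x~=x" unfolding K(2) by (rule mate_props(3)[OF sg K(1) x])
next fix m m' assume "m:mates G M" "m':mates G M"
 thus "finite {x:verts G. m x~=m' x}" using mates_fin[OF mc] unfolding mates_def by blast
next fix D assume D: "D<=verts G" "D~={}" and cl: "!!m x. m:mates G M ==> x:D ==> m x:D"
 obtain d where d: "d:D" using D by blast
 have "y:D" if y: "y:verts G" for y proof -
  have "(d, y):{(x, y). {x, y}:edges G}\<^sup>*"
   using mc_conn[OF mc] d D y unfolding connected_graph_def by blast
  thus ?thesis
  proof (induction rule: rtrancl_induct)
   case (step y z)
   hence "{y, z}:edges G" by simp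
   then obtain K where "K:Perf G M" "mate K y = z" using edge_mate[OF mc] by blast
   thus ?case using cl[of "mate K" y] step unfolding mates_def by blast
  qed (rule d)
 qed
 thus "D = verts G" using D by blast
qed

lemma cut_iff:
 assumes "simple_graph G" "{x, y}:edges G"
 shows "{x, y}:cut G X <-> (x:X)~=(y:X)"
 using simple_edge(3)[OF assms] assms(2) unfolding cut_def by (auto simp: Int_insert_left)

lemma card1_ex1: "card S = 1 <-> (EX! x. x:S)"
 by (auto simp: card_1_singleton_iff)

lemma tight_iff:
 assumes mc: "matching_covered G M"
 shows "tight G M X <-> mate_system.mtight (verts G) (mates G M) X"
proof -
 interpret mate_system "verts G" "mates G M" by (rule mates_system[OF mc])
 note sg = mc_simple[OF mc]
 have main: "card (K Int cut G X) = 1 <-> (EX! x. x:X & mate K x~:X)"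
  if X: "X<=verts G" and K: "K:Perf G M" for K proof -
  note pm = PerfD[OF K]
  let ?S = "{x:X. mate K x~:X}"
  have KE: "K<=edges G" using pm unfolding perfect_matching_def by blast
  have "bij_betw (%x. {x, mate K x}) ?S (K Int cut G X)"
  proof (rule bij_betwI')
   fix x y assume "x:?S" "y:?S"
   thus "({x, mate K x} = {y, mate K y}) = (x = y)" by (auto simp: doubleton_eq_iff)
  next fix x assume x: "x:?S"
   thus "{x, mate K x}:K Int cut G X" using mate_props(1)[OF sg pm] X cut_iff[OF sg, of x "mate K x" X] KE x by blast
  next fix e assume e: "e:K Int cut G X"
   hence "e:edges G" using KE by blast
   then obtain a b where ab: "e = {a, b}" "a:verts G" "b:verts G" by (rule simple_edgeE[OF sg]) blast
   have x: "(a:X)~=(b:X)" using cut_iff[OF sg, of a b X] e ab KE by auto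
   have mab: "mate K a = b" using mate_props(4)[OF sg pm ab(2), of b] e ab(1) by simp
   have mba: "mate K b = a" using mate_props(4)[OF sg pm ab(3), of a] e ab(1) by (simp add: insert_commute)
   show "EX x:?S. e = {x, mate K x}"
   proof (cases "a:X")
    case True thus ?thesis using x mab ab(1) by (intro bexI[of _ a]) simp_all
   next case False thus ?thesis using x mba ab(1) by (intro bexI[of _ b]) (simp_all add: insert_commute)
   qed
  qed
  hence "card ?S = card (K Int cut G X)" by (rule bij_betw_same_card)
  thus ?thesis using card1_ex1[of ?S] by simp
 qed
 have "mtight X <-> X<=verts G & (ALL K:Perf G M. EX! x. x:X & mate K x~:X)"
  unfolding mtight_def by (simp add: mates_def)
 also have "\<dots> <-> tight G M X"
  unfolding tight_def by (rule conj_cong[OF refl], rule ball_cong[OF refl], rule main[symmetric])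
 finally show ?thesis by simp
qed

text \<open>An involution along edges that differs from \<open>M\<close> at finitely many points is the mate function of a
matching in \<open>Perf G M\<close>.\<close>

lemma glue:
 assumes mc: "matching_covered G M"
  and f: "!!x. x:verts G ==> {x, f x}:edges G" "!!x. x:verts G ==> f (f x) = x"
  and fin: "finite {x:verts G. f x~=mate M x}"
 shows "EX K:Perf G M. ALL x:verts G. mate K x = f x"
proof -
 note sg = mc_simple[OF mc]
 let ?K = "{{x, f x} | x. x:verts G}"
 have pm: "perfect_matching G ?K"
  unfolding perfect_matching_def
 proof (intro conjI ballI)
  show "?K<=edges G" using f(1) by blast
  fix v assume v: "v:verts G"
  show "EX! e. e:?K & v:e"
  proof (rule ex1I[of _ "{v, f v}"])
   show "{v, f v}:?K & v:{v, f v}" using v by blast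
   fix e assume "e:?K & v:e"
   then obtain x where "x:verts G" "e = {x, f x}" "v:{x, f x}" by blast
   thus "e = {v, f v}" using f(2)[of x] by auto
  qed
 qed
 have m: "mate ?K x = f x" if x: "x:verts G" for x proof -
  have "{x, f x}:?K" using x by blast
  thus ?thesis by (rule mate_props(4)[OF sg pm x, symmetric])
 qed
 have MV: "EX x:verts G. e = {x, mate M x}" if "e:M" for e proof -
  have "e:edges G" using that mc_pm[OF mc] unfolding perfect_matching_def by blast
  then obtain a b where ab: "e = {a, b}" "a:verts G" by (rule simple_edgeE[OF sg]) blast
  thus ?thesis using mate_props(4)[OF sg mc_pm[OF mc] ab(2), of b] that by blast
 qed
 let ?D = "{x:verts G. f x~=mate M x}"
 have "(M - ?K) Un (?K - M)<=(%x. {x, mate M x}) ` ?D Un (%x. {x, f x}) ` ?D"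
 proof
  fix e assume "e:(M - ?K) Un (?K - M)"
  then consider "e:M" "e~:?K" | "e:?K" "e~:M" by blast
  thus "e:(%x. {x, mate M x}) ` ?D Un (%x. {x, f x}) ` ?D"
  proof cases
   case 1
   then obtain x where x: "x:verts G" "e = {x, mate M x}" using MV by blast
   thus ?thesis using 1(2) x by fastforce
  next case 2
   then obtain x where x: "x:verts G" "e = {x, f x}" by blast
   thus ?thesis using 2(2) mate_props(1)[OF sg mc_pm[OF mc] x(1)] x by auto
  qed
 qed
 hence "finite ((M - ?K) Un (?K - M))" using fin by (meson finite_Un finite_imageI finite_subset)
 hence "?K:Perf G M" using pm unfolding Perf_def by blast
 thus ?thesis using m by blast
qed

definition qed_edges :: "'i set => ('i => 'b) => ('i => 'i => bool) => 'b set set" where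
 "qed_edges I L A = {{L i, L j} | i j. i:I & j:I & i~=j & A i j}"

lemma qed_edges_iff:
 assumes "inj_on L I" "!!i j. A i j <-> A j i" "i:I" "j:I"
 shows "{L i, L j}:qed_edges I L A <-> i~=j & A i j"
proof
 assume "{L i, L j}:qed_edges I L A"
 then obtain a b where ab: "{L i, L j} = {L a, L b}" "a:I" "b:I" "a~=b" "A a b"
  unfolding qed_edges_def by blast
 hence "L i = L a & L j = L b | L i = L b & L j = L a" by (simp add: doubleton_eq_iff)
 hence "i = a & j = b | i = b & j = a"
  using inj_onD[OF assms(1)] assms(3,4) ab(2,3) by blast
 thus "i~=j & A i j" using ab assms(2) by blast
qed (use assms in \<open>auto simp: qed_edges_def\<close>)

lemma joined_sym: "joined F X Y <-> joined F Y X"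
 unfolding joined_def by (metis insert_commute)

text \<open>The labels \<open>L\<close> allow to treat the collapse, whose vertices are the classes, and the graph of a torsoid,
whose vertices are smaller, in the same way.\<close>

locale quotient_graph =
 fixes G :: "'a graph" and M :: "'a set set" and I :: "'i set" and Q :: "'i => 'a set" and L :: "'i => 'b"
 assumes mc: "matching_covered G M"
  and tf: "mate_system.tfam (verts G) (mates G M) I Q"
  and Linj: "inj_on L I"
begin

sublocale mate_system "verts G" "mates G M" by (rule mates_system[OF mc])

lemmas sg = mc_simple[OF mc]

definition qM :: "'a set set => 'b set set" where
 "qM K = qed_edges I L (%i j. joined K (Q i) (Q j))"

definition qG :: "'b graph" where
 "qG = Graph (L ` I) (qM (edges G))"

lemma verts_qG [simp]: "verts qG = L ` I" and edges_qG [simp]: "edges qG = qM (edges G)"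
 unfolding qG_def by simp_all

lemma Qt: "i:I ==> mtight (Q i)" using tf by (simp add: tfam_def)
lemma QV: "i:I ==> Q i<=verts G" using Qt mtight_sub by blast
lemma Qd: "i:I ==> j:I ==> x:Q i ==> x:Q j ==> i = j" using tf by (auto simp: tfam_def)
lemma Qc: "x:verts G ==> EX i:I. x:Q i" using tf unfolding tfam_def by blast

lemma qM_iff: "i:I ==> j:I ==> {L i, L j}:qM K <-> i~=j & joined K (Q i) (Q j)"
 unfolding qM_def by (rule qed_edges_iff[OF Linj joined_sym])

lemma qM_elem: "e:qM K ==> EX i j. e = {L i, L j} & i:I & j:I & i~=j & joined K (Q i) (Q j)"
 unfolding qM_def qed_edges_def by blast

lemma joined_mate:
 assumes K: "K:Perf G M" and i: "i:I"
 shows "joined K (Q i) Y <-> (EX x:Q i. mate K x:Y)"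
 unfolding joined_def using mate_props(1,4)[OF sg PerfD[OF K]] QV[OF i] by blast

lemma mate_mem: "K:Perf G M ==> mate K:mates G M" unfolding mates_def by blast

lemma leaver:
 assumes K: "K:Perf G M" and i: "i:I"
 obtains x j where "x:Q i" "j:I" "j~=i" "mate K x:Q j"
  "!!y. y:Q i ==> mate K y~:Q i ==> y = x"
proof -
 obtain x where x: "x:Q i" "mate K x~:Q i" using mtight_ex[OF Qt[OF i] mate_mem[OF K]] by blast
 moreover obtain j where "j:I" "mate K x:Q j" using Qc mate_in[OF mate_mem[OF K]] x QV[OF i] by blast
 ultimately show ?thesis using that[of x j] mtight_un[OF Qt[OF i] mate_mem[OF K], of _ x] by blast
qed

lemma qM_pm:
 assumes K: "K:Perf G M" shows "perfect_matching qG (qM K)"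
 unfolding perfect_matching_def
proof (intro conjI ballI)
 have "K<=edges G" using PerfD[OF K] unfolding perfect_matching_def by blast
 thus "qM K<=edges qG" unfolding edges_qG qM_def qed_edges_def joined_def by blast
 fix v assume "v:verts qG"
 then obtain i where i: "i:I" "v = L i" by auto
 obtain x j where x: "x:Q i" "j:I" "j~=i" "mate K x:Q j" and
  un: "!!y. y:Q i ==> mate K y~:Q i ==> y = x" using leaver[OF K i(1)] by metis
 show "EX! e. e:qM K & v:e"
 proof (rule ex1I[of _ "{L i, L j}"])
  show "{L i, L j}:qM K & v:{L i, L j}" using joined_mate[OF K i(1)] x qM_iff[OF i(1) x(2)] x(3) i(2) by blast
  fix e assume e: "e:qM K & v:e"
  then obtain a b where ab: "e = {L a, L b}" "a:I" "b:I" "a~=b" "joined K (Q a) (Q b)"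
   using qM_elem by metis
  have "i = a | i = b" using e ab(1) i(2) inj_on_eq_iff[OF Linj] i(1) ab(2,3) by blast
  then obtain c where c: "c:I" "c~=i" "e = {L i, L c}" "joined K (Q i) (Q c)"
   using ab joined_sym by (metis insert_commute)
  then obtain y where y: "y:Q i" "mate K y:Q c" using joined_mate[OF K i(1)] by blast
  hence "c = j" using un Qd[OF i(1) c(1)] c(2) Qd[OF c(1) x(2)] y x by blast
  thus "e = {L i, L j}" using c by simp
 qed
qed

definition cls :: "'a => 'i" where "cls x = (THE i. i:I & x:Q i)"

lemma cls: "i:I ==> x:Q i ==> cls x = i"
 unfolding cls_def using Qd by (intro the_equality) blast+

lemma cls_in: assumes "x:verts G" shows "cls x:I" "x:Q (cls x)"
 using Qc[OF assms] cls by auto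

lemma qM_fin:
 assumes K: "K:Perf G M" "K':Perf G M" shows "finite (qM K - qM K')"
proof (rule finite_subset)
 let ?D = "{x:verts G. mate K x~=mate K' x}"
 show "finite ((%x. {L (cls x), L (cls (mate K x))}) ` ?D)" using mates_fin[OF mc K] by blast
 show "qM K - qM K'<=(%x. {L (cls x), L (cls (mate K x))}) ` ?D"
 proof
  fix e assume e: "e:qM K - qM K'"
  then obtain i j where ij: "e = {L i, L j}" "i:I" "j:I" "i~=j" "joined K (Q i) (Q j)"
   using qM_elem by (metis DiffD1)
  then obtain x where x: "x:Q i" "mate K x:Q j" using joined_mate[OF K(1)] by blast
  have "mate K' x~=mate K x" using e ij qM_iff joined_mate[OF K(2) ij(2)] x by auto
  hence "x:?D" using x QV[OF ij(2)] by auto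
  moreover have "e = {L (cls x), L (cls (mate K x))}" using cls x ij by simp
  ultimately show "e:(%x. {L (cls x), L (cls (mate K x))}) ` ?D" by blast
 qed
qed

lemma M_Perf: "M:Perf G M" using Perf_self[OF mc_pm[OF mc]] .

lemma qM_Perf: "K:Perf G M ==> qM K:Perf qG (qM M)"
 using qM_pm qM_fin[OF M_Perf, of K] qM_fin[OF _ M_Perf, of K] unfolding Perf_def by auto

lemma qG_mc: "matching_covered qG (qM M)"
 unfolding matching_covered_def
proof (intro conjI ballI)
 show "simple_graph qG"
  unfolding simple_graph_def
 proof
  fix e assume "e:edges qG"
  then obtain i j where ij: "e = {L i, L j}" "i:I" "j:I" "i~=j" using qM_elem by (metis edges_qG)
  thus "e<=verts qG & card e = 2" using inj_on_eq_iff[OF Linj] ij by force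
 qed
 show "perfect_matching qG (qM M)" by (rule qM_pm[OF M_Perf])
 show "connected_graph qG"
  unfolding connected_graph_def
 proof (intro conjI ballI)
  have "verts G~={}" using mc_conn[OF mc] unfolding connected_graph_def by blast
  thus "verts qG~={}" using Qc by auto
  fix u v assume "u:verts qG" "v:verts qG"
  then obtain i j where ij: "i:I" "j:I" "u = L i" "v = L j" by auto
  obtain x y where xy: "x:Q i" "y:Q j" using mtight_ne Qt ij by (metis all_not_in_conv)
  have "x:verts G" "y:verts G" using xy QV ij by auto
  hence "(x, y):{(x, y). {x, y}:edges G}\<^sup>*"
   using mc_conn[OF mc] unfolding connected_graph_def by simp
  hence "(L (cls x), L (cls y)):{(x, y). {x, y}:edges qG}\<^sup>*"
  proof (induction rule: rtrancl_induct)
   case (step y z)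
   have yz: "{y, z}:edges G" using step(2) by simp
   have V: "y:verts G" "z:verts G" using simple_edge[OF sg yz] by auto
   show ?case
   proof (cases "cls y = cls z")
    case False
    have "joined (edges G) (Q (cls y)) (Q (cls z))" unfolding joined_def using yz cls_in V by blast
    hence "{L (cls y), L (cls z)}:edges qG"
     unfolding edges_qG using qM_iff[OF cls_in(1)[OF V(1)] cls_in(1)[OF V(2)]] False by blast
    thus ?thesis using step(3) by (simp add: rtrancl.rtrancl_into_rtrancl)
   qed (use step in simp)
  qed simp
  thus "(u, v):{(x, y). {x, y}:edges qG}\<^sup>*" using cls xy ij by simp
 qed
 fix e assume "e:edges qG"
 then obtain i j where ij: "e = {L i, L j}" "i:I" "j:I" "i~=j" "joined (edges G) (Q i) (Q j)"
  using qM_elem by (metis edges_qG)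
 then obtain x y where xy: "x:Q i" "y:Q j" "{x, y}:edges G" unfolding joined_def by blast
 obtain K where K: "K:Perf G M" "{x, y}:K" using edge_mate[OF mc xy(3)] by blast
 hence "joined K (Q i) (Q j)" unfolding joined_def using xy by blast
 thus "EX M':Perf qG (qM M). e:M'" using qM_iff ij qM_Perf[OF K(1)] by meson
qed

lemmas q_sg = mc_simple[OF qG_mc]

lemma mate_qM:
 assumes K: "K:Perf G M" and i: "i:I" "j:I" "i~=j" and x: "x:Q i" "mate K x:Q j"
 shows "mate (qM K) (L i) = L j"
proof -
 show ?thesis using qM_iff[OF i(1,2)] joined_mate[OF K i(1)] i(3) x mate_props(4)[OF q_sg qM_pm[OF K], of "L i" "L j"] i by force
qed

text \<open>A matching of the collapse is realized in \<open>G\<close> by choosing, for each of the finitely many edges where it differs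
from the fixed one, a matching of \<open>G\<close> through an edge between the two classes, and by using it on these
two classes. As each class is left by one edge only, the pieces fit together.\<close>

lemma lift:
 assumes N: "N:Perf qG (qM M)"
 shows "EX K:Perf G M. ALL i:I. ALL j:I. ALL x:Q i. i~=j --> mate K x:Q j --> mate N (L i) = L j"
proof -
 define n where "n = (%i. THE j. j:I & mate N (L i) = L j)"
 have Nm: "mate N (L i):L ` I" "mate N (L i)~=L i" "mate N (mate N (L i)) = L i"
  "{L i, mate N (L i)}:N" if "i:I" for i proof -
  have Li: "L i:verts qG" using that by simp
  show "mate N (L i):L ` I" using mate_props(2)[OF q_sg PerfD[OF N] Li] by simp
  show "mate N (L i)~=L i" by (rule mate_props(3)[OF q_sg PerfD[OF N] Li])
  show "mate N (mate N (L i)) = L i" by (rule mate_invol[OF q_sg PerfD[OF N] Li])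
  show "{L i, mate N (L i)}:N" by (rule mate_props(1)[OF q_sg PerfD[OF N] Li])
 qed
 have n: "n i:I" "mate N (L i) = L (n i)" if "i:I" for i proof -
  obtain j where j: "j:I" "mate N (L i) = L j" using Nm(1)[OF `i:I`] by blast
  hence "n i = j" unfolding n_def using inj_on_eq_iff[OF Linj] by (intro the_equality) auto
  thus "n i:I" "mate N (L i) = L (n i)" using j by auto
 qed
 have nn: "n (n i) = i" "n i~=i" if "i:I" for i
  using n[OF that] n[OF n(1)[OF that]] Nm[OF that] inj_on_eq_iff[OF Linj] that by auto
 define J where "J = {i:I. mate N (L i)~=mate (qM M) (L i)}"
 have finJ: "finite J" proof -
  have "finite {y:verts qG. mate N y~=mate (qM M) y}"
   by (rule mates_fin[OF qG_mc N qM_Perf[OF M_Perf]])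
  hence "finite (L -` {y:verts qG. mate N y~=mate (qM M) y} Int I)"
   by (rule finite_vimage_IntI) (rule Linj)
  thus ?thesis unfolding J_def by (rule rev_finite_subset) auto
 qed
 have M_link: "mate (qM M) (mate (qM M) (L i)) = L i" if "i:I" for i
  using mate_invol[OF q_sg qM_pm[OF M_Perf], of "L i"] that by auto
 have nJ: "n i:J <-> i:J" if "i:I" for i proof -
  have "mate (qM M) (L (n i)) = L i <-> mate (qM M) (L i) = L (n i)"
   using M_link[OF that] M_link[OF n(1)[OF that]] by metis
  moreover have "mate N (L (n i)) = L i" using n(2)[OF n(1)[OF that]] nn(1)[OF that] by simp
  ultimately show ?thesis unfolding J_def using n[OF that] that by (simp add: eq_commute)
 qed
 define P where "P = (%e. SOME K. K:Perf G M & e:qM K)"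
 have P: "P e:Perf G M & e:qM (P e)" if e: "e:qM (edges G)" for e proof -
  obtain i j where ij: "e = {L i, L j}" "i:I" "j:I" "i~=j" "joined (edges G) (Q i) (Q j)"
   using qM_elem[OF e] by blast
  then obtain x y where xy: "x:Q i" "y:Q j" "{x, y}:edges G" unfolding joined_def by blast
  obtain K where K: "K:Perf G M" "{x, y}:K" using edge_mate[OF mc xy(3)] by blast
  hence "joined K (Q i) (Q j)" unfolding joined_def using xy by blast
  hence "K:Perf G M & e:qM K" using qM_iff ij K(1) by blast
  thus ?thesis unfolding P_def by (rule someI)
 qed
 define p where "p = (%i. if i:J then mate (P {L i, L (n i)}) else mate M)"
 have pn: "p (n i) = p i" if "i:I" for i
  unfolding p_def using nJ[OF that] nn[OF that] by (simp add: insert_commute)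
 have edgeN: "{L i, L (n i)}:qM (edges G)" if "i:I" for i proof -
  have "{L i, L (n i)}:N" using Nm(4)[OF that] n(2)[OF that] by simp
  thus ?thesis using PerfD[OF N] unfolding perfect_matching_def by auto
 qed
 have pK: "EX K:Perf G M. p i = mate K" if "i:I" for i
  unfolding p_def using P[OF edgeN[OF that]] M_Perf by auto
 have pl: "p i x:Q (n i)" if i: "i:I" and x: "x:Q i" "p i x~:Q i" for i x
 proof (cases "i:J")
  case True
  let ?K = "P {L i, L (n i)}"
  have K: "?K:Perf G M" "{L i, L (n i)}:qM ?K" using P[OF edgeN[OF i]] by auto
  hence "joined ?K (Q i) (Q (n i))" using qM_iff[OF i n(1)[OF i]] by blast
  then obtain y where y: "y:Q i" "mate ?K y:Q (n i)" using joined_mate[OF K(1) i] by blast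
  hence "x = y" using Qd[OF n(1)[OF i] i] nn(2)[OF i] mtight_un[OF Qt[OF i] mate_mem[OF K(1)] x(1) _ y(1)] x(2) True p_def by auto
  thus ?thesis using y True p_def by simp
 next case False
  have mx: "mate M x~:Q i" using x(2) False p_def by simp
  have "mate M x:verts G" using mate_in[OF mate_mem[OF M_Perf]] x(1) QV[OF i] by blast
  then obtain j where j: "j:I" "mate M x:Q j" using Qc by blast
  hence "mate (qM M) (L i) = L j" using mate_qM[OF M_Perf i j(1) _ x(1) j(2)] mx by blast
  hence "L j = L (n i)" using False i n(2)[OF i] unfolding J_def by simp
  thus ?thesis using inj_on_eq_iff[OF Linj j(1) n(1)[OF i]] j False p_def by presburger
 qed
 define f where "f = (%x. p (cls x) x)"
 have fx: "f x = p i x" if "i:I" "x:Q i" for i x unfolding f_def using cls[OF that] by simp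
 have pp: "p i (p i x) = x" "{x, p i x}:edges G" if i: "i:I" "x:verts G" for i x proof -
  obtain K where "K:Perf G M" "p i = mate K" using pK[OF i(1)] by blast
  thus "p i (p i x) = x" "{x, p i x}:edges G"
   using mate_mate[OF mate_mem i(2)] mate_edge[OF mc mate_mem i(2)] by auto
 qed
 have "EX K:Perf G M. ALL x:verts G. mate K x = f x"
 proof (rule glue[OF mc])
  fix x assume x: "x:verts G"
  then obtain i where i: "i:I" "x:Q i" using Qc by blast
  show "{x, f x}:edges G" using fx[OF i] pp[OF i(1) x] by simp
  show "f (f x) = x"
  proof (cases "p i x:Q i")
   case True thus ?thesis using fx[OF i] fx[OF i(1) True] pp[OF i(1) x] by simp
  next case False thus ?thesis using pl[OF i] fx[OF i] fx[OF n(1)[OF i(1)]] pn[OF i(1)] pp[OF i(1) x] by presburger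
  qed
 next
  have "{x:verts G. f x~=mate M x}<=(UN i:J. {x:verts G. p i x~=mate M x})"
  proof
   fix x assume x: "x:{x:verts G. f x~=mate M x}"
   then obtain i where i: "i:I" "x:Q i" using Qc by blast
   hence "i:J" using x fx[OF i] unfolding p_def by (auto split: if_splits)
   thus "x:(UN i:J. {x:verts G. p i x~=mate M x})" using x fx[OF i] by auto
  qed
  moreover have "finite {x:verts G. p i x~=mate M x}" if "i:J" for i proof -
   have "i:I" using that unfolding J_def by blast
   then obtain K where "K:Perf G M" "p i = mate K" using pK by blast
   thus ?thesis using mates_fin[OF mc _ M_Perf] by simp
  qed
  ultimately show "finite {x:verts G. f x~=mate M x}" using finJ by (meson finite_UN_I finite_subset)
 qed
 then obtain K where K: "K:Perf G M" "ALL x:verts G. mate K x = f x" by blast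
 have "mate N (L i) = L j" if "i:I" "j:I" "x:Q i" "i~=j" "mate K x:Q j" for i j x proof -
  have "mate K x = p i x" using QV[OF that(1)] that(3) K(2) fx[OF that(1,3)] by fastforce
  moreover have "p i x~:Q i" using Qd[OF that(1,2)] that(4,5) calculation by auto
  ultimately show ?thesis using pl[OF that(1,3)] Qd[OF that(2) n(1)[OF that(1)]] that(5) n(2)[OF that(1)] by auto
 qed
 thus ?thesis using K(1) by blast
qed

definition pre :: "'b set => 'a set" where "pre Y = (UN i:{i:I. L i:Y}. Q i)"

lemma leaver_corr:
 assumes K: "K:Perf G M" and N: "N:Perf qG (qM M)" and Y: "Y<=L ` I"
  and c: "ALL i:I. ALL j:I. ALL x:Q i. i~=j --> mate K x:Q j --> mate N (L i) = L j"
 shows "(EX! y. y:Y & mate N y~:Y) <-> (EX! x. x:pre Y & mate K x~:pre Y)"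
proof -
 have in_pre: "x:pre Y <-> L i:Y" if "i:I" "x:Q i" for i x
 proof
  assume "x:pre Y"
  then obtain k where k: "k:I" "L k:Y" "x:Q k" unfolding pre_def by blast
  hence "k = i" using Qd[OF k(1) that(1) k(3) that(2)] by simp
  thus "L i:Y" using k by simp
 qed (use that in \<open>auto simp: pre_def\<close>)
 have preV: "pre Y<=verts G" unfolding pre_def using QV by blast
 have 1: "EX i:I. x:Q i & L i:Y & mate N (L i)~:Y & mate K x~:Q i"
  if x: "x:pre Y" "mate K x~:pre Y" for x proof -
  obtain i where i: "i:I" "x:Q i" "L i:Y" using x unfolding pre_def by blast
  have "mate K x:verts G" using mate_in[OF mate_mem[OF K]] x preV by blast
  then obtain j where j: "j:I" "mate K x:Q j" using Qc by blast
  have Lj: "L j~:Y" using in_pre[OF j] x by blast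
  hence "i~=j" using i by blast
  hence "mate N (L i) = L j" using c i j by blast
  moreover have "mate K x~:Q i" using Qd[OF i(1) j(1)] j `i~=j` by blast
  ultimately show ?thesis using i Lj by auto
 qed
 have 2: "EX x:Q i. x:pre Y & mate K x~:pre Y" if i: "i:I" "L i:Y" "mate N (L i)~:Y" for i proof -
  obtain x j where x: "x:Q i" "j:I" "j~=i" "mate K x:Q j" using leaver[OF K i(1)] by metis
  have "mate N (L i) = L j" using c[rule_format, OF i(1) x(2) x(1) x(3)[symmetric] x(4)] .
  hence "L j~:Y" using i(3) by simp
  hence "mate K x~:pre Y" "x:pre Y" using in_pre[OF x(2,4)] in_pre[OF i(1) x(1)] i(2) by simp_all
  thus ?thesis using x(1) by blast
 qed
 show ?thesis
 proof
  assume "EX! y. y:Y & mate N y~:Y"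
  then obtain y where y: "y:Y" "mate N y~:Y" and un: "!!z. z:Y ==> mate N z~:Y ==> z = y" by blast
  obtain i where i: "i:I" "y = L i" using y Y by blast
  obtain x where x: "x:Q i" "x:pre Y" "mate K x~:pre Y" using 2[OF i(1)] y i by blast
  show "EX! x. x:pre Y & mate K x~:pre Y"
  proof (rule ex1I[of _ x])
   fix z assume z: "z:pre Y & mate K z~:pre Y"
   obtain k where k: "k:I" "z:Q k" "L k:Y" "mate N (L k)~:Y" "mate K z~:Q k" using 1 z by blast
   have "k = i" using un[OF k(3,4)] i inj_on_eq_iff[OF Linj k(1) i(1)] by simp
   moreover have "mate K x~:Q i" using 1[OF x(2,3)] Qd[OF _ i(1) _ x(1)] by blast
   ultimately show "z = x" using mtight_un[OF Qt[OF i(1)] mate_mem[OF K], of z x] k x by blast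
  qed (use x in blast)
 next assume "EX! x. x:pre Y & mate K x~:pre Y"
  then obtain x where x: "x:pre Y" "mate K x~:pre Y"
   and un: "!!z. z:pre Y ==> mate K z~:pre Y ==> z = x" by blast
  obtain i where i: "i:I" "x:Q i" "L i:Y" "mate N (L i)~:Y" using 1[OF x] by blast
  show "EX! y. y:Y & mate N y~:Y"
  proof (rule ex1I[of _ "L i"])
   fix y assume y: "y:Y & mate N y~:Y"
   then obtain k where k: "k:I" "y = L k" using Y by blast
   then obtain z where z: "z:Q k" "z:pre Y" "mate K z~:pre Y" using 2 y by blast
   hence "z = x" using un by blast
   thus "y = L i" using Qd[OF i(1) k(1) i(2)] z k by simp
  qed (use i in blast)
 qed
qed

lemma tight_quotient:
 assumes Y: "Y<=L ` I"
 shows "tight qG (qM M) Y <-> mtight (pre Y)"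
proof -
 interpret q: mate_system "verts qG" "mates qG (qM M)" by (rule mates_system[OF qG_mc])
 have preV: "pre Y<=verts G" unfolding pre_def using QV by blast
 have 1: "q.mtight Y <-> (ALL N:Perf qG (qM M). EX! y. y:Y & mate N y~:Y)"
  unfolding q.mtight_def using Y by (simp add: mates_def)
 have 2: "mtight (pre Y) <-> (ALL K:Perf G M. EX! x. x:pre Y & mate K x~:pre Y)"
  unfolding mtight_def using preV by (simp add: mates_def)
 have "q.mtight Y <-> mtight (pre Y)"
  unfolding 1 2
 proof (intro iffI ballI)
  fix K assume a: "ALL N:Perf qG (qM M). EX! y. y:Y & mate N y~:Y" and K: "K:Perf G M"
  have "ALL i:I. ALL j:I. ALL x:Q i. i~=j --> mate K x:Q j --> mate (qM K) (L i) = L j"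
   using mate_qM[OF K] by blast
  from leaver_corr[OF K qM_Perf[OF K] Y this] show "EX! x. x:pre Y & mate K x~:pre Y"
   using a[rule_format, OF qM_Perf[OF K]] by (rule iffD1)
 next fix N assume a: "ALL K:Perf G M. EX! x. x:pre Y & mate K x~:pre Y" and N: "N:Perf qG (qM M)"
  obtain K where K: "K:Perf G M"
   "ALL i:I. ALL j:I. ALL x:Q i. i~=j --> mate K x:Q j --> mate N (L i) = L j"
   using lift[OF N] by blast
  show "EX! y. y:Y & mate N y~:Y"
   using leaver_corr[OF K(1) N Y K(2)] a[rule_format, OF K(1)] by (rule iffD2)
 qed
 thus ?thesis using tight_iff[OF qG_mc] by simp
qed

lemma pre_image: "A<=I ==> pre (L ` A) = (UN i:A. Q i)"
proof -
 assume A: "A<=I"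
 hence "{i:I. L i:L ` A} = A" using inj_on_image_mem_iff[OF Linj] by blast
 thus ?thesis unfolding pre_def by simp
qed

lemma card_image_1: "A<=I ==> card (L ` A) = 1 <-> (EX i:I. A = {i})"
proof -
 assume A: "A<=I"
 have "card (L ` A) = card A" by (rule card_image[OF inj_on_subset[OF Linj A]])
 thus ?thesis using A by (auto simp: card_1_singleton_iff)
qed

lemma bob_quotient: "bob qG (qM M) <-> bobfam I Q"
proof -
 have 1: "trivial_set qG (L ` A) <-> (EX i:I. A = {i} | A = I - {i})" if A: "A<=I" for A proof -
  have "L ` I - L ` A = L ` (I - A)" using inj_on_image_set_diff[OF Linj, of I A] A by auto
  moreover have "I - A = {i} <-> A = I - {i}" if "i:I" for i using A that by blast
  hence "(EX i:I. I - A = {i}) <-> (EX i:I. A = I - {i})" by blast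
  ultimately have "card (L ` I - L ` A) = 1 <-> (EX i:I. A = I - {i})"
   using card_image_1[of "I - A"] by simp
  thus ?thesis unfolding trivial_set_def verts_qG card_image_1[OF A] by blast
 qed
 have 2: "tight qG (qM M) Y ==> EX A<=I. Y = L ` A" for Y
  unfolding tight_def verts_qG by (meson subset_imageE)
 have "bob qG (qM M) <-> (ALL A<=I. tight qG (qM M) (L ` A) --> trivial_set qG (L ` A))"
  unfolding bob_def using qG_mc 2 by blast
 also have "\<dots> <-> bobfam I Q"
  unfolding bobfam_def using 1 tight_quotient pre_image by (metis image_mono)
 finally show ?thesis .
qed

end

section \<open>Locating tight sets\<close>

context mate_system
begin

lemma npar_one_closed:
 assumes X: "fcut X" "~ par X" and m: "m:Mt"
  and un: "!!x y. x:X ==> m x~:X ==> y:X ==> m y~:X ==> x = y"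
  and x: "x:X"
 shows "m x:X"
proof -
 have "leave m X = {} | (EX x. leave m X = {x})" using one_leaver[OF fcut_sub[OF X(1)]] un by blast
 moreover have "even (card (leave m X))" using par_iff[OF X(1) m] X(2) by simp
 ultimately have "leave m X = {}" by auto
 thus ?thesis using x unfolding leave_def by blast
qed

lemma bridge_mono:
 assumes "bridge A D B" "!!m x. m:Mt ==> x:D ==> m x:A ==> m x:A'"
 shows "bridge A' D B"
 unfolding bridge_def
proof
 fix m assume m: "m:Mt"
 consider "ALL x:D. m x:D" | x y where "x:D" "y:D" "m x:A" "m y:B"
  "ALL z:D. z~=x --> z~=y --> m z:D"
  using assms(1) m unfolding bridge_def by metis
 thus "(ALL x:D. m x:D) |
   (EX x:D. EX y:D. m x:A' & m y:B & (ALL z:D. z~=x --> z~=y --> m z:D))"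
 proof cases
  case 2
  thus ?thesis using assms(2)[OF m] 2 by blast
 qed simp
qed

end

context frame
begin

text \<open>\<open>X\<close> lies around the vertex \<open>i\<close>. The condition on \<open>N i \<union> (X \<inter> E i j)\<close> says that \<open>X\<close> cuts each incident
\<open>E i j\<close> into two parts that both keep the connecting property of \<open>E i j\<close>.\<close>

definition vloc :: "'i => 'a set => bool" where
 "vloc i X <-> X<=U i & mtight (X Int N i) & (ALL j:I. j~=i --> mtight (N i Un (X Int E i j)))"

definition eloc :: "'a set => bool" where
 "eloc X <-> (EX i:I. EX j:I. i~=j & X<=E i j)"

lemma odd_compl:
 assumes X: "mtight X" and Q: "mtight Q"
 shows "par ((V - X) Int Q) <-> ~ par (X Int Q)"
proof -
 have "(V - X) Int Q = Q - X" using mtight_sub[OF Q] by blast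
 thus ?thesis using par_split[of Q X] X Q by (simp add: Int_commute)
qed

lemma U_neV: assumes "i:I" shows "U i~=V"
proof -
 obtain j where "j:I" "j~=i" using two by metis
 thus ?thesis using N_Int_U[OF assms, of j] N_ne[of j] N_V[of j] by blast
qed

text \<open>Let \<open>A i\<close> consist of \<open>N i\<close> and the members of \<open>\<X>\<close> that lie around \<open>i\<close>. These sets are disjoint, as members
around different vertices are nested and cannot contain each other. What is left
of each \<open>E i j\<close> is given to one of its ends, so that a resolution results. Its classes are nested with every
member of \<open>\<X>\<close>, as one side of each member is located, and belong to \<open>\<X>\<close> by maximality.\<close>

lemma star_ex:
 assumes X: "mnf \<X>"
  and loc: "!!X. X:\<X> ==> EX Z:{X, V - X}. eloc Z | (EX i:I. vloc i Z)"
  and ne: "!!X Y i j. X:\<X> ==> Y:\<X> ==> i:I ==> j:I ==> i~=j ==> vloc i X ==> vloc j Y ==> X Un Y~=V"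
 shows "EX Q. subres Q & (ALL i:I. Q i:\<X>)"
proof -
 have Xt: "mtight X" if "X:\<X>" for X using that X unfolding mnf_def by blast
 have Xn: "nest X Y" if "X:\<X>" "Y:\<X>" for X Y using that X unfolding mnf_def by blast
 have Xc: "V - X:\<X>" if "X:\<X>" for X using that X unfolding mnf_def by blast
 define A where "A = (%i. N i Un \<Union>{X:\<X>. vloc i X})"
 have vU: "X<=U i" "X Int N i~={}" if "vloc i X" for X i
  using that mtight_ne unfolding vloc_def by blast+
 have AU: "A i<=U i" for i unfolding A_def using vU(1) N_sub_U by blast
 have AA: "A i Int A j = {}" if ij: "i:I" "j:I" "i~=j" for i j
 proof (rule ccontr)
  assume "~ ?thesis"
  then obtain x where x: "x:A i" "x:A j" by blast
  have "x~:N i" "x~:N j"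
   using x AU[of i] AU[of j] N_Int_U[OF ij] N_Int_U[OF ij(2,1)] ij(3) by blast+
  then obtain X Y where XY: "X:\<X>" "Y:\<X>" "vloc i X" "vloc j Y" "x:X" "x:Y"
   using x unfolding A_def by blast
  have "~ X<=Y" using vU(2)[OF XY(3)] vU(1)[OF XY(4)] N_Int_U[OF ij(2,1)] ij(3) by blast
  moreover have "~ Y<=X" using vU(2)[OF XY(4)] vU(1)[OF XY(3)] N_Int_U[OF ij] by blast
  ultimately show False using Xn[OF XY(1,2)] ne[OF XY(1,2) ij XY(3,4)] XY(5,6) unfolding nest_def by blast
 qed
 have At: "mtight (N i Un (A i Int E i j))" if ij: "i:I" "j:I" "i~=j" for i j proof -
  let ?Z = "N i Un (A i Int E i j)"
  have two: "mtight (N i Un (X Int E i j) Un (Y Int E i j))"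
   if XY: "X:\<X>" "Y:\<X>" "vloc i X" "vloc i Y" for X Y proof -
   have t: "mtight (N i Un (X Int E i j))" "mtight (N i Un (Y Int E i j))"
    using XY(3,4) ij unfolding vloc_def by auto
   have "X Un Y~=V" using vU(1)[OF XY(3)] vU(1)[OF XY(4)] U_neV[OF ij(1)] U_V[OF ij(1)] by blast
   then consider "X Int Y = {}" | "X<=Y" | "Y<=X" using Xn[OF XY(1,2)] unfolding nest_def by blast
   thus ?thesis
   proof cases
    case 1
    hence "mtight ((N i Un (X Int E i j)) Un (N i Un (Y Int E i j)))"
     using NE_disj[OF ij(1,2,1)] by (intro mtight_Un_sub[OF t _ N_tight[OF ij(1)]]) blast
    moreover have "(N i Un (X Int E i j)) Un (N i Un (Y Int E i j)) = N i Un (X Int E i j) Un (Y Int E i j)" by blast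
    ultimately show ?thesis by simp
   next case 2
    hence "N i Un (X Int E i j) Un (Y Int E i j) = N i Un (Y Int E i j)" by blast
    thus ?thesis using t by simp
   next case 3
    hence "N i Un (X Int E i j) Un (Y Int E i j) = N i Un (X Int E i j)" by blast
    thus ?thesis using t by simp
   qed
  qed
  show ?thesis
  proof (cases "{X:\<X>. vloc i X} = {}")
   case True hence "?Z = N i" unfolding A_def by blast
   thus ?thesis using N_tight[OF ij(1)] by simp
  next case False
   show ?thesis
   proof (rule mtightI)
    have "?Z<=U i" using AU N_sub_U by blast
    thus "?Z<=V" "?Z~=V" using U_V[OF ij(1)] U_neV[OF ij(1)] by blast+
    show "?Z~={}" using N_ne[OF ij(1)] by blast
    fix m x y assume m: "m:Mt" and x: "x:?Z" "m x~:?Z" and y: "y:?Z" "m y~:?Z"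
    have ex: "EX X. X:\<X> & vloc i X & z:N i Un (X Int E i j)" if "z:?Z" for z
     using that False unfolding A_def by blast
    obtain X where X: "X:\<X>" "vloc i X" "x:N i Un (X Int E i j)" using ex[OF x(1)] by blast
    obtain Y where Y: "Y:\<X>" "vloc i Y" "y:N i Un (Y Int E i j)" using ex[OF y(1)] by blast
    have sub: "N i Un (X Int E i j) Un (Y Int E i j)<=?Z" using X(1,2) Y(1,2) unfolding A_def by blast
    show "x = y"
     by (rule mtight_un[OF two[OF X(1) Y(1) X(2) Y(2)] m]) (use X(3) Y(3) x(2) y(2) sub in blast)+
   qed
  qed
 qed
 obtain h where h: "tour h" using tour_ex by blast
 have h2: "h i j <-> ~ h j i" if "i~=j" for i j using h that unfolding tour_def by blast
 \<comment> \<open>the tournament decides which end receives the part of \<open>E i j\<close> outside \<open>A i\<close> and \<open>A j\<close>\<close>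
 define S where "S = (%i j. if h i j then E i j - A j else E i j Int A i)"
 define Q where "Q = (%i. N i Un (UN j:I. S i j))"
 have SE: "S i j<=E i j" for i j unfolding S_def by auto
 have QE: "Q i Int E i j = S i j" if ij: "i:I" "j:I" for i j proof -
  have "S i k Int E i j = {}" if "k:I" "k~=j" for k
   using E_Int_E[OF ij(1) that(1) ij(2) that(2)] SE[of i k] by blast
  thus ?thesis unfolding Q_def using NE_disj[OF ij ij(1)] SE[of i j] ij by blast
 qed
 have QU: "Q i<=U i" for i unfolding Q_def U_def using SE by blast
 have NQ: "N i<=Q i" for i unfolding Q_def by blast
 have SS: "S i j Un S j i = E i j" "S i j Int S j i = {}" if ij: "i:I" "j:I" "i~=j" for i j
  using h2[OF ij(3)] AA[OF ij] E_sym[OF ij(1,2)] unfolding S_def by auto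
 have QQ: "Q i Int Q j = {}" if ij: "i:I" "j:I" "i~=j" for i j proof -
  have "Q i Int Q j<=S i j Int S j i" using U_Int_U[OF ij] QU QE[OF ij(1,2)] QE[OF ij(2,1)] E_sym[OF ij(1,2)] by blast 
  thus ?thesis using SS[OF ij] by blast
 qed
 have "subres Q"
  unfolding subres_def
 proof (intro conjI ballI impI)
  fix i assume i: "i:I"
  show "N i<=Q i" "Q i<=U i" using NQ QU by auto
  fix j assume j: "j:I" "i~=j"
  show "Q i Int Q j = {}" using QQ i j by blast
  have "mtight (N i Un S i j)"
  proof (cases "h i j")
   case True
   have ji: "j~=i" using j(2) by blast
   have "~ par (A j Int E j i)"
    using bridge_npar[OF N_tight[OF j(1)] At[OF j(1) i ji]] NE_disj[OF j(1) i j(1)] by blast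
   moreover have "(N i Un E i j) Int (N j Un (A j Int E j i)) = A j Int E j i"
    using N_disj[OF i j] NE_disj[OF i j(1) j(1)] NE_disj[OF i j(1) i] E_sym[OF i j(1)] by blast
   ultimately have "mtight ((N i Un E i j) - (N j Un (A j Int E j i)))"
    using mtight_Diff(1)[OF NE_tight[OF i j] At[OF j(1) i ji]] by simp
   moreover have "(N i Un E i j) - (N j Un (A j Int E j i)) = N i Un S i j"
    using N_disj[OF i j] NE_disj[OF i j(1) j(1)] NE_disj[OF i j(1) i] E_sym[OF i j(1)] True
    unfolding S_def by auto
   ultimately show ?thesis by simp
  next case False thus ?thesis using At[OF i j] unfolding S_def by (simp add: Int_commute)
  qed
  thus "mtight (N i Un (Q i Int E i j))" using QE[OF i j(1)] by simp
 next show "(UN i:I. Q i) = V"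
  proof
   show "(UN i:I. Q i)<=V" using QU U_V by blast
   show "V<=(UN i:I. Q i)"
   proof
    fix x assume "x:V"
    then consider i where "i:I" "x:N i" | i j where "i:I" "j:I" "x:E i j" using cover by blast
    thus "x:(UN i:I. Q i)"
    proof cases
     case 2
     hence "x:S i j Un S j i" using E_refl SS[OF 2(1,2)] 2(3) by blast
     thus ?thesis using 2(1,2) unfolding Q_def by blast
    qed (use NQ in blast)
   qed
  qed
 qed
 moreover have "Q i:\<X>" if i: "i:I" for i proof -
  have AQ: "A k<=Q k" if k: "k:I" for k
  proof
   fix x assume x: "x:A k"
   hence "x:U k" using AU by blast
   then consider "x:N k" | j where "j:I" "x:E k j" "j~=k" unfolding U_def using E_refl by blast
   thus "x:Q k"
   proof cases
    case 2
    hence "x~:A j" using AA[OF k 2(1)] x by blast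
    thus ?thesis using 2 x k unfolding Q_def S_def by auto
   qed (use NQ in blast)
  qed
  have nQ: "nest Z (Q i)" if Z: "Z:\<X>" "eloc Z | (EX k:I. vloc k Z)" for Z
   using Z(2)
  proof
   assume "EX k:I. vloc k Z"
   then obtain k where k: "k:I" "vloc k Z" by blast
   hence ZA: "Z<=Q k" using Z(1) AQ[OF k(1)] unfolding A_def by blast
   thus ?thesis using QQ[OF k(1) i] unfolding nest_def by (cases "k = i") auto
  next assume "eloc Z"
   then obtain a b where ab: "a:I" "b:I" "a~=b" "Z<=E a b" unfolding eloc_def by blast
   show ?thesis
   proof (cases "i = a | i = b")
    case False hence "Z Int Q i = {}" using E_Int_U[OF i ab(1,2)] QU[of i] ab(4) by blast
    thus ?thesis unfolding nest_def by blast
   next case True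
    then obtain c where c: "c:I" "c~=i" "Z<=E i c" using ab E_sym[OF ab(1,2)] by metis
    have ZN: "Z Int N i = {}" "Z Int N c = {}" using NE_disj[OF i c(1) i] NE_disj[OF i c(1) c(1)] c by blast+
    have dich: "Z<=A k | Z Int A k = {}" if k: "k = i & l = c | k = c & l = i" for k l
    proof (rule ccontr)
     assume n: "~ ?thesis"
     have kl: "k:I" "l:I" "k~=l" using k i c by auto
     have Zk: "Z Int N k = {}" "Z Int N l = {}" using k ZN by auto
     obtain Y where Y: "Y:\<X>" "vloc k Y" "Z Int Y~={}" using n Zk unfolding A_def by blast
     have "~ Z<=Y" using n Y unfolding A_def by blast
     moreover have "~ Y<=Z" using vU(2)[OF Y(2)] Zk by blast
     moreover have "Z Un Y~=V" using vU(1)[OF Y(2)] N_Int_U[OF kl] Zk N_ne[OF kl(2)] N_V[OF kl(2)] by blast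
     ultimately show False using Xn[OF Z(1) Y(1)] Y(3) unfolding nest_def by blast
    qed
    have "Z<=S i c | Z Int S i c = {}" using dich[of i c] dich[of c i] c(3) unfolding S_def by auto
    thus ?thesis using QE[OF i c(1)] c(3) unfolding nest_def by blast
   qed
  qed
  have "nest X (Q i)" if "X:\<X>" for X proof -
   obtain Z where Z: "Z:{X, V - X}" "eloc Z | (EX k:I. vloc k Z)" using loc[OF \<open>X:\<X>\<close>] by blast
   hence "nest Z (Q i)" using that Xc nQ Z(2) by blast
   thus ?thesis using Z(1) nest_compl[OF mtight_sub[OF Xt[OF that]]] subset_trans[OF QU U_V[OF i]] by auto
  qed
  moreover have "mtight (Q i)" using subresD(6)[OF `subres Q` i] .
  ultimately show ?thesis using X unfolding mnf_def by blast
 qed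
 ultimately show ?thesis by blast
qed

text \<open>\<open>Q i\<close> and \<open>Q' j\<close> contain different vertices and avoid a third one, so nestedness forces
them to be disjoint for \<open>i \<noteq> j\<close>; two partitions with this property agree.\<close>

lemma star_unique:
 assumes Q: "subres Q" "subres Q'" and three: "!!i j. i:I ==> j:I ==> EX k:I. k~=i & k~=j"
  and n: "!!i j. i:I ==> j:I ==> nest (Q i) (Q' j)" and i: "i:I"
 shows "Q i = Q' i"
proof -
 have d: "Q i Int Q' j = {}" if ij: "i:I" "j:I" "i~=j" for i j proof -
  obtain k where k: "k:I" "k~=i" "k~=j" using three[OF ij(1,2)] by blast
  have s: "N i Int Q' j = {}" "N i<=Q i" "N j Int Q i = {}" "N j<=Q' j" "N k Int Q i = {}" "N k Int Q' j = {}"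
   using subres_N[OF Q(2) ij(2,1)] subres_N[OF Q(1) ij] subresD(1)[OF Q(1) ij(1)] subresD(1)[OF Q(2) ij(2)]
    subres_N[OF Q(1) ij(1) k(1)] subres_N[OF Q(2) ij(2) k(1)] ij k by auto
  thus ?thesis
   using n[OF ij(1,2)] N_ne[OF ij(1)] N_ne[OF ij(2)] N_ne[OF k(1)] N_V[OF k(1)] unfolding nest_def by blast
 qed
 have sub: "Q i<=V" "Q' i<=V" using mtight_sub subresD(6) Q i by blast+
 show ?thesis
 proof
  show "Q i<=Q' i"
  proof
   fix x assume x: "x:Q i"
   then obtain j where "j:I" "x:Q' j" using sub subresD(4)[OF Q(2)] by blast
   thus "x:Q' i" using d[OF i, of j] x by blast
  qed
  show "Q' i<=Q i"
  proof
   fix x assume x: "x:Q' i"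
   then obtain j where "j:I" "x:Q j" using sub subresD(4)[OF Q(1)] by blast
   thus "x:Q i" using d[OF _ i, of j] x by blast
  qed
 qed
qed

end

text \<open>The last assumption is the maximality in (T5), restricted to enlarging \<open>E i j\<close> by a subset of one end.\<close>

locale max_frame = frame V Mt I N E for V :: "'a set" and Mt and I :: "'i set" and N E +
 assumes three: "i:I ==> j:I ==> EX k:I. k~=i & k~=j"
  and maxE: "i:I ==> j:I ==> i~=j ==> D<=N i ==> mtight (N i - D) ==> mtight (N j Un E i j Un D) ==> D = {}"
begin

context
 fixes h X u v
 assumes h: "tour h" and X: "mtight X" and uv: "u:I" "v:I" "u~=v"
  and npu: "~ par (X Int res h u)" and pv: "par (X Int res h v)"
  and only: "!!k. k:I ==> par (X Int res h k) ==> adj u k ==> k = v"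
begin

lemma side_tight: "mtight (res h u - X)"
 using mtight_Diff(2)[OF X subresD(6)[OF subres_res[OF h] uv(1)] npu] .

definition W :: "'a set" where "W = {z:V. EX i:I. z:res h i & par (X Int res h i)}"

lemma side_W: "z:W ==> z~:res h u"
 unfolding W_def using subresD(3)[OF subres_res[OF h], of u] uv npu by blast

lemma side_bridge: "bridge W (X Int res h u) (res h u - X)"
proof (rule bridgeI)
 note Q = subres_res[OF h]
 note tf = subres_tfam[OF Q]
 have Qu: "res h u<=V" using mtight_sub[OF subresD(6)[OF Q uv(1)]] .
 have "W = {z:V. EX i:I. z:res h i & (if i:{} then z:X else par (X Int res h i))}"
  unfolding W_def by simp
 thus "mtight W" using odd_union[OF X tf, of "{}"] by simp
 show "mtight (res h u - X)" by (rule side_tight)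
 have "W Un (X Int res h u) = {z:V. EX i:I. z:res h i & (if i:{u} then z:X else par (X Int res h i))}"
  (is "?L = ?R")
 proof
  show "?L<=?R"
  proof
   fix z assume "z:?L"
   thus "z:?R"
   proof
    assume "z:W"
    then obtain i where "i:I" "z:res h i" "par (X Int res h i)" "z:V" unfolding W_def by blast
    moreover hence "i~=u" using npu by blast
    ultimately show ?thesis by auto
   qed (use Qu uv(1) in auto)
  qed
  show "?R<=?L" unfolding W_def by (auto split: if_splits)
 qed
 thus "mtight (W Un (X Int res h u))" using odd_union[OF X tf, of "{u}"] by simp
 have "res h u - X Un X Int res h u = res h u" by blast
 thus "mtight (res h u - X Un X Int res h u)" using subresD(6)[OF Q uv(1)] by simp
 show "W Int (X Int res h u) = {}" "(res h u - X) Int (X Int res h u) = {}" "W Int (res h u - X) = {}"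
  using side_W by blast+
qed

lemma side_to_W:
 assumes m: "m:Mt" and x: "x:X Int res h u" "m x:W" shows "lk m u v" "m x:res h v"
proof -
 note Q = subres_res[OF h]
 obtain k where k: "k:I" "m x:res h k" "par (X Int res h k)" using x(2) unfolding W_def by blast
 have "lk m u k" using k(3) npu subres_lk[OF Q uv(1) k(1) m] x(1) k(2) by blast
 moreover hence "k = v" using only[OF k(1,3)] m unfolding adj_def by blast
 ultimately show "lk m u v" "m x:res h v" using k by auto
qed

lemma side_closed:
 assumes m: "m:Mt" "~ lk m u v" and x: "x:X Int res h u" shows "m x:X Int res h u"
proof (rule ccontr)
 assume "m x~:X Int res h u"
 then obtain y where "y:X Int res h u" "m y:W" using bridge_open(1)[OF side_bridge m(1) x] by blast
 thus False using side_to_W(1)[OF m(1)] m(2) by blast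
qed

lemma side_out_one:
 assumes "m:Mt" "x:X Int res h u" "y:X Int res h u" "m x:res h u - X" "m y:res h u - X"
 shows "x = y"
 using mtight_un_in[OF side_tight assms(1), of x y] assms mtight_sub[OF X] by blast

lemma side_E_sub: "w:I ==> X Int res h u Int E u w~={} ==> E u w<=res h u"
 using res_Int_E[OF uv(1), of w h] by (auto split: if_splits)

lemma side_E:
 assumes w: "w:I" "w~=u" "w~=v" and np: "~ par (X Int res h u Int E u w)"
 shows "X Int res h u Int E u w = {}"
proof (rule ccontr)
 let ?a = "X Int res h u Int E u w"
 assume ne: "?a~={}"
 note Q = subres_res[OF h]
 have EQ: "E u w<=res h u" by (rule side_E_sub[OF w(1) ne])
 have Nw: "N w Int res h u = {}" by (rule subres_N[OF Q uv(1) w(1) w(2)[symmetric]])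
 have fc: "fcut ?a" using X subresD(6)[OF Q uv(1)] E_fcut[OF uv(1) w(1)] by blast
 have V: "?a<=V" using mtight_sub[OF X] by blast
 have "?a = {}"
 proof (rule closed_empty)
  show "?a<=V" by (rule V)
  show "?a~=V" using NE_disj[OF uv(1) w(1) uv(1)] N_V[OF uv(1)] N_ne[OF uv(1)] by blast
  fix m x assume m: "m:Mt" and x: "x:?a"
  show "m x:?a"
  proof (rule npar_one_closed[OF fc np m _ x])
   fix x y assume xy: "x:?a" "m x~:?a" "y:?a" "m y~:?a"
   show "x = y"
   proof (cases "lk m u v")
    case True hence "~ lk m u w" using lk_un[OF uv(1,2) w(1) m] w(3) by blast
    hence "m x:E u w" "m y:E u w" using nlk_closed[OF uv(1) w(1) m] xy by auto
    thus ?thesis using side_out_one[OF m, of x y] xy EQ by blast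
   next case False
    have *: "z:V - N u & m z:N u" if z: "z:?a" "m z~:?a" for z proof -
     have "m z:X Int res h u" using side_closed[OF m False] z by blast
     moreover have "m z:N u Un N w Un E u w" using E_in[OF uv(1) w(1) m] z by blast
     ultimately show ?thesis using z Nw NE_disj[OF uv(1) w(1) uv(1)] V by blast
    qed
    show ?thesis using mtight_un_in[OF N_tight[OF uv(1)] m] *[OF xy(1,2)] *[OF xy(3,4)] by blast
   qed
  qed
 qed
 thus False using ne by simp
qed

text \<open>Let \<open>X\<close> meet the class \<open>u\<close> evenly, and let only its neighbour \<open>v\<close> be met oddly. Then the part of \<open>X\<close> in the class of \<open>u\<close> could
be moved from \<open>u\<close> to \<open>v\<close>, so its part in \<open>N u\<close> is empty by maximality.\<close>

lemma side_main:
 assumes np: "!!w. w:I ==> w~=u ==> w~=v ==> ~ par (X Int res h u Int E u w)"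
 shows "X Int res h u<=E u v" "mtight (N v Un (X Int res h u))"
proof -
 let ?D = "X Int res h u"
 note Q = subres_res[OF h]
 have vu: "v~=u" using uv by blast
 have "?D<=U u" using subresD(2)[OF Q uv(1)] by blast
 moreover have "?D Int E u w = {}" if "w:I" "w~=u" "w~=v" for w using side_E[OF that np[OF that]] .
 ultimately have D: "?D<=N u Un E u v" unfolding U_def using E_refl by blast
 have fc: "fcut ?D" using X subresD(6)[OF Q uv(1)] by blast
 have DV: "?D<=V" using fcut_sub[OF fc] .
 obtain k where k: "k:I" "k~=u" "k~=v" using three[OF uv(1,2)] by blast
 obtain m1 where m1: "m1:Mt" "~ lk m1 u v" using not_only_nbr[OF uv(1,2) k(1) uv(3) k(2,3)] by blast
 have cD: "m1 x:?D" if "x:?D" for x using side_closed[OF m1 that] .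
 have cE: "m1 x:E u v" if "x:E u v" for x using nlk_closed[OF uv(1,2) m1 that] .
 have npE: "~ par (?D Int E u v)" using npar_closed[OF m1(1), of "?D Int E u v"] cD cE DV by blast
 have NuV: "N u Int E u v = {}" "N v Int E u v = {}" "N v Int N u = {}"
  using NE_disj uv N_disj[OF uv(2,1) vu] by auto
 have DN: "?D Int N u = ?D - E u v" using D NuV by blast
 have npN: "~ par (N u Int ?D)" using par_split[OF fc conjunct1[OF E_fcut[OF uv(1,2)]]] npE
   par_split[OF fc conjunct1[OF E_fcut[OF uv(1,2)]]] npar_closed[OF m1(1) DV cD] DN by (simp add: Int_commute)
 have parNu: "par (N u - ?D)" using par_split[of "N u" ?D] N_tight[OF uv(1)] fc npN by auto
 have "(res h u - X) Int N u = N u - ?D" using subresD(1)[OF Q uv(1)] by blast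
 hence t1: "mtight (N u - ?D)" using mtight_Int_Un(1)[OF side_tight N_tight[OF uv(1)]] parNu by simp
 have QNv: "N v<=res h v" "res h v Int res h u = {}" using subresD(1)[OF Q uv(2)] subresD(3)[OF Q uv(2,1) vu] by auto
 have toW: "m x:res h v & m x:N v Un E u v" if "m:Mt" "x:?D" "m x:W" for m x proof -
  have "lk m u v" "m x:res h v" using side_to_W[OF that(1) _ that(3)] that(2) by blast+
  hence "m x:N u Un E u v Un N v" using lk_closed[OF uv(1,2) that(1)] D that(2) by blast
  moreover have "m x~:N u" using `m x:res h v` QNv subresD(1)[OF Q uv(1)] by blast
  ultimately show ?thesis using `m x:res h v` by blast
 qed
 have "?D<=E u v & mtight (N v Un ?D)"
 proof (cases "h u v")
  case True hence EQ: "E u v<=res h u" using res_Int_E[OF uv(1,2), of h] by auto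
  have "bridge (N v) ?D (res h u - X)"
   by (rule bridge_mono[OF side_bridge]) (use toW EQ QNv in blast)
  hence t2: "mtight (N v Un ?D)"
   by (rule bridge_tight[OF N_tight[OF uv(2)]]) (use QNv DV in blast)+
  have "(N v Un ?D) Int (N v Un E u v) = N v Un (?D Int E u v)" by blast
  moreover have "par (N v Un (?D Int E u v))"
   using par_Un[of "N v" "?D Int E u v"] N_tight[OF uv(2)] fc E_fcut[OF uv(1,2)] npE NuV by auto
  ultimately have "mtight ((N v Un ?D) Un (N v Un E u v))"
   using mtight_Int_Un(2)[OF t2] NE_tight[OF uv(2,1) vu] E_sym[OF uv(1,2)] by simp
  moreover have "(N v Un ?D) Un (N v Un E u v) = N v Un E u v Un (?D Int N u)" using D by blast
  ultimately have t3: "mtight (N v Un E u v Un (?D Int N u))" by simp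
  have "N u - ?D Int N u = N u - ?D" by blast
  hence "?D Int N u = {}" using maxE[OF uv _ _ t3] t1 by simp
  thus ?thesis using D t2 by blast
 next case False hence "res h u Int E u v = {}" using res_Int_E[OF uv(1,2), of h] by simp
  hence DNu: "?D<=N u" using D by blast
  have "bridge (N v Un E u v) ?D (res h u - X)"
   by (rule bridge_mono[OF side_bridge]) (use toW in blast)
  moreover have "mtight (N v Un E u v)" using NE_tight[OF uv(2,1) vu] E_sym[OF uv(1,2)] by simp
  moreover have "(N v Un E u v) Int ?D = {}" "(res h u - X) Int ?D = {}" "(N v Un E u v) Int (res h u - X) = {}"
   using `res h u Int E u v = {}` QNv by blast+
  ultimately have "mtight (N v Un E u v Un ?D)" using bridge_tight[OF _ _ _ _ _ DV] by blast
  hence "?D = {}" using maxE[OF uv DNu t1] by blast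
  thus ?thesis using N_tight[OF uv(2)] by simp
 qed
 thus "X Int res h u<=E u v" "mtight (N v Un (X Int res h u))" by auto
qed

end

text \<open>If the part of \<open>X\<close> in \<open>E u w\<close> were odd, it could not be closed under any mate function; but a
matching that joins \<open>u\<close> neither to \<open>v\<close> nor to \<open>w\<close> preserves it.\<close>

lemma deg3_nosplit:
 assumes deg3: "!!u v w. u:I ==> v:I ==> w:I ==> EX m:Mt. ~ lk m u v & ~ lk m u w"
  and h: "tour h" and X: "mtight X" and uvw: "u:I" "v:I" "w:I" "u~=v" "u~=w" "v~=w"
  and p: "~ par (X Int res h u)" "par (X Int res h v)"
  and only: "!!k. k:I ==> par (X Int res h k) ==> adj u k ==> k = v"
 shows "~ par (X Int res h u Int E u w)"
proof -
 obtain m where m: "m:Mt" "~ lk m u v" "~ lk m u w" using deg3 uvw by metis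
 have "X Int res h u Int E u w<=V" using mtight_sub[OF X] by blast
 moreover have "m x:X Int res h u" if "x:X Int res h u" for x
  by (rule side_closed[OF h X uvw(1,2,4) p _ m(1,2) that]) (use only in blast)
 ultimately show ?thesis
  using npar_closed[OF m(1), of "X Int res h u Int E u w"] nlk_closed[OF uvw(1,3) m(1,3)] by blast
qed

end

text \<open>The two reasons for \<open>nosplit\<close> are different: degree at least three (\<open>deg3_nosplit\<close>), or (T7) in a
cycle (\<open>ring_nosplit\<close>). Everything that follows from it is shared.\<close>

locale loc_frame = max_frame V Mt I N E for V :: "'a set" and Mt and I :: "'i set" and N E +
 assumes nosplit: "tour h ==> mtight X ==> u:I ==> v:I ==> w:I ==> u~=v ==> u~=w ==> v~=w ==>
  ~ par (X Int res h u) ==> par (X Int res h v) ==>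
  (!!k. k:I ==> par (X Int res h k) ==> adj u k ==> k = v) ==> ~ par (X Int res h u Int E u w)"
begin

lemma locA:
 assumes h: "tour h" and X: "mtight X" and uv: "u:I" "v:I" "u~=v"
  and p: "~ par (X Int res h u)" "par (X Int res h v)"
  and only: "!!k. k:I ==> par (X Int res h k) ==> adj u k ==> k = v"
 shows "X Int res h u<=E u v" "mtight (N v Un (X Int res h u))"
proof -
 have np: "~ par (X Int res h u Int E u w)" if "w:I" "w~=u" "w~=v" for w
  by (rule nosplit[OF h X uv(1,2) that(1) uv(3) _ _ p]) (use that only in blast)+
 show "X Int res h u<=E u v" by (rule side_main(1)[OF h X uv p]) (use only np in blast)+
 show "mtight (N v Un (X Int res h u))" by (rule side_main(2)[OF h X uv p]) (use only np in blast)+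
qed

lemma loc1:
 assumes h: "tour h" and X: "mtight X" and v: "v:I"
  and O: "!!k. k:I ==> par (X Int res h k) <-> k = v"
 shows "vloc v X | eloc X"
proof -
 have XV: "X<=V" using mtight_sub[OF X] .
 have A: "X Int res h u<=E u v & mtight (N v Un (X Int res h u))"
  if "tour h" "!!k. k:I ==> par (X Int res h k) <-> k = v" "u:I" "u~=v" "v:I" for h u v
  using locA[OF that(1) X that(3,5,4)] that(2)[OF that(3)] that(2)[OF that(5)] that(2,4) by blast
 have sub: "X<=U v"
  if h': "tour h" and O': "!!k. k:I ==> par (X Int res h k) <-> k = v" and v': "v:I" for h v
 proof
  fix x assume x: "x:X"
  then obtain u where u: "u:I" "x:res h u" using subresD(4)[OF subres_res[OF h']] XV by blast
  show "x:U v"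
  proof (cases "u = v")
   case True thus ?thesis using u subresD(2)[OF subres_res[OF h'] v'] by blast
  next case False hence "x:E u v" using A[OF h' O' u(1) False v'] x u by blast
   thus ?thesis using E_sym[OF u(1) v'] E_sub_U[OF u(1), of v] by blast
  qed
 qed
 have XU: "X<=U v" using sub[OF h O v] .
 have fcX: "fcut (X Int A)" if "mtight A" for A using X that by blast
 have fcE: "fcut (X Int E u v)" if "u:I" for u using X E_fcut[OF that v] by blast
 show ?thesis
 proof (cases "EX u:I. u~=v & par (X Int E u v)")
  case True
  then obtain u where u: "u:I" "u~=v" "par (X Int E u v)" by blast
  note Q = subres_res[OF h]
  have nuv: "~ h u v"
  proof
   assume "h u v"
   hence "E u v<=res h u" using res_Int_E[OF u(1) v, of h] by auto
   hence "X Int res h u = X Int E u v" using A[OF h O u(1,2) v] by blast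
   thus False using O[OF u(1)] u by simp
  qed
  hence hvu: "h v u" using h u(2) unfolding tour_def by blast
  define g where "g = (%a b. if a = u & b = v then True else if a = v & b = u then False else h a b)"
  have g: "tour g"
   unfolding tour_def
  proof (intro allI impI)
   fix a b :: 'i assume "a~=b"
   hence "h a b = (~ h b a)" using h unfolding tour_def by blast
   thus "g a b = (~ g b a)" unfolding g_def using u(2) by auto
  qed
  note Q' = subres_res[OF g]
  have r1: "res g k = res h k" if "k~=u" "k~=v" for k unfolding res_def g_def using that by simp
  have r2: "res g u = res h u Un E u v" unfolding res_def g_def using u v nuv by auto
  have "{j:I. h v j} = insert u {j:I. g v j}" unfolding g_def using u v hvu by auto
  hence r3: "res h v = res g v Un E u v" unfolding res_def using E_sym[OF u(1) v] by auto
  have d2: "res h u Int E u v = {}" using res_Int_E[OF u(1) v, of h] nuv by simp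
  have "~ g v u" unfolding g_def using u(2) by simp
  hence d3: "res g v Int E u v = {}" using res_Int_E[OF v u(1), of g] E_sym[OF u(1) v] by simp
  have "X Int res g u = (X Int res h u) Un (X Int E u v)" using r2 by blast
  moreover have "(X Int res h u) Int (X Int E u v) = {}" using d2 by blast
  ultimately have p2: "par (X Int res g u)"
   using par_Un[OF fcX[OF subresD(6)[OF Q u(1)]] fcE[OF u(1)]] O[OF u(1)] u(2,3) by simp
  have "X Int res h v = (X Int res g v) Un (X Int E u v)" using r3 by blast
  moreover have "(X Int res g v) Int (X Int E u v) = {}" using d3 by blast
  ultimately have p3: "~ par (X Int res g v)"
   using par_Un[OF fcX[OF subresD(6)[OF Q' v]] fcE[OF u(1)]] O[OF v] u(3) by simp
  have "par (X Int res g k) <-> k = u" if "k:I" for k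
   using p2 p3 r1[of k] O[OF that] by (cases "k = u"; cases "k = v") auto
  hence "X<=U u" using sub[OF g _ u(1)] by blast
  hence "X<=E u v" using XU U_Int_U[OF u(1) v u(2)] by blast
  thus ?thesis unfolding eloc_def using u v by blast
 next case False
  define g where "g = (%a b. if a = v then False else if b = v then True else h a b)"
  have g: "tour g"
   unfolding tour_def
  proof (intro allI impI)
   fix a b :: 'i assume "a~=b"
   hence "h a b = (~ h b a)" using h unfolding tour_def by blast
   thus "g a b = (~ g b a)" unfolding g_def using `a~=b` by auto
  qed
  note Q' = subres_res[OF g]
  have rv: "res g v = N v" unfolding res_def g_def by simp
  have ru: "X Int res g u = X Int E u v" if u: "u:I" "u~=v" for u proof -
   have "g u v" unfolding g_def using u by simp
   hence "E u v<=res g u" using res_Int_E[OF u(1) v, of g] by auto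
   moreover have "X Int res g u<=E u v" using XU subresD(2)[OF Q' u(1)] U_Int_U[OF u(1) v u(2)] by blast
   ultimately show ?thesis by blast
  qed
  have "~ par (X Int res g u)" if "u:I" "u~=v" for u using ru[OF that] False that by auto
  hence Og: "par (X Int res g k) <-> k = v" if "k:I" for k
   using odd_class_ex[OF X subres_tfam[OF Q']] that by blast
  have "mtight (X Int N v)" using mtight_Int_Un(1)[OF X N_tight[OF v]] Og[OF v] rv by simp
  moreover have "mtight (N v Un (X Int E v u))" if "u:I" "u~=v" for u
   using A[OF g Og that v] ru[OF that] E_sym[OF that(1) v] by simp
  ultimately show ?thesis unfolding vloc_def using XU by blast
 qed
qed

text \<open>The classes of a resolution that meet \<open>X\<close> oddly form a tight union, hence all but one or only one of
them do. Passing to the complement leaves the second case.\<close>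

lemma bob_loc:
 assumes h: "tour h" and b: "bobfam I (res h)" and X: "mtight X"
 shows "EX Z:{X, V - X}. eloc Z | (EX v:I. vloc v Z)"
proof -
 note Q = subres_res[OF h]
 define O' where "O' = {i:I. par (X Int res h i)}"
 have O'_iff: "k:O' <-> par (X Int res h k)" if "k:I" for k unfolding O'_def using that by simp
 have O'_sub: "O'<=I" unfolding O'_def by blast
 have "(UN i:O'. res h i) = {z:V. EX i:I. z:res h i & (if i:{} then z:X else par (X Int res h i))}" proof -
  have "res h i<=V" if "i:I" for i using mtight_sub[OF subresD(6)[OF Q that]] .
  thus ?thesis unfolding O'_def by auto
 qed
 hence "mtight (UN i:O'. res h i)" using odd_union[OF X subres_tfam[OF Q], of "{}"] by simp
 then obtain v where v: "v:I" "O' = {v} | O' = I - {v}" using b O'_sub unfolding bobfam_def by metis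
 show ?thesis
 proof (cases "O' = {v}")
  case True hence "par (X Int res h k) <-> k = v" if "k:I" for k using O'_iff[OF that] by simp
  thus ?thesis using loc1[OF h X v(1)] v(1) by blast
 next case False hence "O' = I - {v}" using v(2) by simp
  hence "~ par (X Int res h k) <-> k = v" if "k:I" for k using O'_iff[OF that] that by auto
  hence "par ((V - X) Int res h k) <-> k = v" if "k:I" for k
   using odd_compl[OF X subresD(6)[OF Q that]] that by blast
  thus ?thesis using loc1[OF h mtight_compl[OF X] v(1)] v(1) by blast
 qed
qed

end

section \<open>The largest movable pieces of a tight set partition\<close>

locale part_frame = frame V Mt I N "%_ _. {}" for V :: "'a set" and Mt and I :: "'i set" and N +
 assumes three: "i:I ==> j:I ==> EX k:I. k~=i & k~=j"
begin

lemma plk: "lk m i j <-> i~=j & (EX x:N i. m x:N j)"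
 unfolding lk_def by simp

text \<open>The pieces that can be moved from \<open>N i\<close> to \<open>N j\<close>. They are closed under union, including infinite unions, so that
there is a largest one, \<open>B i j\<close>.\<close>

definition LL :: "'i => 'i => 'a set set" where
 "LL i j = {D. D<=N i & mtight (N i - D) & mtight (N j Un D)}"

definition B :: "'i => 'i => 'a set" where "B i j = (if i = j then {} else \<Union>(LL i j))"

lemma nlk_ex:
 assumes "i:I" "j:I" "i~=j" shows "EX m:Mt. ~ lk m i j"
proof -
 obtain k where "k:I" "k~=i" "k~=j" using three[OF assms(1,2)] by blast
 thus ?thesis using not_only_nbr[OF assms(1,2)] assms(3) by blast
qed

lemma LL_bridge:
 assumes "i:I" "j:I" "i~=j" "D:LL i j" shows "bridge (N i - D) D (N j)"
proof (rule bridgeI)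
 have D: "D<=N i" "mtight (N i - D)" "mtight (N j Un D)" using assms(4) unfolding LL_def by auto
 show "mtight (N i - D)" "mtight (N j Un D)" "mtight (N j)" using D N_tight assms by auto
 have "N i - D Un D = N i" using D by blast
 thus "mtight (N i - D Un D)" using N_tight assms by simp
 show "(N i - D) Int D = {}" "N j Int D = {}" "(N i - D) Int N j = {}" using D N_disj[OF assms(1-3)] by blast+
qed

lemma LL_closed:
 assumes "i:I" "j:I" "i~=j" "D:LL i j" "m:Mt" "~ lk m i j" "x:D" shows "m x:D"
proof (rule ccontr)
 assume "m x~:D"
 then obtain y where "y:D" "m y:N j"
  using bridge_open(2)[OF LL_bridge[OF assms(1-4)] assms(5,7)] by blast
 hence "lk m i j" unfolding plk using assms(3,4) unfolding LL_def by blast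
 thus False using assms(6) by simp
qed

lemma LL_npar:
 assumes "i:I" "j:I" "i~=j" "D:LL i j" shows "fcut D & ~ par D"
proof -
 have "N j Int D = {}" using N_disj[OF assms(1-3)] assms(4) unfolding LL_def by blast
 thus ?thesis using bridge_npar[OF N_tight[OF assms(2)]] assms(4) unfolding LL_def by blast
qed

lemma LL_empty: "i:I ==> j:I ==> {}:LL i j"
 unfolding LL_def using N_tight by simp

lemma LL_Un:
 assumes ij: "i:I" "j:I" "i~=j" and D: "D:LL i j" "D':LL i j" shows "D Un D':LL i j"
proof -
 obtain m where m: "m:Mt" "~ lk m i j" using nlk_ex[OF ij] by blast
 have cl: "m x:D" if "x:D" for x using LL_closed[OF ij D(1) m that] .
 have cl': "m x:D'" if "x:D'" for x using LL_closed[OF ij D(2) m that] .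
 have sub: "D<=N i" "D'<=N i" using D unfolding LL_def by auto
 have V: "D<=V" "D'<=V" using sub N_V[OF ij(1)] by auto
 have np: "fcut (D Un D') & ~ par (D Un D')" "fcut (D Int D') & ~ par (D Int D')"
  by (rule npar_closed[OF m(1)], use V cl cl' in blast, use cl cl' in blast)+
 have "par (N j Un (D Int D'))" using sub N_disj[OF ij] par_Un[of "N j" "D Int D'"] np N_tight[OF ij(2)] by blast
 moreover have "(N j Un D) Int (N j Un D') = N j Un (D Int D')" by blast
 ultimately have "mtight ((N j Un D) Un (N j Un D'))"
  using mtight_Int_Un(2)[of "N j Un D" "N j Un D'"] D unfolding LL_def by simp
 moreover have "(N j Un D) Un (N j Un D') = N j Un (D Un D')" by blast
 ultimately have 1: "mtight (N j Un (D Un D'))" by simp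
 have "par (N i - (D Un D'))" using par_Diff[of "N i" "D Un D'"] np N_tight[OF ij(1)] sub by auto
 moreover have "(N i - D) Int (N i - D') = N i - (D Un D')" by blast
 ultimately have "mtight (N i - (D Un D'))"
  using mtight_Int_Un(1)[of "N i - D" "N i - D'"] D unfolding LL_def by simp
 thus ?thesis using 1 sub unfolding LL_def by blast
qed

lemma B_LL:
 assumes ij: "i:I" "j:I" "i~=j" shows "B i j:LL i j"
proof -
 let ?B = "B i j"
 have Bd: "?B = \<Union>(LL i j)" unfolding B_def using ij by simp
 have sub: "?B<=N i" unfolding Bd LL_def by blast
 have in_L: "EX D:LL i j. z:A Un D" if "z:A Un ?B" for z A
  using that LL_empty[OF ij(1,2)] unfolding Bd by blast
 obtain k where k: "k:I" "k~=i" "k~=j" using three[OF ij(1,2)] by blast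
 have NV: "N i<=V" "N j<=V" "N k<=V" using N_V ij k by auto
 have 1: "mtight (N j Un ?B)"
 proof (rule mtightI)
  show "N j Un ?B<=V" using NV sub by blast
  show "N j Un ?B~={}" using N_ne[OF ij(2)] by blast
  show "N j Un ?B~=V" using sub NV N_ne[OF k(1)] N_disj[OF k(1) ij(1)] N_disj[OF k(1) ij(2)] k by blast
  fix m x y assume m: "m:Mt" and x: "x:N j Un ?B" "m x~:N j Un ?B" and y: "y:N j Un ?B" "m y~:N j Un ?B"
  obtain D D' where D: "D:LL i j" "x:N j Un D" "D':LL i j" "y:N j Un D'" using in_L x(1) y(1) by meson
  have "D Un D':LL i j" by (rule LL_Un[OF ij D(1,3)])
  hence t: "mtight (N j Un (D Un D'))" "D Un D'<=?B" unfolding LL_def Bd by blast+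
  show "x = y" by (rule mtight_un[OF t(1) m]) (use D x y t(2) in blast)+
 qed
 let ?Z = "(V - N i) Un ?B"
 have "mtight ?Z"
 proof (rule mtightI)
  show "?Z<=V" using NV sub by blast
  show "?Z~={}" using NV N_ne[OF ij(2)] N_disj[OF ij] by blast
  obtain m where m: "m:Mt" "~ lk m i j" using nlk_ex[OF ij] by blast
  obtain a where a: "a:N i" "m a~:N i" using mtight_ex[OF N_tight[OF ij(1)] m(1)] by blast
  have "a~:?B" using LL_closed[OF ij _ m] a(2) unfolding Bd LL_def by blast
  thus "?Z~=V" using a NV by blast
  fix m x y assume m: "m:Mt" and x: "x:?Z" "m x~:?Z" and y: "y:?Z" "m y~:?Z"
  obtain D D' where D: "D:LL i j" "x:(V - N i) Un D" "D':LL i j" "y:(V - N i) Un D'"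
   using in_L x(1) y(1) by meson
  have DD: "D Un D':LL i j" by (rule LL_Un[OF ij D(1,3)])
  hence s: "D Un D'<=N i" "D Un D'<=?B" unfolding LL_def Bd by blast+
  have "mtight (V - (N i - (D Un D')))" using DD unfolding LL_def by blast
  moreover have "V - (N i - (D Un D')) = (V - N i) Un (D Un D')" using s NV by blast
  ultimately have t: "mtight ((V - N i) Un (D Un D'))" by simp
  show "x = y" by (rule mtight_un[OF t m]) (use D x y s(2) in blast)+
 qed
 hence "mtight (V - ?Z)" by blast
 moreover have "V - ?Z = N i - ?B" using NV by blast
 ultimately have "mtight (N i - ?B)" by simp
 thus ?thesis unfolding LL_def using 1 sub by blast
qed

lemma B_sub: "i:I ==> j:I ==> B i j<=N i"
 using B_LL[of i j] unfolding LL_def B_def by (cases "i = j") auto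

lemma LL_sub_B: "i~=j ==> D:LL i j ==> D<=B i j"
 unfolding B_def by auto

lemma B_closed: "i:I ==> j:I ==> m:Mt ==> ~ lk m i j ==> x:B i j ==> m x:B i j"
 using LL_closed[OF _ _ _ B_LL, of i j m x] unfolding B_def by (cases "i = j") auto

lemma B_back:
 assumes "i:I" "j:I" "m:Mt" "~ lk m i j" "x:V" "m x:B i j" shows "x:B i j"
 using B_closed[OF assms(1-4,6)] mate_mate[OF assms(3,5)] by simp

lemma B_npar: "i:I ==> j:I ==> fcut (B i j) & ~ par (B i j)"
 using LL_npar[OF _ _ _ B_LL, of i j] unfolding B_def by (cases "i = j") auto

lemma B_tight:
 assumes "i:I" "j:I" "i~=j" shows "mtight (N i - B i j)" "mtight (N j Un B i j)"
 using B_LL[OF assms] unfolding LL_def by auto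

text \<open>A matching that joins \<open>i\<close> to at most one of \<open>j\<close> and \<open>k\<close> preserves one of the two pieces. An even intersection
is left at most once, hence never, by any mate function, and is empty by connectivity.\<close>

lemma B_Int_empty:
 assumes ijk: "i:I" "j:I" "k:I" "i~=j" "i~=k" "j~=k" and np: "~ par (B i j Int B i k)"
 shows "B i j Int B i k = {}"
proof -
 let ?D = "B i j Int B i k"
 have sub: "?D<=N i" using B_sub[OF ijk(1,2)] by blast
 have NV: "N i<=V" using N_V ijk by auto
 have fc: "fcut ?D" using B_npar ijk by auto
 have one: "m x:B a b" if ab: "a = i" "b = j | b = k" and m: "m:Mt" "~ lk m i (if b = j then k else j)" and x: "x:?D"
  for m x a b proof -
  define c where "c = (if b = j then k else j)"
  have bc: "b:I" "c:I" "b~=i" "c~=i" "?D = B i b Int B i c" using ab ijk unfolding c_def by auto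
  have cl: "m y:B i c" if "y:?D" for y using B_closed[OF ijk(1) bc(2) m(1)] m(2) that bc(5) unfolding c_def by blast
  have "m x:?D"
  proof (rule npar_one_closed[OF fc np m(1) _ x])
   fix y z assume yz: "y:?D" "m y~:?D" "z:?D" "m z~:?D"
   have "m y:N i - B i b" "m z:N i - B i b" using yz cl[OF yz(1)] cl[OF yz(3)] bc(5) B_sub[OF ijk(1) bc(2)] by blast+
   thus "y = z"
    using mtight_un_in[OF B_tight(1)[OF ijk(1) bc(1)] m(1), of y z] bc yz NV sub by blast
  qed
  thus ?thesis using bc(5) ab by blast
 qed
 show ?thesis
 proof (rule closed_empty)
  show "?D<=V" using sub NV by blast
  show "?D~=V" using sub N_disj[OF ijk(1,2,4)] N_ne[OF ijk(2)] N_V[OF ijk(2)] by blast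
  fix m x assume m: "m:Mt" and x: "x:?D"
  have "~ lk m i j | ~ lk m i k" using lk_un[OF ijk(1,2,3) m] ijk(6) by blast
  thus "m x:?D"
  proof
   assume a: "~ lk m i j"
   thus ?thesis using one[of i k m x] B_closed[OF ijk(1,2) m a] x m ijk(6) by auto
  next assume a: "~ lk m i k"
   thus ?thesis using one[of i j m x] B_closed[OF ijk(1,3) m a] x m by auto
  qed
 qed
qed

lemma deg3_B_disj:
 assumes "!!u v w. u:I ==> v:I ==> w:I ==> EX m:Mt. ~ lk m u v & ~ lk m u w"
  and ijk: "i:I" "j:I" "k:I" "i~=j" "i~=k" "j~=k"
 shows "B i j Int B i k = {}"
proof (rule B_Int_empty[OF ijk])
 obtain m where m: "m:Mt" "~ lk m i j" "~ lk m i k" using assms by metis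
 have "B i j Int B i k<=V" using B_sub[OF ijk(1,2)] N_V[OF ijk(1)] by blast
 thus "~ par (B i j Int B i k)"
  using npar_closed[OF m(1), of "B i j Int B i k"] B_closed[OF ijk(1,2) m(1,2)] B_closed[OF ijk(1,3) m(1,3)] by blast
qed

end

text \<open>If the movable pieces of each class are disjoint, cutting them off leaves the vertices \<open>C i\<close> of a frame with
\<open>F i j\<close> in the place of \<open>E i j\<close>. The given partition is one of its resolutions, and maximality of
the pieces becomes maximality in the sense of (T5).\<close>

locale split_free = part_frame V Mt I N for V :: "'a set" and Mt and I :: "'i set" and N +
 assumes B_disj: "i:I ==> j:I ==> k:I ==> i~=j ==> i~=k ==> j~=k ==> B i j Int B i k = {}"
begin

lemma B_disj': "i:I ==> j:I ==> k:I ==> j~=k ==> B i j Int B i k = {}"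
 using B_disj[of i j k] unfolding B_def by (cases "i = j | i = k") auto

definition F :: "'i => 'i => 'a set" where "F i j = B i j Un B j i"
definition C :: "'i => 'a set" where "C i = N i - (UN j:I. B i j)"

lemma minus_B:
 assumes i: "i:I" and J: "J<=I" shows "mtight (N i - (UN j:J. B i j))"
proof (cases "J = {}")
 case False
 have NV: "N i<=V" using N_V i by auto
 have two: "mtight (N i - (B i a Un B i b))" if ab: "a:I" "b:I" for a b proof -
  have t: "mtight (N i - B i j)" if "j:I" for j
   using B_tight(1)[OF i that] N_tight[OF i] unfolding B_def by (cases "i = j") auto
  show ?thesis
  proof (cases "a = b")
   case False
   have "par (B i a Un B i b) = False"
    using par_Un[of "B i a" "B i b"] B_npar[OF i ab(1)] B_npar[OF i ab(2)] B_disj'[OF i ab False] by blast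
   hence "par (N i - (B i a Un B i b))"
    using par_Diff[of "N i" "B i a Un B i b"] B_npar[OF i ab(1)] B_npar[OF i ab(2)] N_tight[OF i]
     B_sub[OF i ab(1)] B_sub[OF i ab(2)] by auto
   moreover have "(N i - B i a) Int (N i - B i b) = N i - (B i a Un B i b)" by blast
   ultimately show ?thesis using mtight_Int_Un(1)[OF t[OF ab(1)] t[OF ab(2)]] by simp
  qed (use t ab in simp)
 qed
 let ?Z = "(V - N i) Un (UN j:J. B i j)"
 have BN: "B i j<=N i" if "j:J" for j using B_sub i J that by blast
 have "mtight ?Z"
 proof (rule mtightI)
  show "?Z<=V" using NV BN by blast
  obtain j where "j:I" "j~=i" using two by (metis three i)
  thus "?Z~={}" using N_V[of j] N_ne[of j] N_disj[OF i, of j] by blast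
  obtain m where m: "m:Mt" using Mt_ne by blast
  obtain j0 where j0: "j0:I" "lk m i j0" using lk_ex[OF i m] by blast
  have nl: "~ lk m i j" if "j:I" "j~=j0" for j using lk_un[OF i j0(1) that(1) m j0(2)] that(2) by blast
  have "EX a:N i. ALL j:I. a~:B i j"
  proof (cases "ALL x:B i j0. m x:B i j0")
   case True
   obtain a where a: "a:N i" "m a~:N i" using mtight_ex[OF N_tight[OF i] m] by blast
   have "a~:B i j" if "j:I" for j
    using True B_closed[OF i that m nl[OF that]] a(2) B_sub[OF i that] by blast
   thus ?thesis using a(1) by blast
  next case False
   then obtain x where x: "x:B i j0" "m x~:B i j0" by blast
   have ij: "i~=j0" using j0(2) unfolding lk_def by blast
   obtain y where y: "y:B i j0" "m y:N i - B i j0"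
    using bridge_open(1)[OF LL_bridge[OF i j0(1) ij B_LL[OF i j0(1) ij]] m x] by blast
   have yV: "y:V" using y B_sub[OF i j0(1)] NV by blast
   have "m y~:B i j" if j: "j:I" for j
   proof
    assume a: "m y:B i j"
    hence "j~=j0" using y by blast
    hence "y:B i j" using B_back[OF i j m nl[OF j] yV a] by blast
    thus False using B_disj'[OF i j j0(1) `j~=j0`] y(1) by blast
   qed
   thus ?thesis using y(2) by blast
  qed
  thus "?Z~=V" using NV J by blast
  fix m x y assume m: "m:Mt" and x: "x:?Z" "m x~:?Z" and y: "y:?Z" "m y~:?Z"
  have ex: "EX j:J. z:(V - N i) Un B i j" if "z:?Z" for z using that False by blast
  obtain a b where ab: "a:J" "b:J" "x:(V - N i) Un B i a" "y:(V - N i) Un B i b"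
   using ex[OF x(1)] ex[OF y(1)] by blast
  have "mtight (V - (N i - (B i a Un B i b)))" using two ab J by blast
  moreover have "V - (N i - (B i a Un B i b)) = (V - N i) Un B i a Un B i b" using NV BN ab by blast
  ultimately have t: "mtight ((V - N i) Un B i a Un B i b)" by simp
  show "x = y" by (rule mtight_un[OF t m]) (use ab x y in blast)+
 qed
 hence "mtight (V - ?Z)" by blast
 moreover have "V - ?Z = N i - (UN j:J. B i j)" using NV by blast
 ultimately show ?thesis by simp
qed (use N_tight i in simp)

lemma C_N: "C i<=N i" unfolding C_def by blast

lemma C_B: "j:I ==> C i Int B i j = {}" unfolding C_def by blast

lemma CB_tight:
 assumes ij: "i:I" "j:I" shows "mtight (C i Un B i j)"
proof -
 have "C i Un B i j = N i - (UN k:I - {j}. B i k)"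
  unfolding C_def using B_sub[OF ij] B_disj'[OF ij(1)] ij by blast
 thus ?thesis using minus_B[OF ij(1), of "I - {j}"] by simp
qed

lemma CF_tight:
 assumes ij: "i:I" "j:I" "i~=j" shows "mtight (C i Un F i j)"
proof -
 have ji: "j~=i" using ij by blast
 have s: "B j i<=N j" "B i j<=N i" "N i Int N j = {}" "C i<=N i" using B_sub ij N_disj[OF ij] C_N by auto
 have "bridge (N i) (B j i) (N j - B j i)" using bridge_sym[OF LL_bridge[OF ij(2,1) ji B_LL[OF ij(2,1) ji]]] .
 moreover have "m x:C i Un B i j" if m: "m:Mt" and x: "x:B j i" "m x:N i" for m x proof -
  have "lk m j i" unfolding plk using x s ji by blast
  hence l: "lk m i j" by (rule lk_sym[OF ij(2,1) m])
  have xV: "x:V" using x s N_V[OF ij(2)] by blast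
  have "m x~:B i k" if k: "k:I" "k~=j" for k
  proof
   assume "m x:B i k"
   moreover have "~ lk m i k" using lk_un[OF ij(1,2) k(1) m l] k(2) by blast
   ultimately have "x:B i k" using B_back[OF ij(1) k(1) m _ xV] by blast
   thus False using x s B_sub[OF ij(1) k(1)] by blast
  qed
  thus ?thesis using x unfolding C_def by blast
 qed
 ultimately have "bridge (C i Un B i j) (B j i) (N j - B j i)" by (rule bridge_mono)
 hence "mtight (C i Un B i j Un B j i)"
  by (rule bridge_tight[OF CB_tight[OF ij(1,2)]]) (use s N_V[OF ij(2)] in blast)+
 moreover have "C i Un B i j Un B j i = C i Un F i j" unfolding F_def by blast
 ultimately show ?thesis by simp
qed

sublocale core: frame V Mt I C F
proof
 fix i j assume ij: "i:I" "j:I"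
 show "mtight (C i)" using minus_B[OF ij(1), of I] unfolding C_def by simp
 show "C i Int C j = {}" if "i~=j" using N_disj[OF ij that] C_N by blast
 show "F i j = F j i" unfolding F_def by blast
 show "mtight (C i Un F i j)" if "i~=j" by (rule CF_tight[OF ij that])
 fix k assume k: "k:I"
 have *: "C k Int B a b = {}" if "a:I" "b:I" for a b
  using C_N[of k] C_B[OF that(2), of k] B_sub[OF that] N_disj[OF k that(1)] by (cases "k = a") auto
 show "C k Int F i j = {}" unfolding F_def using *[OF ij] *[OF ij(2,1)] by blast
 fix l assume l: "l:I" and n: "{i, j}~={k, l}"
 have "B a b Int B c d = {}" if "a:I" "b:I" "c:I" "d:I" "{a, b}~={c, d}" for a b c d
  using B_sub[OF that(1,2)] B_sub[OF that(3,4)] N_disj[OF that(1,3)] B_disj'[OF that(1,2,4)] that(5)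
  by (cases "a = c") auto
 thus "F i j Int F k l = {}"
  unfolding F_def using ij k l n by (simp add: Int_Un_distrib Int_Un_distrib2 insert_commute)
next fix i show "F i i = {}" unfolding F_def B_def by simp
next
 have e: "N i = C i Un (UN j:I. B i j)" if "i:I" for i unfolding C_def using B_sub[OF that] by blast
 have "V = (UN i:I. N i)" using cover by simp
 also have "\<dots> = (UN i:I. C i Un (UN j:I. B i j))" by (rule SUP_cong[OF refl e])
 also have "\<dots> = (UN i:I. C i) Un (UN i:I. UN j:I. F i j)" unfolding F_def by blast
 finally show "V = (UN i:I. C i) Un (UN i:I. UN j:I. F i j)" .
 show "EX i:I. EX j:I. i~=j" by (rule two)
qed

lemma N_Int_F: assumes "i:I" "j:I" shows "N i Int F i j = B i j"
proof (cases "i = j")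
 case False thus ?thesis using B_sub[OF assms] B_sub[OF assms(2,1)] N_disj[OF assms] unfolding F_def by blast
qed (simp add: F_def B_def)

lemma core_subres: "core.subres N"
 unfolding core.subres_def
proof (intro conjI ballI impI)
 fix i assume i: "i:I"
 show "C i<=N i" by (rule C_N)
 show "N i<=core.U i" unfolding core.U_def C_def F_def by blast
 fix j assume j: "j:I" "i~=j"
 show "N i Int N j = {}" by (rule N_disj[OF i j])
 show "mtight (C i Un (N i Int F i j))" using CB_tight[OF i j(1)] N_Int_F[OF i j(1)] by simp
next show "\<Union> (N ` I) = V" using cover by simp
qed

lemma core_lk: "i:I ==> j:I ==> m:Mt ==> core.lk m i j <-> lk m i j"
 using core.subres_lk[OF core_subres] plk by simp

sublocale core: max_frame V Mt I C F
proof
 show "EX k:I. k~=i & k~=j" if "i:I" "j:I" for i j using three that .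
 fix i j D assume ij: "i:I" "j:I" "i~=j" and D: "D<=C i" "mtight (C i - D)" "mtight (C j Un F i j Un D)"
 have ji: "j~=i" using ij by blast
 have CV: "C i<=V" using core.N_V[OF ij(1)] .
 have dj: "C j Int C i = {}" "C i Int F i j = {}" "N j Int C i = {}" "B i j Int C i = {}"
  using core.N_disj[OF ij(2,1) ji] core.NE_disj[OF ij(1,2) ij(1)] N_disj[OF ij(2,1) ji] C_N[of i] C_B[OF ij(2), of i] by blast+
 have br: "bridge (C j Un F i j) D (C i - D)"
 proof (rule bridgeI)
  show "mtight (C j Un F i j)" using core.NE_tight[OF ij(2,1) ji] core.E_sym[OF ij(1,2)] by simp
  have "C i - D Un D = C i" using D by blast
  thus "mtight (C i - D Un D)" using core.N_tight[OF ij(1)] by simp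
 qed (use D dj in blast)+
 have cl: "m x:D" if m: "m:Mt" "~ lk m i j" and x: "x:D" for m x
 proof (rule ccontr)
  assume "m x~:D"
  then obtain y where "y:D" "m y:C j Un F i j" using bridge_open(1)[OF br m(1) x] by blast
  hence "core.lk m i j" unfolding core.lk_def using ij(3) D(1) by blast
  thus False using core_lk[OF ij(1,2) m(1)] m(2) by blast
 qed
 have bk: "x:D" if m: "m:Mt" "~ lk m i j" and x: "x:V" "m x:D" for m x
  using cl[OF m x(2)] mate_mate[OF m(1) x(1)] by simp
 obtain m1 where m1: "m1:Mt" "~ lk m1 i j" using nlk_ex[OF ij] by blast
 have DV: "D<=V" using D(1) CV by blast
 have np: "fcut D & ~ par D" by (rule npar_closed[OF m1(1) DV cl[OF m1]])
 have NiV: "N i<=V" "N j<=V" "B i j<=N i" using N_V ij B_sub by auto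
 have Ni: "N i = C i Un (UN k:I. B i k)" if "i:I" for i unfolding C_def using B_sub[OF that] by blast
 let ?Y = "N i - B i j"
 have Yt: "mtight ?Y" by (rule B_tight(1)[OF ij])
 have DY: "D<=?Y" using D(1) C_N dj by blast
 have 1: "mtight (?Y - D)"
 proof (rule mtightI_par)
  show "?Y - D<=V" using NiV by blast
  show "par (?Y - D)" using par_Diff[of ?Y D] Yt np DY by auto
  fix m x y assume m: "m:Mt" and x: "x:?Y - D" "m x~:?Y - D" and y: "y:?Y - D" "m y~:?Y - D"
  show "x = y"
  proof (cases "lk m i j")
   case True
   have "z:C i - D & m z~:C i - D" if z: "z:?Y - D" "m z~:?Y - D" for z proof -
    have "z~:B i k" if k: "k:I" for k
    proof
     assume zk: "z:B i k"
     hence kj: "k~=j" using z by blast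
     hence "m z:B i k" using lk_un[OF ij(1,2) k m True] B_closed[OF ij(1) k m] zk by blast
     hence "m z:?Y - D" using B_sub[OF ij(1) k] B_disj'[OF ij(1) k ij(2) kj] D(1) C_B[OF k, of i] by blast
     thus False using z by blast
    qed
    hence "z:C i - D" using z unfolding C_def by blast
    moreover have "C i - D<=?Y - D" using C_N dj by blast
    ultimately show ?thesis using z by blast
   qed
   thus ?thesis using mtight_un[OF D(2) m] x y by blast
  next case False
   have "m z~:?Y" if z: "z:?Y - D" "m z~:?Y - D" for z
    using bk[OF m False, of z] z NiV by blast
   thus ?thesis using mtight_un[OF Yt m] x y by blast
  qed
 qed
 have 2: "mtight (N j Un (B i j Un D))"
 proof (rule mtightI_par)
  let ?Z = "N j Un (B i j Un D)"
  show "?Z<=V" using NiV DV by blast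
  have "(N j Un B i j) Int D = {}" using D(1) dj by blast
  hence "par ((N j Un B i j) Un D)" using par_Un[of "N j Un B i j" D] B_tight(2)[OF ij] np by auto
  thus "par ?Z" by (simp add: Un_assoc)
  fix m x y assume m: "m:Mt" and x: "x:?Z" "m x~:?Z" and y: "y:?Z" "m y~:?Z"
  show "x = y"
  proof (cases "lk m i j")
   case True
   have l: "lk m j i" by (rule lk_sym[OF ij(1,2) m True])
   have sub: "C j Un F i j Un D<=?Z" unfolding F_def using C_N[of j] B_sub[OF ij(2,1)] by blast
   have "z:C j Un F i j Un D" if z: "z:?Z" "m z~:?Z" for z
   proof (cases "z:N j")
    case zN: True
    have "z~:B j k" if k: "k:I" "k~=i" for k
    proof
     assume zk: "z:B j k"
     have "~ lk m j k" using lk_un[OF ij(2,1) k(1) m l] k(2) by blast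
     hence "m z:B j k" using B_closed[OF ij(2) k(1) m] zk by blast
     thus False using z B_sub[OF ij(2) k(1)] by blast
    qed
    thus ?thesis using zN Ni[OF ij(2)] unfolding F_def by blast
   qed (use z F_def in blast)
   thus ?thesis using mtight_un[OF D(3) m, of x y] x y sub by blast
  next case False
   have "z:N j Un B i j" if z: "z:?Z" "m z~:?Z" for z using cl[OF m False, of z] z by blast
   thus ?thesis using mtight_un[OF B_tight(2)[OF ij] m, of x y] x y by blast
  qed
 qed
 have "N i - (B i j Un D) = ?Y - D" by blast
 moreover have "B i j Un D<=N i" using NiV D(1) C_N[of i] by blast
 ultimately have "B i j Un D:LL i j" unfolding LL_def using 1 2 by simp
 hence "D<=B i j" using LL_sub_B[OF ij(3)] by blast
 thus "D = {}" using D(1) dj by blast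
qed

end

section \<open>Cycles and odd arcs\<close>

locale ring_frame = frame V Mt "{..<n}" N E for V :: "'a set" and Mt and n :: nat and N E +
 assumes n4: "4<=n" and n_even: "even n"
  and types: "m:Mt ==> (ALL i<n. lk m i (Suc i mod n) <-> even i) | (ALL i<n. lk m i (Suc i mod n) <-> odd i)"
begin

definition s :: "nat => nat" where "s i = Suc i mod n"

definition cr :: "('a => 'a) => nat => bool" where "cr m i <-> lk m i (s i)"

lemma s_if: "i < n ==> s i = (if Suc i = n then 0 else Suc i)"
 unfolding s_def by auto

lemma s_lt: "i < n ==> s i < n" using n4 by (simp add: s_if)

lemma s_inj: "i < n ==> j < n ==> s i = s j ==> i = j" by (auto simp: s_if split: if_splits)

lemma s_ne: "i < n ==> s i~=i" using n4 by (simp add: s_if)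

lemma ss_ne: "i < n ==> s (s i)~=i"
 using n4 by (cases "Suc i = n"; cases "Suc (Suc i) = n") (simp_all add: s_if)

lemma s_surj: assumes "i < n" obtains p where "p < n" "s p = i"
proof (cases "i = 0")
 case True thus ?thesis using that[of "n - 1"] n4 by (simp add: s_if)
next case False thus ?thesis using that[of "i - 1"] assms by (simp add: s_if)
qed

lemma even_s: "i < n ==> even (s i) <-> odd i"
 using n_even by (cases "Suc i = n") (auto simp: s_if)

lemma cr_types: "m:Mt ==> (ALL i<n. cr m i <-> even i) | (ALL i<n. cr m i <-> odd i)"
 unfolding cr_def s_def by (rule types)

lemma cr_s: "m:Mt ==> i < n ==> cr m (s i) <-> ~ cr m i"
 using cr_types[of m] s_lt[of i] even_s[of i] by auto

lemma cr_par: "m:Mt ==> i < n ==> j < n ==> cr m i ==> cr m j <-> (even i <-> even j)"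
 using cr_types[of m] by auto

lemma lk_nbr:
 assumes m: "m:Mt" and ij: "i < n" "j < n" and l: "lk m i j"
 shows "j = s i & cr m i | i = s j & cr m j"
proof (cases "cr m i")
 case True hence "j = s i" using lk_un[of i j "s i" m] ij s_lt[OF ij(1)] m l unfolding cr_def by simp
 thus ?thesis using True by simp
next case False
 obtain p where p: "p < n" "s p = i" using s_surj[OF ij(1)] by blast
 hence c: "cr m p" using cr_s[OF m p(1)] False by simp
 hence "lk m p i" unfolding cr_def using p by simp
 hence "j = p" using lk_sym[of p i m] p ij m lk_un[of i j p m] ij p m l by blast
 thus ?thesis using p c by simp
qed

lemma cr_ex:
 assumes "i < n" shows "EX m:Mt. cr m i" "EX m:Mt. ~ cr m i"
proof -
 have *: "EX m:Mt. ~ cr m i" if i: "i < n" for i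
  using not_only_nbr[of i "s i" "s (s i)"] i s_lt s_ne[OF i] s_ne[OF s_lt[OF i]] ss_ne[OF i]
  unfolding cr_def by auto
 show "EX m:Mt. ~ cr m i" by (rule *[OF assms])
 show "EX m:Mt. cr m i" using *[OF s_lt[OF assms]] cr_s[OF _ assms] by blast
qed

lemma adj_iff: "i < n ==> j < n ==> adj i j <-> j = s i | i = s j"
 using lk_nbr[of _ i j] cr_ex(1)[of i] cr_ex(1)[of j] lk_sym[of j i] unfolding adj_def cr_def by auto

lemma ring_two:
 assumes "m:Mt" "i < n" "j < n" "k < n" "adj i j" "adj i k" "j~=k" shows "lk m i j | lk m i k"
proof -
 obtain l where l: "l < n" "lk m i l" using lk_ex[of i m] assms(1,2) by auto
 hence "adj i l" unfolding adj_def using assms(1) by blast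
 hence "l = s i | i = s l" "j = s i | i = s j" "k = s i | i = s k"
  using adj_iff[OF assms(2)] assms(3-6) l(1) by auto
 thus ?thesis using s_inj assms(3,4,7) l(1) l(2) by blast
qed

lemma ring_three: "EX k:{..<n}. k~=i & k~=j"
proof -
 have "0:{..<n}" "1:{..<n}" "2:{..<n}" using n4 by auto
 thus ?thesis by (cases "0~=i & 0~=j"; cases "1~=i & 1~=j") (metis, metis, metis, metis zero_neq_one zero_neq_numeral one_eq_numeral_iff semiring_norm(85) numeral_eq_one_iff)
qed

abbreviation e :: "nat => 'a set" where "e i \<equiv> E i (s i)"

lemma E_e:
 assumes "i < n" "j < n" "E i j~={}" shows "j = s i & E i j = e i | i = s j & E i j = e j"
proof -
 show ?thesis using nadj_E[of i j] assms adj_iff[OF assms(1,2)] E_sym[of i j] assms by blast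
qed

lemma e_disj:
 assumes "i < n" "j < n" "i~=j" shows "e i Int e j = {}"
proof -
 show ?thesis using assms ss_ne s_inj E_disj[of i "s i" j "s j"] assms s_lt by blast 
qed

lemma eN_disj: "i < n ==> k < n ==> e i Int N k = {}"
 using NE_disj[of i "s i" k] s_lt by auto

lemma ring_cover:
 assumes "x:V" obtains i where "i < n" "x:N i" | i where "i < n" "x:e i"
proof -
 have "(EX i<n. x:N i) | (EX i<n. EX j<n. x:E i j)" using assms cover by auto
 thus ?thesis
 proof
  assume "EX i<n. EX j<n. x:E i j"
  then obtain i j where "i < n" "j < n" "x:E i j" by blast
  thus ?thesis using E_e[of i j] that(2) by blast
 qed (use that(1) in blast)
qed

lemma cr_closed:
 assumes "m:Mt" "i < n" "cr m i" "x:N i Un e i Un N (s i)" shows "m x:N i Un e i Un N (s i)"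
 using lk_closed[of i "s i" m x] assms s_lt unfolding cr_def by auto

lemma ncr_closed: assumes "m:Mt" "i < n" "~ cr m i" "x:e i" shows "m x:e i"
 using nlk_closed[of i "s i" m x] assms s_lt unfolding cr_def by auto

definition bd :: "nat set => nat => bool" where "bd A p <-> (p:A)~=(s p:A)"

text \<open>An arc with an odd number of vertices has two boundary edges of different parity. As a matching uses
the edges of one parity, this says that each matching crosses the boundary exactly once.\<close>

definition oddarc :: "nat set => bool" where
 "oddarc A <-> A<={..<n} & (EX! p. p < n & even p & bd A p) & (EX! p. p < n & odd p & bd A p)"

lemma oddarc_bds:
 assumes "oddarc A"
 obtains p q where "p < q" "q < n" "odd (q - p)" "!!r. r < n ==> bd A r <-> r = p | r = q"
proof -
 obtain a where a: "a < n" "even a" "bd A a" "!!r. r < n ==> even r ==> bd A r ==> r = a"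
  using assms unfolding oddarc_def by metis
 obtain b where b: "b < n" "odd b" "bd A b" "!!r. r < n ==> odd r ==> bd A r ==> r = b"
  using assms unfolding oddarc_def by metis
 have r: "bd A r <-> r = a | r = b" if "r < n" for r using a b that by blast
 show ?thesis
 proof (cases "a < b")
  case True
  show ?thesis
  proof (rule that[OF True b(1)])
   show "odd (b - a)" using True a(2) b(2) by simp
  qed (rule r)
 next case False
  moreover have "a~=b" using a(2) b(2) by blast
  ultimately have ba: "b < a" by simp
  show ?thesis
  proof (rule that[OF ba a(1)])
   show "odd (a - b)" using ba a(2) b(2) by simp
  qed (use r in blast)
 qed
qed

lemma oddarc_sub: "oddarc A ==> A<={..<n}" unfolding oddarc_def by simp

lemma oddarcI:
 assumes "A<={..<n}" "p < n" "q < n" "odd (q + p)" "!!r. r < n ==> bd A r <-> r = p | r = q"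
 shows "oddarc A"
proof -
 have "EX a b. a < n & b < n & even a & odd b & (ALL r<n. bd A r <-> r = a | r = b)"
  using assms(2-5) by (cases "even p") auto
 then obtain a b where "a < n" "b < n" "even a" "odd b" "ALL r<n. bd A r <-> r = a | r = b" by blast
 thus ?thesis unfolding oddarc_def using assms(1) by metis
qed

lemma bd_interval:
 assumes "p < q" "q < n" "r < n" shows "bd {p<..q} r <-> r = p | r = q"
 using assms unfolding bd_def by (cases "Suc r = n") (auto simp: s_if)

lemma oddarc_interval: "p < q ==> q < n ==> odd (q - p) ==> oddarc {p<..q}"
 using bd_interval by (intro oddarcI[of _ p q]) auto

lemma bd_compl: "r < n ==> bd ({..<n} - A) r <-> bd A r"
 unfolding bd_def using s_lt by auto

lemma oddarc_compl: assumes "oddarc A" shows "oddarc ({..<n} - A)"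
proof -
 have "(p < n & even p & bd ({..<n} - A) p) <-> (p < n & even p & bd A p)"
  "(p < n & odd p & bd ({..<n} - A) p) <-> (p < n & odd p & bd A p)" for p
  using bd_compl by blast+
 thus ?thesis using assms unfolding oddarc_def by (simp only:) blast
qed

lemma bds_interval:
 assumes A: "A<={..<n}" "0~:A" and pq: "p < q" and r: "!!r. r < n ==> bd A r <-> r = p | r = q"
 shows "i < n ==> i:A <-> p < i & i<=q"
proof (induction i)
 case (Suc i)
 have "bd A i <-> (i:A)~=(Suc i:A)" unfolding bd_def using Suc.prems by (simp add: s_if)
 thus ?case using Suc r[of i] pq by auto
qed (use A in simp)

lemma arc_interval:
 assumes "oddarc A" "0~:A"
 obtains p q where "p < q" "q < n" "odd (q - p)" "A = {p<..q}"
proof -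
 obtain p q where pq: "p < q" "q < n" "odd (q - p)" "!!r. r < n ==> bd A r <-> r = p | r = q"
  using oddarc_bds[OF assms(1)] by blast
 have "i:A <-> p < i & i<=q" if "i < n" for i
  using bds_interval[OF oddarc_sub[OF assms(1)] assms(2) pq(1,4) that] .
 hence "A = {p<..q}" using oddarc_sub[OF assms(1)] pq(2) by auto
 thus ?thesis using that pq by blast
qed

lemma arc_interval':
 assumes "oddarc A"
 obtains p q where "p < q" "q < n" "odd (q - p)" "A = {p<..q} | A = {..<n} - {p<..q}"
proof (cases "0:A")
 case True
 then obtain p q where pq: "p < q" "q < n" "odd (q - p)" "{..<n} - A = {p<..q}"
  using arc_interval[OF oddarc_compl[OF assms]] by blast
 thus ?thesis using oddarc_sub[OF assms] that pq by fast 
next case False thus ?thesis using arc_interval[OF assms] that by blast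
qed

lemma oddarc_ne: assumes "oddarc A" shows "EX p<n. p:A" "EX p<n. p~:A"
proof -
 obtain p where "p < n" "bd A p" using assms unfolding oddarc_def by blast
 thus "EX p<n. p:A" "EX p<n. p~:A" unfolding bd_def using s_lt by metis+
qed

lemma iso:
 assumes A: "oddarc A" and a: "a < n" "bd A a" "bd A (s a)" and w: "w < n" "w~=s a"
 shows "(w:A)~=(s a:A)"
proof -
 have *: "(w:B)~=(s a:B)" if B: "oddarc B" "0~:B" "bd B a" "bd B (s a)" for B proof -
  obtain p q where pq: "p < q" "q < n" "odd (q - p)" "B = {p<..q}" using arc_interval[OF B(1,2)] by blast
  have "a = p | a = q" "s a = p | s a = q"
   using bd_interval[OF pq(1,2) a(1)] bd_interval[OF pq(1,2) s_lt[OF a(1)]] B pq(4) by auto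
  hence "a = p & q = Suc p | a = q & p = 0 & Suc q = n"
   using s_ne[OF a(1)] a(1) pq(1,2) by (auto simp: s_if split: if_splits)
  thus ?thesis using w pq a(1) by (auto simp: s_if)
 qed
 show ?thesis
 proof (cases "0:A")
  case True hence "(w:{..<n} - A)~=(s a:{..<n} - A)"
   using *[OF oddarc_compl[OF A]] bd_compl a s_lt[OF a(1)] by auto
  thus ?thesis using w s_lt[OF a(1)] by auto
 next case False thus ?thesis using *[OF A] a by blast
 qed
qed

text \<open>Both types of matchings cross the boundary of a tight union of classes exactly once.\<close>

lemma tight_arc:
 assumes Q: "subres Q" and A: "A<={..<n}" and t: "mtight (UN i:A. Q i)"
 shows "oddarc A"
proof -
 let ?Z = "UN i:A. Q i"
 have in_Z: "x:?Z <-> i:A" if "i < n" "x:Q i" for i x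
 proof
  assume "x:?Z"
  then obtain j where j: "j:A" "x:Q j" by blast
  thus "i:A" using subresD(3)[OF Q, of i j] that A j by blast
 qed (use that in blast)
 have *: "EX! p. p < n & cr m p & bd A p" if m: "m:Mt" for m proof -
  have lv: "EX i j x. {i, j} = {p, s p} & i:A & j~:A & x:Q i & x:?Z & m x:Q j & m x~:?Z"
   if p: "p < n" "cr m p" "bd A p" for p proof -
   obtain i j where ij: "{i, j} = {p, s p}" "i:A" "j~:A" using p(3) unfolding bd_def by blast
   have ij': "i < n" "j < n" using ij(1) p(1) s_lt[OF p(1)] by (auto simp: doubleton_eq_iff)
   have l: "lk m p (s p)" using p(2) unfolding cr_def .
   have "lk m (s p) p" using lk_sym[of p "s p" m] l p(1) s_lt[OF p(1)] m by simp
   hence "lk m i j" using l ij(1) by (auto simp: doubleton_eq_iff)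
   then obtain x where x: "x:Q i" "m x:Q j" using subres_lk[OF Q, of i j m] ij' m by auto
   hence "x:?Z" "m x~:?Z" using in_Z ij ij' by auto
   thus ?thesis using ij x by blast
  qed
  obtain x where x: "x:?Z" "m x~:?Z" using mtight_ex[OF t m] by blast
  have "m x:V" using mate_in[OF m] mtight_sub[OF t] x(1) by blast
  then obtain j where j: "j < n" "m x:Q j" using subresD(4)[OF Q] by blast
  obtain i where i: "i:A" "x:Q i" "i < n" using x(1) A by blast
  have jA: "j~:A" using in_Z[OF j] x(2) by blast
  hence "lk m i j" using subres_lk[OF Q, of i j m] i j m by auto
  hence "EX p. p < n & cr m p & bd A p"
   using lk_nbr[OF m i(3) j(1)] i j jA unfolding bd_def by metis
  thus ?thesis
  proof (rule ex_ex1I)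
   fix p q assume p: "p < n & cr m p & bd A p" and q: "q < n & cr m q & bd A q"
   obtain i j x where x: "{i, j} = {p, s p}" "i:A" "j~:A" "x:Q i" "x:?Z" "m x:Q j" "m x~:?Z"
    using lv[of p] p by blast
   obtain i' j' x' where x': "{i', j'} = {q, s q}" "i':A" "j'~:A" "x':Q i'" "x':?Z" "m x':Q j'" "m x'~:?Z"
    using lv[of q] q by blast
   have "x = x'" using mtight_un[OF t m x(5,7) x'(5,7)] .
   have lt: "i < n" "j < n" "i' < n" "j' < n"
    using x(1) x'(1) p q s_lt by (metis doubleton_eq_iff)+
   have "i = i'" using subresD(3)[OF Q, of i i'] x(4) x'(4) lt `x = x'` by auto
   moreover have "j = j'" using subresD(3)[OF Q, of j j'] x(6) x'(6) lt `x = x'` by auto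
   ultimately have "{p, s p} = {q, s q}" using x(1) x'(1) by simp
   thus "p = q" using ss_ne p q by (metis doubleton_eq_iff)
  qed
 qed
 have 0: "0 < n" using n4 by simp
 obtain m where m: "m:Mt" "cr m 0" using cr_ex(1)[OF 0] by blast
 obtain m' where m': "m':Mt" "~ cr m' 0" using cr_ex(2)[OF 0] by blast
 have "cr m p <-> even p" if "p < n" for p using cr_types[OF m(1)] m(2) 0 that by auto
 moreover have "cr m' p <-> odd p" if "p < n" for p using cr_types[OF m'(1)] m'(2) 0 that by auto
 ultimately show ?thesis unfolding oddarc_def using A *[OF m(1)] *[OF m'(1)] by metis
qed

text \<open>\<open>Z\<close> lies around the arc \<open>A\<close>: it may cut the two sets \<open>E\<close> at the ends of \<open>A\<close>, but contains what is in
between. If \<open>A\<close> is a single vertex, \<open>Z\<close> need not contain \<open>N i\<close>, as in \<open>vloc\<close>.\<close>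

definition zloc :: "nat set => 'a set => bool" where
 "zloc A Z <-> Z<=V & oddarc A & (EX i<n. EX j<n. i~=j & i~:A & j~:A) &
   (ALL i<n. i~:A --> Z Int N i = {}) &
   (ALL i<n. i~:A --> s i~:A --> Z Int e i = {}) &
   (ALL i<n. i~:A --> s i:A --> mtight (N (s i) Un (Z Int e i))) &
   (ALL i<n. i:A --> s i~:A --> mtight (N i Un (Z Int e i))) &
   (ALL i:A. ALL j:A. i~=j --> N i<=Z) &
   (ALL i:A. s i:A --> e i<=Z) &
   (ALL i:A. Z Int N i~={})"

lemma zlocD:
 assumes "zloc A Z"
 shows "Z<=V" "oddarc A" "EX i<n. EX j<n. i~=j & i~:A & j~:A"
  "i < n ==> i~:A ==> Z Int N i = {}" "i < n ==> i~:A ==> s i~:A ==> Z Int e i = {}"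
  "i < n ==> i~:A ==> s i:A ==> mtight (N (s i) Un (Z Int e i))"
  "i < n ==> i:A ==> s i~:A ==> mtight (N i Un (Z Int e i))"
  "i:A ==> j:A ==> i~=j ==> N i<=Z" "i:A ==> s i:A ==> e i<=Z" "i:A ==> Z Int N i~={}"
proof -
 note z = assms[unfolded zloc_def]
 show "Z<=V" "oddarc A" "EX i<n. EX j<n. i~=j & i~:A & j~:A" using z by simp_all
 show "i:A ==> j:A ==> i~=j ==> N i<=Z" using z by blast
qed (use assms in \<open>simp_all add: zloc_def\<close>)

lemma vloc_zloc:
 assumes v: "v < n" and X: "vloc v X" shows "zloc {v} X"
proof -
 have XU: "X<=U v" "mtight (X Int N v)" and Xt: "!!j. j < n ==> j~=v ==> mtight (N v Un (X Int E v j))"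
  using X unfolding vloc_def by auto
 obtain h :: "nat => nat => bool" where h: "tour h" using tour_ex by blast
 have "oddarc {v}" using subresD(6)[OF subres_res[OF h]] v tight_arc[OF subres_res[OF h]] v by auto
 moreover have "EX i<n. EX j<n. i~=j & i~:{v} & j~:{v}"
  using s_ne[OF v] ss_ne[OF v] s_lt[OF v] s_lt[OF s_lt[OF v]] s_ne[OF s_lt[OF v]] by (metis singletonD)
 moreover have "X Int N i = {}" if "i < n" "i~:{v}" for i using N_Int_U[of v i] XU(1) that v by auto
 moreover have "X Int e i = {}" if "i < n" "i~:{v}" "s i~:{v}" for i
  using E_Int_U[of v i "s i"] XU(1) that v s_lt[OF that(1)] by auto
 moreover have "mtight (N (s i) Un (X Int e i))" if "i < n" "i~:{v}" "s i:{v}" for i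
  using Xt[of i] that E_sym[of i v] v by auto
 moreover have "mtight (N i Un (X Int e i))" if "i < n" "i:{v}" "s i~:{v}" for i
  using Xt[of "s i"] that s_lt[OF that(1)] by auto
 moreover have "X<=V" using XU(1) U_V[of v] v by auto
 moreover have "X Int N v~={}" using mtight_ne[OF XU(2)] .
 ultimately show ?thesis unfolding zloc_def using s_ne[OF v] by auto
qed

end

text \<open>A cyclic torsoid. (T7) is stated for an unordered pair of neighbours \<open>j\<close>, \<open>k\<close> of \<open>i\<close>.\<close>

locale ring7 = ring_frame V Mt n N E + max_frame V Mt "{..<n}" N E for V :: "'a set" and Mt and n :: nat and N E +
 assumes T7: "i < n ==> j < n ==> k < n ==> adj i j ==> adj i k ==> j~=k ==> mtight P1 ==> mtight P2 ==> mtight P3 ==>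
   P1 Int P2 = {} ==> P1 Int P3 = {} ==> P2 Int P3 = {} ==> P1 Un P2 Un P3 = E i j Un N i Un E i k ==>
   mtight (N j Un P1 Un P2) ==> mtight (P2 Un P3 Un N k) ==> False"
begin

text \<open>Suppose that \<open>X\<close> takes an odd part \<open>a\<close> of \<open>E u w\<close>. Then \<open>a\<close> and the rest \<open>b\<close> of \<open>E u w\<close> are tight, and
the three sets \<open>E u v \<union> N u\<close>, \<open>a\<close> and \<open>b\<close> contradict (T7).\<close>

lemma ring_nosplit:
 assumes h: "tour h" and X: "mtight X" and uvw: "u < n" "v < n" "w < n" "u~=v" "u~=w" "v~=w"
  and p: "~ par (X Int res h u)" "par (X Int res h v)"
  and only: "!!k. k < n ==> par (X Int res h k) ==> adj u k ==> k = v"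
 shows "~ par (X Int res h u Int E u w)"
proof
 let ?D = "X Int res h u"
 let ?a = "?D Int E u w"
 let ?b = "E u w - X"
 assume pa: "par ?a"
 have I: "u:{..<n}" "v:{..<n}" "w:{..<n}" using uvw by auto
 have only': "!!k. k:{..<n} ==> par (X Int res h k) ==> adj u k ==> k = v" using only by simp
 note Q = subres_res[OF h]
 have closed: "m x:?D" if "m:Mt" "~ lk m u v" "x:?D" for m x
  by (rule side_closed[OF h X I(1,2) uvw(4) p _ that]) (use only' in blast)
 have out: "x = y" if "m:Mt" "x:?D" "y:?D" "m x:res h u - X" "m y:res h u - X" for m x y
  by (rule side_out_one[OF h X I(1,2) uvw(4) p _ that]) (use only' in blast)
 have ane: "?a~={}" using pa par_empty by metis
 have EQ: "E u w<=res h u" using res_Int_E[OF I(1,3), of h] ane by (auto split: if_splits)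
 have auw: "adj u w" using nadj_E[OF I(1,3)] ane by blast
 have auv: "adj u v"
 proof (rule ccontr)
  assume "~ adj u v"
  hence "~ lk m u v" if "m:Mt" for m using that unfolding adj_def by blast
  hence "?D = {}"
  proof (intro closed_empty)
   show "?D<=V" using mtight_sub[OF X] by blast
   show "?D~=V" using mtight_neV[OF X] mtight_sub[OF X] by blast
  qed (use closed in blast)
  thus False using ane by blast
 qed
 have two: "lk m u v | lk m u w" if "m:Mt" for m using ring_two[OF that uvw(1-3) auv auw uvw(6)] .
 have nuvw: "~ lk m u w" if "m:Mt" "lk m u v" for m using lk_un[OF I that] uvw(6) by blast
 have dj: "N u Int E u w = {}" "N w Int E u w = {}" "N v Int E u w = {}" "N v Int E u v = {}" "N u Int E u v = {}"
  "N u Int N v = {}" "N u Int N w = {}" "E u v Int E u w = {}" "N w Int E u v = {}" "N v Int N w = {}"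
  using NE_disj I N_disj[OF I(1,2) uvw(4)] N_disj[OF I(1,3) uvw(5)] N_disj[OF I(2,3) uvw(6)]
   E_Int_E[OF I uvw(6)] by auto
 have V: "N u<=V" "N v<=V" "N w<=V" "E u v<=V" "E u w<=V" using N_V E_V I by auto
 have Nw: "N w Int res h u = {}" using subres_N[OF Q I(1,3) uvw(5)] .
 have ab: "?a Un ?b = E u w" "?a Int ?b = {}" using EQ by blast+
 \<comment> \<open>the unique leaver of \<open>a\<close>: to \<open>b\<close> if \<open>u\<close> is matched towards \<open>v\<close>, to \<open>N u\<close> otherwise\<close>
 have a1: "m x:?b" if m: "m:Mt" "lk m u v" and x: "x:?a" "m x~:?a" for m x
  using nlk_closed[OF I(1,3) m(1) nuvw[OF m]] x ab(1) by blast
 have a2: "m x:N u" if m: "m:Mt" "~ lk m u v" and x: "x:?a" "m x~:?a" for m x proof -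
  have "m x:?D" using closed[OF m] x by blast
  moreover have "m x:N u Un N w Un E u w" using E_in[OF I(1,3) m(1)] x by blast
  ultimately show ?thesis using x Nw by blast
 qed
 have fa: "fcut ?a" using X subresD(6)[OF Q I(1)] E_fcut[OF I(1,3)] by blast
 have at: "mtight ?a"
 proof (rule mtightI_par[OF _ pa])
  show "?a<=V" using V by blast
  fix m x y assume m: "m:Mt" and xy: "x:?a" "m x~:?a" "y:?a" "m y~:?a"
  show "x = y"
  proof (cases "lk m u v")
   case True thus ?thesis using out[OF m, of x y] a1[OF m True xy(1,2)] a1[OF m True xy(3,4)] xy EQ by blast
  next case False thus ?thesis using mtight_un_in[OF N_tight[OF I(1)] m, of x y] a2[OF m False xy(1,2)] a2[OF m False xy(3,4)] xy V dj by blast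
  qed
 qed
 have pb: "par ?b" proof -
  have "?b = E u w - ?a" using EQ by blast
  thus ?thesis using par_Diff[of "E u w" ?a] E_fcut[OF I(1,3)] fa pa by auto
 qed
 have bt: "mtight ?b"
 proof (rule mtightI_par[OF _ pb])
  show "?b<=V" using V by blast
  fix m x y assume m: "m:Mt" and xy: "x:?b" "m x~:?b" "y:?b" "m y~:?b"
  show "x = y"
  proof (cases "lk m u v")
   case True
   have "z:V - ?a & m z:?a" if z: "z:?b" "m z~:?b" for z
    using nlk_closed[OF I(1,3) m nuvw[OF m True]] z ab V by blast
   thus ?thesis using mtight_un_in[OF at m, of x y] xy by blast
  next case False
   obtain a0 where a0: "a0:?a" "m a0~:?a" using mtight_ex[OF at m] by blast
   have ma0: "m a0:N u" using a2[OF m False a0] .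
   have "z:V - N w & m z:N w" if z: "z:?b" "m z~:?b" for z proof -
    have zV: "z:V" using z V by blast
    have "m z:N u Un N w" using closed[OF m False, of "m z"] mate_mate[OF m zV] z E_in[OF I(1,3) m, of z] z ab by auto
    moreover have "m z~:N u"
    proof
     assume "m z:N u"
     hence "z = a0" using mtight_un_in[OF N_tight[OF I(1)] m, of z a0] ma0 z a0 V dj by blast
     thus False using z a0 by blast
    qed
    ultimately have "m z:N w" by blast
    moreover have "z~:N w" using z dj(2) by blast
    ultimately show ?thesis using zV by blast
   qed
   thus ?thesis using mtight_un_in[OF N_tight[OF I(3)] m, of x y] xy by blast
  qed
 qed
 let ?Z = "N v Un (E u v Un N u) Un ?a"
 have Zt: "mtight ?Z"
 proof (rule mtightI_par)
  show "?Z<=V" using V by blast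
  have vt: "mtight (N v Un E u v)" using NE_tight[OF I(2,1)] E_sym[OF I(1,2)] uvw(4) by simp
  have p1: "~ par (N v Un E u v Un N u)" proof -
   have "(N v Un E u v) Int N u = {}" using dj by blast
   thus ?thesis
    using par_Un[OF mtight_fcut[OF vt] mtight_fcut[OF N_tight[OF I(1)]]] mtight_par[OF vt] mtight_par[OF N_tight[OF I(1)]]
    by blast
  qed
  have f1: "fcut (N v Un E u v Un N u)" using vt N_tight[OF I(1)] by blast
  have "par ((N v Un E u v Un N u) Un ?a)" proof -
   show ?thesis using dj par_Un[OF f1 fa] p1 pa by fast
  qed
  moreover have "(N v Un E u v Un N u) Un ?a = ?Z" by blast
  ultimately show "par ?Z" by simp
  fix m x y assume m: "m:Mt" and xy: "x:?Z" "m x~:?Z" "y:?Z" "m y~:?Z"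
  show "x = y"
  proof (cases "lk m u v")
   case True
   have "z:?a & m z~:?a" if z: "z:?Z" "m z~:?Z" for z
    using lk_closed[OF I(1,2) m True] z by blast
   thus ?thesis using mtight_un[OF at m, of x y] xy by blast
  next case False hence uw: "lk m u w" using two[OF m] by blast
   obtain a0 where a0: "a0:?a" "m a0~:?a" using mtight_ex[OF at m] by blast
   have ma0: "m a0:N u" using a2[OF m False a0] .
   have mm: "m (m a0) = a0" using mate_mate[OF m] a0 V by blast
   have "z:N v & m z~:N v" if z: "z:?Z" "m z~:?Z" for z proof -
    have "z~:E u v" using nlk_closed[OF I(1,2) m False] z by blast
    moreover have "z~:?a" using a2[OF m False] z by blast
    moreover have "z~:N u"
    proof
     assume zu: "z:N u"
     have "z = m a0" using mm a0 dj mtight_un[OF N_tight[OF I(1)] m zu _ ma0] z by auto 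
     thus False using mm a0 z by auto
    qed
    ultimately show ?thesis using z by blast
   qed
   thus ?thesis using mtight_un[OF N_tight[OF I(2)] m, of x y] xy by blast
  qed
 qed
 have "mtight (E u v Un N u)" using NE_tight[OF I(1,2) uvw(4)] by (simp add: Un_commute)
 moreover have "mtight (?a Un ?b Un N w)"
  using NE_tight[OF I(3,1)] E_sym[OF I(1,3)] uvw(5) ab(1) by (simp add: Un_commute)
 moreover have "(E u v Un N u) Un ?a Un ?b = E u v Un N u Un E u w" using ab(1) by blast
 ultimately show False
  using T7[OF uvw(1-3) auv auw uvw(6), of "E u v Un N u" ?a ?b] at bt ab dj Zt by blast
qed

sublocale loc_frame V Mt "{..<n}" N E
proof
 fix h X and u v w :: nat
 assume a: "tour h" "mtight X" and i: "u:{..<n}" "v:{..<n}" "w:{..<n}" and d: "u~=v" "u~=w" "v~=w"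
  and p: "~ par (X Int res h u)" "par (X Int res h v)"
  and o: "!!k. k:{..<n} ==> par (X Int res h k) ==> adj u k ==> k = v"
 have "u < n" "v < n" "w < n" using i by auto
 thus "~ par (X Int res h u Int E u w)"
  by (rule ring_nosplit[OF a _ _ _ d p]) (rule o, simp)
qed

lemma arc_locA:
 assumes h: "tour h" and X: "mtight X" and O: "O' = {i:{..<n}. par (X Int res h i)}" "oddarc O'"
  and big: "k < n" "l < n" "k~=l" "k~:O'" "l~:O'" and u: "u < n" "u~:O'"
 shows "EX v:O'. X Int res h u<=E u v & mtight (N v Un (X Int res h u)) & (ALL w:O'. adj u w --> w = v)"
proof -
 have inO: "i:O' <-> par (X Int res h i)" if "i < n" for i using O(1) that by simp
 have Osub: "O'<={..<n}" using oddarc_sub[OF O(2)] .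
 have uniq: "w = v" if vw: "v:O'" "w:O'" "adj u v" "adj u w" for v w
 proof (rule ccontr)
  assume wv: "w~=v"
  have lt: "v < n" "w < n" using vw Osub by auto
  have "v = s u | u = s v" "w = s u | u = s w" using adj_iff[OF u(1)] vw lt by auto
  hence "v = s u & s w = u | s v = u & w = s u" using wv s_inj[OF lt] by auto
  then obtain a where a: "a < n" "s a = u" "a:O'" "s u:O'" using vw(1,2) lt by blast
  have "bd O' a" "bd O' (s a)" unfolding bd_def a(2) using a(3,4) u(2) by simp_all
  hence "(x:O')~=(u:O')" if "x < n" "x~=u" for x using iso[OF O(2) a(1), of x] a that by simp
  thus False using big u by metis
 qed
 have "EX v:O'. ALL w:O'. adj u w --> w = v"
 proof (cases "EX v:O'. adj u v")
  case True thus ?thesis using uniq by blast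
 next case False thus ?thesis using oddarc_ne(1)[OF O(2)] by blast
 qed
 then obtain v where v: "v:O'" "ALL w:O'. adj u w --> w = v" by blast
 have uv: "u:{..<n}" "v:{..<n}" "u~=v" using u v Osub by auto
 have p: "~ par (X Int res h u)" "par (X Int res h v)" using inO u v Osub by auto
 have on: "k = v" if "k:{..<n}" "par (X Int res h k)" "adj u k" for k using v(2) inO that by auto
 have "X Int res h u<=E u v" by (rule locA(1)[OF h X uv p]) (rule on)
 moreover have "mtight (N v Un (X Int res h u))" by (rule locA(2)[OF h X uv p]) (rule on)
 ultimately show ?thesis using v by blast
qed

lemma arc_zloc:
 assumes h: "tour h" and X: "mtight X" and O: "O' = {i:{..<n}. par (X Int res h i)}" "oddarc O'"
  and out: "k < n" "l < n" "k~=l" "k~:O'" "l~:O'" and ins: "k':O'" "l':O'" "k'~=l'"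
 shows "zloc O' X"
proof -
 note Q = subres_res[OF h]
 have XV: "X<=V" using mtight_sub[OF X] .
 have Osub: "O'<={..<n}" using oddarc_sub[OF O(2)] .
 let ?O = "{..<n} - O'"
 have Oc: "?O = {i:{..<n}. par ((V - X) Int res h i)}"
  using odd_compl[OF X] subresD(6)[OF Q] O(1) by auto
 note A = arc_locA[OF h X O out]
 have ins': "k' < n" "l' < n" "k'~:?O" "l'~:?O" using ins Osub by auto
 note B = arc_locA[OF h mtight_compl[OF X] Oc oddarc_compl[OF O(2)] ins'(1,2) ins(3) ins'(3,4)]
 have N1: "X Int N i = {}" if i: "i < n" "i~:O'" for i proof -
  obtain v where v: "v:O'" "X Int res h i<=E i v" using A[OF i] by blast
  thus ?thesis using subresD(1)[OF Q, of i] NE_disj[of i v i] i Osub by blast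
 qed
 have N2: "N i<=X" if i: "i:O'" for i proof -
  obtain v where v: "v:?O" "(V - X) Int res h i<=E i v" using B[of i] i Osub by blast
  thus ?thesis using subresD(1)[OF Q, of i] NE_disj[of i v i] i Osub N_V[of i] by blast
 qed
 have E1: "Y Int E i j Int res h i = {}" if "Y Int res h i<=E i v" "v~=j" "i < n" "j < n" "v < n" for Y i j v
  using E_Int_E[of i v j] that by auto
 have e1: "X Int e i = {}" if i: "i < n" "i~:O'" "s i~:O'" for i proof -
  have si: "s i < n" using s_lt[OF i(1)] .
  obtain v where v: "v:O'" "X Int res h i<=E i v" using A[OF i(1,2)] by blast
  obtain w where w: "w:O'" "X Int res h (s i)<=E (s i) w" using A[OF si i(3)] by blast
  have "X Int E i (s i) Int res h i = {}" using E1[OF v(2), of "s i"] v i si Osub by auto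
  moreover have "X Int E (s i) i Int res h (s i) = {}" using E1[OF w(2), of i] w i si Osub by auto
  moreover have "E i (s i)<=res h i Un res h (s i)" using subres_E[OF Q, of i "s i"] i si by auto
  ultimately show ?thesis using E_sym[of i "s i"] i si by blast
 qed
 have e2: "e i<=X" if i: "i:O'" "s i:O'" for i proof -
  have lt: "i < n" "s i < n" using i Osub by auto
  have ni: "i~:?O" "s i~:?O" using i by auto
  obtain v where v: "v:?O" "(V - X) Int res h i<=E i v" using B[OF lt(1) ni(1)] by blast
  obtain w where w: "w:?O" "(V - X) Int res h (s i)<=E (s i) w" using B[OF lt(2) ni(2)] by blast
  have "(V - X) Int E i (s i) Int res h i = {}" using E1[OF v(2), of "s i"] v i lt by auto
  moreover have "(V - X) Int E (s i) i Int res h (s i) = {}" using E1[OF w(2), of i] w i lt by auto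
  moreover have "E i (s i)<=res h i Un res h (s i)" using subres_E[OF Q, of i "s i"] lt by auto
  ultimately show ?thesis using E_sym[of i "s i"] lt E_V[of i "s i"] by blast
 qed
 have bnd: "mtight (N a Un (X Int E a b))" if a: "a:O'" "b < n" "b~:O'" "adj a b" for a b proof -
  have lt: "a < n" using a Osub by auto
  have I: "a:{..<n}" "b:{..<n}" using lt a by auto
  have ab: "a~=b" using a by blast
  have Es: "E a b = E b a" using E_sym[OF I] .
  have adj': "adj b a" using adj_sym[OF I a(4)] .
  show ?thesis
  proof (cases "h b a")
   case True
   obtain v where v: "X Int res h b<=E b v" "mtight (N v Un (X Int res h b))" "ALL w:O'. adj b w --> w = v"
    using A[OF a(2,3)] by blast
   have "v = a" using v(3) a(1) adj' by blast
   moreover have "E b a<=res h b" using res_Int_E[OF I(2,1), of h] True by auto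
   ultimately have "X Int res h b = X Int E a b" using v(1) Es by blast
   thus ?thesis using v(2) `v = a` by simp
  next case False hence "h a b" using h ab unfolding tour_def by blast
   hence Er: "E a b<=res h a" using res_Int_E[OF I, of h] by auto
   have na: "a~:?O" using a by blast
   obtain v where v: "(V - X) Int res h a<=E a v" "mtight (N v Un ((V - X) Int res h a))" "ALL w:?O. adj a w --> w = v"
    using B[OF lt na] by blast
   have "v = b" using v(3) a by blast
   hence eq: "(V - X) Int res h a = E a b - X" using v(1) Er E_V[OF I] by blast
   have t: "mtight (N b Un (E a b - X))" using v(2) `v = b` eq by simp
   have np: "~ par (E a b - X)" using bridge_npar[OF N_tight[OF I(2)] t] NE_disj[OF I I(2)] by blast
   have dj: "N a Int N b = {}" "N a Int E a b = {}" "N b Int E a b = {}"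
    using N_disj[OF I ab] NE_disj[OF I I(1)] NE_disj[OF I I(2)] by auto
   have "(N a Un E a b) Int (N b Un (E a b - X)) = E a b - X" using dj by blast
   hence "mtight ((N a Un E a b) - (N b Un (E a b - X)))"
    using mtight_Diff(1)[OF NE_tight[OF I ab] t] np by simp
   moreover have "(N a Un E a b) - (N b Un (E a b - X)) = N a Un (X Int E a b)" using dj by blast
   ultimately show ?thesis by simp
  qed
 qed
 have z3: "mtight (N (s i) Un (X Int e i))" if "i < n" "i~:O'" "s i:O'" for i
  using bnd[OF that(3,1,2)] adj_iff[of "s i" i] E_sym[of i "s i"] s_lt[OF that(1)] that(1) by auto
 have z4: "mtight (N i Un (X Int e i))" if "i < n" "i:O'" "s i~:O'" for i
  using bnd[OF that(2) s_lt[OF that(1)] that(3)] adj_iff[of i "s i"] s_lt[OF that(1)] that(1) by auto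
 have "X Int N i~={}" if "i:O'" for i using N2[OF that] N_ne[of i] that Osub by blast
 moreover have "EX i<n. EX j<n. i~=j & i~:O' & j~:O'" using out by blast
 ultimately show ?thesis unfolding zloc_def using XV O(2) N1 N2 e1 e2 z3 z4 by simp
qed

text \<open>The classes that \<open>X\<close> meets oddly form an odd arc by \<open>tight_arc\<close>. After passing to the complement at
least two classes lie outside the arc.\<close>

lemma ring_loc:
 assumes X: "mtight X"
 shows "EX Z:{X, V - X}. eloc Z | (EX A. zloc A Z)"
proof -
 obtain h :: "nat => nat => bool" where h: "tour h" using tour_ex by blast
 note Q = subres_res[OF h]
 define O' where "O' = {i:{..<n}. par (X Int res h i)}"
 have O'_iff: "k:O' <-> par (X Int res h k)" if "k < n" for k unfolding O'_def using that by simp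
 have O'_sub: "O'<={..<n}" unfolding O'_def by blast
 have "(UN i:O'. res h i) = {z:V. EX i:{..<n}. z:res h i & (if i:{} then z:X else par (X Int res h i))}" proof -
  have "res h i<=V" if "i:{..<n}" for i using mtight_sub[OF subresD(6)[OF Q that]] .
  thus ?thesis unfolding O'_def by auto
 qed
 hence O: "oddarc O'" using odd_union[OF X subres_tfam[OF Q], of "{}"] tight_arc[OF Q O'_sub] by argo
 obtain k' where k': "k' < n" "k':O'" using oddarc_ne(1)[OF O] by blast
 obtain k where k: "k < n" "k~:O'" using oddarc_ne(2)[OF O] by blast
 show ?thesis
 proof (cases "EX l':O'. l'~=k'")
  case False hence "k:O' <-> k = k'" for k using k' by blast
  hence "par (X Int res h k) <-> k = k'" if "k:{..<n}" for k using O'_iff that by simp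
  thus ?thesis using loc1[OF h X, of k'] k' vloc_zloc[OF k'(1)] by blast
 next case True
  then obtain l' where l': "l':O'" "l'~=k'" by blast
  show ?thesis
  proof (cases "EX l<n. l~:O' & l~=k")
   case False hence "l~:O' <-> l = k" if "l < n" for l using k that by blast
   hence "par ((V - X) Int res h l) <-> l = k" if "l:{..<n}" for l
    using odd_compl[OF X subresD(6)[OF Q that]] that O'_iff by simp
   thus ?thesis using loc1[OF h mtight_compl[OF X], of k] k vloc_zloc[OF k(1)] by blast
  next case True
   then obtain l where l: "l < n" "l~:O'" "k~=l" by blast
   have "zloc O' X" by (rule arc_zloc[OF h X O'_def O k(1) l(1,3) k(2) l(2) k'(2) l'(1) l'(2)[symmetric]])
   thus ?thesis by blast
  qed
 qed
qed

end

section \<open>Coarsening a cycle along arcs\<close>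

context frame
begin

lemma flip:
 assumes I: "a:I" "b:I" "a~=b" and D: "D<=E a b" and t: "mtight (N a Un D)"
 shows "mtight (N b Un (E a b - D))"
proof -
 have dj: "N a Int N b = {}" "N a Int E a b = {}" "N b Int E a b = {}"
  using N_disj[OF I] NE_disj[OF I(1,2,1)] NE_disj[OF I(1,2,2)] by auto
 have np: "~ par D" using bridge_npar[OF N_tight[OF I(1)] t] dj D by blast
 have tb: "mtight (N b Un E a b)" using NE_tight[OF I(2,1)] E_sym[OF I(1,2)] I(3) by simp
 have "(N b Un E a b) Int (N a Un D) = D" using dj D by blast
 hence "mtight ((N b Un E a b) - (N a Un D))" using mtight_Diff(1)[OF tb t] np by simp
 moreover have "(N b Un E a b) - (N a Un D) = N b Un (E a b - D)" using dj D by blast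
 ultimately show ?thesis by simp
qed

end

context ring_frame
begin

text \<open>What belongs to an arc with certainty, whatever happens to the sets \<open>E\<close> at its ends.\<close>

definition NA :: "nat set => 'a set" where
 "NA A = (UN i:A. N i) Un (UN i:{i:A. s i:A}. e i)"

lemma bd_cross_unique:
 assumes "oddarc A" "m:Mt" "p < n" "q < n" "cr m p" "cr m q" "bd A p" "bd A q" shows "p = q"
 using assms cr_par[OF assms(2-5)] unfolding oddarc_def by metis

lemma e_Int_NA:
 assumes "p < n" "A<={..<n}" "p~:A | s p~:A" shows "e p Int NA A = {}"
proof -
 have "e p Int N i = {}" if "i:A" for i using eN_disj[OF assms(1)] assms(2) that by auto
 moreover have "e p Int e i = {}" if "i:A" "s i:A" for i
  using e_disj[OF assms(1), of i] assms(2,3) that by auto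
 ultimately show ?thesis unfolding NA_def by blast
qed

lemma N_Int_NA: "k < n ==> A<={..<n} ==> k~:A ==> N k Int NA A = {}"
 unfolding NA_def using N_disj[of k] eN_disj[of _ k] by (auto simp: subset_iff)

lemma NA_V: "A<={..<n} ==> NA A<=V"
 unfolding NA_def using N_V E_V s_lt by (fastforce simp: subset_iff)

lemma NA_leaver:
 assumes A: "A<={..<n}" and m: "m:Mt" and x: "x:NA A" "m x~:NA A"
 obtains p a where "p < n" "cr m p" "bd A p" "a:A" "a = p | a = s p & p~:A" "x:N a"
proof -
 from x(1) consider i where "i:A" "s i:A" "x:e i" | i where "i:A" "x:N i" unfolding NA_def by blast
 thus ?thesis
 proof cases
  case 1
  have i: "i < n" using 1 A by auto
  have "m x:N i Un e i Un N (s i)"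
   using cr_closed[OF m i, of x] ncr_closed[OF m i, of x] 1 by blast
  hence "m x:NA A" unfolding NA_def using 1 by blast
  thus ?thesis using x(2) by simp
 next case 2
  have i: "i < n" using 2 A by auto
  obtain l where l: "l < n" "lk m i l" using lk_ex[of i m] i m by auto
  from lk_nbr[OF m i l] show ?thesis
  proof
   assume a: "l = s i & cr m i"
   hence "m x:N i Un e i Un N (s i)" using cr_closed[OF m i, of x] 2 by blast
   hence "s i~:A" using x(2) 2 unfolding NA_def by blast
   hence "bd A i" unfolding bd_def using 2 by blast
   thus ?thesis using that[of i i] a i 2 by blast
  next assume a: "i = s l & cr m l"
   hence "m x:N l Un e l Un N i" using cr_closed[OF m l(1), of x] 2 by blast
   hence "l~:A" using x(2) 2 a unfolding NA_def by blast
   hence "bd A l" unfolding bd_def using 2 a by blast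
   thus ?thesis using that[of l i] a l 2 `l~:A` by blast
  qed
 qed
qed

lemma NA_tight:
 assumes A: "oddarc A" shows "mtight (NA A)"
proof (rule mtightI)
 note sub = oddarc_sub[OF A]
 show "NA A<=V" by (rule NA_V[OF sub])
 obtain i j where ij: "i < n" "i:A" "j < n" "j~:A" using oddarc_ne[OF A] by blast
 have "N i<=NA A" "N i~={}" using ij N_ne[of i] unfolding NA_def by auto
 thus "NA A~={}" by blast
 have "N j Int NA A = {}" "N j~={}" "N j<=V" using N_Int_NA[OF ij(3) sub ij(4)] N_ne[of j] N_V[of j] ij by auto
 thus "NA A~=V" by blast
 fix m x y assume m: "m:Mt" and xy: "x:NA A" "m x~:NA A" "y:NA A" "m y~:NA A"
 obtain p a where p: "p < n" "cr m p" "bd A p" "a:A" "a = p | a = s p & p~:A" "x:N a"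
  using NA_leaver[OF sub m xy(1,2)] by blast
 obtain q b where q: "q < n" "cr m q" "bd A q" "b:A" "b = q | b = s q & q~:A" "y:N b"
  using NA_leaver[OF sub m xy(3,4)] by blast
 have "p = q" by (rule bd_cross_unique[OF A m p(1) q(1) p(2) q(2) p(3) q(3)])
 hence "a = b" using p(4,5) q(4,5) by blast
 have a: "a:{..<n}" using p(4) sub by blast
 have "N a<=NA A" using p(4) unfolding NA_def by blast
 thus "x = y" using mtight_un[OF N_tight[OF a] m, of x y] p(6) q(6) `a = b` xy by blast
qed

lemma end_tight:
 assumes p: "p < n" and A: "oddarc A" and a: "a:A" "a = p | a = s p" "p~:A | s p~:A"
  and D: "D<=e p" "mtight (N a Un D)"
 shows "mtight (NA A Un D)"
proof -
 note sub = oddarc_sub[OF A]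
 have an: "a:{..<n}" using a sub by blast
 have "e p Int NA A = {}" by (rule e_Int_NA[OF p sub a(3)])
 moreover have "N a<=NA A" using a(1) unfolding NA_def by blast
 ultimately have "NA A Int (N a Un D) = N a" using D(1) by blast
 hence "mtight (NA A Un (N a Un D))" by (rule mtight_Un_sub[OF NA_tight[OF A] D(2) _ N_tight[OF an]])
 moreover have "NA A Un (N a Un D) = NA A Un D" using `N a<=NA A` by blast
 ultimately show ?thesis by simp
qed

lemma Ne_tight: "p < n ==> a = p | a = s p ==> mtight (N a Un e p)"
 using NE_tight[of p "s p"] NE_tight[of "s p" p] E_sym[of p "s p"] s_lt[of p] s_ne[of p] by auto

lemma zloc_compl:
 assumes Z: "zloc A Z" and A: "k:A" "l:A" "k~=l" shows "zloc ({..<n} - A) (V - Z)"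
proof -
 note z = zlocD[OF Z]
 have sub: "A<={..<n}" using oddarc_sub[OF z(2)] .
 have NZ: "N i<=Z" if "i:A" for i using z(8)[of i k] z(8)[of i l] that A by metis
 have fl: "mtight (N b Un ((V - Z) Int e p))"
  if p: "p < n" "a = p & b = s p | a = s p & b = p" "mtight (N a Un (Z Int e p))" for a b p proof -
  have I: "a:{..<n}" "b:{..<n}" "a~=b" using p s_lt[OF p(1)] s_ne[OF p(1)] by auto
  have E: "E a b = e p" using p(2) E_sym[OF I(1,2)] by auto
  have "mtight (N b Un (E a b - Z Int e p))" by (rule flip[OF I _ p(3)]) (use E in auto)
  moreover have "E a b - Z Int e p = (V - Z) Int e p" using E E_V[OF I(1,2)] by auto
  ultimately show ?thesis by simp
 qed
 show ?thesis
  unfolding zloc_def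
 proof (intro conjI allI ballI impI)
  show "V - Z<=V" by blast
  show "oddarc ({..<n} - A)" by (rule oddarc_compl[OF z(2)])
  show "EX i<n. EX j<n. i~=j & i~:{..<n} - A & j~:{..<n} - A" using A sub by blast
 next fix i assume i: "i < n"
  show "(V - Z) Int N i = {}" if "i~:{..<n} - A" using NZ[of i] that i by blast
  show "(V - Z) Int e i = {}" if "i~:{..<n} - A" "s i~:{..<n} - A"
   using z(9)[of i] that i s_lt[OF i] by blast
  show "mtight (N (s i) Un ((V - Z) Int e i))" if "i~:{..<n} - A" "s i:{..<n} - A"
   using fl[OF i, of i "s i"] z(7)[OF i] that i by blast
  show "mtight (N i Un ((V - Z) Int e i))" if "i:{..<n} - A" "s i~:{..<n} - A"
   using fl[OF i, of "s i" i] z(6)[OF i] that s_lt[OF i] by blast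
 next fix i assume i: "i:{..<n} - A"
  hence Zi: "Z Int N i = {}" using z(4) by blast
  have NV: "N i<=V" "N i~={}" using N_V[of i] N_ne[of i] i by auto
  show "N i<=V - Z" using Zi NV by blast
  show "(V - Z) Int N i~={}" using Zi NV by blast
  show "e i<=V - Z" if "s i:{..<n} - A" using z(5)[of i] i that E_V[of i "s i"] by blast
 qed
qed

lemma zloc_side:
 assumes Z: "zloc A Z" and S: "S = A | S = {..<n} - A" "S<={i:{..<n}. c i = j}"
 shows "EX Z':{Z, V - Z}. EX A' i. i < n & zloc A' Z' & A'<={k:{..<n}. c k = c i}"
proof -
 note z = zlocD[OF Z]
 have sub: "A<={..<n}" using oddarc_sub[OF z(2)] .
 obtain k where k: "k < n" "k:A" using oddarc_ne(1)[OF z(2)] by blast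
 show ?thesis
 proof (cases "EX l:A. l~=k")
  case False thus ?thesis using sub Z k(1) by fastforce
 next case True
  then obtain l where l: "l:A" "l~=k" by blast
  have ZS: "EX Z':{Z, V - Z}. zloc S Z'" using S(1) Z zloc_compl[OF Z k(2) l(1)] l(2) by auto
  then obtain Z' where Z': "Z':{Z, V - Z}" "zloc S Z'" by blast
  obtain i where i: "i < n" "i:S" using oddarc_ne(1)[OF zlocD(2)[OF Z'(2)]] by blast
  hence "S<={k:{..<n}. c k = c i}" using S(2) S(2) by blast
  thus ?thesis using Z' i(1) by blast
 qed
qed

end

text \<open>The fibres of \<open>c\<close> are odd arcs. Merging every fibre gives a frame again (\<open>cf\<close>), in general without the
maximality of (T5); the results on stars apply to it nevertheless.\<close>

locale coarse = ring_frame V Mt n N E for V :: "'a set" and Mt and n :: nat and N E +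
 fixes c :: "nat => nat"
 assumes arcs: "i < n ==> oddarc {k:{..<n}. c k = c i}"
begin

definition cl :: "nat => nat set" where "cl j = {k:{..<n}. c k = j}"

definition NN :: "nat => 'a set" where "NN j = NA (cl j)"

definition EE :: "nat => nat => 'a set" where
 "EE j k = (if j = k then {} else (UN i:{i:{..<n}. {c i, c (s i)} = {j, k}}. e i))"

lemma cl_sub: "cl j<={..<n}" unfolding cl_def by blast

lemma cl_arc: "j:c ` {..<n} ==> oddarc (cl j)" unfolding cl_def using arcs by auto

lemma NN_iff_N: "i < n ==> x:N i ==> x:NN j <-> c i = j"
 using N_Int_NA[OF _ cl_sub, of i j] unfolding NN_def NA_def cl_def by blast

lemma NN_iff_e: "i < n ==> x:e i ==> x:NN j <-> c i = j & c (s i) = j"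
 using e_Int_NA[OF _ cl_sub, of i j] s_lt[of i] unfolding NN_def NA_def cl_def by blast

lemma EE_iff_e: 
 assumes "i < n" "x:e i" shows "x:EE j k <-> j~=k & {c i, c (s i)} = {j, k}"
proof -
 have "x:e l ==> l < n ==> l = i" for l using e_disj[OF assms(1), of l] assms(2) by blast
 hence "x:(UN i:{i:{..<n}. {c i, c (s i)} = {j, k}}. e i) <-> {c i, c (s i)} = {j, k}"
  using assms by blast
 thus ?thesis unfolding EE_def by simp
qed

lemma EE_e: "x:EE j k ==> EX i<n. x:e i & j~=k & {c i, c (s i)} = {j, k}"
 unfolding EE_def by (auto split: if_splits)

lemma EE_star:
 assumes j: "j:c ` {..<n}" and k: "k:c ` {..<n}" and jk: "j~=k"
  and D: "!!p. p < n ==> D p<=e p"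
  and t: "!!p a. p < n ==> a:cl j ==> a = p | a = s p ==> p~:cl j | s p~:cl j ==> mtight (NN j Un D p)"
 shows "mtight (NN j Un (UN p:{p:{..<n}. {c p, c (s p)} = {j, k}}. D p))"
proof (rule star_union)
 show "mtight (NN j)" unfolding NN_def by (rule NA_tight[OF cl_arc[OF j]])
 show "mtight (NN j Un D p)" if p: "p:{p:{..<n}. {c p, c (s p)} = {j, k}}" for p proof -
  have "p < n" "c p = j & c (s p) = k | c p = k & c (s p) = j" using p by (auto simp: doubleton_eq_iff)
  then obtain a where "p < n" "a:cl j" "a = p | a = s p" "p~:cl j | s p~:cl j"
   using s_lt[of p] jk unfolding cl_def by auto
  thus ?thesis by (rule t)
 qed
 show "D p Int D q = {}" if "p:{p:{..<n}. {c p, c (s p)} = {j, k}}" "q:{p:{..<n}. {c p, c (s p)} = {j, k}}" "p~=q" for p q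
  using D[of p] D[of q] e_disj[of p q] that by blast
 obtain i where i: "i < n" "c i = k" using k by auto
 have "N i<=V" "N i~={}" using N_V[of i] N_ne[of i] i by auto
 moreover have "x~:NN j Un (UN p:{p:{..<n}. {c p, c (s p)} = {j, k}}. D p)" if "x:N i" for x
  using NN_iff_N[OF i(1) that, of j] i(2) jk D eN_disj[OF _ i(1)] that by blast
 ultimately show "NN j Un (UN p:{p:{..<n}. {c p, c (s p)} = {j, k}}. D p)~=V" by blast
qed

sublocale cf: frame V Mt "c ` {..<n}" NN EE
proof
 fix i j assume ij: "i:c ` {..<n}" "j:c ` {..<n}"
 show "mtight (NN i)" unfolding NN_def by (rule NA_tight[OF cl_arc[OF ij(1)]])
 have NNc: "(EX l<n. x:N l) | (EX l<n. x:e l)" if "x:NN i" for x i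
  using that cl_sub unfolding NN_def NA_def by blast
 show "NN i Int NN j = {}" if "i~=j" proof -
  have "x~:NN j" if "x:NN i" for x
   using NNc[OF that] NN_iff_N[of _ x] NN_iff_e[of _ x] that `i~=j` by metis
  thus ?thesis by blast
 qed
 show "EE i j = EE j i" unfolding EE_def by (simp add: insert_commute)
 show "mtight (NN i Un EE i j)" if "i~=j" proof -
  have "mtight (NN i Un (UN p:{p:{..<n}. {c p, c (s p)} = {i, j}}. e p))"
  proof (rule EE_star[OF ij that order_refl])
   fix p a assume p: "p < n" "a:cl i" "a = p | a = s p" "p~:cl i | s p~:cl i"
   show "mtight (NN i Un e p)" unfolding NN_def
    by (rule end_tight[OF p(1) cl_arc[OF ij(1)] p(2,3,4) order_refl Ne_tight[OF p(1,3)]])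
  qed
  thus ?thesis unfolding EE_def using that by simp
 qed
 fix k
 show "NN k Int EE i j = {}" proof -
  have "x~:NN k" if x: "x:EE i j" for x proof -
   obtain l where "l < n" "x:e l" "i~=j" "{c l, c (s l)} = {i, j}" using EE_e[OF x] by blast
   thus ?thesis using NN_iff_e[of l x k] by (auto simp: doubleton_eq_iff)
  qed
  thus ?thesis by blast
 qed
 fix l
 show "EE i j Int EE k l = {}" if n: "{i, j}~={k, l}" proof -
  have "x~:EE k l" if x: "x:EE i j" for x proof -
   obtain p where p: "p < n" "x:e p" "{c p, c (s p)} = {i, j}" using EE_e[OF x] by blast
   thus ?thesis using EE_iff_e[OF p(1,2), of k l] n by simp
  qed
  thus ?thesis by blast
 qed
next fix i show "EE i i = {}" unfolding EE_def by simp
next show "V = (UN i:c ` {..<n}. NN i) Un (UN i:c ` {..<n}. UN j:c ` {..<n}. EE i j)"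
 proof
  show "V<=(UN i:c ` {..<n}. NN i) Un (UN i:c ` {..<n}. UN j:c ` {..<n}. EE i j)"
  proof
   fix x assume "x:V"
   thus "x:(UN i:c ` {..<n}. NN i) Un (UN i:c ` {..<n}. UN j:c ` {..<n}. EE i j)"
   proof (cases rule: ring_cover)
    case (1 i)
    thus ?thesis using NN_iff_N 1 by fast
   next case (2 i)
    have "c i:c ` {..<n}" "c (s i):c ` {..<n}" using 2 s_lt by auto
    moreover have "x:NN (c i) | x:EE (c i) (c (s i))"
     using NN_iff_e[OF 2, of "c i"] EE_iff_e[OF 2, of "c i" "c (s i)"] by metis
    ultimately show ?thesis by blast
   qed
  qed
  have "EE i j<=V" for i j unfolding EE_def using E_V s_lt by (auto split: if_splits)
  thus "(UN i:c ` {..<n}. NN i) Un (UN i:c ` {..<n}. UN j:c ` {..<n}. EE i j)<=V"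
   unfolding NN_def using NA_V[OF cl_sub] by blast
 qed
 have "0 < n" using n4 by simp
 then obtain p where "p < n" "p~:{k:{..<n}. c k = c 0}" using oddarc_ne(2)[OF arcs[of 0]] by blast
 thus "EX i:c ` {..<n}. EX j:c ` {..<n}. i~=j" using `0 < n` `p < n` by blast
qed

lemma zloc_coarse:
 assumes Z: "zloc A Z" and t: "mtight Z" and A: "A<=cl j" and j: "j:c ` {..<n}" shows "cf.vloc j Z"
proof -
 note z = zlocD[OF Z]
 have ZU: "Z<=cf.U j"
 proof
  fix x assume x: "x:Z"
  hence "x:V" using z(1) by blast
  thus "x:cf.U j"
  proof (cases rule: ring_cover)
   case (1 i)
   hence "i:A" using z(4) x by blast
   hence "x:NN j" using A 1 NN_iff_N unfolding cl_def by blast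
   thus ?thesis unfolding cf.U_def by blast
  next case (2 i)
   hence "i:A | s i:A" using z(5) x by blast
   hence "c i = j | c (s i) = j" using A unfolding cl_def by blast
   hence "x:NN j | x:EE j (c i) | x:EE j (c (s i))"
    using NN_iff_e[OF 2, of j] EE_iff_e[OF 2, of j] by (metis insert_commute)
   moreover have "c i:c ` {..<n}" "c (s i):c ` {..<n}" using 2 s_lt by auto
   ultimately show ?thesis unfolding cf.U_def by blast
  qed
 qed
 have tE: "mtight (NN j Un (Z Int EE j k))" if k: "k:c ` {..<n}" "k~=j" for k proof -
  have "mtight (NN j Un (UN p:{p:{..<n}. {c p, c (s p)} = {j, k}}. Z Int e p))"
  proof (rule EE_star[OF j k(1) k(2)[symmetric]])
   fix p a assume p: "p < n" "a:cl j" "a = p | a = s p" "p~:cl j | s p~:cl j"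
   show "mtight (NN j Un (Z Int e p))"
   proof (cases "a:A")
    case True
    have "mtight (N a Un (Z Int e p))" using p(4) A z(6)[OF p(1)] z(7)[OF p(1)] p(3) True by blast
    thus ?thesis unfolding NN_def using end_tight[OF p(1) cl_arc[OF j] p(2,3,4), of "Z Int e p"] by blast
   next case False hence "Z Int e p = {}" using p A z(5)[OF p(1)] by blast
    thus ?thesis using cf.N_tight[OF j] by simp
   qed
  qed blast
  moreover have "Z Int EE j k = (UN p:{p:{..<n}. {c p, c (s p)} = {j, k}}. Z Int e p)"
   unfolding EE_def using k(2) by auto
  ultimately show ?thesis by simp
 qed
 have "mtight (NN j Un Z)"
 proof (rule cf.star_tight[OF j])
  show "NN j Un Z<=cf.U j" using ZU unfolding cf.U_def by blast
  fix k assume k: "k:c ` {..<n}" "k~=j"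
  have "(NN j Un Z) Int EE j k = Z Int EE j k" using cf.NE_disj[OF j k(1) j] by blast
  thus "mtight (NN j Un ((NN j Un Z) Int EE j k))" using tE[OF k] by simp
 qed blast
 hence "par (Z Un (NN j - Z))" by (simp add: Un_commute)
 moreover have "fcut (NN j - Z)" using cf.N_tight[OF j] t by blast
 ultimately have "~ par (NN j - Z)" using par_Un[of Z "NN j - Z"] t by auto
 hence "par (Z Int NN j)" using par_split[of "NN j" Z] cf.N_tight[OF j] t by (simp add: Int_commute)
 hence "mtight (Z Int NN j)" using mtight_Int_Un(1)[OF t cf.N_tight[OF j]] by simp
 thus ?thesis unfolding cf.vloc_def using ZU tE by blast
qed

lemma eloc_coarse:
 assumes Z: "eloc Z" and t: "mtight Z" shows "cf.eloc Z | (EX j:c ` {..<n}. cf.vloc j Z)"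
proof -
 obtain i k where ik: "i < n" "k < n" "i~=k" "Z<=E i k" using Z unfolding eloc_def by auto
 have "E i k~={}" using mtight_ne[OF t] ik(4) by blast
 then obtain p where p: "p < n" "Z<=e p" using E_e[OF ik(1,2)] ik by auto
 have J: "c p:c ` {..<n}" "c (s p):c ` {..<n}" using p s_lt by auto
 show ?thesis
 proof (cases "c p = c (s p)")
  case False
  have "Z<=EE (c p) (c (s p))" using EE_iff_e[OF p(1)] p(2) False by blast
  thus ?thesis unfolding cf.eloc_def using J False by blast
 next case True
  have ZN: "Z<=NN (c p)" using NN_iff_e[OF p(1)] p(2) True by (metis subset_iff)
  have "Z Int EE (c p) k = {}" if "k:c ` {..<n}" for k using ZN cf.NE_disj[OF J(1) that J(1)] by blast
  moreover have "Z Int NN (c p) = Z" using ZN by blast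
  moreover have "Z<=cf.U (c p)" using ZN unfolding cf.U_def by blast
  ultimately have "cf.vloc (c p) Z" unfolding cf.vloc_def using t cf.N_tight[OF J(1)] by simp
  thus ?thesis using J by blast
 qed
qed

end

section \<open>Odd chords of a polygon\<close>

definition crossing :: "nat \<times> nat => nat \<times> nat => bool" where
 "crossing x y <-> fst x < fst y & fst y < snd x & snd x < snd y |
   fst y < fst x & fst x < snd y & snd y < snd x"

locale ring_family = ring7 V Mt n N E for V :: "'a set" and Mt and n :: nat and N E +
 fixes \<X> :: "'a set set"
 assumes X: "mnf \<X>"
begin

lemma Xt: "X:\<X> ==> mtight X" and Xc: "X:\<X> ==> V - X:\<X>"
 and Xn: "X:\<X> ==> Y:\<X> ==> nest X Y"
 using X unfolding mnf_def by blast+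

definition D :: "(nat \<times> nat) set" where
 "D = {(p, q). p < q & q < n & odd (q - p) &
   (EX Z:\<X>. EX A. zloc A Z & (A = {p<..q} | A = {..<n} - {p<..q}))}"

lemma zloc_D:
 assumes "Z:\<X>" "zloc A Z"
 obtains p q where "(p, q):D" "p < q" "q < n" "odd (q - p)" "A = {p<..q} | A = {..<n} - {p<..q}"
proof -
 obtain p q where "p < q" "q < n" "odd (q - p)" "A = {p<..q} | A = {..<n} - {p<..q}"
  using arc_interval'[OF zlocD(2)[OF assms(2)]] by blast
 thus ?thesis using that[of p q] assms unfolding D_def by blast
qed

text \<open>The location of \<open>Z\<close> in the sense of \<open>zloc\<close> is determined by the vertices that \<open>Z\<close> contains.\<close>

lemma chord_mem:
 assumes Z: "Z:\<X>" and pq: "p < q" "q < n" "odd (q - p)"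
  and i: "!!i. i < n ==> i:{p<..q} ==> N i<=Z" "!!i. i < n ==> i~:{p<..q} ==> N i Int Z = {}"
 shows "(p, q):D"
proof -
 have ne: "N i~={}" "N i<=V" if "i < n" for i using N_ne[of i] N_V[of i] that by auto
 have NE: "N i Int E a b = {}" if "i < n" "a < n" "b < n" for i a b using NE_disj[of a b i] that by simp
 have q: "q < n" "q:{p<..q}" "0 < n" "0~:{p<..q}" using pq by auto
 obtain Y where Y: "Y:{Z, V - Z}" "eloc Y | (EX A. zloc A Y)" using ring_loc[OF Xt[OF Z]] by blast
 have YX: "Y:\<X>" using Y(1) Z Xc by blast
 have "~ eloc Y"
 proof
  assume "eloc Y"
  then obtain a b where ab: "a < n" "b < n" "Y<=E a b" unfolding eloc_def by auto
  have "N q<=Y | N 0<=Y" using Y(1) i(1)[OF q(1,2)] i(2)[OF q(3,4)] ne(2)[OF q(3)] by blast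
  thus False using ab NE[OF q(1) ab(1,2)] NE[OF q(3) ab(1,2)] ne(1)[OF q(1)] ne(1)[OF q(3)] by blast
 qed
 then obtain A where A: "zloc A Y" using Y(2) by blast
 note z = zlocD[OF A]
 have sub: "A<={..<n}" using oddarc_sub[OF z(2)] .
 have Aiff: "k:A <-> Y Int N k~={}" if "k < n" for k using z(4)[OF that] z(10)[of k] by blast
 have Ziff: "Z Int N k~={} <-> k:{p<..q}" if "k < n" for k using i[OF that] ne[OF that] by blast
 have VZiff: "(V - Z) Int N k~={} <-> k~:{p<..q}" if "k < n" for k using i[OF that] ne[OF that] by blast
 have iq: "{p<..q}<={..<n}" using pq by auto
 have "A = {p<..q} | A = {..<n} - {p<..q}"
 proof (cases "Y = Z")
  case True hence "k:A <-> k:{p<..q}" if "k < n" for k using Aiff[OF that] Ziff[OF that] by simp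
  thus ?thesis using sub iq by blast
 next case False hence "k:A <-> k~:{p<..q}" if "k < n" for k using Y(1) Aiff[OF that] VZiff[OF that] by simp
  thus ?thesis using sub iq by blast
 qed
 thus ?thesis unfolding D_def using pq YX A by blast
qed

text \<open>Four arcs between the ends of two crossing chords each contain a vertex, which the two sets
separate in all four ways; so the sets are not nested.\<close>

lemma D_noncross: assumes "x:D" "y:D" shows "~ crossing x y"
proof -
 have *: False if x: "(p, q):D" and y: "(p', q'):D" and c: "p < p'" "p' < q" "q < q'" for p q p' q' proof -
  obtain Z A where Z: "Z:\<X>" "zloc A Z" "A = {p<..q} | A = {..<n} - {p<..q}" and qn: "q < n"
   using x unfolding D_def by blast
  obtain Z' A' where Z': "Z':\<X>" "zloc A' Z'" "A' = {p'<..q'} | A' = {..<n} - {p'<..q'}" and qn': "q' < n"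
   using y unfolding D_def by blast
  have NZ: "N i<=Z" if "i:A" for i proof -
   have "Suc p:{p<..q}" "q:{p<..q}" "Suc p~=q" "0:{..<n} - {p<..q}" "q':{..<n} - {p<..q}" "0~=q'"
    using c qn' by auto
   thus ?thesis using Z(3) zlocD(8)[OF Z(2) that] by blast
  qed
  have NZ': "N i<=Z'" if "i:A'" for i proof -
   have "Suc p':{p'<..q'}" "q':{p'<..q'}" "Suc p'~=q'" "0:{..<n} - {p'<..q'}" "Suc p:{..<n} - {p'<..q'}" "0~=Suc p"
    using c qn' by auto
   thus ?thesis using Z'(3) zlocD(8)[OF Z'(2) that] by blast
  qed
  have ZN: "Z Int N i = {}" if "i < n" "i~:A" for i using zlocD(4)[OF Z(2) that] .
  have ZN': "Z' Int N i = {}" if "i < n" "i~:A'" for i using zlocD(4)[OF Z'(2) that] .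
  have ex: "EX i<n. (i:A <-> a) & (i:A' <-> b)" for a b proof -
   have 4: "EX i<n. (i:{p<..q} <-> a) & (i:{p'<..q'} <-> b)" for a b
   proof (cases a; cases b)
    assume "a" "b" thus ?thesis using c qn by (intro exI[of _ q]) auto
   next assume "a" "~ b" thus ?thesis using c qn by (intro exI[of _ "Suc p"]) auto
   next assume "~ a" "b" thus ?thesis using c qn' by (intro exI[of _ q']) auto
   next assume "~ a" "~ b" thus ?thesis using c qn by (intro exI[of _ 0]) auto
   qed
   obtain a' b' where a': "a' <-> (if A = {p<..q} then a else ~ a)" and b': "b' <-> (if A' = {p'<..q'} then b else ~ b)"
    by blast
   obtain i where i: "i < n" "i:{p<..q} <-> a'" "i:{p'<..q'} <-> b'" using 4[of a' b'] by blast
   have "i:A <-> a" using i a' Z(3) by (auto split: if_splits)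
   moreover have "i:A' <-> b" using i b' Z'(3) by (auto split: if_splits)
   ultimately show ?thesis using i(1) by blast
  qed
  have ne: "N i~={}" "N i<=V" if "i < n" for i using N_ne[of i] N_V[of i] that by auto
  obtain i1 where i1: "i1 < n" "i1:A" "i1:A'" using ex[of True True] by blast
  obtain i2 where i2: "i2 < n" "i2:A" "i2~:A'" using ex[of True False] by blast
  obtain i3 where i3: "i3 < n" "i3~:A" "i3:A'" using ex[of False True] by blast
  obtain i4 where i4: "i4 < n" "i4~:A" "i4~:A'" using ex[of False False] by blast
  have "Z Int Z'~={}" using NZ[OF i1(2)] NZ'[OF i1(3)] ne[OF i1(1)] by blast
  moreover have "~ Z<=Z'" using NZ[OF i2(2)] ZN'[OF i2(1,3)] ne[OF i2(1)] by blast
  moreover have "~ Z'<=Z" using NZ'[OF i3(3)] ZN[OF i3(1,2)] ne[OF i3(1)] by blast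
  moreover have "Z Un Z'~=V" using ZN[OF i4(1,2)] ZN'[OF i4(1,3)] ne[OF i4(1)] by blast
  ultimately show False using Xn[OF Z(1) Z'(1)] unfolding nest_def by blast
 qed
 show ?thesis
 proof
  assume "crossing x y"
  thus False using *[of "fst x" "snd x" "fst y" "snd y"] *[of "fst y" "snd y" "fst x" "snd x"] assms
   unfolding crossing_def by auto
 qed
qed

text \<open>If every chord of the family has a side inside one class of a coarsening of the ring, then the
 family resolves this coarsening.\<close>

lemma coarse_star:
 assumes co: "coarse V Mt n N E c"
  and side: "!!p q. (p, q):D ==> EX j. {p<..q}<={i:{..<n}. c i = j} | {..<n} - {p<..q}<={i:{..<n}. c i = j}"
  and ne: "!!X Y i j. X:\<X> ==> Y:\<X> ==> i:c ` {..<n} ==> j:c ` {..<n} ==> i~=j ==>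
   X<=frame.U (c ` {..<n}) (coarse.NN n N E c) (coarse.EE n E c) i ==>
   Y<=frame.U (c ` {..<n}) (coarse.NN n N E c) (coarse.EE n E c) j ==> X Un Y~=V"
 shows "EX Q. frame.subres V Mt (c ` {..<n}) (coarse.NN n N E c) (coarse.EE n E c) Q & (ALL j:c ` {..<n}. Q j:\<X>)"
proof -
 interpret c: coarse V Mt n N E c by (rule co)
 show ?thesis
 proof (rule c.cf.star_ex[OF X])
  fix X assume XX: "X:\<X>"
  obtain Z where Z: "Z:{X, V - X}" "eloc Z | (EX A. zloc A Z)" using ring_loc[OF Xt[OF XX]] by blast
  have ZX: "Z:\<X>" using Z(1) XX Xc by blast
  have ZV: "Z<=V" "X<=V" using mtight_sub[OF Xt[OF ZX]] mtight_sub[OF Xt[OF XX]] by auto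
  have Zc: "V - Z:{X, V - X}" using Z(1) ZV by auto
  show "EX Z:{X, V - X}. c.cf.eloc Z | (EX i:c ` {..<n}. c.cf.vloc i Z)"
   using Z(2)
  proof
   assume "eloc Z"
   thus ?thesis using c.eloc_coarse[OF _ Xt[OF ZX]] Z(1) by blast
  next assume "EX A. zloc A Z"
   then obtain A where A: "zloc A Z" by blast
   obtain p q where pq: "(p, q):D" "q < n" "A = {p<..q} | A = {..<n} - {p<..q}" using zloc_D[OF ZX A] by blast
   obtain j S where S: "S = {p<..q} | S = {..<n} - {p<..q}" "S<={i:{..<n}. c i = j}" using side[OF pq(1)] by blast
   have "S = A | S = {..<n} - A" using pq(2) S(1) pq(3) by fastforce
   then obtain Z' A' i where Z': "Z':{Z, V - Z}" "i < n" "zloc A' Z'" "A'<={k:{..<n}. c k = c i}"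
    using zloc_side[OF A _ S(2)] by blast
   have "mtight Z'" using Z'(1) Xt[OF ZX] by auto
   hence "c.cf.vloc (c i) Z'" using c.zloc_coarse[OF Z'(3)] Z'(2,4) unfolding c.cl_def by blast
   moreover have "Z':{X, V - X}" using Z'(1) Z(1) Zc by blast
   ultimately show ?thesis using Z'(2) by blast
  qed
 next fix X Y i j
  assume "X:\<X>" "Y:\<X>" "i:c ` {..<n}" "j:c ` {..<n}" "i~=j" "c.cf.vloc i X" "c.cf.vloc j Y"
  thus "X Un Y~=V" using ne[of X Y i j] unfolding c.cf.vloc_def by blast
 qed
qed

text \<open>Coarsen the cycle to the two arcs that the chord separates. As no chord of the family crosses it, the star
construction applies and yields a member of the family that contains the vertices of one arc and
avoids those of the other.\<close>

lemma D_max: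
 assumes pq: "p < q" "q < n" "odd (q - p)" and nc: "!!y. y:D ==> ~ crossing (p, q) y"
 shows "(p, q):D"
proof (rule ccontr)
 assume nD: "(p, q)~:D"
 define c where "c = (%i. if i:{p<..q} then 1 else 0 :: nat)"
 have c1: "{k:{..<n}. c k = 1} = {p<..q}" unfolding c_def using pq by auto
 have c0: "{k:{..<n}. c k = 0} = {..<n} - {p<..q}" unfolding c_def by auto
 have c01: "c k = 0 | c k = 1" for k unfolding c_def by simp
 have oa: "oddarc {p<..q}" by (rule oddarc_interval[OF pq])
 have co: "coarse V Mt n N E c"
 proof
  fix i
  from c01[of i] show "oddarc {k:{..<n}. c k = c i}"
  proof
   assume "c i = 0"
   thus ?thesis using c0 oddarc_compl[OF oa] by simp
  next assume "c i = 1"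
   thus ?thesis using c1 oa by simp
  qed
 qed
 interpret c: coarse V Mt n N E c by (rule co)
 have 0: "0 < n" "c 0 = 0" "c q = 1" unfolding c_def using pq by auto
 have J: "c ` {..<n} = {0, 1}"
 proof
  show "c ` {..<n}<={0, 1}" unfolding c_def by auto
  have "c 0:c ` {..<n}" "c q:c ` {..<n}" using 0(1) pq(2) by auto
  thus "{0, 1}<=c ` {..<n}" using 0 by simp
 qed
 have key: False if Z: "Z:\<X>" "c.NN 1<=Z" "c.NN 0 Int Z = {}" for Z proof -
  have Nc: "N i<=c.NN (c i)" if "i < n" for i using c.NN_iff_N[OF that] by blast
  have "N i<=Z" if "i < n" "i:{p<..q}" for i proof -
   have "c i = 1" unfolding c_def using that(2) by simp
   thus ?thesis using Nc[OF that(1)] Z(2) by simp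
  qed
  moreover have "N i Int Z = {}" if "i < n" "i~:{p<..q}" for i proof -
   have "c i = 0" unfolding c_def using that(2) by simp
   thus ?thesis using Nc[OF that(1)] Z(3) by auto
  qed
  ultimately have "(p, q):D" using chord_mem[OF Z(1) pq] by blast
  thus False using nD by simp
 qed
 have U: "c.NN j Int c.cf.U i = {}" if "i:{0, 1}" "j:{0, 1}" "i~=j" for i j
  using c.cf.N_Int_U[of i j] that J by simp
 have NV: "c.NN 1<=V" using c.cf.N_V[of 1] J by simp
 have "EX Q. c.cf.subres Q & (ALL j:c ` {..<n}. Q j:\<X>)"
 proof (rule coarse_star[OF co])
  fix p' q' assume d: "(p', q'):D"
  have d': "p' < q'" "q' < n" using d unfolding D_def by auto
  have "~ crossing (p, q) (p', q')" using nc[OF d] .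
  hence "(p<=p' & q'<=q) | (q'<=p | q<=p') | (p'<=p & q<=q')"
   unfolding crossing_def by auto
  thus "EX j. {p'<..q'}<={i:{..<n}. c i = j} | {..<n} - {p'<..q'}<={i:{..<n}. c i = j}"
  proof (elim disjE)
   assume "p<=p' & q'<=q"
   hence "{p'<..q'}<={p<..q}" by auto
   thus ?thesis using c1 by blast
  next assume "q'<=p"
   thus ?thesis using d' c0 by fastforce 
  next assume "q<=p'"
   thus ?thesis using d' c0 by fastforce 
  next assume "p'<=p & q<=q'"
   hence "{..<n} - {p'<..q'}<={..<n} - {p<..q}" by auto
   thus ?thesis using c0 by blast
  qed
 next fix X Y i j
  assume XY: "X:\<X>" "Y:\<X>" "i:c ` {..<n}" "j:c ` {..<n}" "i~=j" "X<=c.cf.U i" "Y<=c.cf.U j"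
  show "X Un Y~=V"
  proof
   assume u: "X Un Y = V"
   have "i = 1 & j = 0 | i = 0 & j = 1" using XY(3-5) J by auto
   thus False
   proof
    assume a: "i = 1 & j = 0"
    have "c.NN 1 Int Y = {}" "c.NN 0 Int X = {}" using U[of 0 1] U[of 1 0] XY(6,7) a by auto
    thus False using key[OF XY(1)] u NV by blast
   next assume a: "i = 0 & j = 1"
    have "c.NN 1 Int X = {}" "c.NN 0 Int Y = {}" using U[of 0 1] U[of 1 0] XY(6,7) a by auto
    thus False using key[OF XY(2)] u NV by blast
   qed
  qed
 qed
 then obtain Q where Q: "c.cf.subres Q" "ALL j:c ` {..<n}. Q j:\<X>" by blast
 have "c.NN 1<=Q 1" using c.cf.subresD(1)[OF Q(1), of 1] J by simp
 moreover have "c.NN 0 Int Q 1 = {}" using c.cf.subres_N[OF Q(1), of 1 0] J by simp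
 ultimately show False using key[of "Q 1"] Q(2) J by simp
qed

end

text \<open>A purely combinatorial abstraction: an inclusion-maximal set of pairwise non-crossing chords of an \<open>n\<close>-gon with ends of different
parity, including the sides. The chord \<open>(p, q)\<close> separates the vertices \<open>p+1, \<dots>, q\<close> from the others.\<close>

locale chord_system =
 fixes n :: nat and D :: "(nat \<times> nat) set"
 assumes D_sub: "(p, q):D ==> p < q & q < n & odd (q - p)"
  and D_nc: "x:D ==> y:D ==> ~ crossing x y"
  and D_mx: "p < q ==> q < n ==> odd (q - p) ==> (!!y. y:D ==> ~ crossing (p, q) y) ==> (p, q):D"
begin

lemma D_pair_nc: "(p, q):D ==> (c, d):D ==> ~ (p < c & c < q & q < d) & ~ (c < p & p < d & d < q)"
 using D_nc[of "(p, q)" "(c, d)"] unfolding crossing_def by auto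

lemma D_side: "Suc i < n ==> (i, Suc i):D"
 by (rule D_mx) (auto simp: crossing_def)

lemma D_full: "even n ==> 2<=n ==> (0, n - 1):D"
 by (rule D_mx) (use D_sub in \<open>force simp: crossing_def\<close>)+

definition quad :: "nat => nat => nat => nat => bool" where
 "quad p a b q <-> p < a & a < b & b < q & (p, a):D & (a, b):D & (b, q):D & (p, q):D"

lemma quad_decomp:
 assumes q: "quad p a b q" and cd: "(c, d):D" "p<=c" "d<=q" "(c, d)~=(p, q)"
 shows "d<=a | a<=c & d<=b | b<=c"
proof -
 have D: "(p, a):D" "(a, b):D" "(b, q):D" "(p, q):D" and lt: "p < a" "a < b" "b < q"
  using q unfolding quad_def by auto
 have odd: "odd (a - p)" "odd (b - a)" "odd (q - b)" "odd (d - c)" "c < d"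
  using D_sub[OF D(1)] D_sub[OF D(2)] D_sub[OF D(3)] D_sub[OF cd(1)] by auto
 have nc: "~ (p < c & c < a & a < d)" "~ (a < c & c < b & b < d)" "~ (c < a & a < d & d < b)"
  "~ (c < b & b < d & d < q)"
  using D_pair_nc[OF D(1) cd(1)] D_pair_nc[OF D(2) cd(1)] D_pair_nc[OF D(3) cd(1)] by auto
 have par: "odd (a + p)" "odd (b + a)" "odd (q + b)" "odd (d + c)"
  using odd lt by simp_all
 show ?thesis
 proof (rule ccontr)
  assume n: "~ ?thesis"
  hence n': "a < d" "c < b" "c < a | b < d" by auto
  show False
  proof (cases "c < a")
   case True hence "c = p" using nc(1) n'(1) cd(2) by auto
   moreover have "~ d < b" using nc(3) True n'(1) by auto
   moreover have "d~=b" using par `c = p` by auto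
   ultimately have "d = q" using nc(4) cd(3) n'(2) by auto
   thus False using `c = p` cd(4) by simp
  next case False hence "b < d" using n' by auto
   hence "c = a" using nc(2) False n'(2) by auto
   moreover have "d = q" using nc(4) `b < d` n'(2) cd(3) by auto
   ultimately show False using par by auto
  qed
 qed
qed

text \<open>The quadrilateral below a chord: maximality provides two further corners.\<close>

lemma quad_ex:
 assumes pq: "(p, q):D" "Suc p~=q" shows "EX a b. quad p a b q"
proof -
 have lt: "p < q" "q < n" "odd (q - p)" using D_sub[OF pq(1)] by auto
 have A: "(p, Suc p):D & Suc p < q" using lt(1) pq(2) D_side[of p] lt by force
 obtain a where a: "(p, a):D" "a < q" and amax: "!!x. (p, x):D ==> x < q ==> x<=a"
  using ex_has_greatest_nat[of "%x. (p, x):D & x < q" "Suc p" id q] A by auto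
 have pa: "p < a" "odd (a - p)" using D_sub[OF a(1)] by auto
 have ev: "odd (q + p)" "odd (a + p)" using lt pa by simp_all
 have B: "a<=q - 1 & (q - 1, q):D" using a(2) D_side[of "q - 1"] lt by simp
 obtain b where b: "a<=b" "(b, q):D" and bmin: "!!x. a<=x ==> (x, q):D ==> b<=x"
  using ex_has_least_nat[of "%x. a<=x & (x, q):D" "q - 1" id] B by auto
 have bq: "b < q" "odd (q - b)" using D_sub[OF b(2)] by auto
 have ev2: "odd (q + b)" using bq by simp
 have ab: "a < b" using b(1) ev ev2 by (cases "a = b") auto
 have "(a, b):D"
 proof (rule D_mx[OF ab])
  show "b < n" using bq lt by simp
  show "odd (b - a)" using ev ev2 ab by presburger
  fix y assume y: "y:D"
  obtain c d where cd: "y = (c, d)" by (cases y)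
  have cdD: "(c, d):D" "c < d" using y cd D_sub[of c d] by auto
  show "~ crossing (a, b) y"
  proof
   assume "crossing (a, b) y"
   then consider "a < c" "c < b" "b < d" | "c < a" "a < d" "d < b" unfolding crossing_def cd by auto
   thus False
   proof cases
    case 1
    have "d<=q" using D_pair_nc[OF pq(1) cdD(1)] 1 pa bq by auto
    moreover have "~ d < q" using D_pair_nc[OF b(2) cdD(1)] 1 bq by auto
    ultimately have "d = q" by simp
    thus False using bmin[of c] 1 cdD by auto
   next case 2
    have "p<=c" using D_pair_nc[OF pq(1) cdD(1)] 2 pa bq by auto
    moreover have "~ p < c" using D_pair_nc[OF a(1) cdD(1)] 2 by auto
    ultimately have "c = p" by simp
    thus False using amax[of d] 2 cdD bq by auto
   qed
  qed
 qed
 hence "quad p a b q" unfolding quad_def using pq a b ab pa bq by auto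
 thus ?thesis by blast
qed

lemma quad_unique:
 assumes "quad p a b q" "quad p a' b' q" shows "a = a'" "b = b'"
proof -
 have *: "a'<=a & b<=b'" if "quad p a b q" "quad p a' b' q" for a b a' b' proof -
  have lt: "p < a" "a < b" "b < q" "p < a'" "a' < b'" "b' < q" "(p, a'):D" "(b', q):D"
   using that unfolding quad_def by auto
  thus ?thesis using quad_decomp[OF that(1) lt(7)] quad_decomp[OF that(1) lt(8)] by auto
 qed
 show "a = a'" "b = b'" using *[OF assms] *[OF assms(2,1)] by auto
qed

lemma D_finite: "finite D"
proof (rule finite_subset)
 show "D<={..<n} \<times> {..<n}" using D_sub by force
qed simp

text \<open>The chords within \<open>p, \<dots>, q\<close> that do not join consecutive corners. Each is the top edge of exactly one
quadrilateral, so counting them counts quadrilaterals.\<close>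

definition S :: "nat => nat => (nat \<times> nat) set" where
 "S p q = {(c, d):D. p<=c & d<=q & Suc c~=d}"

lemma S_finite: "finite (S p q)"
 by (rule finite_subset[OF _ D_finite]) (auto simp: S_def)

lemma S_count: "(p, q):D ==> 2 * card (S p q) + 1 = q - p"
proof (induction "q - p" arbitrary: p q rule: less_induct)
 case less
 show ?case
 proof (cases "Suc p = q")
  case True
  have "S p q = {}" proof -
   have "Suc c = d" if "(c, d):D" "p<=c" "d<=q" for c d using D_sub[OF that(1)] that True by auto
   thus ?thesis unfolding S_def by auto
  qed
  thus ?thesis using True by simp
 next case False
  then obtain a b where q: "quad p a b q" using quad_ex[OF less.prems] by blast
  hence D: "p < a" "a < b" "b < q" "(p, a):D" "(a, b):D" "(b, q):D" unfolding quad_def by auto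
  have IH: "2 * card (S p a) + 1 = a - p" "2 * card (S a b) + 1 = b - a" "2 * card (S b q) + 1 = q - b"
   using less.hyps[OF _ D(4)] less.hyps[OF _ D(5)] less.hyps[OF _ D(6)] D by auto
  have cd_lt: "c < d" if "(c, d):D" for c d using D_sub[OF that] by simp
  have eq: "S p q = insert (p, q) (S p a Un (S a b Un S b q))"
  proof
   show "insert (p, q) (S p a Un (S a b Un S b q))<=S p q" using D less.prems False unfolding S_def by auto
   show "S p q<=insert (p, q) (S p a Un (S a b Un S b q))"
   proof
    fix x assume "x:S p q"
    then obtain c d where x: "x = (c, d)" "(c, d):D" "p<=c" "d<=q" "Suc c~=d" unfolding S_def by auto
    show "x:insert (p, q) (S p a Un (S a b Un S b q))"
    proof (cases "(c, d) = (p, q)")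
     case False thus ?thesis using quad_decomp[OF q x(2-4)] x unfolding S_def by auto
    qed (use x in simp)
   qed
  qed
  have d1: "S a b Int S b q = {}" "S p a Int (S a b Un S b q) = {}" "(p, q)~:S p a Un (S a b Un S b q)"
   using cd_lt D unfolding S_def by fastforce+
  have "card (S p q) = Suc (card (S p a) + (card (S a b) + card (S b q)))"
   unfolding eq using d1 S_finite by (simp add: card_Un_disjoint)
  thus ?thesis using IH D by simp
 qed
qed

end

lemma rel_bij:
 assumes "!!a. a:A ==> EX! b. b:B & R a b" "!!b. b:B ==> EX! a. a:A & R a b"
 shows "EX f. bij_betw f A B"
proof -
 define f where "f = (%a. THE b. b:B & R a b)"
 have f: "f a:B & R a (f a)" if "a:A" for a unfolding f_def by (rule theI'[OF assms(1)[OF that]])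
 have fu: "f a = b" if "a:A" "b:B" "R a b" for a b using f[OF that(1)] assms(1)[OF that(1)] that by blast
 have "bij_betw f A B"
 proof (rule bij_betwI')
  fix x y assume xy: "x:A" "y:A"
  thus "(f x = f y) = (x = y)" using f[OF xy(1)] f[OF xy(2)] assms(2)[of "f x"] by metis
 next fix x assume "x:A" thus "f x:B" using f by blast
 next fix y assume y: "y:B"
  then obtain a where a: "a:A" "R a y" using assms(2) by blast
  thus "EX x:A. y = f x" using fu[OF a(1) y a(2)] by blast
 qed
 thus ?thesis by blast
qed

lemma four_others:
 assumes "at_least_four S" "x:S"
 obtains a b c where "a:S" "b:S" "c:S" "a~=x" "b~=x" "c~=x" "a~=b" "a~=c" "b~=c"
proof -
 have "EX T. T<=S - {x} & card T = 3"
 proof (cases "finite S")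
  case True hence "3<=card (S - {x})" using assms by (simp add: at_least_four_def)
  thus ?thesis by (meson obtain_subset_with_card_n)
 next case False hence "infinite (S - {x})" by simp
  thus ?thesis by (meson infinite_arbitrarily_large)
 qed
 thus ?thesis using that by (auto simp: card_3_iff)
qed

context ring7
begin

lemma cleave_zloc:
 assumes tf: "tfam \<P> (%P. P)" and four: "at_least_four \<P>" and cl: "ALL P:\<P>. EX i<n. N i<=P" and P: "P:\<P>"
 shows "EX A. zloc A P & (ALL i<n. i:A <-> N i<=P) & (ALL i<n. i:A <-> P Int N i~={})"
proof -
 have Pt: "mtight P" using tf P unfolding tfam_def by blast
 have Pd: "P' Int P = {}" if "P':\<P>" "P'~=P" for P' using tf P that unfolding tfam_def by blast
 have PV: "P'<=V" if "P':\<P>" for P' using tf that mtight_sub unfolding tfam_def by blast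
 have ne: "N i~={}" if "i < n" for i using N_ne[of i] that by simp
 \<comment> \<open>two further classes show that the complement of \<open>P\<close> is not located around a single vertex\<close>
 obtain P1 P2 P3 where P123: "P1:\<P>" "P2:\<P>" "P1~=P" "P2~=P" "P1~=P2"
  using four_others[OF four P] by metis
 obtain i0 where i0: "i0 < n" "N i0<=P" using cl P by blast
 obtain i1 where i1: "i1 < n" "N i1<=P1" using cl P123 by blast
 obtain i2 where i2: "i2 < n" "N i2<=P2" using cl P123 by blast
 have P12: "P1 Int P2 = {}" using tf P123 unfolding tfam_def by blast
 have i12: "i1~=i2" using i1 i2 P12 ne by blast
 have sub: "N i1<=V - P" "N i2<=V - P" using i1 i2 Pd P123 PV by blast+
 have nel: "~ eloc Y" if "N i<=Y" "i < n" for Y i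
 proof
  assume "eloc Y"
  then obtain a b where "a < n" "b < n" "Y<=E a b" unfolding eloc_def by auto
  thus False using NE_disj[of a b i] that ne by fastforce
 qed
 have "EX A. zloc A P" proof -
  obtain Z where Z: "Z:{P, V - P}" "eloc Z | (EX A. zloc A Z)" using ring_loc[OF Pt] by blast
  show ?thesis
  proof (cases "Z = P")
   case True thus ?thesis using Z nel[OF i0(2,1)] by blast
  next case False hence Zc: "Z = V - P" using Z by blast
   then obtain A where A: "zloc A Z" using Z(2) nel[OF sub(1) i1(1)] by blast
   have "i1:A" using zlocD(4)[OF A i1(1)] sub(1) ne[OF i1(1)] Zc by blast
   moreover have "i2:A" using zlocD(4)[OF A i2(1)] sub(2) ne[OF i2(1)] Zc by blast
   ultimately have "zloc ({..<n} - A) (V - Z)" using zloc_compl[OF A _ _ i12] by blast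
   moreover have "V - Z = P" using Zc PV[OF P] by blast
   ultimately show ?thesis by auto
  qed
 qed
 then obtain A where A: "zloc A P" by blast
 note z = zlocD[OF A]
 have meet: "i:A <-> P Int N i~={}" if "i < n" for i using z(4)[OF that] z(10)[of i] by blast
 have "i:A <-> N i<=P" if i: "i < n" for i
 proof
  assume iA: "i:A"
  show "N i<=P"
  proof (cases "i = i0")
   case False
   show ?thesis using meet[OF i0(1)] i0 ne z(8)[OF iA _ False] by blast
  qed (use i0 in simp)
 next assume "N i<=P" thus "i:A" using meet[OF i] ne[OF i] by blast
 qed
 thus ?thesis using A meet by blast
qed

lemma cleave_cover:
 assumes tf: "tfam \<P> (%P. P)" and four: "at_least_four \<P>" and cl: "ALL P:\<P>. EX i<n. N i<=P" and i: "i < n"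
 shows "EX P:\<P>. N i<=P"
proof -
 obtain x where x: "x:N i" "x:V" using N_ne[of i] N_V[of i] i by auto
 then obtain P where P: "P:\<P>" "x:P" using tf unfolding tfam_def by blast
 obtain A where "ALL i<n. i:A <-> N i<=P" "ALL i<n. i:A <-> P Int N i~={}"
  using cleave_zloc[OF tf four cl P(1)] by blast
 thus ?thesis using i x P(2) P(1) by fastforce
qed

end

context ring_family
begin

sublocale chord_system n D
proof
 fix p q assume "(p, q):D" thus "p < q & q < n & odd (q - p)" unfolding D_def by blast
next fix x y assume "x:D" "y:D" thus "~ crossing x y" by (rule D_noncross)
next fix p q assume "p < q" "q < n" "odd (q - p)" "!!y. y:D ==> ~ crossing (p, q) y"
 thus "(p, q):D" by (rule D_max)
qed

lemma D_I: "Z:\<X> ==> p < q ==> q < n ==> odd (q - p) ==> zloc A Z ==> A = {p<..q} | A = {..<n} - {p<..q} ==> (p, q):D"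
 unfolding D_def by blast

text \<open>The maximal stars with all classes from the family that cleave the torsoid, described without graphs.\<close>

definition Tor :: "'a set set set" where
 "Tor = {\<P>. tfam \<P> (%P. P) & \<P><=\<X> & card \<P> = 4 & (ALL P:\<P>. EX i<n. N i<=P)}"

lemma Tor_four: "\<P>:Tor ==> at_least_four \<P>"
 unfolding Tor_def at_least_four_def by simp

lemma Tor_quad:
 assumes P: "\<P>:Tor"
 obtains p a b q P0 P1 P2 P3 where "\<P> = {P0, P1, P2, P3}" "quad p a b q" "q < n"
  "zloc ({..<n} - {p<..q}) P0" "zloc {p<..a} P1" "zloc {a<..b} P2" "zloc {b<..q} P3"
proof -
 have tf: "tfam \<P> (%P. P)" and XX: "\<P><=\<X>" and c4: "card \<P> = 4" and cl: "ALL P:\<P>. EX i<n. N i<=P"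
  using P unfolding Tor_def by auto
 note four = Tor_four[OF P]
 have ne: "N i~={}" if "i < n" for i using N_ne[of i] that by simp
 have Pd: "P Int P' = {}" if "P:\<P>" "P':\<P>" "P~=P'" for P P' using tf that unfolding tfam_def by blast
 note cz = cleave_zloc[OF tf four cl]
 note cc = cleave_cover[OF tf four cl]
 have n0: "0 < n" using n4 by simp
 obtain P0 where P0: "P0:\<P>" "N 0<=P0" using cc[OF n0] by blast
 obtain A0 where A0: "zloc A0 P0" "ALL i<n. i:A0 <-> N i<=P0" using cz[OF P0(1)] by blast
 have "0~:{..<n} - A0" using A0(2) P0(2) n0 by blast
 then obtain p q where pq: "p < q" "q < n" "odd (q - p)" "{..<n} - A0 = {p<..q}"
  using arc_interval[OF oddarc_compl[OF zlocD(2)[OF A0(1)]]] by blast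
 have A0e: "A0 = {..<n} - {p<..q}" using pq(4) oddarc_sub[OF zlocD(2)[OF A0(1)]] by blast
 have out0: "~ N i<=P0" if "i:{p<..q}" for i proof -
  have "i < n" "i~:A0" using that A0e pq(2) by auto
  thus ?thesis using A0(2) by blast
 qed
 have in0: "N i<=P0" if "i < n" "i~:{p<..q}" for i using A0(2) A0e that by auto
 have seg: "EX P d. P:\<P> & P~=P0 & zloc {c<..d} P & c < d & d<=q & odd (d - c) & (ALL i<n. i:{c<..d} <-> N i<=P)"
  if c: "p<=c" "c < q" and cprev: "c = p | (EX P:\<P>. N c<=P & ~ N (Suc c)<=P)" for c proof -
  have sc: "Suc c < n" "Suc c:{p<..q}" using c pq by auto
  obtain P where P: "P:\<P>" "N (Suc c)<=P" using cc[OF sc(1)] by blast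
  have PP0: "P~=P0" using out0[OF sc(2)] P(2) by blast
  obtain A where A: "zloc A P" "ALL i<n. i:A <-> N i<=P" using cz[OF P(1)] by blast
  have one: "P' = P" if "P':\<P>" "N i<=P'" "N i<=P" "i < n" for P' i
   using Pd[OF that(1) P(1)] that ne by blast
  have AI: "A<={p<..q}"
  proof
   fix i assume i: "i:A"
   thus "i:{p<..q}" using oddarc_sub[OF zlocD(2)[OF A(1)]] in0[of i] one[OF P0(1), of i] PP0 A(2) i by blast
  qed
  hence "0~:A" by auto
  then obtain c' d where cd: "c' < d" "d < n" "odd (d - c')" "A = {c'<..d}" using arc_interval[OF zlocD(2)[OF A(1)]] by blast
  have "Suc c:A" using A(2) sc(1) P(2) by blast
  hence cl: "c'<=c" "Suc c<=d" using cd(4) by auto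
  have "d<=q" "p<=c'" using AI cd by (auto simp: subset_iff)
  have "c' = c"
  proof (rule ccontr)
   assume "c'~=c"
   hence cA: "c:A" "c~=p" using cl cd `p<=c'` by auto
   then obtain P' where P': "P':\<P>" "N c<=P'" "~ N (Suc c)<=P'" using cprev by blast
   have "P' = P" using A(2) cA(1) sc(1) one[OF P'(1,2)] sc(1) by force
   thus False using P' P by blast
  qed
  thus ?thesis using P(1) PP0 A cd `d<=q` by blast
 qed
 obtain P1 a where P1: "P1:\<P>" "P1~=P0" "zloc {p<..a} P1" "p < a" "a<=q" "odd (a - p)" "ALL i<n. i:{p<..a} <-> N i<=P1"
  using seg[of p] pq by blast
 have aq: "a < q"
 proof (rule ccontr)
  assume "~ a < q"
  hence "a = q" using P1(5) by simp
  obtain P2 where P2: "P2:\<P>" "P2~=P0" "P2~=P1" proof -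
   have "card {P0, P1}<=2" by (simp add: card_insert_if)
   hence "\<P>~={P0, P1}" using c4 by auto
   thus ?thesis using that P0(1) P1(1) by blast
  qed
  obtain i where i: "i < n" "N i<=P2" using cl P2(1) by blast
  hence "N i<=P0 | N i<=P1" using in0[OF i(1)] P1(7) `a = q` by blast
  thus False using Pd[OF P2(1) P0(1) P2(2)] Pd[OF P2(1) P1(1) P2(3)] i ne by blast
 qed
 have "a:{p<..a}" "Suc a~:{p<..a}" "a < n" "Suc a < n" using P1(4) aq pq(2) by auto
 hence "N a<=P1 & ~ N (Suc a)<=P1" using P1(7) by blast
 hence pa: "p<=a" "a = p | (EX P:\<P>. N a<=P & ~ N (Suc a)<=P)" using P1(1,4) by auto
 obtain P2 b where P2: "P2:\<P>" "P2~=P0" "zloc {a<..b} P2" "a < b" "b<=q" "odd (b - a)" "ALL i<n. i:{a<..b} <-> N i<=P2"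
  using seg[OF pa(1) aq pa(2)] by blast
 have bq: "b < q"
 proof (rule ccontr)
  assume "~ b < q"
  hence "b = q" using P2(5) by simp
  hence "odd (q + p)" "odd (a + p)" "odd (q + a)" using pq P1 P2 by simp_all
  thus False by (auto simp: even_add)
 qed
 have "b:{a<..b}" "Suc b~:{a<..b}" "b < n" "Suc b < n" using P2(4) bq pq(2) by auto
 hence "N b<=P2 & ~ N (Suc b)<=P2" using P2(7) by blast
 hence pb: "p<=b" "b = p | (EX P:\<P>. N b<=P & ~ N (Suc b)<=P)" using P2(1,4) P1(4) by auto
 obtain P3 d where P3: "P3:\<P>" "P3~=P0" "zloc {b<..d} P3" "b < d" "d<=q" "odd (d - b)" "ALL i<n. i:{b<..d} <-> N i<=P3"
  using seg[OF pb(1) bq pb(2)] by blast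
 have dist: "P1~=P2" "P1~=P3" "P2~=P3" proof -
  have "a:{p<..a}" "a~:{a<..b}" "a~:{b<..d}" "b:{a<..b}" "b~:{b<..d}" "a < n" "b < n"
   using P1(4) P2(4) aq bq pq(2) by auto
  hence "N a<=P1" "~ N a<=P2" "~ N a<=P3" "N b<=P2" "~ N b<=P3"
   using P1(7) P2(7) P3(7) by blast+
  thus "P1~=P2" "P1~=P3" "P2~=P3" by auto
 qed
 have eq: "\<P> = {P0, P1, P2, P3}" proof -
  have "{P0, P1, P2, P3}<=\<P>" using P0 P1 P2 P3 by blast
  moreover have "card {P0, P1, P2, P3} = 4" using P1(2) P2(2) P3(2) dist by auto
  moreover have "finite \<P>" using c4 by (metis card.infinite zero_neq_numeral)
  ultimately show ?thesis using c4 by (metis card_subset_eq)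
 qed
 have "d = q" proof -
  obtain P where P: "P:\<P>" "N q<=P" using cc[OF pq(2)] by blast
  have "P~=P0" using pq out0 P(2) by auto
  moreover have "q~:{p<..a}" "q~:{a<..b}" using aq bq by auto
  hence "P~=P1" "P~=P2" using P(2) P1(7) P2(7) pq(2) by blast+
  ultimately have "q:{b<..d}" using P(1) eq P3(7) P(2) pq(2) by simp
  thus ?thesis using P3(5) by simp
 qed
 have "(p, q):D" "(p, a):D" "(a, b):D" "(b, q):D" proof -
  have "a < n" "b < n" using aq bq pq(2) by auto
  moreover have "P0:\<X>" "P1:\<X>" "P2:\<X>" "P3:\<X>" using P0(1) P1(1) P2(1) P3(1) XX by auto
  ultimately show "(p, q):D" "(p, a):D" "(a, b):D" "(b, q):D"
   using D_I[OF _ pq(1-3), of P0 A0] A0 A0e D_I[OF _ P1(4) _ P1(6), of P1 "{p<..a}"] P1(3)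
    D_I[OF _ P2(4) _ P2(6), of P2 "{a<..b}"] P2(3) D_I[OF _ P3(4) _ P3(6), of P3 "{b<..d}"] P3(3)
    `d = q` pq(2) by simp_all
 qed
 hence "quad p a b q" unfolding quad_def using P1(4) P2(4) bq by blast
 thus ?thesis using that[OF eq] pq(2) A0(1) A0e P1(3) P2(3) P3(3) `d = q` by blast
qed

text \<open>The coarsening of the cycle to the four arcs below and above a quadrilateral.\<close>

definition cq :: "nat => nat => nat => nat => nat => nat" where
 "cq p a b q i = (if i:{p<..a} then 1 else if i:{a<..b} then 2 else if i:{b<..q} then 3 else 0)"

lemma quad_lt: "quad p a b q ==> p < a & a < b & b < q & q < n"
 unfolding quad_def using D_sub[of p q] by auto

lemma cq_cl:
 assumes "quad p a b q"
 shows "{k:{..<n}. cq p a b q k = 1} = {p<..a}" "{k:{..<n}. cq p a b q k = 2} = {a<..b}"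
  "{k:{..<n}. cq p a b q k = 3} = {b<..q}" "{k:{..<n}. cq p a b q k = 0} = {..<n} - {p<..q}"
 using quad_lt[OF assms] unfolding cq_def by (auto split: if_splits)

lemma cq_vals: "cq p a b q i:{0, 1, 2, 3}" unfolding cq_def by simp

lemma cq_arcs:
 assumes "quad p a b q"
 shows "oddarc {p<..a}" "oddarc {a<..b}" "oddarc {b<..q}" "oddarc ({..<n} - {p<..q})"
proof -
 have D: "(p, a):D" "(a, b):D" "(b, q):D" "(p, q):D" using assms unfolding quad_def by auto
 show "oddarc {p<..a}" "oddarc {a<..b}" "oddarc {b<..q}" "oddarc ({..<n} - {p<..q})"
  using oddarc_interval D_sub[OF D(1)] D_sub[OF D(2)] D_sub[OF D(3)] D_sub[OF D(4)] oddarc_compl by blast+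
qed

lemma cq_coarse:
 assumes "quad p a b q" shows "coarse V Mt n N E (cq p a b q)"
proof
 fix i
 show "oddarc {k:{..<n}. cq p a b q k = cq p a b q i}" proof -
  consider "cq p a b q i = 0" | "cq p a b q i = 1" | "cq p a b q i = 2" | "cq p a b q i = 3"
   using cq_vals[of p a b q i] by auto
  thus ?thesis by cases (simp_all only: cq_cl[OF assms] cq_arcs[OF assms])
 qed
qed

lemma cq_image:
 assumes "quad p a b q" shows "cq p a b q ` {..<n} = {0, 1, 2, 3}"
proof
 show "cq p a b q ` {..<n}<={0, 1, 2, 3}" by (rule image_subsetI) (rule cq_vals)
 have ex: "k:cq p a b q ` {..<n}" if o: "oddarc {i:{..<n}. cq p a b q i = k}" for k proof -
  obtain i where "i < n" "i:{i:{..<n}. cq p a b q i = k}" using oddarc_ne(1)[OF o] by blast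
  thus ?thesis by auto
 qed
 show "{0, 1, 2, 3}<=cq p a b q ` {..<n}"
  using ex[of 0] ex[of 1] ex[of 2] ex[of 3] cq_arcs[OF assms] unfolding cq_cl[OF assms] by simp
qed

text \<open>No chord crosses the sides of the quadrilateral, so that every chord has one of its sides within one of the four arcs
and the star construction applies to the coarsening.\<close>

lemma quad_torso:
 assumes q: "quad p a b q" shows "EX \<P>:Tor. EX P:\<P>. zloc ({..<n} - {p<..q}) P"
proof -
 let ?c = "cq p a b q"
 note co = cq_coarse[OF q]
 interpret c: coarse V Mt n N E ?c by (rule co)
 note J = cq_image[OF q]
 note cl = cq_cl[OF q]
 have D: "(p, a):D" "(a, b):D" "(b, q):D" "(p, q):D" using q unfolding quad_def by auto
 have third: "EX k:?c ` {..<n}. k~=i & k~=j" for i j unfolding J by auto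
 have "EX Q. c.cf.subres Q & (ALL j:?c ` {..<n}. Q j:\<X>)"
 proof (rule coarse_star[OF co])
  fix p' q' assume d: "(p', q'):D"
  have d': "p' < q'" "q' < n" using D_sub[OF d] by auto
  have nc: "~ (p < p' & p' < q & q < q')" "~ (p' < p & p < q' & q' < q)" using D_pair_nc[OF D(4) d] by auto
  show "EX j. {p'<..q'}<={i:{..<n}. ?c i = j} | {..<n} - {p'<..q'}<={i:{..<n}. ?c i = j}"
  proof (cases "p<=p' & q'<=q & (p', q')~=(p, q)")
   case True
   then consider "q'<=a" | "a<=p'" "q'<=b" | "b<=p'" using quad_decomp[OF q d] by blast
   thus ?thesis
   proof cases
    case 1
    hence "{p'<..q'}<={p<..a}" using True by auto
    thus ?thesis using cl(1) by blast
   next case 2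
    hence "{p'<..q'}<={a<..b}" by auto
    thus ?thesis using cl(2) by blast
   next case 3
    hence "{p'<..q'}<={b<..q}" using True by auto
    thus ?thesis using cl(3) by blast
   qed
  next case False hence "p'<=p & q<=q' | q'<=p | q<=p'" using nc d' by auto
   thus ?thesis
   proof (elim disjE)
    assume "p'<=p & q<=q'"
    hence "{..<n} - {p'<..q'}<={..<n} - {p<..q}" by auto
    thus ?thesis using cl(4) by blast
   next assume "q'<=p"
    thus ?thesis using d' cl(4) by fastforce 
   next assume "q<=p'"
    thus ?thesis using d' cl(4) by fastforce 
   qed
  qed
 next fix X Y i j
  assume a: "X:\<X>" "Y:\<X>" "i:?c ` {..<n}" "j:?c ` {..<n}" "i~=j" "X<=c.cf.U i" "Y<=c.cf.U j"
  obtain k where k: "k:?c ` {..<n}" "k~=i" "k~=j" using third by blast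
  have "c.NN k Int X = {}" "c.NN k Int Y = {}" "c.NN k~={}" "c.NN k<=V"
   using c.cf.N_Int_U[OF a(3) k(1)] c.cf.N_Int_U[OF a(4) k(1)] k(2,3) a(6,7) c.cf.N_ne[OF k(1)] c.cf.N_V[OF k(1)]
   by blast+
  thus "X Un Y~=V" by blast
 qed
 then obtain Q where Q: "c.cf.subres Q" "ALL j:?c ` {..<n}. Q j:\<X>" by blast
 let ?P = "Q ` (?c ` {..<n})"
 have Qd: "Q i Int Q j = {}" if "i:?c ` {..<n}" "j:?c ` {..<n}" "i~=j" for i j
  using c.cf.subresD(3)[OF Q(1) that] .
 have Qne: "Q i~={}" if "i:?c ` {..<n}" for i using mtight_ne[OF c.cf.subresD(6)[OF Q(1) that]] .
 have inj: "inj_on Q (?c ` {..<n})"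
 proof (rule inj_onI, rule ccontr)
  fix x y assume "x:?c ` {..<n}" "y:?c ` {..<n}" "Q x = Q y" "x~=y"
  thus False using Qd[of x y] Qne[of x] by simp
 qed
 have NQ: "N i<=Q (?c i)" if "i < n" for i proof -
  have "N i<=c.NN (?c i)" using c.NN_iff_N[OF that] by blast
  also have "\<dots><=Q (?c i)" by (rule c.cf.subresD(1)[OF Q(1)]) (use that in simp)
  finally show ?thesis .
 qed
 have tf: "tfam ?P (%P. P)"
  unfolding tfam_def
 proof (intro conjI ballI impI)
  fix P assume "P:?P" thus "mtight P" using c.cf.subresD(6)[OF Q(1)] by blast
 next fix P P' assume PP: "P:?P" "P':?P" "P~=P'"
  obtain i where i: "i:?c ` {..<n}" "P = Q i" using PP(1) by (rule imageE)
  obtain j where j: "j:?c ` {..<n}" "P' = Q j" using PP(2) by (rule imageE)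
  have "i~=j" using PP(3) i(2) j(2) by blast
  thus "P Int P' = {}" unfolding i(2) j(2) by (rule Qd[OF i(1) j(1)])
 next
  have "(UN P:?P. P) = (UN i:?c ` {..<n}. Q i)" by (simp only: image_ident)
  also have "\<dots> = V" by (rule c.cf.subresD(4)[OF Q(1)])
  finally show "(UN P:?P. P) = V" .
 qed
 have cleave: "ALL P:?P. EX i<n. N i<=P" using NQ by auto
 have "card ?P = card (?c ` {..<n})" by (rule card_image[OF inj])
 hence card: "card ?P = 4" unfolding J by simp
 have T: "?P:Tor" unfolding Tor_def using tf Q(2) card cleave by blast
 have Q0: "Q 0:?P" using J by simp
 obtain A where A: "zloc A (Q 0)" "ALL i<n. i:A <-> N i<=Q 0" using cleave_zloc[OF tf Tor_four[OF T] cleave Q0] by blast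
 have "N i<=Q 0 <-> ?c i = 0" if i: "i < n" for i
 proof
  assume "N i<=Q 0"
  thus "?c i = 0" using NQ[OF i] N_ne[of i] i Qd[of "?c i" 0] J i by blast 
 next assume "?c i = 0" thus "N i<=Q 0" using NQ[OF i] by simp
 qed
 hence "A = {..<n} - {p<..q}" using A(2) oddarc_sub[OF zlocD(2)[OF A(1)]] cl(4) by blast 
 hence "zloc ({..<n} - {p<..q}) (Q 0)" using A(1) by simp
 thus ?thesis by (intro bexI[of _ ?P, OF _ T] bexI[of _ "Q 0", OF _ Q0])
qed

lemma NA_sub_zloc:
 assumes "zloc A P" "ALL i<n. i:A <-> N i<=P" shows "NA A<=P"
 using zlocD(9)[OF assms(1)] assms(2) oddarc_sub[OF zlocD(2)[OF assms(1)]] unfolding NA_def by blast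

lemma Tor_subres:
 assumes T: "\<P>:Tor" and P: "\<P> = {P0, P1, P2, P3}" and q: "quad p a b q"
  and z: "zloc ({..<n} - {p<..q}) P0" "zloc {p<..a} P1" "zloc {a<..b} P2" "zloc {b<..q} P3"
  and f: "f = (%k. if k = 0 then P0 else if k = 1 then P1 else if k = 2 then P2 else P3)"
 shows "frame.subres V Mt (cq p a b q ` {..<n}) (coarse.NN n N E (cq p a b q)) (coarse.EE n E (cq p a b q)) f"
proof -
 let ?c = "cq p a b q"
 interpret c: coarse V Mt n N E ?c by (rule cq_coarse[OF q])
 note J = cq_image[OF q]
 note cl = cq_cl[OF q]
 have tf: "tfam \<P> (%P. P)" and c4: "card \<P> = 4" and cv: "ALL P:\<P>. EX i<n. N i<=P"
  using T unfolding Tor_def by auto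
 have dist: "P0~=P1" "P0~=P2" "P0~=P3" "P1~=P2" "P1~=P3" "P2~=P3"
  using c4 unfolding P by (auto simp: card_insert_if split: if_splits)
 have fz: "zloc (c.cl k) (f k) & f k:\<P>" if "k:?c ` {..<n}" for k proof -
  have "k = 0 | k = 1 | k = 2 | k = 3" using that J by auto
  thus ?thesis
   unfolding c.cl_def f using z P cl by (elim disjE) simp_all
 qed
 have fd: "f k Int f l = {}" if "k:?c ` {..<n}" "l:?c ` {..<n}" "k~=l" for k l proof -
  have "k:{0,1,2,3}" "l:{0,1,2,3}" using that J by auto
  hence "f k~=f l" unfolding f using that(3) dist by auto
  thus ?thesis using fz[OF that(1)] fz[OF that(2)] tf unfolding tfam_def by blast
 qed
 have fN: "c.NN k<=f k" if k: "k:?c ` {..<n}" for k proof -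
  obtain A where A: "zloc A (f k)" "ALL i<n. i:A <-> N i<=f k" "ALL i<n. i:A <-> f k Int N i~={}"
   using cleave_zloc[OF tf Tor_four[OF T] cv, of "f k"] fz[OF k] by (elim exE conjE) blast
  have "i:A <-> i:c.cl k" if i: "i < n" for i
   using A(3) zlocD(4)[of "c.cl k" "f k" i] zlocD(10)[of "c.cl k" "f k" i] fz[OF k] i by blast
  hence "A = c.cl k" using oddarc_sub[OF zlocD(2)[OF A(1)]] c.cl_sub by blast
  thus ?thesis unfolding c.NN_def using NA_sub_zloc[OF A(1,2)] by simp
 qed
 have fv: "c.cf.vloc k (f k)" if "k:?c ` {..<n}" for k proof -
  have "mtight (f k)" using fz[OF that] tf unfolding tfam_def by blast
  thus ?thesis using c.zloc_coarse[OF _ _ order_refl that] fz[OF that] by blast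
 qed
 show ?thesis
  unfolding c.cf.subres_def
 proof (intro conjI ballI impI)
  fix k assume k: "k:?c ` {..<n}"
  show "c.NN k<=f k" by (rule fN[OF k])
  show "f k<=c.cf.U k" using fv[OF k] unfolding c.cf.vloc_def by blast
  fix l assume l: "l:?c ` {..<n}" "k~=l"
  show "f k Int f l = {}" by (rule fd[OF k l])
  show "mtight (c.NN k Un (f k Int c.EE k l))" using fv[OF k] l unfolding c.cf.vloc_def by (metis Int_commute)
 next
  have "f 0 = P0" "f 1 = P1" "f 2 = P2" "f 3 = P3" unfolding f by auto
  hence "f ` (?c ` {..<n}) = \<P>" unfolding J P by auto
  thus "(UN k:?c ` {..<n}. f k) = V" using tf unfolding tfam_def by simp
 qed
qed

lemma Tor_unique:
 assumes T: "\<P>:Tor" "\<P>':Tor" and P: "\<P> = {P0, P1, P2, P3}" "\<P>' = {P0', P1', P2', P3'}" and q: "quad p a b q"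
  and z: "zloc ({..<n} - {p<..q}) P0" "zloc {p<..a} P1" "zloc {a<..b} P2" "zloc {b<..q} P3"
  and z': "zloc ({..<n} - {p<..q}) P0'" "zloc {p<..a} P1'" "zloc {a<..b} P2'" "zloc {b<..q} P3'"
 shows "\<P> = \<P>'"
proof -
 let ?c = "cq p a b q"
 interpret c: coarse V Mt n N E ?c by (rule cq_coarse[OF q])
 note J = cq_image[OF q]
 define f where "f = (%k::nat. if k = 0 then P0 else if k = 1 then P1 else if k = 2 then P2 else P3)"
 define g where "g = (%k::nat. if k = 0 then P0' else if k = 1 then P1' else if k = 2 then P2' else P3')"
 have f: "c.cf.subres f" by (rule Tor_subres[OF T(1) P(1) q z f_def])
 have g: "c.cf.subres g" by (rule Tor_subres[OF T(2) P(2) q z' g_def])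
 have fv: "f 0 = P0" "f 1 = P1" "f 2 = P2" "f 3 = P3" "g 0 = P0'" "g 1 = P1'" "g 2 = P2'" "g 3 = P3'"
  unfolding f_def g_def by auto
 have im: "f ` (?c ` {..<n}) = \<P>" "g ` (?c ` {..<n}) = \<P>'" unfolding J P using fv by auto
 have "f k = g k" if k: "k:?c ` {..<n}" for k
 proof (rule c.cf.star_unique[OF f g _ _ k])
  show "EX k:?c ` {..<n}. k~=i & k~=j" for i j unfolding J by auto
  fix i j assume "i:?c ` {..<n}" "j:?c ` {..<n}"
  hence "f i:\<P>" "g j:\<P>'" using im by auto
  hence "f i:\<X>" "g j:\<X>" using T unfolding Tor_def by auto
  thus "nest (f i) (g j)" by (rule Xn)
 qed
 thus ?thesis using im by blast
qed

lemma interval_eq: "p < q ==> p' < q' ==> q < n ==> q' < n ==> {..<n} - {p<..q} = {..<n} - {p'<..q'} ==> p = p' & q = q'"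
proof -
 assume a: "p < q" "p' < q'" "q < n" "q' < n" "{..<n} - {p<..q} = {..<n} - {p'<..q'}"
 have "{p<..q}<={..<n}" "{p'<..q'}<={..<n}" using a(3,4) by (auto simp: subset_iff)
 hence "{p<..q} = {p'<..q'}" using a(5) by blast
 thus ?thesis using a(1,2) by (simp add: Ioc_inj)
qed

lemma Tor_root:
 assumes T: "\<P>:Tor" and P: "P:\<P>" "zloc ({..<n} - {p<..q}) P" and P': "P':\<P>" "zloc ({..<n} - {p'<..q'}) P'"
  and lt: "p < q" "q < n" "p' < q'" "q' < n"
 shows "p = p' & q = q'"
proof -
 have tf: "tfam \<P> (%P. P)" and cv: "ALL P:\<P>. EX i<n. N i<=P"
  using T unfolding Tor_def by auto
 note cz = cleave_zloc[OF tf Tor_four[OF T] cv]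
 have 0: "0 < n" using n4 by simp
 have *: "N 0<=P" if "P:\<P>" "zloc ({..<n} - {p<..q}) P" for P p q proof -
  show ?thesis using zlocD(10)[OF that(2), of 0] 0 cz[OF that(1)] 0 by auto
 qed
 have "N 0~={}" using N_ne[of 0] 0 by simp
 hence "P = P'" using *[OF P] *[OF P'] tf P(1) P'(1) unfolding tfam_def by blast
 hence "i:{..<n} - {p<..q} <-> i:{..<n} - {p'<..q'}" if "i < n" for i
  using zlocD(4,10)[OF P(2), of i] zlocD(4,10)[OF P'(2), of i] that by blast
 thus ?thesis using interval_eq lt by blast 
qed

text \<open>A torso corresponds to the chord above which its class around the vertex \<open>0\<close> lies.\<close>

lemma Tor_card: "finite Tor" "2 * card Tor + 2 = n"
proof -
 let ?D = "S 0 (n - 1)"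
 \<comment> \<open>the chord of a star is the one that separates the vertices of its class around \<open>0\<close> from the others\<close>
 let ?R = "%\<P> x. EX P:\<P>. zloc ({..<n} - {fst x<..snd x}) P"
 have D3: "EX a b. quad p a b q" if "(p, q):?D" for p q
  using that quad_ex unfolding S_def by auto
 have Dlt: "p < q" "q < n" if "(p, q):?D" for p q
  using that D_sub unfolding S_def by auto
 have "EX f. bij_betw f Tor ?D"
 proof (rule rel_bij[where R = ?R])
  fix \<P> assume T: "\<P>:Tor"
  obtain p a b q P0 P1 P2 P3 where P: "\<P> = {P0, P1, P2, P3}" "quad p a b q" "q < n" "zloc ({..<n} - {p<..q}) P0"
   using Tor_quad[OF T] by metis
  have lt: "p < a" "a < b" "b < q" "(p, q):D" using P(2) unfolding quad_def by auto
  have "(p, q):?D" unfolding S_def using lt P(3) by auto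
  moreover have R: "?R \<P> (p, q)" using P by auto
  moreover have "x = (p, q)" if xD: "x:?D" and xR: "?R \<P> x" for x proof -
   obtain p' q' where x: "x = (p', q')" by (cases x)
   obtain P' where "P':\<P>" "zloc ({..<n} - {p'<..q'}) P'" using xR x by auto
   thus ?thesis using Tor_root[OF T _ P(4), of _ p' q'] P(1) Dlt[of p' q'] xD x lt P(3) by auto
  qed
  ultimately show "EX! x. x:?D & ?R \<P> x" by blast
 next fix x assume x: "x:?D"
  obtain p q where pq: "x = (p, q)" by (cases x)
  obtain a b where q: "quad p a b q" using D3 x pq by blast
  have lt: "p < q" "q < n" using Dlt x pq by auto
  obtain \<P> where \<P>: "\<P>:Tor" "?R \<P> x" using quad_torso[OF q] pq by auto
  have "\<P>1 = \<P>2" if T: "\<P>1:Tor" "\<P>2:Tor" and R: "?R \<P>1 x" "?R \<P>2 x" for \<P>1 \<P>2 proof -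
   have *: "EX P0 P1 P2 P3. \<P> = {P0, P1, P2, P3} & zloc ({..<n} - {p<..q}) P0 & zloc {p<..a} P1 & zloc {a<..b} P2 & zloc {b<..q} P3"
    if T: "\<P>:Tor" and R: "?R \<P> x" for \<P> proof -
    obtain P where P: "P:\<P>" "zloc ({..<n} - {p<..q}) P" using R pq by auto
    obtain p' a' b' q' P0 P1 P2 P3 where P': "\<P> = {P0, P1, P2, P3}" "quad p' a' b' q'" "q' < n"
     "zloc ({..<n} - {p'<..q'}) P0" "zloc {p'<..a'} P1" "zloc {a'<..b'} P2" "zloc {b'<..q'} P3"
     using Tor_quad[OF T] by metis
    have "p' < q'" using quad_lt[OF P'(2)] by simp
    moreover have "P0:\<P>" using P'(1) by simp
    ultimately have e: "p = p' & q = q'" using Tor_root[OF T P _ P'(4) lt _ P'(3)] by blast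
    hence "a' = a" "b' = b" using quad_unique[of p a b q a' b'] q P'(2) by auto
    thus ?thesis using P' e by blast
   qed
   obtain P0 P1 P2 P3 where 1: "\<P>1 = {P0, P1, P2, P3}" "zloc ({..<n} - {p<..q}) P0" "zloc {p<..a} P1" "zloc {a<..b} P2" "zloc {b<..q} P3"
    using *[OF T(1) R(1)] by blast
   obtain P0' P1' P2' P3' where 2: "\<P>2 = {P0', P1', P2', P3'}" "zloc ({..<n} - {p<..q}) P0'" "zloc {p<..a} P1'" "zloc {a<..b} P2'" "zloc {b<..q} P3'"
    using *[OF T(2) R(2)] by blast
   show ?thesis by (rule Tor_unique[OF T 1(1) 2(1) q 1(2-5) 2(2-5)])
  qed
  thus "EX! \<P>. \<P>:Tor & ?R \<P> x" using \<P> by blast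
 qed
 then obtain f where f: "bij_betw f Tor ?D" by blast
 show "finite Tor" using bij_betw_finite[OF f] S_finite by simp
 have "card Tor = card ?D" by (rule bij_betw_same_card[OF f])
 moreover have "2 * card ?D + 1 = n - 1 - 0" by (rule S_count[OF D_full]) (use n_even n4 in auto)
 ultimately show "2 * card Tor + 2 = n" using n4 by simp
qed

end

section \<open>Longest rings satisfy the last torsoid axiom\<close>

context part_frame
begin

lemma two_nbr_LL:
 assumes uv: "u:I" "v:I" "u~=v" and T: "T<=N u" "mtight T"
  and out: "!!m x. m:Mt ==> ~ lk m u v ==> x:T ==> m x~:T ==> m x~:N u"
 shows "N u - T:LL u v"
proof -
 note Nu = N_tight[OF uv(1)] and Nv = N_tight[OF uv(2)]
 have dj: "N u Int N v = {}" by (rule N_disj[OF uv])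
 have V: "N u<=V" "N v<=V" using N_V uv by auto
 have "mtight (N v Un (N u - T))"
 proof (rule mtightI)
  show "N v Un (N u - T)<=V" using V by blast
  show "N v Un (N u - T)~={}" using N_ne[OF uv(2)] by blast
  show "N v Un (N u - T)~=V" using mtight_ne[OF T(2)] T(1) dj V by blast
  fix m x y assume m: "m:Mt" and x: "x:N v Un (N u - T)" "m x~:N v Un (N u - T)"
   and y: "y:N v Un (N u - T)" "m y~:N v Un (N u - T)"
  show "x = y"
  proof (cases "lk m u v")
   case True
   have in_T: "z:V - T & m z:T" if z: "z:N v Un (N u - T)" "m z~:N v Un (N u - T)" for z proof -
    have "m z:N u Un {} Un N v" by (rule lk_closed[OF uv(1,2) m True]) (use z in blast)
    thus ?thesis using z V T(1) dj by blast
   qed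
   show ?thesis using mtight_un_in[OF T(2) m, of x y] in_T[OF x] in_T[OF y] by blast
  next case False
   have in_v: "z:N v" if z: "z:N v Un (N u - T)" "m z~:N v Un (N u - T)" for z
   proof (rule ccontr)
    assume "z~:N v"
    hence zu: "z:N u" "z~:T" using z by auto
    have mm: "m (m z) = z" using mate_mate[OF m] zu V by blast
    have mu: "m z~:N u" using out[OF m False, of "m z"] mm zu z(2) by auto
    obtain t where t: "t:T" "m t~:T" using mtight_ex[OF T(2) m] by blast
    have "m t~:N u" by (rule out[OF m False t])
    hence "t = z" using mtight_un[OF Nu m _ _ zu(1) mu, of t] t T(1) by blast
    thus False using t zu by blast
   qed
   show ?thesis using mtight_un[OF Nv m in_v[OF x] _ in_v[OF y]] x y by blast
  qed
 qed
 moreover have "N u - (N u - T) = T" using T(1) by blast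
 ultimately show ?thesis unfolding LL_def using T by simp
qed

end

text \<open>A violation of (T7) by the frame of movable pieces of a ring. The vertices \<open>l\<close> and \<open>l'\<close> are the other neighbours of
\<open>k\<close> and \<open>j\<close>. The situation is symmetric (\<open>swap\<close>).\<close>

locale split_seven = split_free V Mt I N for V :: "'a set" and Mt and I :: "'i set" and N +
 fixes i j k l l' and P1 P2 P3 :: "'a set"
 assumes iI: "i:I" "j:I" "k:I" "l:I" "l':I"
  and d: "i~=j" "i~=k" "j~=k" "l~=k" "l'~=j"
  and ij: "m:Mt ==> lk m i j | lk m i k"
  and kl: "m:Mt ==> lk m k i | lk m k l" and jl: "m:Mt ==> lk m j i | lk m j l'"
  and Pt: "mtight P1" "mtight P2" "mtight P3"
  and Pd: "P1 Int P2 = {}" "P1 Int P3 = {}" "P2 Int P3 = {}"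
  and Pu: "P1 Un P2 Un P3 = F i j Un C i Un F i k"
  and t1: "mtight (C j Un P1 Un P2)" and t2: "mtight (P2 Un P3 Un C k)"
begin

lemma swap: "split_seven V Mt I N i k j l' l P3 P2 P1"
proof unfold_locales
 show "P3 Un P2 Un P1 = F i k Un C i Un F i j" using Pu by blast
 have "C k Un P3 Un P2 = P2 Un P3 Un C k" "P2 Un P1 Un C j = C j Un P1 Un P2" by blast+
 thus "mtight (C k Un P3 Un P2)" "mtight (P2 Un P1 Un C j)" using t1 t2 by simp_all
qed (use iI d ij kl jl Pt Pd in blast)+

lemma lki: "a:I ==> b:I ==> m:Mt ==> core.lk m a b <-> lk m a b" by (rule core_lk)

lemma excl: assumes "m:Mt" "lk m i j" shows "~ lk m i k" "~ lk m k i"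
 using lk_un[OF iI(1,2,3) assms] lk_sym[OF iI(3,1) assms(1)] d(3) by blast+

lemma disj:
 assumes "r:I" "r~=i" shows "C r Int (F i j Un C i Un F i k) = {}"
 using core.NE_disj[OF iI(1,2) assms(1)] core.NE_disj[OF iI(1,3) assms(1)] core.N_disj[OF assms(1) iI(1) assms(2)] by blast

lemma U_step:
 assumes m: "m:Mt" "lk m i j" and x: "x:F i j Un C i Un F i k"
 shows "m x:F i j Un C i Un F i k Un C j" "x:F i k ==> m x:F i k"
proof -
 have c: "core.lk m i j" "~ core.lk m i k" using m excl lki iI by auto
 show k: "m x:F i k" if "x:F i k" by (rule core.nlk_closed[OF iI(1,3) m(1) c(2) that])
 show "m x:F i j Un C i Un F i k Un C j"
  using k core.lk_closed[OF iI(1,2) m(1) c(1), of x] x by blast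
qed

lemma closed23:
 assumes m: "m:Mt" "lk m i j" and x: "x:P2 Un P3"
 shows "m x:P2 Un P3"
proof (rule ccontr)
 assume mx: "m x~:P2 Un P3"
 obtain c where c: "c:C k" "m c~:C k" using mtight_ex[OF core.N_tight[OF iI(3)] m(1)] by blast
 obtain r where r: "r:I" "core.lk m k r" using core.lk_ex[OF iI(3) m(1)] by blast
 have ri: "r~=i" using r excl[OF m] lki[OF iI(3) r(1) m(1)] by blast
 have kr: "k~=r" using r(2) unfolding core.lk_def by blast
 have mc: "m c:C r Un F k r" by (rule core.lk_leaver[OF iI(3) r(1) m(1) r(2) c])
 have F1: "F k r Int F i j = {}" by (rule core.E_disj[OF iI(3) r(1) iI(1,2)]) (use d in \<open>auto simp: doubleton_eq_iff\<close>)
 have F2: "F k r Int F i k = {}" by (rule core.E_disj[OF iI(3) r(1) iI(1,3)]) (use d ri kr in \<open>auto simp: doubleton_eq_iff\<close>)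
 have F3: "C i Int F k r = {}" by (rule core.NE_disj[OF iI(3) r(1) iI(1)])
 have mcP: "m c~:P2 Un P3 Un C k" using mc F1 F2 F3 disj[OF r(1) ri] Pu c(2) by blast
 have xU: "x:F i j Un C i Un F i k" using x Pu by blast
 have "x = c" using U_step(1)[OF m xU] disj[OF iI(3)] core.N_disj[OF iI(2,3) d(3)] d(2) mtight_un[OF t2 m(1) _ _ _ mcP, of x] x mx c(1) by blast
 thus False using xU c(1) disj[OF iI(3)] d(2) by blast
qed

lemma PV: "P1<=V" "P2<=V" "P3<=V" using Pt mtight_sub by blast+

text \<open>If \<open>P1 \<union> P2\<close> takes a part \<open>a\<close> of \<open>F i k\<close>, then \<open>a\<close> and the rest \<open>b\<close> are tight, and \<open>a\<close> is odd in the
class of \<open>i\<close> or in that of \<open>k\<close>. In the first case everything but \<open>b\<close> can be moved from \<open>N i\<close> to \<open>N j\<close>, in the second everything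
but \<open>a\<close> from \<open>N k\<close> to \<open>N l\<close>. But then the core \<open>C i\<close> or \<open>C k\<close> is moved, too, against its definition.\<close>

lemma empty_end: "(P1 Un P2) Int F i k = {}"
proof (rule ccontr)
 define a where "a = (P1 Un P2) Int F i k"
 assume "(P1 Un P2) Int F i k~={}"
 hence ane: "a~={}" unfolding a_def .
 interpret sw: split_seven V Mt I N i k j l' l P3 P2 P1 by (rule swap)
 have FV: "F i k<=V" by (rule core.E_V[OF iI(1,3)])
 have CV: "C i<=V" "C k<=V" using core.N_V iI by auto
 have CiF: "C i Int F i k = {}" by (rule core.NE_disj[OF iI(1,3,1)])
 have CkF: "C k Int F i k = {}" by (rule core.NE_disj[OF iI(1,3,3)])
 have CkU: "C k Int (F i j Un C i Un F i k) = {}" by (rule disj[OF iI(3)]) (use d in auto)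
 have NN: "N i Int N k = {}" by (rule N_disj[OF iI(1,3) d(2)])
 have beta: "m x:P1 Un P2" if "m:Mt" "lk m i k" "x:P1 Un P2" for m x
  using sw.closed23[OF that(1,2)] that(3) by blast
 have mm: "m (m x) = x" if "m:Mt" "x:V" for m x using mate_mate that by blast
 have a_beta: "m x:C i" if m: "m:Mt" "lk m i k" and x: "x:a" "m x~:a" for m x proof -
  have "m x:P1 Un P2" using beta[OF m] x(1) unfolding a_def by blast
  moreover have "m x:C i Un C k Un F i k" by (rule core.E_in[OF iI(1,3) m(1)]) (use x(1) a_def in blast)
  ultimately show ?thesis using x(2) CkU Pu unfolding a_def by blast
 qed
 have at: "mtight a"
 proof (rule mtightI)
  show "a<=V" "a~={}" using FV ane unfolding a_def by auto
  show "a~=V" using core.N_ne[OF iI(1)] CV CiF unfolding a_def by blast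
  fix m x y assume m: "m:Mt" and x: "x:a" "m x~:a" and y: "y:a" "m y~:a"
  show "x = y"
  proof (cases "lk m i j")
   case True
   have in2: "z:P2 & m z~:P2" if z: "z:a" "m z~:a" for z proof -
    have zF: "z:F i k" "z:F i j Un C i Un F i k" using z(1) unfolding a_def by auto
    have "m z:F i k" using U_step(2)[OF m True zF(2)] zF(1) by blast
    hence "m z:P3" using z(2) Pu unfolding a_def by blast
    hence "z:P2 Un P3" using closed23[OF m True] mm[OF m] zF(1) FV by force
    thus ?thesis using z(1) `m z:P3` Pd unfolding a_def by blast
   qed
   show ?thesis using mtight_un[OF Pt(2) m] in2[OF x] in2[OF y] by blast
  next case False hence b: "lk m i k" using ij[OF m] by blast
   show ?thesis
    using mtight_un_in[OF core.N_tight[OF iI(1)] m _ a_beta[OF m b x] _ a_beta[OF m b y]] x(1) y(1) FV CiF unfolding a_def by blast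
  qed
 qed
 \<comment> \<open>\<open>b\<close> has odd parity, as \<open>F i k\<close> has even parity\<close>
 define b where "b = F i k - a"
 have aF: "a<=F i k" unfolding a_def by blast
 have pb: "par b" unfolding b_def using par_Diff[OF _ _ aF] core.E_fcut[OF iI(1,3)] at by auto
 have b12: "b Int (P1 Un P2) = {}" unfolding b_def a_def by blast
 have b_beta: "m x:C k" if m: "m:Mt" "lk m i k" and x: "x:b" "m x~:b" for m x proof -
  have xV: "x:V" using x(1) FV unfolding b_def by blast
  have "m x~:a"
  proof
   assume "m x:a"
   hence "m (m x):P1 Un P2" using beta[OF m] unfolding a_def by blast
   thus False using mm[OF m(1) xV] x(1) b12 by auto
  qed
  hence "m x~:F i k" using x(2) unfolding b_def by blast
  moreover have "m x:C i Un C k Un F i k" by (rule core.E_in[OF iI(1,3) m(1)]) (use x(1) b_def in blast)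
  moreover have "m x~:C i"
  proof
   assume mx: "m x:C i"
   obtain y where y: "y:a" "m y~:a" using mtight_ex[OF at m(1)] by blast
   have "x = y" using mtight_un_in[OF core.N_tight[OF iI(1)] m(1) _ mx _ a_beta[OF m y]] x(1) y(1) FV CiF aF unfolding b_def by blast
   thus False using x(1) y(1) unfolding b_def by blast
  qed
  ultimately show ?thesis by blast
 qed
 have bt: "mtight b"
 proof (rule mtightI_par[OF _ pb])
  show "b<=V" using FV unfolding b_def by blast
  fix m x y assume m: "m:Mt" and x: "x:b" "m x~:b" and y: "y:b" "m y~:b"
  show "x = y"
  proof (cases "lk m i j")
   case True
   have in_a: "z:V - a & m z:a" if z: "z:b" "m z~:b" for z proof -
    have zF: "z:F i k" "z:F i j Un C i Un F i k" using z(1) unfolding b_def by auto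
    show ?thesis using U_step(2)[OF m True zF(2) zF(1)] z FV unfolding b_def by blast
   qed
   show ?thesis using mtight_un_in[OF at m] in_a[OF x] in_a[OF y] by blast
  next case False hence b: "lk m i k" using ij[OF m] by blast
   show ?thesis
    using mtight_un_in[OF core.N_tight[OF iI(3)] m _ b_beta[OF m b x] _ b_beta[OF m b y]] x(1) y(1) FV CkF unfolding b_def by blast
  qed
 qed
 have FN: "F i k = B i k Un B k i" unfolding F_def ..
 have Bi: "B i k<=N i" and Bk: "B k i<=N k" using B_sub iI by auto
 have C_N': "C i<=N i" "C k<=N k" using C_N by auto
 have "par a <-> (par (a Int N i)~=par (a - N i))" by (rule par_split) (use at N_tight iI in auto)
 moreover have "a - N i = a Int N k" using aF FN Bi Bk NN by blast
 ultimately consider "par (a Int N i)" | "par (a Int N k)" using at by auto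
 thus False
 proof cases
  case 1
  have bN: "b Int N i = B i k - a Int N i" unfolding b_def using FN Bi Bk NN by blast
  have aB: "a Int N i<=B i k" using aF FN Bk NN by blast
  have f: "fcut (a Int N i)" using at N_tight[OF iI(1)] by blast
  have "par (b Int N i)" unfolding bN using par_Diff[OF _ f aB] B_npar[OF iI(1,3)] 1 by auto
  hence T: "mtight (b Int N i)" by (rule mtight_Int_Un(1)[OF bt N_tight[OF iI(1)]])
  have "N i - (b Int N i):LL i j"
  proof (rule two_nbr_LL[OF iI(1,2) d(1) _ T])
   fix m x assume m: "m:Mt" "~ lk m i j" and x: "x:b Int N i" "m x~:b Int N i"
   hence b: "lk m i k" using ij[OF m(1)] by blast
   show "m x~:N i"
    using b_beta[OF m(1) b, of x] x C_N' NN by blast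
  qed blast
  hence "N i - (b Int N i)<=B i j" by (rule LL_sub_B[OF d(1)])
  moreover have "C i<=N i - (b Int N i)" using C_N' CiF unfolding b_def by blast
  ultimately show False using C_B[OF iI(2), of i] core.N_ne[OF iI(1)] by blast
 next case 2
  have T: "mtight (a Int N k)" by (rule mtight_Int_Un(1)[OF at N_tight[OF iI(3)] 2])
  have "N k - (a Int N k):LL k l"
  proof (rule two_nbr_LL[OF iI(3,4) d(4)[symmetric] _ T])
   fix m x assume m: "m:Mt" "~ lk m k l" and x: "x:a Int N k" "m x~:a Int N k"
   hence "lk m k i" using kl[OF m(1)] by blast
   hence b: "lk m i k" by (rule lk_sym[OF iI(3,1) m(1)])
   show "m x~:N k"
    using a_beta[OF m(1) b, of x] x C_N' NN by blast
  qed blast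
  hence "N k - (a Int N k)<=B k l" by (rule LL_sub_B[OF d(4)[symmetric]])
  moreover have "C k<=N k - (a Int N k)" using C_N' CkF aF by blast
  ultimately show False using C_B[OF iI(4), of k] core.N_ne[OF iI(3)] by blast
 qed
qed

text \<open>By \<open>empty_end\<close> for both ends, \<open>P2\<close> is contained in \<open>C i\<close>, and the part of \<open>P1 \<union> P2\<close> in \<open>C i\<close> could be
added to \<open>F i j\<close>.\<close>

lemma seven_False: False
proof -
 interpret sw: split_seven V Mt I N i k j l' l P3 P2 P1 by (rule swap)
 have e1: "(P1 Un P2) Int F i k = {}" by (rule empty_end)
 have e2: "(P3 Un P2) Int F i j = {}" by (rule sw.empty_end)
 define D where "D = (P1 Un P2) Int C i"
 have FF: "F i j Int C i = {}" "F i k Int C i = {}" "F i j Int F i k = {}"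
  using core.NE_disj[OF iI(1,2,1)] core.NE_disj[OF iI(1,3,1)] core.E_Int_E[OF iI(1,2,3) d(3)] by blast+
 have "D = {}"
 proof (rule core.maxE[OF iI(1,2) d(1)])
  show "D<=C i" unfolding D_def by blast
  have "C j Un F i j Un D = C j Un P1 Un P2" unfolding D_def using Pu e1 e2 by blast
  thus "mtight (C j Un F i j Un D)" using t1 by simp
  have c: "C i - D = P3 Int C i" unfolding D_def using Pu Pd by blast
  have c': "P3 Int C i = P3 - F i k" using Pu e2 FF by blast
  have "par (P3 - F i k)" using Pu e1 par_Diff[of P3 "F i k"] core.E_fcut[OF iI(1,3)] Pt(3) by blast
  hence "mtight (P3 Int C i)" unfolding c'[symmetric] by (rule mtight_Int_Un(1)[OF Pt(3) core.N_tight[OF iI(1)]])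
  thus "mtight (C i - D)" unfolding c .
 qed
 moreover have "P2<=C i" using Pu e1 e2 by blast
 ultimately have "P2 = {}" unfolding D_def by blast
 thus False using mtight_ne[OF Pt(2)] by blast
qed

end

locale ring_part = ring_frame V Mt n q "%_ _. {}" for V :: "'a set" and Mt and n :: nat and q

sublocale ring_part < part_frame V Mt "{..<n}" q
 by unfold_locales (use ring_three in blast)

context ring_part
begin

lemma other_nbr:
 assumes k: "k < n" and i: "i < n" "adj k i" shows "EX l<n. l~=k & l~=i & adj k l"
proof -
 obtain p where p: "p < n" "s p = k" using s_surj[OF k] by blast
 have "s k~=p" using ss_ne[OF p(1)] p(2) by simp
 moreover have "s k~=k" "p~=k" using s_ne[OF k] s_ne[OF p(1)] p(2) by auto
 moreover have "adj k (s k)" "adj k p" using adj_iff k p s_lt[OF k] by auto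
 ultimately show ?thesis using s_lt[OF k] p(1) by metis
qed

lemma nonadj_B:
 assumes "i < n" "j < n" "~ adj i j" shows "B i j = {}"
proof (rule closed_empty)
 have i: "i:{..<n}" "j:{..<n}" using assms by auto
 show "B i j<=V" using B_sub[OF i] N_V[OF i(1)] by blast
 show "B i j~=V" using B_sub[OF i] N_V[OF i(1)] mtight_neV[OF N_tight[OF i(1)]] by blast
 fix m x assume "m:Mt" "x:B i j"
 thus "m x:B i j" using B_closed[OF i, of m x] assms(3) unfolding adj_def by blast
qed

lemma core_ring7:
 assumes "!!i j k. i < n ==> j < n ==> k < n ==> i~=j ==> i~=k ==> j~=k ==> B i j Int B i k = {}"
 shows "EX C F. ring7 V Mt n C F & (ALL i<n. C i<=q i)"
proof -
 interpret sf: split_free V Mt "{..<n}" q by unfold_locales (use assms in auto)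
 have lk: "sf.core.lk m i j <-> lk m i j" if "m:Mt" "i < n" "j < n" for m i j
  using sf.core_lk that by auto
 have adj: "sf.core.adj i j <-> adj i j" if "i < n" "j < n" for i j
  unfolding sf.core.adj_def adj_def using lk that by blast
 have "ring7 V Mt n sf.C sf.F"
 proof unfold_locales
  show "4<=n" "even n" by (rule n4, rule n_even)
  fix m assume m: "m:Mt"
  have s: "Suc i mod n < n" for i using n4 by simp
  show "(ALL i<n. sf.core.lk m i (Suc i mod n) <-> even i) | (ALL i<n. sf.core.lk m i (Suc i mod n) <-> odd i)"
   using types[OF m] lk[OF m _ s] by simp
 next fix i j k P1 P2 P3
  assume i: "i < n" "j < n" "k < n" and a: "sf.core.adj i j" "sf.core.adj i k" and jk: "j~=k"
   and P: "mtight P1" "mtight P2" "mtight P3" "P1 Int P2 = {}" "P1 Int P3 = {}" "P2 Int P3 = {}"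
    "P1 Un P2 Un P3 = sf.F i j Un sf.C i Un sf.F i k" "mtight (sf.C j Un P1 Un P2)" "mtight (P2 Un P3 Un sf.C k)"
  have a': "adj i j" "adj i k" using a adj i by auto
  have ai: "adj j i" "adj k i" using adj_sym a' i by auto
  have ne: "i~=j" "i~=k" using a' unfolding adj_def lk_def by auto
  obtain l where l: "l < n" "l~=k" "l~=i" "adj k l" using other_nbr[OF i(3,1) ai(2)] by blast
  obtain l' where l': "l' < n" "l'~=j" "l'~=i" "adj j l'" using other_nbr[OF i(2,1) ai(1)] by blast
  interpret sv: split_seven V Mt "{..<n}" q i j k l l' P1 P2 P3
  proof unfold_locales
   fix m assume m: "m:Mt"
   show "lk m i j | lk m i k" by (rule ring_two[OF m i a' jk])
   show "lk m k i | lk m k l" by (rule ring_two[OF m i(3) i(1) l(1) ai(2) l(4)]) (use l in auto)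
   show "lk m j i | lk m j l'" by (rule ring_two[OF m i(2) i(1) l'(1) ai(1) l'(4)]) (use l' in auto)
  qed (use i jk ne l l' P in auto)
  show False by (rule sv.seven_False)
 qed
 thus ?thesis using sf.C_N by blast
qed

text \<open>Two matchings of different types match some point of every class differently, and they differ
at finitely many points.\<close>

lemma bounded:
 assumes m: "m0:Mt" "m1:Mt" "cr m0 0~=cr m1 0"
 shows "n<=card {x:V. m0 x~=m1 x}"
proof -
 have opp: "cr m0 i~=cr m1 i" if "i < n" for i
  using cr_par[OF m(1) _ that, of 0] cr_par[OF m(2) _ that, of 0] cr_types[OF m(1)] cr_types[OF m(2)] m(3) that n4
  by (metis not_numeral_le_zero gr0I)
 have "EX x. x:q i & m0 x~=m1 x" if i: "i < n" for i proof -
  obtain t where t: "t < n" "lk m0 i t" using lk_ex[of i m0] i m(1) by auto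
  then obtain x where x: "x:q i" "m0 x:q t" "i~=t" using plk by blast
  have "m0 x~=m1 x"
  proof
   assume "m0 x = m1 x"
   hence "lk m1 i t" using x plk by auto
   hence "t = s i & cr m1 i | i = s t & cr m1 t" by (rule lk_nbr[OF m(2) i t(1)])
   moreover have "t = s i & cr m0 i | i = s t & cr m0 t" by (rule lk_nbr[OF m(1) i t])
   ultimately have "t = s i" "i = s t" using opp[OF i] opp[OF t(1)] by auto
   thus False using ss_ne[OF i] by simp
  qed
  thus ?thesis using x by blast
 qed
 then obtain f where f: "!!i. i < n ==> f i:q i & m0 (f i)~=m1 (f i)" by metis
 have "inj_on f {..<n}"
 proof (rule inj_onI, rule ccontr)
  fix x y assume a: "x:{..<n}" "y:{..<n}" "f x = f y" "x~=y"
  thus False using f[of x] f[of y] N_disj[OF a(1,2,4)] by auto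
 qed
 moreover have "f ` {..<n}<={x:V. m0 x~=m1 x}"
  by (rule image_subsetI) (use f N_V in blast)
 moreover have "finite {x:V. m0 x~=m1 x}" by (rule mate_fin[OF m(1,2)])
 ultimately have "card {..<n}<=card {x:V. m0 x~=m1 x}" by (rule card_inj_on_le)
 thus ?thesis by simp
qed

end

lemma all_less_4: "(ALL i<4::nat. P i (Suc i mod 4)) <-> P 0 (Suc 0) & P (Suc 0) 2 & P 2 3 & P 3 0"
proof -
 have four: "i < 4 <-> i:{0, Suc 0, 2, 3}" for i :: nat by auto
 have "(ALL i<4::nat. P i (Suc i mod 4)) <-> (ALL i:{0, Suc 0, 2, 3}. P i (Suc i mod 4))" using four by blast
 moreover have "Suc 0 mod 4 = Suc 0" "Suc (Suc 0) mod 4 = 2" "Suc 2 mod 4 = 3" "Suc 3 mod 4 = 0" by simp_all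
 ultimately show ?thesis by simp
qed

context mate_system
begin

definition link :: "('a => 'a) => 'a set => 'a set => bool" where
 "link m X Y <-> (EX x:X. m x:Y)"

lemma link_sym: "m:Mt ==> X<=V ==> Y<=V ==> link m X Y <-> link m Y X"
 unfolding link_def using mate_mate by (metis subsetD)

lemma link_un:
 assumes P: "mtight P" and m: "m:Mt" and l: "link m P R" "link m P R'" and d: "P Int R = {}" "P Int R' = {}"
 shows "R Int R'~={}"
proof -
 obtain x where x: "x:P" "m x:R" using l(1) unfolding link_def by blast
 obtain y where y: "y:P" "m y:R'" using l(2) unfolding link_def by blast
 show ?thesis using mtight_un[OF P m x(1) _ y(1)] x y d x y by blast
qed

text \<open>Two classes that are always matched to each other form a closed set.\<close>

lemma one_partner:
 assumes P: "mtight P" and R: "mtight R" and d: "P Int R = {}" and l: "!!m. m:Mt ==> link m P R"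
 shows "P Un R = V"
proof (rule ccontr)
 assume ne: "P Un R~=V"
 have V: "P Un R<=V" using P R mtight_sub by blast
 have "P Un R = {}"
 proof (rule closed_empty[OF V ne])
  fix m x assume m: "m:Mt" and x: "x:P Un R"
  obtain y where y: "y:P" "m y:R" using l[OF m] unfolding link_def by blast
  have mm: "m (m y) = y" using mate_mate[OF m] y V by blast
  show "m x:P Un R"
  proof (rule ccontr)
   assume mx: "m x~:P Un R"
   show False
   proof (cases "x:P")
    case True
    have "x = y" using y d mtight_un[OF P m True _ y(1)] mx by blast
    thus False using mx y by blast
   next case False hence xR: "x:R" using x by blast
    have "x = m y" using mm y d mtight_un[OF R m xR _ y(2)] mx by fastforce
    thus False using mx mm y by simp
   qed
  qed
 qed
 thus False using mtight_ne[OF P] by blast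
qed

lemma tfam_frame:
 assumes tf: "tfam I Q" and two: "EX i:I. EX j:I. i~=j"
 shows "frame V Mt I Q (%_ _. {})"
proof unfold_locales
 show "V = (UN i:I. Q i) Un (UN i:I. UN j:I. {})" using tf unfolding tfam_def by simp
qed (use tf two in \<open>auto simp: tfam_def\<close>)

lemma ring_partI:
 assumes n: "4<=n" "even n" and tf: "tfam {..<n} q"
  and ty: "!!m. m:Mt ==> EX b. ALL i<n. link m (q i) (q (Suc i mod n)) <-> (even i <-> b)"
 shows "ring_part V Mt n q"
proof -
 have "(0::nat):{..<n}" "1:{..<n}" "(0::nat)~=1" using n by auto
 hence two: "EX i:{..<n}. EX j:{..<n}. i~=j" by blast
 interpret f: frame V Mt "{..<n}" q "%_ _. {}" by (rule tfam_frame[OF tf two])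
 show ?thesis
 proof unfold_locales
  fix m assume m: "m:Mt"
  have ne: "Suc i mod n~=i" if "i < n" for i using that n by (cases "Suc i = n") auto
  have lk: "f.lk m i (Suc i mod n) <-> link m (q i) (q (Suc i mod n))" if "i < n" for i
   using ne[OF that] unfolding f.lk_def link_def by auto
  obtain b where b: "ALL i<n. link m (q i) (q (Suc i mod n)) <-> (even i <-> b)" using ty[OF m] by blast
  show "(ALL i<n. f.lk m i (Suc i mod n) <-> even i) | (ALL i<n. f.lk m i (Suc i mod n) <-> odd i)"
   using b lk by (cases b) auto
 qed (use n in auto)
qed

lemma four_bobfam:
 assumes tf: "tfam I Q" and c: "card I = 4" shows "bobfam I Q"
 unfolding bobfam_def
proof (intro allI impI)
 fix A assume A: "A<=I" and t: "mtight (UN i:A. Q i)"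
 have fin: "finite I" using c by (simp add: card_ge_0_finite)
 have "card A~=0" using mtight_ne[OF t] finite_subset[OF A fin] by auto
 moreover have "card A~=4"
 proof
  assume "card A = 4"
  hence "A = I" using card_subset_eq[OF fin A] c by simp
  hence "(UN i:A. Q i) = V" using tf unfolding tfam_def by simp
  thus False using mtight_neV[OF t] by blast
 qed
 moreover have "card A~=2"
 proof
  assume "card A = 2"
  then obtain i j where ij: "A = {i, j}" "i~=j" unfolding card_2_iff by blast
  have "mtight (Q i)" "mtight (Q j)" "Q i Int Q j = {}" using tf A ij unfolding tfam_def by blast+
  thus False using mtight_disj3 t ij by auto
 qed
 moreover have "card A<=4" using card_mono[OF fin A] c by simp
 ultimately consider "card A = 1" | "card A = 3" by linarith
 thus "EX i:I. A = {i} | A = I - {i}"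
 proof cases
  case 1
  then obtain i where "A = {i}" using card_1_singletonE by blast
  thus ?thesis using A by blast
 next case 2
  hence "card (I - A) = 1" using card_Diff_subset[OF finite_subset[OF A fin] A] c by simp
  then obtain i where "I - A = {i}" using card_1_singletonE by blast
  hence "i:I" "A = I - {i}" using A by blast+
  thus ?thesis by blast
 qed
qed

text \<open>If \<open>u\<close> is always matched to \<open>v\<close> or \<open>w\<close>, the union of the three classes is tight. In a BoB its
complement is then a single class, so the collapse is a cycle of length four.\<close>

lemma deg2_C4:
 assumes tf: "tfam \<P> (%P. P)" and b: "bobfam \<P> (%P. P)" and four: "at_least_four \<P>"
  and uvw: "u:\<P>" "v:\<P>" "w:\<P>" "u~=v" "u~=w" and l: "!!m. m:Mt ==> link m u v | link m u w"
 shows "EX q. \<P> = q ` {..<4} & card \<P> = 4 & ring_part V Mt 4 q"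
proof -
 have t: "mtight P" if "P:\<P>" for P using tf that unfolding tfam_def by blast
 have dj: "P Int P' = {}" if "P:\<P>" "P':\<P>" "P~=P'" for P P' using tf that unfolding tfam_def by blast
 have cov: "\<Union>\<P> = V" using tf unfolding tfam_def by simp
 interpret f: frame V Mt \<P> "%P. P" "%_ _. {}" by (rule tfam_frame[OF tf]) (use uvw in blast)
 have lk: "f.lk m P R <-> P~=R & link m P R" for m P R unfolding f.lk_def link_def by simp
 obtain a b' c where abc: "a:\<P>" "b':\<P>" "c:\<P>" "a~=u" "b'~=u" "c~=u" "a~=b'" "a~=c" "b'~=c"
  by (rule four_others[OF four uvw(1)])
 have PV: "P<=V" "P~={}" if "P:\<P>" for P using mtight_sub[OF t[OF that]] mtight_ne[OF t[OF that]] by auto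
 have vw: "v~=w"
 proof
  assume e: "v = w"
  have "u Un v = V" by (rule one_partner[OF t t dj]) (use uvw l e in auto)
  moreover obtain z where "z:\<P>" "z~=u" "z~=v" using abc by blast
  ultimately show False using dj[of z u] dj[of z v] PV[of z] uvw by blast
 qed
 obtain z where z: "z:\<P>" "z~=u" "z~=v" "z~=w" using abc by blast
 have zd: "z Int (u Un v Un w) = {}" using dj z uvw by blast
 have X: "mtight (u Un v Un w)"
 proof (rule mtightI)
  show "u Un v Un w<=V" "u Un v Un w~={}" using PV uvw by blast+
  show "u Un v Un w~=V" using zd PV[OF z(1)] by blast
  fix m x y assume m: "m:Mt" and x: "x:u Un v Un w" "m x~:u Un v Un w" and y: "y:u Un v Un w" "m y~:u Un v Un w"
  have *: "x = y" if vw': "v':\<P>" "w':\<P>" "u Un v Un w = u Un v' Un w'" "u~=v'" and lv: "link m u v'" for v' w' proof -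
   have "z:w'" if zz: "z:u Un v Un w" "m z~:u Un v Un w" for z
    using f.lk_closed[OF uvw(1) vw'(1) m, of z] lk lv vw'(3,4) zz by auto
   hence "x:w'" "y:w'" using x y by auto
   moreover have "m x~:w'" "m y~:w'" using x y vw'(3) by auto
   ultimately show ?thesis using mtight_un[OF t[OF vw'(2)] m] by blast
  qed
  show "x = y"
  proof (cases "link m u v")
   case True thus ?thesis using *[of v w] uvw by blast
  next case False
   show ?thesis using *[of w v] uvw l[OF m] False by blast
  qed
 qed
 have "(UN P:{u, v, w}. P) = u Un v Un w" by blast
 hence "mtight (UN P:{u, v, w}. P)" using X by simp
 moreover have "{u, v, w}<=\<P>" using uvw by simp
 ultimately obtain x where x: "x:\<P>" "{u, v, w} = {x} | {u, v, w} = \<P> - {x}" 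
  using b[unfolded bobfam_def, rule_format, of "{u, v, w}"] by auto
 have xz: "{u, v, w} = \<P> - {x}" using uvw(4) x(2) by force 
 hence "z = x" using z by blast
 hence Pe: "\<P> = {u, v, w, z}" using xz x(1) by blast
 define q where "q = (%i::nat. if i = 0 then u else if i = 1 then v else if i = 2 then z else w)"
 have qv: "q 0 = u" "q (Suc 0) = v" "q 2 = z" "q 3 = w" unfolding q_def by auto
 have I4: "{..<4::nat} = {0, Suc 0, 2, 3}" by auto
 have im: "\<P> = q ` {..<4}" unfolding I4 Pe using qv by auto
 have card: "card \<P> = 4" unfolding Pe using uvw z vw by auto
 have qd: "q i~=q j" if "i < 4" "j < 4" "i~=j" for i j proof -
  have "i:{0, Suc 0, 2, 3}" "j:{0, Suc 0, 2, 3}" using that by auto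
  thus ?thesis using that(3) uvw z vw unfolding q_def by auto
 qed
 have qP: "q i:\<P>" if "i < 4" for i unfolding im using that by simp
 have "ring_part V Mt 4 q"
 proof (rule ring_partI)
  show "tfam {..<4} q" unfolding tfam_def
  proof (intro conjI ballI impI)
   fix i :: nat assume "i:{..<4}" thus "mtight (q i)" using t qP by simp
   fix j :: nat assume "j:{..<4}" "i~=j"
   thus "q i Int q j = {}" using dj[OF qP qP qd] `i:{..<4}` by simp
  next show "(UN i:{..<4}. q i) = V" using cov unfolding im by simp
  qed
  fix m assume m: "m:Mt"
  have ls: "f.lk m P R <-> f.lk m R P" if "P:\<P>" "R:\<P>" for P R using f.lk_sym that m by blast
  have lu: "R = R'" if "f.lk m P R" "f.lk m P R'" "P:\<P>" "R:\<P>" "R':\<P>" for P R R' using f.lk_un[OF that(3-5) m] that by blast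
  have lq: "link m (q i) (q (Suc i mod 4)) <-> f.lk m (q i) (q (Suc i mod 4))" if "i < 4" for i proof -
   have "Suc i mod 4 < 4" "Suc i mod 4~=i" using that by (simp, cases "Suc i = 4", auto)
   thus ?thesis using lk qd[of i "Suc i mod 4"] that by auto
  qed
  show "EX b. ALL i<4. link m (q i) (q (Suc i mod 4)) <-> (even i <-> b)"
  proof (cases "link m u v")
   case True hence uv: "f.lk m u v" using lk uvw by blast
   obtain r where r: "r:\<P>" "f.lk m w r" using f.lk_ex[OF uvw(3) m] by blast
   have "r~=u" "r~=v" "r~=w"
    using r ls[OF uvw(3,1)] ls[OF uvw(3,2)] ls[OF uvw(1,2)] lu[OF uv, of w] lu[of v u w] uv uvw vw lk by auto
   hence wz: "f.lk m w z" using r Pe by blast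
   have "f.lk m (q 0) (q 1)" "~ f.lk m (q 1) (q 2)" "f.lk m (q 2) (q 3)" "~ f.lk m (q 3) (q 0)"
    using uv wz ls[OF uvw(1,2)] ls[OF uvw(3) z(1)] ls[OF uvw(3,1)] lu[of v u z] lu[of w z u] z uvw vw unfolding q_def by auto
   hence "ALL i<4. f.lk m (q i) (q (Suc i mod 4)) <-> (even i <-> True)"
    unfolding all_less_4[of "%i j. f.lk m (q i) (q j) <-> (even i <-> True)"] by simp
   thus ?thesis using lq by blast
  next case False hence uw: "f.lk m u w" using l[OF m] lk uvw by blast
   obtain r where r: "r:\<P>" "f.lk m v r" using f.lk_ex[OF uvw(2) m] by blast
   have "r~=u" "r~=w" "r~=v"
    using r ls[OF uvw(2,1)] ls[OF uvw(2,3)] ls[OF uvw(1,3)] lu[OF uw, of v] lu[of w u v] uw uvw vw lk by auto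
   hence vz: "f.lk m v z" using r Pe by blast
   have "~ f.lk m (q 0) (q 1)" "f.lk m (q 1) (q 2)" "~ f.lk m (q 2) (q 3)" "f.lk m (q 3) (q 0)"
    using uw vz ls[OF uvw(1,3)] ls[OF uvw(2) z(1)] ls[OF uvw(3) z(1)] lu[of u w v] lu[of z v w] z uvw vw unfolding q_def by auto
   hence "ALL i<4. f.lk m (q i) (q (Suc i mod 4)) <-> (even i <-> False)"
    unfolding all_less_4[of "%i j. f.lk m (q i) (q j) <-> (even i <-> False)"] by simp
   thus ?thesis using lq by blast
  qed
 qed auto
 thus ?thesis using im card by blast
qed

end

context part_frame
begin

text \<open>If the movable pieces of a class with two neighbours overlap in an odd set, they cover the
class, and the class splits into three tight sets in a row (\<open>overlap_links\<close>).\<close>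

lemma overlap:
 assumes ijk: "i:I" "j:I" "k:I" "i~=j" "i~=k" "j~=k"
  and two: "!!m. m:Mt ==> lk m i j | lk m i k" and p: "par (B i j Int B i k)"
 shows "B i j Un B i k = N i" "mtight (B i j Int B i k)"
proof -
 note BB = B_npar[OF ijk(1,2)] B_npar[OF ijk(1,3)]
 note Bs = B_sub[OF ijk(1,2)] B_sub[OF ijk(1,3)]
 note Nt = N_tight[OF ijk(1)]
 have NV: "N i<=V" by (rule N_V[OF ijk(1)])
 have p1: "par (B i j - B i k)" using par_split[of "B i j" "B i k"] BB p by blast
 have U: "B i j Un B i k = (B i j - B i k) Un B i k" "(B i j - B i k) Int B i k = {}" by blast+
 have pU: "par (B i j Un B i k)" unfolding U(1) using par_Un[OF _ _ U(2)] BB p1 by blast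
 define R where "R = N i - (B i j Un B i k)"
 have f: "fcut R" unfolding R_def using BB Nt by blast
 have "par R <-> (par (N i)~=par (B i j Un B i k))" unfolding R_def by (rule par_Diff) (use BB Nt Bs in auto)
 hence np: "~ par R" using pU Nt by auto
 have one: "x = y" if m: "m:Mt" and x: "x:R" "m x~:R" and y: "y:R" "m y~:R" for m x y proof -
  have gen: "x = y" if b: "b:I" "c:I" "i~=b" and bc: "B i b Un B i c = B i j Un B i k" and n: "~ lk m i c" for b c proof -
   have *: "z:N i - B i b & m z~:N i - B i b" if z: "z:R" "m z~:R" for z
    using z B_back[OF ijk(1) b(2) m n, of z] NV bc unfolding R_def by blast
   show ?thesis using mtight_un[OF B_tight(1)[OF ijk(1) b(1,3)] m] *[OF x] *[OF y] by blast
  qed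
  show ?thesis
  proof (cases "lk m i j")
   case True hence "~ lk m i k" using lk_un[OF ijk(1-3) m] ijk(6) by blast
   thus ?thesis by (rule gen[OF ijk(2,3,4) refl])
  next case False thus ?thesis by (intro gen[OF ijk(3,2,5)]) auto
  qed
 qed
 have "R = {}"
 proof (rule closed_empty)
  show "R<=V" "R~=V" using NV mtight_neV[OF Nt] unfolding R_def by blast+
  fix m x assume m: "m:Mt" and x: "x:R"
  show "m x:R" by (rule npar_one_closed[OF f np m _ x]) (rule one[OF m])
 qed
 thus U: "B i j Un B i k = N i" using Bs unfolding R_def by blast
 show "mtight (B i j Int B i k)"
 proof (rule mtightI_par[OF _ p])
  show "B i j Int B i k<=V" using Bs NV by blast
  fix m x y assume m: "m:Mt" and x: "x:B i j Int B i k" "m x~:B i j Int B i k" and y: "y:B i j Int B i k" "m y~:B i j Int B i k"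
  have gen: "x = y" if b: "b:I" "c:I" "i~=b" and bc: "B i b Int B i c = B i j Int B i k" and n: "~ lk m i c" for b c proof -
   have *: "z:V - (N i - B i b) & m z:N i - B i b" if z: "z:B i j Int B i k" "m z~:B i j Int B i k" for z
    using z B_closed[OF ijk(1) b(2) m n, of z] B_sub[OF ijk(1) b(2)] NV bc by blast
   show ?thesis using mtight_un_in[OF B_tight(1)[OF ijk(1) b(1,3)] m] *[OF x] *[OF y] by blast
  qed
  show "x = y"
  proof (cases "lk m i j")
   case True hence "~ lk m i k" using lk_un[OF ijk(1-3) m] ijk(6) by blast
   thus ?thesis by (rule gen[OF ijk(2,3,4) refl])
  next case False thus ?thesis by (intro gen[OF ijk(3,2,5)]) auto
  qed
 qed
qed

lemma overlap_links:
 assumes ijk: "i:I" "j:I" "k:I" "i~=j" "i~=k" "j~=k"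
  and two: "!!m. m:Mt ==> lk m i j | lk m i k" and p: "par (B i j Int B i k)"
  and m: "m:Mt" "lk m i j"
 shows "link m (N j) (N i - B i k)" "~ link m (N i - B i k) (B i j Int B i k)"
  "link m (B i j Int B i k) (N i - B i j)" "~ link m (N i - B i j) (N k)"
proof -
 note ov = overlap[OF ijk two p]
 have n: "~ lk m i k" using lk_un[OF ijk(1-3) m] ijk(6) by blast
 have NV: "N i<=V" "N j<=V" using N_V ijk by auto
 note Bs = B_sub[OF ijk(1,2)] B_sub[OF ijk(1,3)]
 have cl: "m x:B i k" if "x:B i k" for x by (rule B_closed[OF ijk(1,3) m(1) n that])
 have dj: "N i Int N j = {}" "N i Int N k = {}" using N_disj ijk by blast+
 obtain x where x: "x:N i" "m x:N j" using m(2) plk by blast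
 have "x~:B i k" using cl x Bs dj by blast
 hence "link m (N i - B i k) (N j)" unfolding link_def using x by blast
 thus "link m (N j) (N i - B i k)" using link_sym[OF m(1), of "N i - B i k" "N j"] NV by blast
 show "~ link m (N i - B i k) (B i j Int B i k)"
  unfolding link_def using B_back[OF ijk(1,3) m(1) n] NV by blast
 obtain y where y: "y:B i j Int B i k" "m y~:B i j Int B i k" using mtight_ex[OF ov(2) m(1)] by blast
 have "m y:N i - B i j" using cl[of y] y Bs by blast
 thus "link m (B i j Int B i k) (N i - B i j)" unfolding link_def using y by blast
 show "~ link m (N i - B i j) (N k)"
  unfolding link_def using ov(1) cl Bs dj by blast
qed

end

context ring_part
begin

lemma cr_link: "i < n ==> cr m i <-> link m (q i) (q (s i))"
 unfolding cr_def plk link_def using s_ne[of i] by metis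

lemma cr_0: "m:Mt ==> i < n ==> cr m i <-> (even i <-> cr m 0)"
 using cr_types[of m] n4 by (metis even_zero gr_zeroI not_numeral_le_zero)

text \<open>The three sets replace the class \<open>q i\<close>, which gives a ring with two more classes. Parities along the ring are
preserved, so the new ring distinguishes the same two types of matchings.\<close>

lemma lengthen:
 assumes i: "i < n" and p: "p < n" "s p = i" and pr: "par (B i p Int B i (s i))"
 shows "EX q'. ring_part V Mt (n + 2) q' & (ALL r<n+2. EX t<n. q' r<=q t) & (ALL m:Mt. link m (q' 0) (q' 1) <-> cr m 0)"
proof -
 define k where "k = s i"
 have k: "k < n" "k~=i" using s_lt[OF i] s_ne[OF i] unfolding k_def by auto
 have pi: "p~=i" using s_ne[OF p(1)] p(2) by auto
 have pk: "p~=k" using ss_ne[OF p(1)] p(2) unfolding k_def by auto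
 have I: "i:{..<n}" "p:{..<n}" "k:{..<n}" using i p k by auto
 have lkp: "lk m i p <-> cr m p" if "m:Mt" for m
  using lk_sym[OF I(1,2) that] lk_sym[OF I(2,1) that] p(2) unfolding cr_def by blast
 have lkk: "lk m i k <-> cr m i" for m unfolding cr_def k_def ..
 have crx: "cr m i <-> ~ cr m p" if "m:Mt" for m using cr_s[OF that p(1)] p(2) by simp
 have two: "lk m i p | lk m i k" "lk m i k | lk m i p" if "m:Mt" for m using lkp[OF that] lkk crx[OF that] by blast+
 define P1 P2 P3 where P: "P1 = q i - B i k" "P2 = B i p Int B i k" "P3 = q i - B i p"
 have pr': "par (B i p Int B i k)" "par (B i k Int B i p)" using pr unfolding k_def by (simp_all add: Int_commute)
 note ne = pi[symmetric] k(2)[symmetric] pk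
 note ov = overlap[OF I ne two(1) pr'(1)]
 have t: "mtight P1" "mtight P2" "mtight P3"
  unfolding P using B_tight(1)[OF I(1,3) ne(2)] B_tight(1)[OF I(1,2) ne(1)] ov(2) by auto
 have sub: "P1<=q i" "P2<=q i" "P3<=q i" unfolding P using B_sub[OF I(1,2)] by auto
 have PU: "P1 Un P2 Un P3 = q i" using sub ov(1) unfolding P by blast
 have Pd: "P1 Int P2 = {}" "P1 Int P3 = {}" "P2 Int P3 = {}" unfolding P using ov(1) by blast+
 have V: "q p<=V" "q k<=V" "P1<=V" "P2<=V" "P3<=V" using N_V[OF I(2)] N_V[OF I(3)] N_V[OF I(1)] sub by blast+
 have L: "link m (q p) P1 <-> cr m p" "link m P1 P2 <-> cr m i" "link m P2 P3 <-> cr m p" "link m P3 (q k) <-> cr m i"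
  if m: "m:Mt" for m proof -
  note s12 = link_sym[OF m V(3,4)] and s23 = link_sym[OF m V(4,5)] and sp = link_sym[OF m V(1,3)] and sk = link_sym[OF m V(2,5)]
  have PP: "B i k Int B i p = P2" unfolding P by blast
  have A: "link m (q p) P1 & ~ link m P1 P2 & link m P2 P3 & ~ link m P3 (q k)" if "cr m p"
   using overlap_links[OF I ne two(1) pr'(1) m] lkp[OF m] that unfolding P by blast
  have C: "link m (q k) P3 & ~ link m P3 P2 & link m P2 P1 & ~ link m P1 (q p)" if "cr m i"
   using overlap_links[OF I(1,3,2) ne(2,1) pk[symmetric] two(2) pr'(2) m] lkk that unfolding P(1,3) PP by blast
  show "link m (q p) P1 <-> cr m p" "link m P1 P2 <-> cr m i" "link m P2 P3 <-> cr m p" "link m P3 (q k) <-> cr m i"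
   using A C crx[OF m] s12 s23 sp sk by blast+
 qed
 define q' where "q' = (%r. if r < i then q r else if r = i then P1 else if r = Suc i then P2 else if r = i + 2 then P3 else q (r - 2))"
 \<comment> \<open>the old class of which the new class \<open>r\<close> is a part\<close>
 define \<rho> where "\<rho> = (%r. if r < i then r else if r<=i + 2 then i else r - 2)"
 have rho: "\<rho> r < n" "q' r<=q (\<rho> r)" if "r < n + 2" for r
  using that i sub unfolding \<rho>_def q'_def by auto
 have ty: "link m (q' r) (q' (Suc r mod (n + 2))) <-> (even r <-> cr m 0)" if m: "m:Mt" and r: "r < n + 2" for m r proof -
  note c0 = cr_0[OF m]
  consider "Suc r < i" | "Suc r = i" | "r = i" | "r = Suc i" | "r = i + 2" | "i + 2 < r" by linarith
  thus ?thesis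
  proof cases
   case 1
   hence "q' r = q r" "q' (Suc r mod (n + 2)) = q (s r)" "r < n" using i unfolding q'_def by (auto simp: s_if)
   thus ?thesis using cr_link[of r m] c0[of r] by simp
  next case 2
   hence rn: "r < n" "s r = i" using i by (auto simp: s_if)
   hence rp: "r = p" using s_inj[of r p] p by auto
   have "q' r = q r" "q' (Suc r mod (n + 2)) = P1" using 2 i unfolding q'_def by auto
   thus ?thesis using L(1)[OF m] c0[of r] rp rn by simp
  next case 3
   have "q' r = P1" "q' (Suc r mod (n + 2)) = P2" using 3 i unfolding q'_def by auto
   thus ?thesis using L(2)[OF m] c0[of r] 3 i by simp
  next case 4
   have "q' r = P2" "q' (Suc r mod (n + 2)) = P3" using 4 i unfolding q'_def by auto
   thus ?thesis using L(3)[OF m] c0[OF i] crx[OF m] 4 by auto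
  next case 5
   have "q' r = P3" using 5 unfolding q'_def by auto
   moreover have "q' (Suc r mod (n + 2)) = q k"
   proof (cases "Suc i < n")
    case True thus ?thesis using 5 i unfolding q'_def k_def by (auto simp: s_if)
   next case False hence "Suc i = n" using i by simp
    thus ?thesis using 5 i n4 unfolding q'_def k_def by (auto simp: s_if)
   qed
   ultimately show ?thesis using L(4)[OF m] c0[OF i] 5 by simp
  next case 6
   define t where "t = r - 2"
   have t: "r = t + 2" "i < t" "t < n" using 6 r unfolding t_def by auto
   have q1: "q' r = q t" unfolding q'_def using t by auto
   show ?thesis
   proof (cases "Suc t < n")
    case True
    have "q' (Suc r mod (n + 2)) = q (s t)" using t True unfolding q'_def by (auto simp: s_if)
    thus ?thesis using cr_link[OF t(3), of m] c0[OF t(3)] q1 t(1) by simp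
   next case False hence tn: "Suc t = n" using t by simp
    hence st: "s t = 0" using t by (simp add: s_if)
    have m0: "Suc r mod (n + 2) = 0" using t(1) tn by simp
    show ?thesis
    proof (cases "i = 0")
     case True
     have "t = p" using s_inj[OF t(3) p(1)] st p(2) True by simp
     moreover have "q' 0 = P1" unfolding q'_def using True by simp
     ultimately show ?thesis using L(1)[OF m] c0[OF t(3)] q1 t(1) m0 by simp
    next case False
     have "q' 0 = q (s t)" unfolding q'_def using False st by simp
     thus ?thesis using cr_link[OF t(3), of m] c0[OF t(3)] q1 t(1) m0 by simp
    qed
   qed
  qed
 qed
 have rp: "ring_part V Mt (n + 2) q'"
 proof (rule ring_partI)
  show "tfam {..<n + 2} q'" unfolding tfam_def
  proof (intro conjI ballI impI)
   fix r assume r: "r:{..<n + 2}"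
   have "mtight (q t)" if "t < n" for t using N_tight that by simp
   thus "mtight (q' r)" using r i t unfolding q'_def by simp
   fix r' assume r': "r':{..<n + 2}" "r~=r'"
   show "q' r Int q' r' = {}"
   proof (cases "\<rho> r = \<rho> r'")
    case False
    have "q (\<rho> r) Int q (\<rho> r') = {}" by (rule N_disj[OF _ _ False]) (use rho r r' in auto)
    thus ?thesis using rho[of r] rho[of r'] r r' by blast
   next case True hence "r:{i, Suc i, i + 2}" "r':{i, Suc i, i + 2}" using r'(2) unfolding \<rho>_def by (auto split: if_splits)
    thus ?thesis using r'(2) Pd unfolding q'_def by (auto simp: Int_commute)
   qed
  next show "(UN r:{..<n + 2}. q' r) = V"
   proof
    show "(UN r:{..<n + 2}. q' r)<=V"
    proof (rule UN_least)
     fix r assume "r:{..<n + 2}"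
     thus "q' r<=V" using rho[of r] N_V[of "\<rho> r"] by auto
    qed
    show "V<=(UN r:{..<n + 2}. q' r)"
    proof
     fix x assume "x:V"
     then obtain t where t: "t < n" "x:q t" using cover by auto
     have "EX r<n+2. x:q' r"
     proof (cases "t = i")
      case True
      have v: "q' i = P1" "q' (Suc i) = P2" "q' (i + 2) = P3" "i < n + 2" "Suc i < n + 2" "i + 2 < n + 2" using i unfolding q'_def by auto
      show ?thesis using t True PU v by blast
     next case False
      have "q' (if t < i then t else t + 2) = q t" using False unfolding q'_def by auto
      moreover have "(if t < i then t else t + 2) < n + 2" using t by auto
      ultimately show ?thesis using t by metis
     qed
     thus "x:(UN r:{..<n + 2}. q' r)" by auto
    qed
   qed
  qed
  fix m assume m: "m:Mt"
  show "EX b. ALL r<n + 2. link m (q' r) (q' (Suc r mod (n + 2))) <-> (even r <-> b)"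
   using ty[OF m] by blast
 qed (use n4 n_even in auto)
 moreover have "link m (q' 0) (q' 1) <-> cr m 0" if "m:Mt" for m using ty[OF that, of 0] n4 by simp
 ultimately show ?thesis using rho by blast
qed

end

context mate_system
begin

text \<open>Among the rings that refine \<open>\<P>\<close> and separate two fixed matchings of different types, one of maximal
length exists by \<open>bounded\<close>. Its movable pieces are disjoint by \<open>lengthen\<close>.\<close>

lemma ring_exists:
 assumes rp: "ring_part V Mt n0 q0" and ref: "ALL i<n0. EX P:\<P>. q0 i<=P" and tf: "tfam \<P> (%P. P)"
 shows "EX n C F. ring7 V Mt n C F & (ALL P:\<P>. EX i<n. C i<=P)"
proof -
 interpret r0: ring_part V Mt n0 q0 by (rule rp)
 have n0: "0 < n0" using r0.n4 by simp
 obtain m0 where m0: "m0:Mt" "r0.cr m0 0" using r0.cr_ex(1)[OF n0] by blast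
 obtain m1 where m1: "m1:Mt" "~ r0.cr m1 0" using r0.cr_ex(2)[OF n0] by blast
 \<comment> \<open>distinguishing \<open>m0\<close> from \<open>m1\<close> bounds the length\<close>
 define good where "good n q <-> ring_part V Mt n q & (ALL i<n. EX P:\<P>. q i<=P) & link m0 (q 0) (q 1) & ~ link m1 (q 0) (q 1)" for n q
 have cr0: "ring_frame.cr n q (%_ _. {}) m 0 <-> link m (q 0) (q 1)" if "ring_part V Mt n q" for n q m proof -
  interpret r: ring_part V Mt n q by (rule that)
  have "0 < n" "r.s 0 = 1" using r.n4 by (auto simp: r.s_if)
  thus ?thesis using r.cr_link[of 0 m] by simp
 qed
 have g0: "good n0 q0" unfolding good_def using rp ref m0 m1 cr0[OF rp] by blast
 have bd: "n<=card {x:V. m0 x~=m1 x}" if ex: "EX q. good n q" for n proof -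
  obtain q where g: "good n q" using ex by blast
  then interpret r: ring_part V Mt n q unfolding good_def by blast
  have "r.cr m0 0~=r.cr m1 0" using g cr0[of n q] unfolding good_def by blast
  thus ?thesis by (rule r.bounded[OF m0(1) m1(1)])
 qed
 define n where "n = (GREATEST n. EX q. good n q)"
 have ex: "EX n. EX q. good n q" using g0 by blast
 have "EX q. good n q" unfolding n_def by (rule GreatestI_ex_nat[OF ex bd])
 then obtain q where q: "good n q" by blast
 have mx: "n'<=n" if "good n' q'" for n' q'
  unfolding n_def by (rule Greatest_le_nat[where b = "card {x:V. m0 x~=m1 x}"]) (use that bd in blast)+
 interpret r: ring_part V Mt n q using q unfolding good_def by blast
 have "EX C F. ring7 V Mt n C F & (ALL i<n. C i<=q i)"
 proof (rule r.core_ring7)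
  fix i j k assume a: "i < n" "j < n" "k < n" "i~=j" "i~=k" "j~=k"
  show "r.B i j Int r.B i k = {}"
  proof (cases "r.adj i j & r.adj i k")
   case False thus ?thesis using r.nonadj_B[OF a(1,2)] r.nonadj_B[OF a(1,3)] by blast
  next case True
   obtain p where p: "p < n" "r.s p = i" using r.s_surj[OF a(1)] by blast
   have "j = r.s i | j = p" using True r.adj_iff[OF a(1,2)] r.s_inj[OF a(2) p(1)] p(2) by auto
   moreover have "k = r.s i | k = p" using True r.adj_iff[OF a(1,3)] r.s_inj[OF a(3) p(1)] p(2) by auto
   ultimately have e: "r.B i j Int r.B i k = r.B i p Int r.B i (r.s i)" using a(6) by auto
   have "~ par (r.B i p Int r.B i (r.s i))"
   proof
    assume "par (r.B i p Int r.B i (r.s i))"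
    then obtain q' where q': "ring_part V Mt (n + 2) q'" "ALL r<n+2. EX t<n. q' r<=q t" "ALL m:Mt. link m (q' 0) (q' 1) <-> r.cr m 0"
     using r.lengthen[OF a(1) p] by blast
    have "good (n + 2) q'" unfolding good_def
    proof (intro conjI allI impI)
     fix t assume "t < n + 2"
     then obtain t' where "t' < n" "q' t<=q t'" using q'(2) by blast
     thus "EX P:\<P>. q' t<=P" using q unfolding good_def by blast
    qed (use q'(1,3) q cr0[of n q] m0 m1 in \<open>auto simp: good_def\<close>)
    thus False using mx by fastforce
   qed
   thus ?thesis unfolding e[symmetric] by (intro r.B_Int_empty) (use a in auto)
  qed
 qed
 then obtain C F where CF: "ring7 V Mt n C F" "ALL i<n. C i<=q i" by blast
 have "EX i<n. C i<=P" if P: "P:\<P>" for P proof -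
  have "mtight P" using tf P unfolding tfam_def by blast
  then obtain x where x: "x:P" "x:V" using mtight_ne mtight_sub by blast
  then obtain i where i: "i < n" "x:q i" using r.cover by auto
  obtain P' where P': "P':\<P>" "q i<=P'" using q i(1) unfolding good_def by blast
  have "P' = P" using tf P P' x i unfolding tfam_def by blast
  thus ?thesis using CF(2) i(1) P'(2) by blast
 qed
 thus ?thesis using CF(1) by blast
qed

end

context ring_frame
begin

lemma arc_ends:
 assumes A: "oddarc A"
 obtains p q where "p < n" "q < n" "p~:A" "s p:A" "q:A" "s q~:A" "odd (p + q)"
proof -
 obtain a b where ab: "a < b" "b < n" "odd (b - a)" "A = {a<..b} | A = {..<n} - {a<..b}" by (rule arc_interval'[OF A])
 have o: "odd (a + b)" "odd (b + a)" using ab(1,3) by auto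
 have sa: "s a = Suc a" using ab by (simp add: s_if)
 have sb: "s b~:{a<..b}" "s b < n" using ab s_lt[of b] by (auto simp: s_if)
 show ?thesis using ab(4)
 proof
  assume "A = {a<..b}"
  thus ?thesis using that[of a b] ab sa sb o by auto
 next assume "A = {..<n} - {a<..b}"
  thus ?thesis using that[of b a] ab sa sb o by auto
 qed
qed

lemma cr_odd: "m:Mt ==> p < n ==> q < n ==> odd (p + q) ==> cr m q <-> ~ cr m p"
 using cr_types[of m] by auto

lemma zloc_single:
 assumes v: "v < n" and z: "zloc {v} X" and X: "mtight X" shows "vloc v X"
proof -
 note z = zlocD[OF z]
 have vI: "v:{..<n}" using v by simp
 obtain p where p: "p < n" "s p = v" using s_surj[OF v] by blast
 have pv: "p~=v" "s v~=v" using s_ne[OF p(1)] p(2) s_ne[OF v] by auto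
 have U: "X<=N v Un e v Un e p"
 proof
  fix x assume x: "x:X"
  hence "x:V" using z(1) by blast
  thus "x:N v Un e v Un e p"
  proof (rule ring_cover)
   fix i assume "i < n" "x:N i" thus ?thesis using z(4)[of i] x by blast
  next fix i assume i: "i < n" "x:e i"
   thus ?thesis using z(5)[of i] x i s_inj[OF i(1) p(1)] p(2) by fast
  qed
 qed
 have ev: "mtight (N v Un (X Int e v))" by (rule z(7)[OF v]) (use pv in auto)
 have ep: "mtight (N v Un (X Int e p))" using z(6)[OF p(1)] p(2) pv by simp
 have dj: "N v Int e v = {}" "N v Int e p = {}" "e v Int e p = {}"
  using eN_disj[OF v v] eN_disj[OF p(1) v] e_disj[OF v p(1)] pv by blast+
 note Nt = N_tight[OF vI]
 have npar: "fcut (X Int e v) & ~ par (X Int e v)" "fcut (X Int e p) & ~ par (X Int e p)"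
  by (rule bridge_npar[OF Nt ev], use dj in blast, rule bridge_npar[OF Nt ep], use dj in blast)
 have "~ par ((X Int e v) Un (X Int e p))" using par_Un[of "X Int e v" "X Int e p"] npar dj by blast
 moreover have "X - N v = (X Int e v) Un (X Int e p)" using U dj by blast
 ultimately have "par (X Int N v)" using par_split[of X "N v"] X Nt by auto
 hence XN: "mtight (X Int N v)" by (rule mtight_Int_Un(1)[OF X Nt])
 show ?thesis unfolding vloc_def
 proof (intro conjI ballI impI XN)
  have "e v<=U v" by (rule E_sub_U) (use s_lt[OF v] in simp)
  moreover have "e p<=U v" using E_sym[of p "s p"] p v E_sub_U[of p v] p by fast
  ultimately show "X<=U v" using U N_sub_U by blast
  fix j assume j: "j:{..<n}" "j~=v"
  show "mtight (N v Un (X Int E v j))"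
  proof (cases "E v j = {}")
   case True thus ?thesis using Nt by simp
  next case False hence "j = s v & E v j = e v | v = s j & E v j = e j" using E_e[of v j] v j by auto
   thus ?thesis
   proof (elim disjE conjE)
    assume "E v j = e v" thus ?thesis using ev by simp
   next assume a: "v = s j" "E v j = e j"
    show ?thesis using s_inj[of j p] j p a(1) ep a(2) by auto
   qed
  qed
 qed
qed

end

context ring7
begin

lemma cleave_e:
 assumes tf: "tfam \<P> (%P. P)" and four: "at_least_four \<P>" and cl: "ALL P:\<P>. EX i<n. N i<=P"
  and i: "i < n" and P: "P:\<P>" "N i<=P" and R: "R:\<P>" "N (s i)<=R"
 shows "e i<=P Un R"
proof
 fix x assume x: "x:e i"
 have "x:V" using E_V[of i "s i"] x i s_lt[OF i] by auto
 then obtain P' where P': "P':\<P>" "x:P'" using tf unfolding tfam_def by blast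
 obtain A where A: "zloc A P'" "ALL i<n. i:A <-> N i<=P'" using cleave_zloc[OF tf four cl P'(1)] by blast
 have "N i<=P' | N (s i)<=P'" using zlocD(5)[OF A(1) i] x P'(2) A(2) i s_lt[OF i] by blast
 moreover have "N i~={}" "N (s i)~={}" using N_ne[of i] N_ne[of "s i"] i s_lt[OF i] by auto
 ultimately have "P' Int P~={} | P' Int R~={}" using P R by blast
 hence "P' = P | P' = R" using tf P P' R unfolding tfam_def by blast
 thus "x:P Un R" using P' by blast
qed

section \<open>Uniqueness of the cleaved torsoid\<close>

lemma ring_links:
 assumes tf: "tfam \<P> (%P. P)" and four: "at_least_four \<P>" and cl: "ALL P:\<P>. EX i<n. N i<=P" and P: "P:\<P>"
 shows "EX R1:\<P>. EX R2:\<P>. R1~=P & R2~=P & R1~=R2 & (ALL m:Mt. link m P (if cr m 0 then R1 else R2))"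
proof -
 have t: "mtight P'" if "P':\<P>" for P' using tf that unfolding tfam_def by blast
 have dj: "P' Int P'' = {}" if "P':\<P>" "P'':\<P>" "P'~=P''" for P' P'' using tf that unfolding tfam_def by blast
 obtain A where A: "zloc A P" "ALL i<n. i:A <-> N i<=P" using cleave_zloc[OF tf four cl P] by blast
 note z = zlocD[OF A(1)]
 obtain p q where pq: "p < n" "q < n" "p~:A" "s p:A" "q:A" "s q~:A" "odd (p + q)" by (rule arc_ends[OF z(2)])
 have sn: "s p < n" "s q < n" using s_lt pq by auto
 obtain R1 where R1: "R1:\<P>" "N p<=R1" using cleave_cover[OF tf four cl pq(1)] by blast
 obtain R2 where R2: "R2:\<P>" "N (s q)<=R2" using cleave_cover[OF tf four cl sn(2)] by blast
 have NP: "N (s p)<=P" "N q<=P" using A(2) pq sn by blast+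
 have RP: "R1~=P" "R2~=P" using A(2) pq sn R1 R2 by blast+
 have go: "link m P R" if m: "m:Mt" "cr m i" and i: "i < n" and T: "T = N a Un (P Int e i)" "mtight T"
  and ab: "a = i & b = s i | a = s i & b = i" and Na: "N a<=P" and R: "R:\<P>" "N b<=R" "R~=P" for m i a b T R proof -
  obtain x where x: "x:T" "m x~:T" using mtight_ex[OF T(2) m(1)] by blast
  have ee: "e i<=P Un R"
   using ab
  proof
   assume "a = i & b = s i" thus ?thesis using cleave_e[OF tf four cl i P _ R(1)] Na R(2) by blast
  next assume "a = s i & b = i" thus ?thesis using cleave_e[OF tf four cl i R(1) _ P] Na R(2) by blast
  qed
  have "x:N i Un e i Un N (s i)" using x(1) T(1) ab by blast
  hence "m x:N i Un e i Un N (s i)" by (rule cr_closed[OF m(1) i m(2)])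
  hence "m x:R" using x(2) T(1) ab ee R(2) by blast
  thus ?thesis unfolding link_def using x(1) T(1) Na by blast
 qed
 have L1: "link m P R1" if "m:Mt" "cr m p" for m
  by (rule go[OF that pq(1) refl z(6)[OF pq(1,3,4)] _ NP(1) R1 RP(1)]) blast
 have L2: "link m P R2" if "m:Mt" "~ cr m p" for m proof -
  have c: "cr m q" using cr_odd[OF that(1) pq(1,2,7)] that(2) by blast
  show ?thesis by (rule go[OF that(1) c pq(2) refl z(7)[OF pq(2,5,6)] _ NP(2) R2 RP(2)]) blast
 qed
 have R12: "R1~=R2"
 proof
  assume e: "R1 = R2"
  have "P Un R1 = V" by (rule one_partner[OF t t dj]) (use P R1 RP L1 L2 e in auto)
  moreover obtain P' where "P':\<P>" "P'~=P" "P'~=R1" using four_others[OF four P] by metis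
  ultimately obtain P' where P': "P':\<P>" "P'~=P" "P'~=R1" "P Un R1 = V" by blast
  have "P' Int (P Un R1) = {}" using dj[OF P'(1) P P'(2)] dj[OF P'(1) R1(1) P'(3)] by blast
  thus False using P'(4) mtight_ne[OF t[OF P'(1)]] mtight_sub[OF t[OF P'(1)]] by blast
 qed
 have c0: "cr m p <-> (even p <-> cr m 0)" if "m:Mt" for m
  using cr_types[OF that] pq(1) by (metis even_zero gr_zeroI less_nat_zero_code)
 show ?thesis
 proof (cases "even p")
  case True hence "ALL m:Mt. link m P (if cr m 0 then R1 else R2)" using L1 L2 c0 by auto
  thus ?thesis using R1(1) R2(1) RP R12 by blast
 next case False thus ?thesis using L1 L2 c0 R1(1) R2(1) RP R12 by force 
 qed
qed

end

context frame
begin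

text \<open>A part of \<open>E i k\<close> that may be added to \<open>N i\<close> behaves like \<open>E i k\<close> itself.\<close>

lemma sub_closed:
 assumes i: "i:I" "k:I" "i~=k" and D: "D<=E i k" "mtight (N i Un D)" and m: "m:Mt" "~ lk m i k" and x: "x:D"
 shows "m x:D"
proof (rule ccontr)
 assume mx: "m x~:D"
 have mE: "m x:E i k" by (rule nlk_closed[OF i(1,2) m]) (use x D in blast)
 have dj: "N i Int E i k = {}" by (rule NE_disj[OF i(1,2,1)])
 obtain r where r: "r:I" "lk m i r" using lk_ex[OF i(1) m(1)] by blast
 have rk: "r~=k" "i~=r" using r m unfolding lk_def by blast+
 obtain c where c: "c:N i" "m c~:N i" using mtight_ex[OF N_tight[OF i(1)] m(1)] by blast
 have "m c:N r Un E i r" by (rule lk_leaver[OF i(1) r(1) m(1) r(2) c])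
 hence "m c~:N i Un D" using c(2) D NE_disj[OF i(1,2) r(1)] E_Int_E[OF i(1) r(1) i(2) rk(1)] by blast
 hence "x = c" using mtight_un[OF D(2) m(1), of x c] mx mE dj c(1) x by blast
 thus False using c x D dj by blast
qed

lemma sub_npar:
 assumes i: "i:I" "k:I" and D: "D<=E i k" "mtight (N i Un D)" shows "fcut D & ~ par D"
 by (rule bridge_npar[OF N_tight[OF i(1)] D(2)]) (use NE_disj[OF i(1,2,1)] D in blast)

text \<open>Extends the part \<open>S\<close> of a set \<open>X\<close> around \<open>i\<close> by the rest of \<open>E i j\<close> (\<open>K\<close> empty) and by \<open>N j\<close> as well (\<open>K = N j\<close>). Both cases
have the same structure: leaving points are matched into \<open>N j\<close> and into \<open>X - S\<close>, respectively.\<close>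

lemma end_ext:
 assumes i: "i:I" "j:I" "i~=j" and X: "mtight X" "N i<=X" "X<=U i"
  and Xt: "!!k. k:I ==> k~=i ==> mtight (N i Un (X Int E i k))"
  and S: "S<=X" and K: "K = {} & mtight S | K = N j & mtight (X - S)"
  and out: "!!m. m:Mt ==> lk m i j ==> EX z:S. m z~:X"
  and cl: "!!m x. m:Mt ==> ~ lk m i j ==> K~={} ==> x:S ==> m x:S"
 shows "mtight (K Un (E i j - X) Un S)"
proof -
 define D where "D = E i j - X"
 have D_eq: "E i j - (X Int E i j) = D" unfolding D_def by blast
 have G: "mtight (N j Un D)" using flip[OF i _ Xt[OF i(2)], of ] i(3) D_eq by auto
 have GE: "D<=E j i" using E_sym[OF i(1,2)] unfolding D_def by blast
 have Nj: "mtight (N j)" by (rule N_tight[OF i(2)])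
 have one: "mtight S" if "K = {}" using K that mtight_ne[OF Nj] by auto
 have V: "N j<=V" "N i<=V" "D<=V" "X<=V" "E i j<=V"
  using N_V i E_V[OF i(1,2)] mtight_sub[OF X(1)] unfolding D_def by blast+
 have NjX: "N j Int X = {}" using N_Int_U[OF i] X(3) by blast
 have DX: "D Int X = {}" unfolding D_def by blast
 have Dnp: "fcut D & ~ par D" by (rule sub_npar[OF i(2,1) GE G])
 have Dcl: "m x:D" if "m:Mt" "~ lk m i j" "x:D" for m x
  by (rule sub_closed[OF i(2,1) i(3)[symmetric] GE G that(1) _ that(3)]) (use lk_sym[OF i(2,1) that(1)] that(2) in blast)
 have mm: "m (m x) = x" if "m:Mt" "x:V" for m x using mate_mate that by blast
 have step: "m x:N i Un E i j Un N j Un X" if m: "m:Mt" "lk m i j" and x: "x:X Un D Un N j" for m x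
 proof (cases "x:N i Un E i j Un N j")
  case True thus ?thesis using lk_closed[OF i(1,2) m True] by blast
 next case False hence xX: "x:X" using x unfolding D_def by blast
  then obtain k where k: "k:I" "x:E i k" using X(3) False unfolding U_def by blast
  have kj: "k~=j" using k False by blast
  have ki: "k~=i" using k E_refl by auto
  have "~ lk m i k" using lk_un[OF i(1,2) k(1) m] kj by blast
  hence "m x:X Int E i k" by (intro sub_closed[OF i(1) k(1) ki[symmetric] _ Xt[OF k(1) ki] m(1)]) (use xX k in auto)
  thus ?thesis by blast
 qed
 have zG: "m z:N j Un D" if m: "m:Mt" "lk m i j" and z: "z:S" "m z~:X" for m z
  using step[OF m, of z] z S X(2) unfolding D_def by blast
 let ?Y = "K Un D Un S"
 have YV: "?Y<=V" using K V S by blast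
 have main: "m x:(if K = {} then N j else X - S)" if m: "m:Mt" "lk m i j" and x: "x:?Y" "m x~:?Y" for m x proof -
  obtain z where z: "z:S" "m z~:X" using out[OF m] by blast
  have xx: "x:X Un D Un N j" using x(1) S K by blast
  note st = step[OF m xx]
  have un: "w = z" if "w:X" "m w~:X" for w using mtight_un[OF X(1) m(1) that _ z(2)] z(1) S by blast
  have xV: "x:V" using YV x(1) by blast
  have mxN: "m x:N j | m x:X" using st x(2) X(2) unfolding D_def by blast
  show ?thesis
  proof (cases "K = {}")
   case True
   have "m x~:X"
   proof
    assume mX: "m x:X"
    show False
    proof (cases "x:S")
     case True
     have "x = z" using z S mtight_un[OF one[OF `K = {}`] m(1) True _ z(1)] x(2) by blast
     thus False using mX z by blast
    next case False hence "m (m x)~:X" using x(1) `K = {}` mm[OF m(1) xV] DX by auto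
     hence "m x = z" using un[OF mX] by blast
     thus False using x(2) z(1) by blast
    qed
   qed
   thus ?thesis using mxN True by auto
  next case False hence KN: "K = N j" using K by blast
   have "m x:X" using mxN x(2) KN by blast
   moreover have "m x~:S" using x(2) by blast
   ultimately show ?thesis using False by auto
  qed
 qed
 show ?thesis unfolding D_def[symmetric]
 proof (cases "K = {}")
  case True
  have St: "mtight S" by (rule one[OF True])
  have dj: "D Int S = {}" using DX S by blast
  have "par (D Un S)" using par_Un[of D S] Dnp St dj by auto
  show "mtight ?Y"
  proof (rule mtightI_par[OF YV])
   show "par ?Y" using `par (D Un S)` True by simp
   fix m x y assume m: "m:Mt" and x: "x:?Y" "m x~:?Y" and y: "y:?Y" "m y~:?Y"
   show "x = y"
   proof (cases "lk m i j")
    case l: True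
    have "x:V - N j" "y:V - N j" using x(1) y(1) YV S NjX True NE_disj[OF i(1,2,2)] unfolding D_def by blast+
    thus ?thesis using mtight_un_in[OF Nj m _ _ _] main[OF m l x] main[OF m l y] True by auto
   next case False
    have "x:S" "y:S" using x y Dcl[OF m False] True by blast+
    thus ?thesis using mtight_un[OF St m] x y by blast
   qed
  qed
 next case False hence KN: "K = N j" and R: "mtight (X - S)" using K by blast+
  show "mtight ?Y"
  proof (rule mtightI[OF YV])
   show "?Y~={}" using False by blast
   show "?Y~=V" using mtight_ne[OF R] V NjX DX KN by blast
   fix m x y assume m: "m:Mt" and x: "x:?Y" "m x~:?Y" and y: "y:?Y" "m y~:?Y"
   show "x = y"
   proof (cases "lk m i j")
    case l: True
    have "x:V - (X - S)" "y:V - (X - S)" using x(1) y(1) YV DX NjX KN by blast+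
    thus ?thesis using mtight_un_in[OF R m] main[OF m l x] main[OF m l y] False by auto
   next case nl: False
    have "x:N j Un D" "y:N j Un D" using x y cl[OF m nl False] KN by blast+
    thus ?thesis using mtight_un[OF G m] x y KN by blast
   qed
  qed
 qed
qed

end

context ring7
begin

text \<open>(T7) for a set \<open>X\<close> around \<open>i\<close> in the place of \<open>E i j \<union> N i \<union> E i k\<close>. The two outer sets are
extended by what is missing.\<close>

lemma T7_loc:
 assumes i: "i < n" "j < n" "k < n" "adj i j" "adj i k" "j~=k"
  and X: "mtight X" "N i<=X" "X<=U i"
  and Xt: "!!k. k < n ==> k~=i ==> mtight (N i Un (X Int E i k))"
  and P: "mtight P1" "mtight P2" "mtight P3" "P1 Int P2 = {}" "P1 Int P3 = {}" "P2 Int P3 = {}" "P1 Un P2 Un P3 = X"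
  and out1: "!!m. m:Mt ==> lk m i j ==> EX z:P1. m z~:X"
  and out3: "!!m. m:Mt ==> lk m i k ==> EX z:P3. m z~:X"
 shows False
proof -
 have I: "i:{..<n}" "j:{..<n}" "k:{..<n}" using i by auto
 have ne: "i~=j" "i~=k" using i(4,5) unfolding adj_def lk_def by blast+
 have Xt': "mtight (N i Un (X Int E i r))" if "r:{..<n}" "r~=i" for r using Xt that by simp
 have XV: "X<=V" by (rule mtight_sub[OF X(1)])
 have one: "lk m i j | lk m i k" if "m:Mt" for m by (rule ring_two[OF that i])
 have U: "U i = E i j Un N i Un E i k" proof -
  have "E i l<=E i j Un E i k" if l: "l < n" for l
  proof (cases "adj i l")
   case True
   have "j = s i | i = s j" "k = s i | i = s k" "l = s i | i = s l" using True i adj_iff l by auto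
   thus ?thesis using i(6) s_inj i(1,2,3) l by blast
  next case False thus ?thesis using nadj_E[of i l] i(1) l by simp
  qed
  thus ?thesis unfolding U_def using I by blast
 qed
 have clos: "m x:S" if m: "m:Mt" and Q: "mtight Q" "S Un Q = X" "S Int Q = {}" and z: "EX z:Q. m z~:X" and x: "x:S" for m S Q x
 proof (rule ccontr)
  assume mx: "m x~:S"
  obtain z where z: "z:Q" "m z~:X" using z by blast
  have mm: "m (m x) = x" using mate_mate[OF m] x Q XV by blast
  show False
  proof (cases "m x:X")
   case True hence mQ: "m x:Q" "m (m x)~:Q" using mx mm x Q by auto
   have "m x = z" using mtight_un[OF Q(1) m mQ z(1)] z(2) Q(2) by blast
   thus False using mm z x Q by auto
  next case False
   have "x = z" using mtight_un[OF X(1) m _ False _ z(2)] x z Q by blast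
   thus False using x z Q by blast
  qed
 qed
 have r1: "X - (P1 Un P2) = P3" "X - (P2 Un P3) = P1" "(P1 Un P2) Un P3 = X" "(P2 Un P3) Un P1 = X"
  "(P1 Un P2) Int P3 = {}" "(P2 Un P3) Int P1 = {}" using P(4-7) by blast+
 have t1: "mtight ({} Un (E i j - X) Un P1)"
  by (rule end_ext[OF I(1,2) ne(1) X Xt']) (use P out1 in blast)+
 have t3: "mtight ({} Un (E i k - X) Un P3)"
  by (rule end_ext[OF I(1,3) ne(2) X Xt']) (use P out3 in blast)+
 have t12: "mtight (N j Un (E i j - X) Un (P1 Un P2))"
 proof (rule end_ext[OF I(1,2) ne(1) X Xt'])
  show "N j = {} & mtight (P1 Un P2) | N j = N j & mtight (X - (P1 Un P2))" unfolding r1(1) using P(3) by blast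
  fix m assume m: "m:Mt"
  show "EX z:P1 Un P2. m z~:X" if "lk m i j" using out1[OF m that] by blast
  fix x assume nl: "~ lk m i j" and x: "x:P1 Un P2"
  have "lk m i k" using one[OF m] nl by blast
  thus "m x:P1 Un P2" by (intro clos[OF m P(3) r1(3,5) out3[OF m] x])
 qed (use P in blast)+
 have t23: "mtight (N k Un (E i k - X) Un (P2 Un P3))"
 proof (rule end_ext[OF I(1,3) ne(2) X Xt'])
  show "N k = {} & mtight (P2 Un P3) | N k = N k & mtight (X - (P2 Un P3))" unfolding r1(2) using P(1) by blast
  fix m assume m: "m:Mt"
  show "EX z:P2 Un P3. m z~:X" if "lk m i k" using out3[OF m that] by blast
  fix x assume nl: "~ lk m i k" and x: "x:P2 Un P3"
  have "lk m i j" using one[OF m] nl by blast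
  thus "m x:P2 Un P3" by (intro clos[OF m P(1) r1(4,6) out1[OF m] x])
 qed (use P in blast)+
 have Ed: "E i j Int E i k = {}" by (rule E_Int_E[OF I i(6)])
 let ?P1 = "P1 Un (E i j - X)" and ?P3 = "P3 Un (E i k - X)"
 show False
 proof (rule T7[OF i(1-5) i(6), of ?P1 P2 ?P3])
  have "?P1 = {} Un (E i j - X) Un P1" "?P3 = {} Un (E i k - X) Un P3" by blast+
  thus "mtight ?P1" "mtight ?P3" using t1 t3 by simp_all
  show "?P1 Int P2 = {}" "P2 Int ?P3 = {}" "?P1 Int ?P3 = {}" using P(4-7) Ed by blast+
  show "?P1 Un P2 Un ?P3 = E i j Un N i Un E i k" using P(7) X(2,3) U by blast
  have "N j Un ?P1 Un P2 = N j Un (E i j - X) Un (P1 Un P2)" "P2 Un ?P3 Un N k = N k Un (E i k - X) Un (P2 Un P3)" by blast+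
  thus "mtight (N j Un ?P1 Un P2)" "mtight (P2 Un ?P3 Un N k)" using t12 t23 by simp_all
 qed (rule P(2))
qed

end

context frame
begin

lemma located_NE:
 assumes "i:I" "j:I" "j~=i" "k:I" "k~=i"
 shows "mtight (N i Un ((N i Un E i j) Int E i k))" "mtight (N i Un (N i Int E i k))"
proof -
 have a: "N i Int E i k = {}" by (rule NE_disj[OF assms(1,4,1)])
 have "(N i Un E i j) Int E i k = (if k = j then E i j else {})"
  using E_Int_E[OF assms(1,2,4)] a by auto
 thus "mtight (N i Un ((N i Un E i j) Int E i k))" "mtight (N i Un (N i Int E i k))"
  using NE_tight[of i j] N_tight[of i] assms a by auto
qed

lemma two_left:
 assumes tf: "tfam \<P> (%P. P)" and four: "at_least_four \<P>" and cl: "ALL P:\<P>. EX i:I. N i<=P"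
  and P: "P:\<P>" "R:\<P>" and X: "X<=P Un R"
 shows "EX a:I. EX b:I. a~=b & N a<=V - X & N b<=V - X"
proof -
 obtain a b c where abc: "a:\<P>" "b:\<P>" "c:\<P>" "a~=P" "b~=P" "c~=P" "a~=b" "a~=c" "b~=c"
  by (rule four_others[OF four P(1)])
 obtain P1 P2 where PP: "P1:\<P>" "P2:\<P>" "P1~=P" "P2~=P" "P1~=R" "P2~=R" "P1~=P2"
  using abc by metis
 have dj: "P' Int P'' = {}" if "P':\<P>" "P'':\<P>" "P'~=P''" for P' P'' using tf that unfolding tfam_def by blast
 have PV: "P'<=V" if "P':\<P>" for P' using tf that mtight_sub unfolding tfam_def by blast
 obtain i where i: "i:I" "N i<=P1" using cl PP by blast
 obtain j where j: "j:I" "N j<=P2" using cl PP by blast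
 have "i~=j" using i j dj[OF PP(1,2,7)] N_ne[OF i(1)] by blast
 moreover have "N i<=V - X" using i X dj[OF PP(1) P(1) PP(3)] dj[OF PP(1) P(2) PP(5)] PV[OF PP(1)] by blast
 moreover have "N j<=V - X" using j X dj[OF PP(2) P(1) PP(4)] dj[OF PP(2) P(2) PP(6)] PV[OF PP(2)] by blast
 ultimately show ?thesis using i(1) j(1) by blast
qed

lemma N_not_in_E: "v:I ==> N v<=Y ==> ~ eloc Y"
 unfolding eloc_def using NE_disj N_ne by (metis Int_absorb2 subset_trans)

end

text \<open>Two frames whose vertices and half-extended vertices are located in each other.\<close>

locale frame_pair = a: frame V Mt I N E + b: frame V Mt J N' E'
 for V :: "'a set" and Mt and I :: "'i set" and N E and J :: "'j set" and N' E' +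
 assumes a3: "i:I ==> j:I ==> EX k:I. k~=i & k~=j"
  and b3: "i':J ==> j':J ==> EX k:J. k~=i' & k~=j'"
  and aN: "i:I ==> b.eloc (N i) | (EX v:J. b.vloc v (N i))"
  and aNE: "i:I ==> j:I ==> i~=j ==> b.eloc (N i Un E i j) | (EX v:J. b.vloc v (N i Un E i j))"
  and bN: "i':J ==> a.eloc (N' i') | (EX v:I. a.vloc v (N' i'))"
  and bNE: "i':J ==> j':J ==> i'~=j' ==> a.eloc (N' i' Un E' i' j') | (EX v:I. a.vloc v (N' i' Un E' i' j'))"
begin

lemma flipped: "frame_pair V Mt J N' E' I N E"
 by unfold_locales (use a3 b3 aN aNE bN bNE in blast)+

text \<open>Suppose that \<open>N' v\<close> lies in \<open>E i j\<close>. Then \<open>N i \<union> E i j\<close> and \<open>N j \<union> E i j\<close> lie around \<open>v\<close>, so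
\<open>N i\<close> and \<open>N j\<close> lie in sets \<open>E' v k\<close> and \<open>E' v k'\<close>. Parity gives \<open>k = k'\<close>; and a matching that does
not join \<open>v\<close> to \<open>k\<close> would preserve \<open>N i\<close>.\<close>

lemma not_in_edge:
 assumes v: "v:J" shows "~ a.eloc (N' v)"
proof
 assume "a.eloc (N' v)"
 then obtain i j where ij: "i:I" "j:I" "i~=j" "N' v<=E i j" unfolding a.eloc_def by blast
 have big: "b.vloc v (N i Un E i j)" if ij: "i:I" "j:I" "i~=j" "N' v<=E i j" for i j proof -
  have "~ b.eloc (N i Un E i j)" by (rule b.N_not_in_E[OF v]) (use ij in blast)
  then obtain w where w: "w:J" "b.vloc w (N i Un E i j)" using aNE[OF ij(1-3)] by blast
  hence "N' v<=b.U w" using ij(4) unfolding b.vloc_def by blast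
  hence "w = v" using b.N_Int_U[OF w(1) v] b.N_ne[OF v] by blast
  thus ?thesis using w by blast
 qed
 have sm: "EX k:J. k~=v & N i<=E' v k" if ij: "i:I" "j:I" "i~=j" "N' v<=E i j" for i j proof -
  have NU: "N i<=b.U v" using big[OF ij] unfolding b.vloc_def by blast
  have NN: "N i Int N' v = {}" using a.NE_disj[OF ij(1,2,1)] ij(4) by blast
  have "b.eloc (N i)"
  proof (rule ccontr)
   assume "~ b.eloc (N i)"
   then obtain w where w: "w:J" "b.vloc w (N i)" using aN[OF ij(1)] by blast
   hence m: "a.mtight (N i Int N' w)" unfolding b.vloc_def by blast
   hence "N i Int N' w~={}" by (rule a.mtight_ne)
   hence "w = v" using NU b.N_Int_U[OF v w(1)] by blast
   thus False using NN `N i Int N' w~={}` by blast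
  qed
  then obtain a c where ac: "a:J" "c:J" "a~=c" "N i<=E' a c" unfolding b.eloc_def by blast
  have "E' a c Int b.U v~={}" using ac(4) NU a.N_ne[OF ij(1)] by blast
  hence "v = a | v = c" using b.E_Int_U[OF v ac(1,2)] by blast
  thus ?thesis
  proof
   assume va: "v = a"
   show ?thesis unfolding va by (rule bexI[OF _ ac(2)]) (use ac(3,4) in simp)
  next assume va: "v = c"
   have "N i<=E' c a" by (subst b.E_sym[OF ac(2,1)]) (rule ac(4))
   thus ?thesis unfolding va by (intro bexI[OF _ ac(1)] conjI ac(3))
  qed
 qed
 have Eji: "E j i = E i j" by (rule a.E_sym[OF ij(2,1)])
 have ji: "j:I" "i:I" "j~=i" "N' v<=E j i"
  unfolding Eji by (rule ij(2), rule ij(1), rule ij(3)[symmetric], rule ij(4))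
 obtain k where k: "k:J" "k~=v" "N i<=E' v k" using sm[OF ij] by blast
 obtain k' where k': "k':J" "k'~=v" "N j<=E' v k'" using sm[OF ji] by blast
 let ?D = "%r. (N i Un E i j) Int E' v r" and ?D2 = "%r. (N j Un E i j) Int E' v r"
 have Dt: "a.mtight (N' v Un ?D r)" and Dt2: "a.mtight (N' v Un ?D2 r)" if "r:J" "r~=v" for r
  using big[OF ij] big[OF ji] that unfolding b.vloc_def Eji by blast+
 have np: "a.fcut (?D r) & ~ a.par (?D r)" "a.fcut (?D2 r) & ~ a.par (?D2 r)" if "r:J" "r~=v" for r
  using b.sub_npar[OF v that(1) _ Dt[OF that]] b.sub_npar[OF v that(1) _ Dt2[OF that]] by blast+
 have NE: "N i Int E i j = {}" "N j Int E i j = {}" "N i Int N j = {}"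
  using a.NE_disj[OF ij(1,2)] ij(1,2) a.N_disj[OF ij(1-3)] by blast+
 have kk: "k = k'"
 proof (rule ccontr)
  assume "k~=k'"
  hence d: "E' v k Int E' v k' = {}" by (rule b.E_Int_E[OF v k(1) k'(1)])
  have e: "?D2 k = E i j Int E' v k" using k'(3) d by blast
  have D: "?D k = N i Un (E i j Int E' v k)" using k(3) by blast
  have "a.par (N i Un (E i j Int E' v k)) <-> (a.par (N i)~=a.par (E i j Int E' v k))"
   by (rule a.par_Un) (use a.N_tight[OF ij(1)] np(2)[OF k(1,2)] e NE in auto)
  thus False using np(1)[OF k(1,2)] np(2)[OF k(1,2)] a.N_tight[OF ij(1)] unfolding D e by auto
 qed
 obtain r where r: "r:J" "r~=v" "r~=k" using b3[OF v k(1)] by blast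
 obtain m where m: "m:Mt" "~ b.lk m v k" using b.not_only_nbr[OF v k(1) r(1)] k(2) r by blast
 have c1: "m x:?D k" if "x:?D k" for x by (rule b.sub_closed[OF v k(1) k(2)[symmetric] _ Dt[OF k(1,2)] m that]) blast
 have c2: "m x:?D2 k" if "x:?D2 k" for x by (rule b.sub_closed[OF v k(1) k(2)[symmetric] _ Dt2[OF k(1,2)] m that]) blast
 obtain x where x: "x:N i" "m x~:N i" using a.mtight_ex[OF a.N_tight[OF ij(1)] m(1)] by blast
 have "x:?D k" using x k by blast
 hence "m x:E i j Int E' v k" using c1[of x] x by blast
 hence "m x:?D2 k" by blast
 hence "m (m x):?D2 k" by (rule c2)
 hence "x:?D2 k" using a.mate_mate[OF m(1), of x] x a.N_V[OF ij(1)] by auto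
 thus False using x NE by blast
qed

lemma match_ex:
 assumes v: "v:J" shows "EX i:I. N' v Int N i~={} & b.U v<=a.U i"
proof -
 obtain i where i: "i:I" "a.vloc i (N' v)" using not_in_edge[OF v] bN[OF v] by blast
 have ne: "N' v Int N i~={}" using i a.mtight_ne unfolding a.vloc_def by blast
 have "E' v j<=a.U i" if j: "j:J" for j
 proof (cases "j = v")
  case True thus ?thesis using b.E_refl by simp
 next case False
  have "~ a.eloc (N' v Un E' v j)"
  proof
   assume "a.eloc (N' v Un E' v j)"
   hence "a.eloc (N' v)" unfolding a.eloc_def by blast
   thus False using not_in_edge[OF v] by blast
  qed
  then obtain w where w: "w:I" "a.vloc w (N' v Un E' v j)" using bNE[OF v j] False by blast
  hence U: "N' v Un E' v j<=a.U w" unfolding a.vloc_def by blast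
  hence "w = i" using a.N_Int_U[OF w(1) i(1)] ne by blast
  thus ?thesis using U by blast
 qed
 moreover have "N' v<=a.U i" using i unfolding a.vloc_def by blast
 ultimately show ?thesis using i(1) ne unfolding b.U_def by blast
qed

text \<open>\<open>N' v\<close> lies around a unique \<open>f v\<close>, and conversely. So the sets \<open>U\<close> of corresponding vertices agree, and the sets
\<open>U\<close> determine \<open>E\<close> and \<open>N\<close>.\<close>

lemma pair_match:
 "EX f. bij_betw f J I & (ALL v:J. N' v = N (f v)) & (ALL v:J. ALL w:J. E' v w = E (f v) (f w))"
proof -
 interpret fl: frame_pair V Mt J N' E' I N E by (rule flipped)
 obtain f where f: "!!v. v:J ==> f v:I & N' v Int N (f v)~={} & b.U v<=a.U (f v)" using match_ex by metis
 obtain g where g: "!!i. i:I ==> g i:J & N i Int N' (g i)~={} & a.U i<=b.U (g i)" using fl.match_ex by metis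
 have gf: "g (f v) = v" if v: "v:J" for v
 proof (rule ccontr)
  assume ne: "g (f v)~=v"
  have "N (f v)<=b.U (g (f v))" using g[of "f v"] f[OF v] a.N_sub_U[of "f v"] by blast
  thus False using b.N_Int_U[of "g (f v)" v] g[of "f v"] f[OF v] v ne by blast
 qed
 have fg: "f (g i) = i" if i: "i:I" for i
 proof (rule ccontr)
  assume ne: "f (g i)~=i"
  have "N' (g i)<=a.U (f (g i))" using f[of "g i"] g[OF i] b.N_sub_U[of "g i"] by blast
  thus False using a.N_Int_U[of "f (g i)" i] f[of "g i"] g[OF i] i ne by blast
 qed
 have bij: "bij_betw f J I" by (rule bij_betw_byWitness[where f' = g]) (use f g gf fg in auto)
 have U: "b.U v = a.U (f v)" if v: "v:J" for v using f[OF v] g[of "f v"] gf[OF v] by auto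
 have E: "E' v w = E (f v) (f w)" if "v:J" "w:J" for v w
 proof (cases "v = w")
  case True thus ?thesis using a.E_refl b.E_refl by simp
 next case False hence "f v~=f w" using gf that by metis
  hence "a.U (f v) Int a.U (f w) = E (f v) (f w)" using a.U_Int_U f that by blast
  moreover have "b.U v Int b.U w = E' v w" by (rule b.U_Int_U[OF that False])
  ultimately show ?thesis using U that by simp
 qed
 have "N' v = N (f v)" if v: "v:J" for v proof -
  have b: "N' v = b.U v - (UN w:J. E' v w)" unfolding b.U_def using b.NE_disj[OF v _ v] by blast
  have a: "N (f v) = a.U (f v) - (UN i:I. E (f v) i)" unfolding a.U_def using a.NE_disj[of "f v" _ "f v"] f[OF v] by blast
  have "(UN i:I. E (f v) i) = (UN i:f ` J. E (f v) i)" using bij unfolding bij_betw_def by simp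
  also have "\<dots> = (UN w:J. E' v w)" using E[OF v] by auto
  finally show ?thesis using a b U[OF v] by simp
 qed
 thus ?thesis using bij E by blast
qed

end

locale ring_pair = a: ring7 V Mt n N E + b: ring7 V Mt n' N' E'
 for V :: "'a set" and Mt and n n' :: nat and N E N' E' +
 fixes \<P> :: "'a set set"
 assumes tf: "a.tfam \<P> (%P. P)" and four: "at_least_four \<P>"
  and cla: "ALL P:\<P>. EX i<n. N i<=P" and clb: "ALL P:\<P>. EX i<n'. N' i<=P"
begin

text \<open>The type of a matching can be read off from the partner of one fixed class of \<open>\<P>\<close>.\<close>

lemma type_agree: "(ALL m:Mt. a.cr m 0 <-> b.cr m 0) | (ALL m:Mt. a.cr m 0 <-> ~ b.cr m 0)"
proof -
 obtain P where P: "P:\<P>" using four unfolding at_least_four_def by (metis all_not_in_conv card.empty finite.emptyI not_numeral_le_zero)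
 obtain R1 R2 where R: "R1:\<P>" "R2:\<P>" "R1~=P" "R2~=P" "R1~=R2" "ALL m:Mt. a.link m P (if a.cr m 0 then R1 else R2)"
  using a.ring_links[OF tf four cla P] by blast
 obtain S1 S2 where S: "S1:\<P>" "S2:\<P>" "S1~=P" "S2~=P" "S1~=S2" "ALL m:Mt. a.link m P (if b.cr m 0 then S1 else S2)"
  using b.ring_links[OF tf four clb P] by blast
 have dj: "P' Int P'' = {}" if "P':\<P>" "P'':\<P>" "P'~=P''" for P' P'' using tf that unfolding a.tfam_def by blast
 have Pt: "a.mtight P" using tf P unfolding a.tfam_def by blast
 have eq: "(if a.cr m 0 then R1 else R2) = (if b.cr m 0 then S1 else S2)" if m: "m:Mt" for m
 proof (rule ccontr)
  let ?R = "if a.cr m 0 then R1 else R2" and ?S = "if b.cr m 0 then S1 else S2"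
  assume ne: "?R~=?S"
  have RS: "?R:\<P>" "?S:\<P>" "?R~=P" "?S~=P" using R S by auto
  have "?R Int ?S~={}"
   by (rule a.link_un[OF Pt m]) (use R(6) S(6) m dj[OF P RS(1)] dj[OF P RS(2)] RS(3,4) in auto)
  thus False using dj[OF RS(1,2) ne] by blast
 qed
 show ?thesis
 proof (cases "R1 = S1")
  case True
  have "a.cr m 0 <-> b.cr m 0" if "m:Mt" for m using eq[OF that] R(5) S(5) True by (auto split: if_splits)
  thus ?thesis by blast
 next case False
  have "a.cr m 0 <-> ~ b.cr m 0" if "m:Mt" for m proof -
   obtain m1 where m1: "m1:Mt" "a.cr m1 0" using a.cr_ex(1)[of 0] a.n4 by auto
   show ?thesis using eq[OF m1(1)] m1(2) False eq[OF that] R(5) S(5) False by argo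
  qed
  thus ?thesis by blast
 qed
qed

lemma type_agree_at:
 assumes p: "p < n" and i: "i < n'"
 shows "(ALL m:Mt. a.cr m p <-> b.cr m i) | (ALL m:Mt. a.cr m p <-> ~ b.cr m i)"
proof -
 have a: "a.cr m p <-> (even p <-> a.cr m 0)" if "m:Mt" for m
  using a.cr_types[OF that] p by (metis even_zero gr_zeroI less_nat_zero_code)
 have b: "b.cr m i <-> (even i <-> b.cr m 0)" if "m:Mt" for m
  using b.cr_types[OF that] i by (metis even_zero gr_zeroI less_nat_zero_code)
 show ?thesis using type_agree a b by (cases "even p"; cases "even i") auto
qed

text \<open>If a set around a vertex of the second cycle lay around an arc of at least three vertices of the first,
these vertices would split it into three tight sets. By \<open>type_agree\<close> the outer ones are matched to the two sides, against (T7).\<close>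

lemma long_False:
 assumes i: "i < n'" and X: "a.mtight X" "N' i<=X" "X<=b.U i"
  and Xt: "!!k. k < n' ==> k~=i ==> a.mtight (N' i Un (X Int E' i k))"
  and A: "a.zloc A X" and p: "p < n" "p~:A" "a.s p:A" "a.s (a.s p):A"
 shows False
proof -
 note z = a.zlocD[OF A]
 define c where "c = a.s p"
 define d where "d = a.s c"
 have cn: "c < n" "d < n" unfolding c_def d_def using a.s_lt p(1) by auto
 have cd: "c:A" "d:A" "c~=d" "p~=c" "p~=d"
  using p a.s_ne[OF cn(1)] unfolding c_def d_def by auto
 have I: "p:{..<n}" "c:{..<n}" "d:{..<n}" using p cn by auto
 have NX: "N c<=X" "N d<=X" "a.e c<=X" using z(8)[OF cd(1,2,3)] z(8)[OF cd(2,1) cd(3)[symmetric]] z(9)[OF cd(1)] cd(2) unfolding d_def by auto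
 have NpX: "X Int N p = {}" by (rule z(4)[OF p(1,2)])
 have ept: "a.mtight (N c Un (X Int a.e p))" using z(6)[OF p(1,2)] cd(1) unfolding c_def by simp
 have ect: "a.mtight (N c Un a.e c)" by (rule a.NE_tight[OF I(2)]) (use cn cd d_def in auto)
 have ee: "a.e p Int a.e c = {}" by (rule a.e_disj[OF p(1) cn(1) cd(4)])
 have eN: "a.e p Int N c = {}" "a.e c Int N c = {}" "a.e p Int N d = {}" "a.e c Int N d = {}" using a.eN_disj p(1) cn by blast+
 have Ncd: "N c Int N d = {}" by (rule a.N_disj[OF I(2,3) cd(3)])
 have Epc: "a.e p = E c p" using a.E_sym[OF I(1,2)] unfolding c_def by simp
 \<comment> \<open>cut after \<open>E c d\<close> and after \<open>N d\<close>, where \<open>c\<close>, \<open>d\<close> are the first two vertices of the arc\<close>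
 define P1 P2 P3 where P: "P1 = (X Int a.e p) Un N c Un a.e c" "P2 = N d" "P3 = X - (P1 Un P2)"
 have U: "P1 = (N c Un (X Int a.e p)) Un (N c Un a.e c)" "(N c Un (X Int a.e p)) Int (N c Un a.e c) = N c"
  unfolding P using ee eN by blast+
 have t1: "a.mtight P1" unfolding U(1) by (rule a.mtight_Un_sub[OF ept ect U(2) a.N_tight[OF I(2)]])
 have t2: "a.mtight P2" unfolding P by (rule a.N_tight[OF I(3)])
 have d12: "P1 Int P2 = {}" unfolding P using eN Ncd by blast
 have s12: "P1 Un P2<=X" unfolding P using NX by blast
 have XV: "X<=V" by (rule z(1))
 have np12: "~ a.par (P1 Un P2)" "a.fcut (P1 Un P2)" using a.par_Un[OF _ _ d12] t1 t2 by auto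
 have p3: "a.par P3" unfolding P(3) using a.par_Diff[OF _ np12(2) s12] X(1) np12(1) by auto
 have crs: "a.cr m c <-> ~ a.cr m p" "a.cr m d <-> a.cr m p" if "m:Mt" for m
  using a.cr_s[OF that p(1)] a.cr_s[OF that cn(1)] unfolding c_def d_def by auto
 have nlk: "~ a.lk m c p" if "m:Mt" "~ a.cr m p" for m
  using a.lk_sym[OF I(2,1) that(1)] that(2) unfolding a.cr_def c_def by blast
 have mm: "m (m x) = x" if "m:Mt" "x:X" for m x using a.mate_mate that XV by blast
 have T0: "m x:P1 Un P2" if m: "m:Mt" "~ a.cr m p" and x: "x:P1 Un P2" for m x
 proof (cases "x:X Int a.e p")
  case True
  have "m x:X Int a.e p"
   by (rule a.sub_closed[OF I(2,1) cd(4)[symmetric] _ ept m(1) nlk[OF m] True]) (use Epc in blast)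
  thus ?thesis unfolding P by blast
 next case False
  have "m x:N c Un a.e c Un N (a.s c)"
   by (rule a.cr_closed[OF m(1) cn(1)]) (use crs(1)[OF m(1)] m(2) x False d_def P in auto)
  thus ?thesis unfolding P d_def by blast
 qed
 have T1: "m x~:X" if m: "m:Mt" "a.cr m p" and x: "x:P1" "m x~:P1" for m x proof -
  have "m x:N p Un a.e p Un N c Un a.e c"
  proof (cases "x:a.e c")
   case True thus ?thesis using a.ncr_closed[OF m(1) cn(1) _ True] crs(1)[OF m(1)] m(2) by blast
  next case False
   have "m x:N p Un a.e p Un N (a.s p)" by (rule a.cr_closed[OF m(1) p(1) m(2)]) (use x False c_def P in auto)
   thus ?thesis unfolding c_def by blast
  qed
  thus ?thesis using x(2) NpX unfolding P by blast
 qed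
 have t3: "a.mtight P3"
 proof (rule a.mtightI_par[OF _ p3])
  show "P3<=V" unfolding P using XV by blast
  fix m x y assume m: "m:Mt" and x: "x:P3" "m x~:P3" and y: "y:P3" "m y~:P3"
  show "x = y"
  proof (cases "a.cr m p")
   case True
   obtain w where w: "w:P1" "m w~:P1" using a.mtight_ex[OF t1 m] by blast
   have wX: "m w~:X" "w:X" using T1[OF m True w] w s12 by auto
   have in2: "v:V - P2 & m v:P2" if v: "v:P3" "m v~:P3" for v proof -
    have vX: "v:X" "v~:P1 Un P2" using v(1) unfolding P(3) by auto
    have mX: "m v:X"
    proof (rule ccontr)
     assume "m v~:X"
     hence "v = w" using a.mtight_un[OF X(1) m vX(1) _ wX(2,1)] by blast
     thus False using w vX by blast
    qed
    have "m v~:P1"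
    proof
     assume "m v:P1"
     hence "m (m v)~:X" using T1[OF m True, of "m v"] mm[OF m vX(1)] vX(2) by auto
     thus False using mm[OF m vX(1)] vX by simp
    qed
    thus ?thesis using mX v(2) vX XV unfolding P(3) by blast
   qed
   show ?thesis using a.mtight_un_in[OF t2 m] in2[OF x] in2[OF y] by blast
  next case False
   have out: "v:X & m v~:X" if v: "v:P3" "m v~:P3" for v proof -
    have vX: "v:X" "v~:P1 Un P2" using v(1) unfolding P(3) by auto
    have "m v~:P1 Un P2"
    proof
     assume "m v:P1 Un P2"
     hence "m (m v):P1 Un P2" by (rule T0[OF m False])
     thus False using mm[OF m vX(1)] vX by simp
    qed
    thus ?thesis using v(2) vX unfolding P(3) by blast
   qed
   show ?thesis using a.mtight_un[OF X(1) m] out[OF x] out[OF y] by blast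
  qed
 qed
 have o1: "EX z:P1. m z~:X" if m: "m:Mt" "a.cr m p" for m
  using a.mtight_ex[OF t1 m(1)] T1[OF m] by blast
 have o3: "EX z:P3. m z~:X" if m: "m:Mt" "~ a.cr m p" for m proof -
  obtain z where z: "z:X" "m z~:X" using a.mtight_ex[OF X(1) m(1)] by blast
  have "z~:P1 Un P2" using T0[OF m, of z] z s12 by blast
  thus ?thesis using z unfolding P(3) by blast
 qed
 have PX: "P1 Un P2 Un P3 = X" "P1 Int P3 = {}" "P2 Int P3 = {}" using s12 unfolding P(3) by blast+
 obtain r where r: "r < n'" "b.s r = i" using b.s_surj[OF i] by blast
 have si: "b.s i < n'" by (rule b.s_lt[OF i])
 have ad: "b.adj i (b.s i)" "b.adj i r" using b.adj_iff i si r by auto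
 have rs: "b.s i~=r" using b.ss_ne[OF r(1)] r(2) by simp
 have lr: "b.lk m i r <-> ~ b.cr m i" if m: "m:Mt" for m
  using b.cr_s[OF m r(1)] b.lk_sym[of i r m] b.lk_sym[of r i m] m r i unfolding b.cr_def by auto
 have ls: "b.lk m i (b.s i) <-> b.cr m i" for m unfolding b.cr_def ..
 show False using type_agree_at[OF p(1) i]
 proof
  assume t: "ALL m:Mt. a.cr m p <-> b.cr m i"
  show False
   by (rule b.T7_loc[OF i si r(1) ad rs X Xt t1 t2 t3 d12 PX(2,3,1)]) (use t lr ls o1 o3 in blast)+
 next assume t: "ALL m:Mt. a.cr m p <-> ~ b.cr m i"
  show False
   by (rule b.T7_loc[OF i r(1) si ad(2,1) rs[symmetric] X Xt t1 t2 t3 d12 PX(2,3,1)]) (use t lr ls o1 o3 in blast)+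
 qed
qed

lemma located:
 assumes i: "i < n'" and X: "a.mtight X" "N' i<=X" "X<=b.U i"
  and Xt: "!!k. k < n' ==> k~=i ==> a.mtight (N' i Un (X Int E' i k))"
  and PR: "P:\<P>" "R:\<P>" "X<=P Un R"
 shows "a.eloc X | (EX v:{..<n}. a.vloc v X)"
proof -
 have cla': "ALL P:\<P>. EX i:{..<n}. N i<=P" using cla by blast
 obtain c d where cd: "c < n" "d < n" "c~=d" "N c<=V - X" "N d<=V - X"
  using a.two_left[OF tf four cla' PR] by auto
 have XV: "X<=V" by (rule a.mtight_sub[OF X(1)])
 have ne: "N c~={}" "N d~={}" using a.N_ne[of c] a.N_ne[of d] cd by auto
 have "a.eloc X | (EX A. a.zloc A X)" proof -
  obtain Z where Z: "Z:{X, V - X}" "a.eloc Z | (EX A. a.zloc A Z)" using a.ring_loc[OF X(1)] by blast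
  show ?thesis
  proof (cases "Z = X")
   case True thus ?thesis using Z by blast
  next case False hence Zc: "Z = V - X" using Z by blast
   have "~ a.eloc Z" by (rule a.N_not_in_E[of c]) (use cd Zc in auto)
   then obtain A where A: "a.zloc A Z" using Z(2) by blast
   have "c:A" "d:A" using a.zlocD(4)[OF A cd(1)] a.zlocD(4)[OF A cd(2)] cd Zc ne by blast+
   hence "a.zloc ({..<n} - A) (V - Z)" using a.zloc_compl[OF A _ _ cd(3)] by blast
   moreover have "V - Z = X" using Zc XV by blast
   ultimately show ?thesis by auto
  qed
 qed
 thus ?thesis
 proof
  assume "EX A. a.zloc A X"
  then obtain A where A: "a.zloc A X" by blast
  note z = a.zlocD[OF A]
  obtain p q where pq: "p < n" "q < n" "p~:A" "a.s p:A" "q:A" "a.s q~:A" "odd (p + q)" by (rule a.arc_ends[OF z(2)])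
  have sn: "a.s p < n" by (rule a.s_lt[OF pq(1)])
  have ss: "a.s (a.s p)~:A" using long_False[OF i X Xt A pq(1,3,4)] by blast
  have "w~:A" if "w < n" "w~=a.s p" for w
   using a.iso[OF z(2) pq(1) _ _ that] pq(3,4) ss unfolding a.bd_def by blast
  hence "A = {a.s p}" using a.oddarc_sub[OF z(2)] pq(4) by blast
  hence "a.vloc (a.s p) X" using a.zloc_single[OF sn _ X(1)] A by simp
  thus ?thesis using sn by blast
 qed blast
qed

lemma half_pair:
 assumes i: "i < n'"
 shows "a.eloc (N' i) | (EX v:{..<n}. a.vloc v (N' i))"
  "j < n' ==> i~=j ==> a.eloc (N' i Un E' i j) | (EX v:{..<n}. a.vloc v (N' i Un E' i j))"
proof -
 obtain P where P: "P:\<P>" "N' i<=P" using b.cleave_cover[OF tf four clb i] by blast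
 have I: "i:{..<n'}" using i by simp
 show "a.eloc (N' i) | (EX v:{..<n}. a.vloc v (N' i))"
 proof (rule located[OF i _ order_refl b.N_sub_U _ P(1) P(1)])
  show "a.mtight (N' i)" by (rule b.N_tight[OF I])
  fix k assume k: "k < n'" "k~=i"
  show "a.mtight (N' i Un (N' i Int E' i k))" by (rule b.located_NE(2)[OF I, of k k]) (use k in auto)
 qed (use P in blast)
 assume j: "j < n'" "i~=j"
 obtain R where R: "R:\<P>" "N' j<=R" using b.cleave_cover[OF tf four clb j(1)] by blast
 have J: "j:{..<n'}" using j by simp
 show "a.eloc (N' i Un E' i j) | (EX v:{..<n}. a.vloc v (N' i Un E' i j))"
 proof (rule located[OF i _ _ _ _ P(1) R(1)])
  show "a.mtight (N' i Un E' i j)" by (rule b.NE_tight[OF I J j(2)])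
  show "N' i Un E' i j<=b.U i" using b.N_sub_U b.E_sub_U[OF J] by blast
  fix k assume k: "k < n'" "k~=i"
  show "a.mtight (N' i Un ((N' i Un E' i j) Int E' i k))" by (rule b.located_NE(1)[OF I J]) (use k j in auto)
 next
  have "E' i j<=P Un R"
  proof (cases "E' i j = {}")
   case False hence "j = b.s i & E' i j = b.e i | i = b.s j & E' i j = b.e j" by (rule b.E_e[OF i j(1)])
   thus ?thesis
    using b.cleave_e[OF tf four clb i P] b.cleave_e[OF tf four clb j(1) R] P R by blast
  qed blast
  thus "N' i Un E' i j<=P Un R" using P by blast
 qed blast
qed

end

lemma ring_pair_match:
 assumes "ring_pair V Mt n n' N E N' E' \<P>"
 shows "EX f. bij_betw f {..<n'} {..<n} & (ALL v<n'. N' v = N (f v)) & (ALL v<n'. ALL w<n'. E' v w = E (f v) (f w))"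
proof -
 interpret rp: ring_pair V Mt n n' N E N' E' \<P> by (rule assms)
 interpret pr: ring_pair V Mt n' n N' E' N E \<P> by unfold_locales (use rp.tf rp.four rp.cla rp.clb in auto)
 interpret fp: frame_pair V Mt "{..<n}" N E "{..<n'}" N' E'
  by unfold_locales (use rp.a.ring_three rp.b.ring_three rp.half_pair pr.half_pair in auto)
 show ?thesis using fp.pair_match by auto
qed

context loc_frame
begin

lemma bob_noncompl:
 assumes b: "bobfam I (res h)" and h: "tour h" and X: "mtight X" and cd: "c:I" "d:I" "c~=d" "N c<=V - X" "N d<=V - X"
 shows "eloc X | (EX v:I. vloc v X)"
proof -
 obtain Z where Z: "Z:{X, V - X}" "eloc Z | (EX v:I. vloc v Z)" using bob_loc[OF h b X] by blast
 show ?thesis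
 proof (cases "Z = X")
  case True thus ?thesis using Z by blast
 next case False hence Zc: "Z = V - X" using Z by blast
  have "~ eloc Z" by (rule N_not_in_E[OF cd(1)]) (use cd Zc in auto)
  then obtain v where v: "v:I" "vloc v Z" using Z(2) by blast
  hence "N c<=U v" "N d<=U v" using cd Zc unfolding vloc_def by blast+
  hence "v = c" "v = d" using N_Int_U[OF v(1) cd(1)] N_Int_U[OF v(1) cd(2)] N_ne cd by blast+
  thus ?thesis using cd(3) by simp
 qed
qed

text \<open>Every class contains a vertex and misses two, so it lies around exactly one vertex.\<close>

lemma bob_cleave:
 assumes b: "bobfam I (res h)" and h: "tour h"
  and tf: "tfam \<P> (%P. P)" and four: "at_least_four \<P>" and cl: "ALL P:\<P>. EX i:I. N i<=P"
 shows "EX Q. subres Q & \<P> = Q ` I & inj_on Q I"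
proof -
 have t: "mtight P" if "P:\<P>" for P using tf that unfolding tfam_def by blast
 have dj: "P Int P' = {}" if "P:\<P>" "P':\<P>" "P~=P'" for P P' using tf that unfolding tfam_def by blast
 have loc: "EX v:I. vloc v P & N v<=P" if P: "P:\<P>" for P proof -
  obtain c d where cd: "c:I" "d:I" "c~=d" "N c<=V - P" "N d<=V - P"
   using two_left[OF tf four cl P P, of P] by blast
  obtain i where i: "i:I" "N i<=P" using cl P by blast
  have "~ eloc P" by (rule N_not_in_E[OF i])
  then obtain v where v: "v:I" "vloc v P" using bob_noncompl[OF b h t[OF P] cd] by blast
  hence "N i<=U v" using i unfolding vloc_def by blast
  thus ?thesis using N_Int_U[OF v(1) i(1)] N_ne[OF i(1)] v i by blast
 qed
 have ex: "EX P. P:\<P> & N i<=P & vloc i P" if i: "i:I" for i proof -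
  obtain x where x: "x:N i" "x:V" using N_ne[OF i] N_V[OF i] by blast
  then obtain P where P: "P:\<P>" "x:P" using tf unfolding tfam_def by blast
  obtain v where v: "v:I" "vloc v P" "N v<=P" using loc[OF P(1)] by blast
  hence "x:U v" using P unfolding vloc_def by blast
  thus ?thesis using N_Int_U[OF v(1) i] x v P by blast
 qed
 then obtain Q where Q: "!!i. i:I ==> Q i:\<P> & N i<=Q i & vloc i (Q i)" by metis
 have inj: "inj_on Q I"
 proof (rule inj_onI, rule ccontr)
  fix i j assume a: "i:I" "j:I" "Q i = Q j" "i~=j"
  have "Q i<=U i" using Q[OF a(1)] unfolding vloc_def by blast
  thus False using Q[OF a(2)] a(3) N_Int_U[OF a(1,2,4)] N_ne[OF a(2)] by blast
 qed
 have im: "\<P> = Q ` I"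
 proof
  show "Q ` I<=\<P>" by (rule image_subsetI) (use Q in blast)
  show "\<P><=Q ` I"
  proof
   fix P assume P: "P:\<P>"
   obtain v where v: "v:I" "N v<=P" using loc[OF P] by blast
   have "Q v = P" using v Q[OF v(1)] N_ne[OF v(1)] dj[of "Q v" P] Q[OF v(1)] P by blast
   thus "P:Q ` I" using v(1) by blast
  qed
 qed
 have "subres Q" unfolding subres_def
 proof (intro conjI ballI impI)
  fix i assume i: "i:I"
  show "N i<=Q i" "Q i<=U i" using Q[OF i] unfolding vloc_def by blast+
  fix j assume j: "j:I" "i~=j"
  have "Q i~=Q j" using inj i j unfolding inj_on_def by blast
  thus "Q i Int Q j = {}" using dj Q[OF i] Q[OF j(1)] by blast
  show "mtight (N i Un (Q i Int E i j))" using Q[OF i] j(1) j(2)[symmetric] unfolding vloc_def by blast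
 next
  have "(UN i:I. Q i) = \<Union>\<P>" unfolding im by simp
  also have "\<dots> = V" using tf unfolding tfam_def by simp
  finally show "(UN i:I. Q i) = V" .
 qed
 thus ?thesis using im inj by blast
qed

end

locale bob_pair = a: loc_frame V Mt I N E + b: loc_frame V Mt J N' E'
 for V :: "'a set" and Mt and I :: "'i set" and N E and J :: "'j set" and N' E' +
 fixes \<P> :: "'a set set" and h h'
 assumes h: "a.tour h" "b.tour h'" and bob: "a.bobfam I (a.res h)" "a.bobfam J (b.res h')"
  and tf: "a.tfam \<P> (%P. P)" and four: "at_least_four \<P>"
  and cla: "ALL P:\<P>. EX i:I. N i<=P" and clb: "ALL P:\<P>. EX i:J. N' i<=P"
begin

lemma half_pair:
 assumes i: "i:J" "j:J"
 shows "a.eloc (N' i) | (EX v:I. a.vloc v (N' i))"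
  "i~=j ==> a.eloc (N' i Un E' i j) | (EX v:I. a.vloc v (N' i Un E' i j))"
proof -
 obtain Q where Q: "b.subres Q" "\<P> = Q ` J" "inj_on Q J" using b.bob_cleave[OF bob(2) h(2) tf four clb] by blast
 have P: "Q i:\<P>" "Q j:\<P>" using Q(2) i by auto
 have s: "N' i Un E' i j<=Q i Un Q j" using b.subres_E[OF Q(1) i] b.subresD(1)[OF Q(1) i(1)] by blast
 obtain c d where cd: "c:I" "d:I" "c~=d" "N c<=V - (N' i Un E' i j)" "N d<=V - (N' i Un E' i j)"
  using a.two_left[OF tf four cla P s] by blast
 show "a.eloc (N' i) | (EX v:I. a.vloc v (N' i))"
  by (rule a.bob_noncompl[OF bob(1) h(1) b.N_tight[OF i(1)] cd(1-3)]) (use cd in blast)+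
 show "i~=j ==> a.eloc (N' i Un E' i j) | (EX v:I. a.vloc v (N' i Un E' i j))"
  by (rule a.bob_noncompl[OF bob(1) h(1) b.NE_tight[OF i] cd])
qed

end

lemma bob_pair_match:
 assumes "bob_pair V Mt I N E J N' E' \<P> h h'"
 shows "EX f. bij_betw f J I & (ALL v:J. N' v = N (f v)) & (ALL v:J. ALL w:J. E' v w = E (f v) (f w))"
proof -
 interpret rp: bob_pair V Mt I N E J N' E' \<P> h h' by (rule assms)
 interpret pr: bob_pair V Mt J N' E' I N E \<P> h' h by unfold_locales (use rp.tf rp.four rp.cla rp.clb rp.h rp.bob in auto)
 interpret fp: frame_pair V Mt I N E J N' E'
  by unfold_locales (use rp.a.three rp.b.three rp.half_pair pr.half_pair in blast)+
 show ?thesis by (rule fp.pair_match)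
qed

section \<open>Translation between torsoids and frames\<close>

lemma cyc_qed:
 assumes L: "inj_on L I" and r: "bij_betw r {..<n} I" and n: "3<=n"
  and A: "!!i j. i < n ==> j < n ==> A (r i) (r j) <-> j = Suc i mod n | i = Suc j mod n"
 shows "is_cycle (Graph (L ` I) (qed_edges I L A))"
proof -
 let ?xs = "map (%i. L (r i)) [0..<n]"
 have rI: "r ` {..<n} = I" "inj_on r {..<n}" using r unfolding bij_betw_def by auto
 have Lr: "inj_on (%i. L (r i)) {..<n}" using comp_inj_on[OF rI(2)] L rI(1) unfolding comp_def by auto
 have "distinct ?xs" unfolding distinct_map using Lr by (simp add: lessThan_atLeast0)
 moreover have "set ?xs = L ` I" unfolding rI(1)[symmetric] by (auto simp: image_image)
 moreover have "qed_edges I L A = {{?xs ! i, ?xs ! (Suc i mod length ?xs)} | i. i < length ?xs}" (is "_ = ?R")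
 proof
  have sn: "Suc i mod n < n" for i using n by simp
  have "(x = {?xs ! i, ?xs ! (Suc i mod length ?xs)} & i < length ?xs) <-> (x = {L (r i), L (r (Suc i mod n))} & i < n)" for x i
   using sn[of i] by (cases "i < n") simp_all
  hence R: "?R = {{L (r i), L (r (Suc i mod n))} | i. i < n}" by (intro Collect_cong ex_cong1)
  show "qed_edges I L A<=?R"
  proof
   fix e assume "e:qed_edges I L A"
   then obtain a b where ab: "e = {L a, L b}" "a:I" "b:I" "A a b" unfolding qed_edges_def by blast
   obtain i where i: "i < n" "a = r i" using ab(2) unfolding rI(1)[symmetric] by auto
   obtain j where j: "j < n" "b = r j" using ab(3) unfolding rI(1)[symmetric] by auto
   have "(e = {L (r i), L (r (Suc i mod n))}) | (e = {L (r j), L (r (Suc j mod n))})" using A[OF i(1) j(1)] ab(4) i j ab(1) i(2) j(2) by fastforce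
   thus "e:?R" unfolding R using i(1) j(1) by blast
  qed
  show "?R<=qed_edges I L A"
  proof
   fix e assume "e:?R"
   then obtain i where i: "i < n" "e = {L (r i), L (r (Suc i mod n))}" unfolding R by blast
   have s: "Suc i mod n < n" "Suc i mod n~=i" using n i(1) by (auto simp: mod_Suc)
   have "A (r i) (r (Suc i mod n))" using A[OF i(1) s(1)] by simp
   moreover have "r i~=r (Suc i mod n)" using rI(2) i(1) s unfolding inj_on_def by (metis lessThan_iff)
   moreover have "r i:I" "r (Suc i mod n):I" using rI(1) i(1) s(1) by auto
   ultimately show "e:qed_edges I L A" unfolding qed_edges_def i(2) by blast
  qed
 qed
 ultimately show ?thesis unfolding is_cycle_def using n by (intro exI[of _ ?xs]) simp
qed

lemma is_cycle_index:
 assumes "is_cycle K"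
 shows "EX n g. 3<=n & bij_betw g {..<n} (verts K) &
  (ALL i<n. ALL j<n. {g i, g j}:edges K <-> j = Suc i mod n | i = Suc j mod n)"
proof -
 obtain xs where xs: "distinct xs" "3<=length xs" "verts K = set xs"
  "edges K = {{xs ! i, xs ! (Suc i mod length xs)} | i. i < length xs}" using assms unfolding is_cycle_def by blast
 have b: "bij_betw ((!) xs) {..<length xs} (verts K)" by (rule bij_betw_nth[OF xs(1)]) (use xs(3) in auto)
 have s: "Suc i mod length xs < length xs" for i using xs(2) by (intro mod_less_divisor) linarith
 have eq: "xs ! i = xs ! j <-> i = j" if "i < length xs" "j < length xs" for i j
  using nth_eq_iff_index_eq[OF xs(1) that] .
 have "{xs ! i, xs ! j}:edges K <-> j = Suc i mod length xs | i = Suc j mod length xs"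
  if ij: "i < length xs" "j < length xs" for i j
 proof
  assume "{xs ! i, xs ! j}:edges K"
  then obtain k where k: "k < length xs" "{xs ! i, xs ! j} = {xs ! k, xs ! (Suc k mod length xs)}" unfolding xs(4) by blast
  from k(2) have "xs ! i = xs ! k & xs ! j = xs ! (Suc k mod length xs) | xs ! i = xs ! (Suc k mod length xs) & xs ! j = xs ! k"
   unfolding doubleton_eq_iff .
  thus "j = Suc i mod length xs | i = Suc j mod length xs"
   using eq[OF ij(1) k(1)] eq[OF ij(2) k(1)] eq[OF ij(1) s] eq[OF ij(2) s] by auto
 next assume "j = Suc i mod length xs | i = Suc j mod length xs"
  thus "{xs ! i, xs ! j}:edges K"
  proof
   assume "j = Suc i mod length xs" thus ?thesis unfolding xs(4) using ij by blast
  next assume "i = Suc j mod length xs"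
   moreover have "{xs ! i, xs ! j} = {xs ! j, xs ! i}" by blast
   ultimately show ?thesis unfolding xs(4) using ij by auto
  qed
 qed
 thus ?thesis using b xs(2) by blast
qed

lemma is_cycle_nbrs:
 assumes "is_cycle K"
 shows "EX v:verts K. EX a:verts K. EX b:verts K. v~=a & v~=b & (ALL w:verts K. {v, w}:edges K --> w = a | w = b)"
proof -
 obtain n g where g: "3<=n" "bij_betw g {..<n} (verts K)"
  "ALL i<n. ALL j<n. {g i, g j}:edges K <-> j = Suc i mod n | i = Suc j mod n" using is_cycle_index[OF assms] by blast
 have lt: "0 < n" "1 < n" "n - 1 < n" using g(1) by auto
 have mem: "g i:verts K" if "i < n" for i using g(2) that unfolding bij_betw_def by auto
 have ne: "g i~=g j" if "i < n" "j < n" "i~=j" for i j using g(2) that unfolding bij_betw_def inj_on_def by auto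
 have "w = g 1 | w = g (n - 1)" if w: "w:verts K" "{g 0, w}:edges K" for w proof -
  obtain j where j: "j < n" "w = g j" using w(1) g(2) unfolding bij_betw_def by auto
  have "j = 1 | j = n - 1" using g(3) j w(2) lt(1) g(1) j(1) by force
  thus ?thesis using j(2) by blast
 qed
 thus ?thesis
  by (intro bexI[of _ "g 0"] bexI[of _ "g 1"] bexI[of _ "g (n - 1)"] conjI ballI impI)
   (use mem lt ne[of 0 1] ne[of 0 "n - 1"] g(1) in auto)
qed

lemma at_least_four_three:
 assumes "at_least_four S" shows "i:S ==> j:S ==> EX k:S. k~=i & k~=j" "EX i:S. EX j:S. i~=j"
proof -
 show "EX k:S. k~=i & k~=j" if "i:S" "j:S" for i j
  using four_others[OF assms that(1)] by metis
 have "S~={}" using assms unfolding at_least_four_def by auto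
 then obtain x where "x:S" by blast
 thus "EX i:S. EX j:S. i~=j" using four_others[OF assms] by metis
qed

context mate_system
begin

text \<open>Each vertex is matched to exactly one of its two neighbours. Hence matched and unmatched sides alternate
around the cycle, whose length must be even.\<close>

lemma ring_frameI:
 assumes fr: "frame V Mt {..<n} N E" and n: "4<=n"
  and nb: "!!m i j. m:Mt ==> i < n ==> j < n ==> frame.lk N E m i j ==> j = Suc i mod n | i = Suc j mod n"
 shows "ring_frame V Mt n N E"
proof -
 interpret f: frame V Mt "{..<n}" N E by (rule fr)
 define s where "s i = Suc i mod n" for i
 have s: "s i < n" for i using n unfolding s_def by simp
 have s_if: "s i = (if Suc i = n then 0 else Suc i)" if "i < n" for i using that unfolding s_def by auto
 have ss: "s (s i)~=i" "s i~=i" if "i < n" for i using s_if[OF that] s_if[OF s, of i] n that by (auto split: if_splits)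
 have inj: "i = j" if "s i = s j" "i < n" "j < n" for i j using that s_if[of i] s_if[of j] by (auto split: if_splits)
 have alt: "f.lk m (s i) (s (s i)) <-> ~ f.lk m i (s i)" if m: "m:Mt" and i: "i < n" for m i proof -
  have I: "i:{..<n}" "s i:{..<n}" "s (s i):{..<n}" using i s by auto
  obtain j where j: "j < n" "f.lk m (s i) j" using f.lk_ex[OF I(2) m] by auto
  have "j = s (s i) | s i = s j" using nb[OF m s j] unfolding s_def .
  hence "j = s (s i) | j = i" using inj i j(1) by blast
  hence "f.lk m (s i) (s (s i)) | f.lk m (s i) i" using j(2) by blast
  moreover have "~ (f.lk m (s i) (s (s i)) & f.lk m (s i) i)" using f.lk_un[OF I(2,3,1) m] ss(1)[OF i] by blast
  ultimately show ?thesis using f.lk_sym[OF I(1,2) m] f.lk_sym[OF I(2,1) m] by blast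
 qed
 have par: "f.lk m i (s i) <-> (even i <-> f.lk m 0 (s 0))" if m: "m:Mt" and i: "i < n" for m i
  using i
 proof (induction i)
  case (Suc i)
  hence "s i = Suc i" using s_if[of i] by simp
  thus ?case using alt[OF m, of i] Suc by auto
 qed simp
 obtain m0 where m0: "m0:Mt" using Mt_ne by blast
 have "s (n - 1) = 0" using s_if[of "n - 1"] n by simp
 hence "f.lk m0 0 (s 0) <-> ~ f.lk m0 (n - 1) 0" using alt[OF m0, of "n - 1"] n by simp
 hence "odd (n - 1)" using par[OF m0, of "n - 1"] `s (n - 1) = 0` n by auto
 hence ev: "even n" using n by (cases n) auto
 show ?thesis
 proof unfold_locales
  show "4<=n" "even n" by (rule n, rule ev)
  fix m assume m: "m:Mt"
  show "(ALL i<n. f.lk m i (Suc i mod n) <-> even i) | (ALL i<n. f.lk m i (Suc i mod n) <-> odd i)"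
   using par[OF m] unfolding s_def by blast
 qed
qed

lemma bobfam_image:
 assumes b: "bobfam I Q" and inj: "inj_on Q I" shows "bobfam (Q ` I) (%P. P)"
 unfolding bobfam_def
proof (intro allI impI)
 fix A assume A: "A<=Q ` I" and t: "mtight (UN P:A. P)"
 define A' where "A' = {i:I. Q i:A}"
 have QA: "Q ` A' = A" using A unfolding A'_def by blast
 have "(UN i:A'. Q i) = (UN P:A. P)" unfolding QA[symmetric] by simp
 hence "mtight (UN i:A'. Q i)" using t by simp
 moreover have "A'<=I" unfolding A'_def by blast
 ultimately obtain i where i: "i:I" "A' = {i} | A' = I - {i}" using b unfolding bobfam_def by blast
 have "Q ` (I - {i}) = Q ` I - {Q i}" using inj_on_image_set_diff[OF inj, of I "{i}"] i(1) by auto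
 hence "A = {Q i} | A = Q ` I - {Q i}" using i(2) unfolding QA[symmetric] by (elim disjE) simp_all
 thus "EX P:Q ` I. A = {P} | A = Q ` I - {P}" using i(1) by blast
qed

lemma tfam_inj:
 assumes "tfam I Q" shows "inj_on Q I"
proof (rule inj_onI, rule ccontr)
 fix i j assume a: "i:I" "j:I" "Q i = Q j" "i~=j"
 hence "Q i Int Q j = {}" "mtight (Q i)" using assms unfolding tfam_def by blast+
 thus False using mtight_ne[of "Q i"] a(3) by simp
qed

lemma tfam_image: assumes "tfam I Q" shows "tfam (Q ` I) (%P. P)"
proof -
 have 1: "mtight (Q i)" if "i:I" for i using assms that unfolding tfam_def by blast
 have 2: "Q i Int Q j = {}" if "i:I" "j:I" "Q i~=Q j" for i j proof -
  have "i~=j" using that by blast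
  thus ?thesis using assms that unfolding tfam_def by blast
 qed
 show ?thesis unfolding tfam_def
 proof (intro conjI ballI impI)
  fix P assume "P:Q ` I" thus "mtight P" using 1 by blast
 next fix P P' assume "P:Q ` I" "P':Q ` I" "P~=P'" thus "P Int P' = {}" using 2 by (elim imageE) simp
 next show "(UN P:Q ` I. P) = V" using assms unfolding tfam_def by simp
 qed
qed

lemma at_least_four_image: "inj_on Q I ==> at_least_four (Q ` I) <-> at_least_four I"
 unfolding at_least_four_def by (simp add: finite_image_iff card_image)

end

context frame
begin

lemma subres_link:
 assumes Q: "subres Q" and ij: "i:I" "j:I" "i~=j" and m: "m:Mt"
 shows "lk m i j <-> link m (Q i) (Q j)"
 unfolding subres_lk[OF Q ij(1,2) m] link_def using ij(3) by simp

lemma proper_nbrs: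
 assumes uvw: "u:I" "v:I" "w:I" and l: "!!m. m:Mt ==> lk m u v | lk m u w"
 shows "EX v':I. EX w':I. u~=v' & u~=w' & (ALL m:Mt. lk m u v' | lk m u w')"
proof -
 obtain m where m: "m:Mt" using Mt_ne by blast
 have nl: "~ lk m u u" for m unfolding lk_def by blast
 show ?thesis
 proof (cases "u = v")
  case True hence "ALL m:Mt. lk m u w" "u~=w" using l m nl by blast+
  thus ?thesis using uvw(3) by blast
 next case F: False
  show ?thesis
  proof (cases "u = w")
   case True thus ?thesis using l nl uvw(2) F by blast
  next case False thus ?thesis using uvw(2,3) F l by blast
  qed
 qed
qed

lemma deg2_ring:
 assumes Q: "subres Q" and b: "bobfam I Q" and four: "at_least_four I"
  and uvw: "u:I" "v:I" "w:I" and l: "!!m. m:Mt ==> lk m u v | lk m u w"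
 shows "EX r. bij_betw r {..<4} I & (ALL i<4. ALL j<4. adj (r i) (r j) <-> j = Suc i mod 4 | i = Suc j mod 4)"
proof -
 obtain v' w' where v': "v':I" "w':I" "u~=v'" "u~=w'" "!!m. m:Mt ==> lk m u v' | lk m u w'"
  using proper_nbrs[OF uvw] l by blast
 note tf = subres_tfam[OF Q]
 note inj = tfam_inj[OF tf]
 have ne: "Q u~=Q v'" "Q u~=Q w'" using inj v' uvw(1) unfolding inj_on_def by blast+
 have "EX q. Q ` I = q ` {..<4} & card (Q ` I) = 4 & ring_part V Mt 4 q"
  by (rule deg2_C4[OF tfam_image[OF tf] bobfam_image[OF b inj] _ _ _ _ ne])
   (use at_least_four_image[OF inj] four uvw(1) v' subres_link[OF Q] in auto)
 then obtain q where q: "Q ` I = q ` {..<4}" "ring_part V Mt 4 q" by blast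
 interpret r: ring_part V Mt 4 q by (rule q(2))
 have qinj: "inj_on q {..<4}"
 proof (rule tfam_inj)
  show "tfam {..<4} q" unfolding tfam_def
   by (intro conjI ballI impI r.N_tight r.N_disj) (use r.cover in simp_all)
 qed
 define r where "r i = inv_into I Q (q i)" for i
 have rI: "r i:I" "Q (r i) = q i" if "i < 4" for i proof -
  have qi: "q i:Q ` I" using q(1) that by blast
  show "r i:I" "Q (r i) = q i" unfolding r_def by (rule inv_into_into[OF qi], rule f_inv_into_f[OF qi])
 qed
 have rinj: "inj_on r {..<4}"
 proof (rule inj_onI)
  fix x y assume a: "x:{..<4::nat}" "y:{..<4}" "r x = r y"
  hence "q x = q y" using rI(2)[of x] rI(2)[of y] by simp
  thus "x = y" using qinj a unfolding inj_on_def by blast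
 qed
 have "I<=r ` {..<4}"
 proof
  fix a assume a: "a:I"
  hence "Q a:q ` {..<4}" using q(1) by blast
  then obtain i where i: "i < 4" "Q a = q i" by auto
  have "r i = a" unfolding r_def i(2)[symmetric] by (rule inv_into_f_f[OF inj a])
  thus "a:r ` {..<4}" using i(1) by blast
 qed
 hence bij: "bij_betw r {..<4} I" unfolding bij_betw_def using rinj rI(1) by auto
 have "adj (r i) (r j) <-> j = Suc i mod 4 | i = Suc j mod 4" if ij: "i < 4" "j < 4" for i j
 proof (cases "i = j")
  case True
  have "Suc j mod 4~=j" using ij(2) by (auto simp: mod_Suc)
  thus ?thesis using True unfolding adj_def lk_def by auto
 next case False hence "r i~=r j" using rinj ij unfolding inj_on_def by auto
  hence "adj (r i) (r j) <-> (EX m:Mt. link m (q i) (q j))"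
   unfolding adj_def using subres_link[OF Q rI(1)[OF ij(1)] rI(1)[OF ij(2)]] rI(2) ij by auto
  also have "\<dots> <-> r.adj i j" unfolding r.adj_def r.plk link_def using False by auto
  also have "\<dots> <-> j = Suc i mod 4 | i = Suc j mod 4" using r.adj_iff[OF ij] unfolding r.s_def .
  finally show ?thesis .
 qed
 thus ?thesis using bij by blast
qed

end

lemma qed_edges_cong:
 assumes "!!i j. i:I ==> j:I ==> i~=j ==> A i j = A' i j" shows "qed_edges I L A = qed_edges I L A'"
 unfolding qed_edges_def using assms by blast

locale mcg =
 fixes G :: "'a graph" and M
 assumes mc: "matching_covered G M"

sublocale mcg < mate_system "verts G" "mates G M" by (rule mates_system[OF mc])

context mcg
begin

abbreviation V where "V \<equiv> verts G"
abbreviation Mt where "Mt \<equiv> mates G M"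

lemma tight_mtight: "tight G M X <-> mtight X" by (rule tight_iff[OF mc])

lemma mM: "mate M:Mt" unfolding mates_def using Perf_self[OF mc_pm[OF mc]] by blast

lemma joined_edges:
 assumes "X<=V" shows "joined (edges G) X Y <-> (EX m:Mt. link m X Y)"
proof
 assume "joined (edges G) X Y"
 then obtain x y where xy: "x:X" "y:Y" "{x, y}:edges G" unfolding joined_def by blast
 obtain K where "K:Perf G M" "mate K x = y" using edge_mate[OF mc xy(3)] by blast
 hence "mate K:Mt" "link (mate K) X Y" using xy unfolding mates_def link_def by auto
 thus "EX m:Mt. link m X Y" by blast
next assume "EX m:Mt. link m X Y"
 then obtain m x where "m:Mt" "x:X" "m x:Y" unfolding link_def by blast
 thus "joined (edges G) X Y" unfolding joined_def using mate_edge[OF mc, of m x] assms by blast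
qed

lemma joined_M:
 assumes "X<=V" shows "joined M X Y <-> link (mate M) X Y"
 unfolding joined_def link_def
 using mate_props(1,4)[OF mc_simple[OF mc] mc_pm[OF mc]] assms by (metis subsetD)

end

text \<open>The graph and the map \<open>\<epsilon>\<close> of a frame: the vertices are the sets \<open>N i\<close>, and the edges join indices that some
matching links.\<close>

locale fgraph = mcg G M + frame "verts G" "mates G M" I N E
 for G :: "'a graph" and M and I :: "'i set" and N E
begin

definition gE where "gE = qed_edges I N adj"
definition gH where "gH = Graph (N ` I) gE"

lemma N_inj: "inj_on N I"
proof (rule inj_onI, rule ccontr)
 fix i j assume a: "i:I" "j:I" "N i = N j" "i~=j"
 thus False using N_disj[OF a(1,2,4)] N_ne[OF a(1)] by simp
qed

lemma adj_link: "i:I ==> j:I ==> subres Q ==> i~=j ==> joined (edges G) (Q i) (Q j) <-> adj i j"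
 unfolding adj_def using joined_edges[of "Q i"] mtight_sub[OF subresD(6)] subres_link by blast

lemma gE_iff: "i:I ==> j:I ==> {N i, N j}:gE <-> adj i j"
proof -
 assume ij: "i:I" "j:I"
 have "{N i, N j}:gE <-> (EX a b. {N i, N j} = {N a, N b} & a:I & b:I & a~=b & adj a b)"
  unfolding gE_def qed_edges_def by blast
 also have "\<dots> <-> adj i j"
 proof
  assume "EX a b. {N i, N j} = {N a, N b} & a:I & b:I & a~=b & adj a b"
  then obtain a b where ab: "{N i, N j} = {N a, N b}" "a:I" "b:I" "adj a b" by blast
  hence "i = a & j = b | i = b & j = a" using N_inj ij unfolding doubleton_eq_iff inj_on_def by blast
  thus "adj i j" using ab adj_sym by blast
 next assume a: "adj i j"
  hence "i~=j" unfolding adj_def lk_def by blast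
  thus "EX a b. {N i, N j} = {N a, N b} & a:I & b:I & a~=b & adj a b" using a ij by blast
 qed
 finally show ?thesis .
qed

lemma quotient:
 assumes Q: "subres Q"
 shows "matching_covered gH (qed_edges I N (lk (mate M)))" "bob gH (qed_edges I N (lk (mate M))) <-> bobfam I Q"
proof -
 interpret q: quotient_graph G M I Q N
  by unfold_locales (rule mc, rule subres_tfam[OF Q], rule N_inj)
 have 1: "q.qM (edges G) = gE" unfolding q.qM_def gE_def by (rule qed_edges_cong) (use adj_link Q in blast)
 have 2: "q.qM M = qed_edges I N (lk (mate M))" unfolding q.qM_def
 proof (rule qed_edges_cong)
  fix i j assume ij: "i:I" "j:I" "i~=j"
  show "joined M (Q i) (Q j) = lk (mate M) i j"
   using joined_M[OF mtight_sub[OF subresD(6)[OF Q ij(1)]]] subres_link[OF Q ij mM] by blast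
 qed
 have H: "q.qG = gH" unfolding q.qG_def gH_def 1 ..
 show "matching_covered gH (qed_edges I N (lk (mate M)))" using q.qG_mc unfolding H 2 .
 show "bob gH (qed_edges I N (lk (mate M))) <-> bobfam I Q" using q.bob_quotient unfolding H 2 .
qed

lemma cycle_not_deg3:
 assumes "is_cycle gH"
 shows "EX u:I. EX v:I. EX w:I. ALL m:Mt. lk m u v | lk m u w"
proof -
 obtain x a b where x: "x:N ` I" "a:N ` I" "b:N ` I" "ALL w:N ` I. {x, w}:gE --> w = a | w = b"
  using is_cycle_nbrs[OF assms] unfolding gH_def by auto
 obtain u v w where uvw: "u:I" "v:I" "w:I" "x = N u" "a = N v" "b = N w" using x(1-3) by blast
 have "lk m u v | lk m u w" if m: "m:Mt" for m proof -
  obtain j where j: "j:I" "lk m u j" using lk_ex[OF uvw(1) m] by blast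
  hence "{N u, N j}:gE" using gE_iff[OF uvw(1) j(1)] m unfolding adj_def by blast
  hence "N j = N v | N j = N w" using x(4) j(1) uvw by blast
  hence "j = v | j = w" using N_inj j(1) uvw unfolding inj_on_def by blast
  thus ?thesis using j(2) by blast
 qed
 thus ?thesis using uvw by blast
qed

lemma deg2_cycle:
 assumes "subres Q" "bobfam I Q" "at_least_four I" "u:I" "v:I" "w:I" "!!m. m:Mt ==> lk m u v | lk m u w"
 shows "is_cycle gH" "card I = 4"
proof -
 obtain r where r: "bij_betw r {..<4} I" "ALL i<4. ALL j<4. adj (r i) (r j) <-> j = Suc i mod 4 | i = Suc j mod 4"
  using deg2_ring[OF assms] by blast
 show "is_cycle gH" unfolding gH_def gE_def by (rule cyc_qed[OF N_inj r(1)]) (use r(2) in auto)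
 show "card I = 4" using bij_betw_same_card[OF r(1)] by simp
qed

lemma lk_joined:
 assumes i: "i:I" "j:I" "i~=j" and m: "m:Mt" shows "link m (N i Un E i j) (N j) <-> lk m i j"
proof -
 have "link m (N i Un E i j) (N j) <-> link m (N j) (N i Un E i j)"
  by (rule link_sym[OF m]) (use N_V i E_V in blast)+
 also have "\<dots> <-> lk m j i" unfolding link_def lk_def using i E_sym[OF i(1,2)] by auto
 also have "\<dots> <-> lk m i j" using lk_sym m i by blast
 finally show ?thesis .
qed

definition gep where
 "gep = restrict (%e. UN i:I. UN j:I. if e = {N i, N j} then E i j else {}) gE"

lemma gep: assumes ij: "i:I" "j:I" "adj i j" shows "gep {N i, N j} = E i j"
proof -
 have "(UN a:I. UN b:I. if {N i, N j} = {N a, N b} then E a b else {}) = E i j"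
 proof
  show "E i j<=(UN a:I. UN b:I. if {N i, N j} = {N a, N b} then E a b else {})" using ij by force
  show "(UN a:I. UN b:I. if {N i, N j} = {N a, N b} then E a b else {})<=E i j"
  proof (intro UN_least)
   fix a b assume ab: "a:I" "b:I"
   show "(if {N i, N j} = {N a, N b} then E a b else {})<=E i j"
   proof (cases "{N i, N j} = {N a, N b}")
    case True hence "i = a & j = b | i = b & j = a" using N_inj ij ab unfolding doubleton_eq_iff inj_on_def by blast
    thus ?thesis using E_sym[OF ab] by auto
   qed auto
  qed
 qed
 moreover have "{N i, N j}:gE" using gE_iff ij by blast
 ultimately show ?thesis unfolding gep_def by simp
qed

lemma matching_eq: "torsoid_matching M gH gep = qed_edges I N (lk (mate M))"
proof -
 have "e:torsoid_matching M gH gep <-> e:qed_edges I N (lk (mate M))" for e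
 proof
  assume "e:torsoid_matching M gH gep"
  then obtain v w where vw: "e = {v, w}" "{v, w}:gE" "joined M (v Un gep {v, w}) w" unfolding torsoid_matching_def gH_def by auto
  then obtain i j where ij: "{v, w} = {N i, N j}" "i:I" "j:I" "adj i j" "i~=j" unfolding gE_def qed_edges_def by blast
  then obtain a b where ab: "v = N a" "w = N b" "a:I" "b:I" "adj a b" "a~=b"
   unfolding doubleton_eq_iff using adj_sym by blast
  have "link (mate M) (N a Un E a b) (N b)" using vw(3) gep[OF ab(3-5)] ab joined_M[of "N a Un E a b"] N_V[OF ab(3)] E_V[OF ab(3,4)] by simp
  hence "lk (mate M) a b" using lk_joined[OF ab(3,4,6) mM] by blast
  thus "e:qed_edges I N (lk (mate M))" unfolding qed_edges_def vw(1) using ab by blast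
 next assume "e:qed_edges I N (lk (mate M))"
  then obtain a b where ab: "e = {N a, N b}" "a:I" "b:I" "a~=b" "lk (mate M) a b" unfolding qed_edges_def by blast
  hence ad: "adj a b" unfolding adj_def using mM by blast
  have "link (mate M) (N a Un E a b) (N b)" using lk_joined[OF ab(2-4) mM] ab(5) by blast
  hence "joined M (N a Un gep {N a, N b}) (N b)"
   unfolding gep[OF ab(2,3) ad] using joined_M[of "N a Un E a b"] N_V[OF ab(2)] E_V[OF ab(2,3)] by blast
  moreover have "{N a, N b}:edges gH" unfolding gH_def using gE_iff ab ad by simp
  ultimately show "e:torsoid_matching M gH gep" unfolding torsoid_matching_def ab(1) by blast
 qed
 thus ?thesis by blast
qed

lemma gE_elim:
 assumes "{v, w}:gE" obtains i j where "v = N i" "w = N j" "i:I" "j:I" "i~=j" "adj i j"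
proof -
 obtain i j where ij: "{v, w} = {N i, N j}" "i:I" "j:I" "i~=j" "adj i j" using assms unfolding gE_def qed_edges_def by blast
 from ij(1) have "v = N i & w = N j | v = N j & w = N i" unfolding doubleton_eq_iff .
 thus ?thesis
 proof
  assume "v = N i & w = N j" thus ?thesis using that[of i j] ij by simp
 next assume "v = N j & w = N i" thus ?thesis using that[of j i] ij adj_sym[OF ij(2,3,5)] by simp
 qed
qed

text \<open>In (T5) a passable set may meet both ends. Its parts in the two ends are treated
separately by \<open>maxE\<close>.\<close>

lemma torsoid:
 assumes mf: "max_frame V Mt I N E" and four: "at_least_four I" and Q: "subres Q"
  and bc: "bobfam I Q | is_cycle gH"
  and T7: "!!i j k P1 P2 P3. is_cycle gH ==> i:I ==> j:I ==> k:I ==> adj i j ==> adj i k ==> j~=k ==> mtight P1 ==> mtight P2 ==> mtight P3 ==>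
   P1 Int P2 = {} ==> P1 Int P3 = {} ==> P2 Int P3 = {} ==> P1 Un P2 Un P3 = E i j Un N i Un E i k ==>
   mtight (N j Un P1 Un P2) ==> mtight (P2 Un P3 Un N k) ==> False"
 shows "(gH, gep):torsoids G M"
proof -
 interpret mf: max_frame V Mt I N E by (rule mf)
 have e: "edges gH = gE" "verts gH = N ` I" unfolding gH_def by auto
 have t1: "torsoid_T1 M (gH, gep)"
  unfolding torsoid_T1_def case_prod_conv matching_eq
  using quotient[OF Q] bc at_least_four_image[OF N_inj] four e by simp
 have t2: "torsoid_T2 G M (gH, gep)"
  unfolding torsoid_T2_def case_prod_conv e tight_mtight using N_tight by blast
 have gep_out: "gep x = undefined" if "x~:gE" for x unfolding gep_def using that by simp
 have gE_e: "EX i:I. EX j:I. x = {N i, N j} & adj i j & gep x = E i j" if x: "x:gE" for x proof -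
  obtain i j where ij: "x = {N i, N j}" "i:I" "j:I" "adj i j" using x unfolding gE_def qed_edges_def by blast
  thus ?thesis using gep by blast
 qed
 have t3: "torsoid_T3 G (gH, gep)"
  unfolding torsoid_T3_def case_prod_conv e
 proof (rule PiE_I)
  fix x assume "x:gE" thus "gep x:Pow (verts G)" using gE_e[of x] E_V by auto
 qed (rule gep_out)
 have t4: "torsoid_T4 G (gH, gep)"
  unfolding torsoid_T4_def case_prod_conv e
 proof (intro conjI ballI)
  show "disjoint (N ` I)" unfolding disjoint_def
  proof (intro ballI impI)
   fix a b assume "a:N ` I" "b:N ` I" "a~=b"
   then obtain i j where "i:I" "j:I" "a = N i" "b = N j" "i~=j" by blast
   thus "a Int b = {}" using N_disj by simp
  qed
  show "disjoint_family_on gep gE" unfolding disjoint_family_on_def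
  proof (intro ballI impI)
   fix x y assume x: "x:gE" and y: "y:gE" and ne: "x~=y"
   obtain i j where ij: "i:I" "j:I" "x = {N i, N j}" "gep x = E i j" using gE_e[OF x] by blast
   obtain k l where kl: "k:I" "l:I" "y = {N k, N l}" "gep y = E k l" using gE_e[OF y] by blast
   have "{i, j}~={k, l}" using ne ij(3) kl(3) by (auto simp: doubleton_eq_iff)
   thus "gep x Int gep y = {}" unfolding ij(4) kl(4) by (rule E_disj[OF ij(1,2) kl(1,2)])
  qed
  fix v x assume v: "v:N ` I" and x: "x:gE"
  obtain i j where ij: "i:I" "j:I" "gep x = E i j" using gE_e[OF x] by blast
  obtain k where k: "k:I" "v = N k" using v by blast
  show "v Int gep x = {}" unfolding ij(3) k(2) by (rule NE_disj[OF ij(1,2) k(1)])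
 next show "\<Union> (N ` I) Un \<Union> (gep ` gE) = verts G"
  proof
   show "\<Union> (N ` I) Un \<Union> (gep ` gE)<=verts G"
   proof (intro Un_least UN_least)
    fix i assume "i:I" thus "N i<=V" by (rule N_V)
   next fix x assume "x:gE" thus "gep x<=V" using gE_e[of x] E_V by blast
   qed
   show "verts G<=\<Union> (N ` I) Un \<Union> (gep ` gE)"
   proof
    fix z assume "z:V"
    then consider i where "i:I" "z:N i" | i j where "i:I" "j:I" "z:E i j" using cover by blast
    thus "z:\<Union> (N ` I) Un \<Union> (gep ` gE)"
    proof cases
     case 2
     hence a: "adj i j" using nadj_E[of i j] by blast
     have "z:gep {N i, N j}" using gep[OF 2(1,2) a] 2(3) by simp
     moreover have "{N i, N j}:gE" using gE_iff 2 a by blast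
     ultimately show ?thesis by blast
    qed blast
   qed
  qed
 qed
 have t5: "torsoid_T5 G M (gH, gep)"
  unfolding torsoid_T5_def case_prod_conv e
 proof (intro allI impI)
  fix v w assume "{v, w}:gE"
  then obtain i j where ij: "v = N i" "w = N j" "i:I" "j:I" "i~=j" "adj i j" by (rule gE_elim)
  have ge: "gep {v, w} = E i j" unfolding ij(1,2) by (rule gep[OF ij(3,4,6)])
  have sym: "E j i = E i j" by (rule E_sym[OF ij(4,3)])
  have V: "N i<=V" "N j<=V" "E i j<=V" using N_V ij E_V by blast+
  have dj: "N i Int E i j = {}" "N j Int E i j = {}" "N i Int N j = {}" using NE_disj[OF ij(3,4)] N_disj[OF ij(3-5)] ij(3,4) by blast+
  note Nt = N_tight[OF ij(3)] N_tight[OF ij(4)]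
  note NEt = NE_tight[OF ij(3-5)] NE_tight[OF ij(4,3) ij(5)[symmetric], unfolded sym]
  have j: "joined (edges G) (N i Un E i j) (N j)"
   using joined_edges[of "N i Un E i j"] V ij(6) lk_joined[OF ij(3-5)] unfolding adj_def by blast
  have d: "N i - E i j = N i" "N j - E i j = N j" using dj by blast+
  have side: "S Int N a = {}" if S: "S<=N a Un E a b Un N b" "mtight (N a - S)" "mtight (N b Un S)" and ab: "a:I" "b:I" "a~=b" for S a b proof -
   have djab: "N a Int E a b = {}" "N b Int E a b = {}" "N a Int N b = {}" using NE_disj[OF ab(1,2)] N_disj[OF ab] ab(1,2) by blast+
   note Na = N_tight[OF ab(1)]
   have sy: "E b a = E a b" by (rule E_sym[OF ab(2,1)])
   have NEb: "mtight (N b Un E a b)" using NE_tight[OF ab(2,1)] ab(3) unfolding sy by simp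
   have D: "N a - (N a - S) = S Int N a" by blast
   have np: "fcut (S Int N a)" "~ par (S Int N a)"
    unfolding D[symmetric] using par_Diff[of "N a" "N a - S"] Na S(2) by auto
   have eq: "(N b Un S) Int (N b Un E a b) = (N b Un S) - (S Int N a)" using S(1) djab by blast
   have "par ((N b Un S) Int (N b Un E a b))"
    unfolding eq using par_Diff[of "N b Un S" "S Int N a"] np S(3) by auto
   hence "mtight ((N b Un S) Un (N b Un E a b))" by (rule mtight_Int_Un(2)[OF S(3) NEb])
   moreover have "(N b Un S) Un (N b Un E a b) = N b Un E a b Un (S Int N a)" using S(1) by blast
   moreover have "N a - (S Int N a) = N a - S" by blast
   ultimately show ?thesis using mf.maxE[OF ab, of "S Int N a"] S(2) by auto
  qed
  show "joined (edges G) (v Un gep {v, w}) w & passable G M (gep {v, w}) v & passable G M (gep {v, w}) w &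
   (ALL S. S<=v Un gep {v, w} Un w & passable G M S v & passable G M S w --> S<=gep {v, w})"
  proof (intro conjI allI impI)
   show "joined (edges G) (v Un gep {v, w}) w" unfolding ge using j ij(1,2) by simp
   show "passable G M (gep {v, w}) v" unfolding ge passable_def tight_mtight unfolding ij(1) d using V Nt NEt by blast
   show "passable G M (gep {v, w}) w" unfolding ge passable_def tight_mtight unfolding ij(2) d using V Nt NEt by blast
   fix S assume "S<=v Un gep {v, w} Un w & passable G M S v & passable G M S w"
   hence S: "S<=N i Un E i j Un N j" "mtight (N i - S)" "mtight (N j - S)" "mtight (N i Un S)" "mtight (N j Un S)"
    unfolding ge passable_def tight_mtight unfolding ij(1,2) by simp_all
   have S': "S<=N j Un E j i Un N i" using S(1) sym by blast
   have "S Int N i = {}" by (rule side[OF S(1,2,5) ij(3-5)])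
   moreover have "S Int N j = {}" by (rule side[OF S' S(3,4) ij(4,3) ij(5)[symmetric]])
   ultimately show "S<=gep {v, w}" unfolding ge using S(1) by blast
  qed
 qed
 have t6: "torsoid_T6 G (gH, gep)"
  unfolding torsoid_T6_def case_prod_conv e
 proof (intro ballI impI)
  fix v w assume "v:N ` I" "w:N ` I" and vw: "v~=w & {v, w}~:gE"
  then obtain i j where ij: "i:I" "j:I" "v = N i" "w = N j" by blast
  have ne: "i~=j" using vw ij by blast
  show "~ joined (edges G) v w"
  proof
   assume "joined (edges G) v w"
   then obtain m x where m: "m:Mt" "x:N i" "m x:N j" using joined_edges[of v w] N_V[OF ij(1)] ij unfolding link_def by blast
   hence "adj i j" unfolding adj_def lk_def using ne by blast
   thus False using vw gE_iff[OF ij(1,2)] ij by blast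
  qed
 qed
 have t7: "torsoid_T7 G M (gH, gep)"
  unfolding torsoid_T7_def case_prod_conv e tight_mtight
 proof (intro impI allI notI, elim conjE exE)
  fix u v w P1 P2 P3
  assume c: "is_cycle gH" and uv: "{u, v}:gE" and vw: "{v, w}:gE" and uw: "u~=w"
   and P: "mtight P1" "mtight P2" "mtight P3" "P1 Int P2 = {}" "P1 Int P3 = {}" "P2 Int P3 = {}"
    "P1 Un P2 Un P3 = gep {u, v} Un v Un gep {v, w}" "mtight (u Un P1 Un P2)" "mtight (P2 Un P3 Un w)"
  obtain j i where ji: "u = N j" "v = N i" "j:I" "i:I" "adj j i" using uv by (rule gE_elim)
  obtain i' k where ik: "v = N i'" "w = N k" "i':I" "k:I" "adj i' k" using vw by (rule gE_elim)
  have ii: "i' = i" using N_inj ji(2,4) ik(1,3) unfolding inj_on_def by metis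
  have jk: "j~=k" using uw ji ik by blast
  have ij: "adj i j" by (rule adj_sym[OF ji(3,4,5)])
  have g1: "gep {u, v} = E i j" unfolding ji(1,2) using gep[OF ji(3,4,5)] E_sym[OF ji(3,4)] by simp
  have g2: "gep {v, w} = E i k" unfolding ik(1,2) using gep[OF ik(3,4,5)] ii by simp
  show False
   by (rule T7[OF c ji(4,3) ik(4) ij _ jk P(1-6)]) (use P(7-9) g1 g2 ji ik ii in simp_all)
 qed
 show ?thesis unfolding torsoids_def using t1 t2 t3 t4 t5 t6 t7 by simp
qed

end

locale fmax = fgraph G M I N E + max_frame "verts G" "mates G M" I N E
 for G :: "'a graph" and M and I :: "'i set" and N E

locale tors = mcg G M for G :: "'a graph" and M +
 fixes T :: "'a torsoid"
 assumes T: "T:torsoids G M"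
begin

definition H where "H = fst T"
definition ep where "ep = snd T"
definition tE where "tE v w = (if {v, w}:edges H then ep {v, w} else {})"

lemma T_eq: "T = (H, ep)" unfolding H_def ep_def by simp

lemma TT: "torsoid_T1 M (H, ep)" "torsoid_T2 G M (H, ep)" "torsoid_T3 G (H, ep)" "torsoid_T4 G (H, ep)"
  "torsoid_T5 G M (H, ep)" "torsoid_T6 G (H, ep)" "torsoid_T7 G M (H, ep)"
 using T unfolding torsoids_def by (simp_all add: T_eq[symmetric])

lemma four: "at_least_four (verts H)" and simpleH: "simple_graph H"
 using TT(1) mc_simple unfolding torsoid_T1_def by auto

lemma bob_or_cycle: "bob H (torsoid_matching M H ep) | is_cycle H"
 using TT(1) unfolding torsoid_T1_def by auto

lemma edgeD: assumes "{v, w}:edges H" shows "v:verts H" "w:verts H" "v~=w"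
 using simple_edge[OF simpleH assms] by auto

lemma tE_sym: "tE v w = tE w v" unfolding tE_def by (simp add: insert_commute)
lemma tE_refl: "tE v v = {}" unfolding tE_def using edgeD(3)[of v v] by auto

text \<open>\<open>maxE\<close> comes from (T5) for an edge. For nonadjacent vertices a movable set would be a bridge between sets that
no edge joins by (T6), hence empty.\<close>

lemma frm:
 assumes g: "bij_betw g J (verts H)" shows "max_frame V Mt J g (%i j. tE (g i) (g j))"
proof -
 have gv: "g i:verts H" if "i:J" for i using g that unfolding bij_betw_def by blast
 have gi: "g i~=g j" if "i:J" "j:J" "i~=j" for i j using g that unfolding bij_betw_def inj_on_def by blast
 have gs: "g ` J = verts H" using g unfolding bij_betw_def by blast
 have tv: "mtight v" if "v:verts H" for v using TT(2) that unfolding torsoid_T2_def tight_mtight by auto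
 have dv: "v Int w = {}" if "v:verts H" "w:verts H" "v~=w" for v w using TT(4) that unfolding torsoid_T4_def disjoint_def by auto
 have de: "ep x Int ep y = {}" if "x:edges H" "y:edges H" "x~=y" for x y using TT(4) that unfolding torsoid_T4_def disjoint_family_on_def by auto
 have dve: "v Int ep x = {}" if "v:verts H" "x:edges H" for v x using TT(4) that unfolding torsoid_T4_def by auto
 have cov: "\<Union>(verts H) Un \<Union>(ep ` edges H) = V" using TT(4) unfolding torsoid_T4_def by auto
 have T5: "passable G M (ep {v, w}) v" "passable G M (ep {v, w}) w" "joined (edges G) (v Un ep {v, w}) w"
  "S<=v Un ep {v, w} Un w ==> passable G M S v ==> passable G M S w ==> S<=ep {v, w}"
  if "{v, w}:edges H" for v w S using TT(5) that unfolding torsoid_T5_def by auto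
 have four': "at_least_four J" using four at_least_four_image[of g J] g unfolding bij_betw_def by auto
 interpret f: frame V Mt J g "%i j. tE (g i) (g j)"
 proof unfold_locales
  fix i assume i: "i:J"
  show "mtight (g i)" by (rule tv[OF gv[OF i]])
  fix j assume j: "j:J"
  show "tE (g i) (g j) = tE (g j) (g i)" by (rule tE_sym)
  show "g i Int g j = {}" if "i~=j" by (rule dv[OF gv[OF i] gv[OF j] gi[OF i j that]])
  show "mtight (g i Un tE (g i) (g j))" if "i~=j"
   unfolding tE_def using T5(1)[of "g i" "g j"] tv[OF gv[OF i]] unfolding passable_def tight_mtight by auto
  fix k assume k: "k:J"
  show "g k Int tE (g i) (g j) = {}" unfolding tE_def using dve[OF gv[OF k]] by auto
  fix l assume l: "l:J"
  assume ne: "{i, j}~={k, l}"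
  have "{g i, g j}~={g k, g l}"
  proof
   assume "{g i, g j} = {g k, g l}"
   hence "g i = g k & g j = g l | g i = g l & g j = g k" unfolding doubleton_eq_iff .
   hence "i = k & j = l | i = l & j = k" using gi i j k l by metis
   thus False using ne by (auto simp: insert_commute)
  qed
  thus "tE (g i) (g j) Int tE (g k) (g l) = {}" unfolding tE_def using de by auto
 next show "tE (g i) (g i) = {}" for i by (rule tE_refl)
  show "EX i:J. EX j:J. i~=j" by (rule at_least_four_three(2)[OF four'])
  have a: "(UN i:J. g i) = \<Union>(verts H)" unfolding gs[symmetric] by simp
  have "(UN i:J. UN j:J. tE (g i) (g j)) = (UN v:verts H. UN w:verts H. tE v w)" unfolding gs[symmetric] by simp
  also have "\<dots> = \<Union>(ep ` edges H)"
  proof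
   show "(UN v:verts H. UN w:verts H. tE v w)<=\<Union>(ep ` edges H)" unfolding tE_def by (auto split: if_splits)
   show "\<Union>(ep ` edges H)<=(UN v:verts H. UN w:verts H. tE v w)"
   proof (rule UN_least)
    fix x assume x: "x:edges H"
    then obtain v w where vw: "x = {v, w}" by (rule simple_edgeE[OF simpleH])
    hence "ep x = tE v w" "v:verts H" "w:verts H" using x edgeD[of v w] unfolding tE_def by auto
    thus "ep x<=(UN v:verts H. UN w:verts H. tE v w)" by blast
   qed
  qed
  finally show "V = (UN i:J. g i) Un (UN i:J. UN j:J. tE (g i) (g j))" using a cov by simp
 qed
 show ?thesis
 proof unfold_locales
  show "EX k:J. k~=i & k~=j" if "i:J" "j:J" for i j by (rule at_least_four_three(1)[OF four' that])
  fix i j D assume ij: "i:J" "j:J" "i~=j" and D: "D<=g i" "mtight (g i - D)" "mtight (g j Un tE (g i) (g j) Un D)"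
  let ?v = "g i" and ?w = "g j"
  have v: "?v:verts H" "?w:verts H" "?v~=?w" using gv ij gi by auto
  have dvw: "?v Int ?w = {}" by (rule dv[OF v])
  have vV: "?v<=V" by (rule mtight_sub[OF tv[OF v(1)]])
  show "D = {}"
  proof (cases "{?v, ?w}:edges H")
   case True
   have dj: "?v Int ep {?v, ?w} = {}" "?w Int ep {?v, ?w} = {}" using dve v True by blast+
   have tEe: "tE ?v ?w = ep {?v, ?w}" unfolding tE_def using True by simp
   let ?S = "ep {?v, ?w} Un D"
   have "?v - ?S = ?v - D" "?v Un ?S = ?v Un ep {?v, ?w}" "?w - ?S = ?w - ep {?v, ?w}" "?w Un ?S = ?w Un ep {?v, ?w} Un D"
    using dj D(1) dvw by blast+
   moreover have "?S<=V" using T5(1)[OF True] D(1) vV unfolding passable_def by blast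
   ultimately have "passable G M ?S ?v" "passable G M ?S ?w"
    using T5(1,2)[OF True] D(2,3) unfolding passable_def tight_mtight tEe by simp_all
   hence "?S<=ep {?v, ?w}" by (intro T5(4)[OF True]) (use D(1) in blast)
   thus ?thesis using dj D(1) by blast
  next case False hence t0: "tE ?v ?w = {}" unfolding tE_def by simp
   have nj: "~ joined (edges G) ?v ?w" using TT(6) v False unfolding torsoid_T6_def by auto
   have vD: "(?v - D) Un D = ?v" using D(1) by blast
   have br: "bridge (?v - D) D ?w"
    by (rule bridgeI[OF D(2) tv[OF v(2)]]) (use D tv[OF v(1)] vD dvw t0 in auto)
   show ?thesis
   proof (rule closed_empty)
    show "D<=V" using D(1) vV by blast
    show "D~=V" using D(1) mtight_neV[OF tv[OF v(1)]] vV by blast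
    fix m x assume m: "m:Mt" and x: "x:D"
    show "m x:D"
    proof (rule ccontr)
     assume "m x~:D"
     then obtain y where "y:D" "m y:?w" using bridge_open(2)[OF br m x] by blast
     thus False using nj joined_edges[OF vV] m D(1) unfolding link_def by blast
    qed
   qed
  qed
 qed
qed

lemma edge_iff:
 assumes v: "v:verts H" "w:verts H"
 shows "{v, w}:edges H <-> v~=w & (EX m:Mt. EX x:v. m x:w Un tE v w)"
proof -
 interpret f: max_frame V Mt "verts H" "%v. v" tE by (rule frm) (simp add: bij_betw_def inj_on_def)
 have ad: "f.adj v w <-> v~=w & (EX m:Mt. EX x:v. m x:w Un tE v w)" unfolding f.adj_def f.lk_def by blast
 have vV: "v<=V" "w<=V" using f.N_V v by blast+
 show ?thesis unfolding ad[symmetric]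
 proof
  assume e: "{v, w}:edges H"
  have te: "tE v w = ep {v, w}" unfolding tE_def using e by simp
  interpret g: fgraph G M "verts H" "%v. v" tE by unfold_locales
  have "joined (edges G) (v Un tE v w) w" using TT(5) e unfolding torsoid_T5_def te by auto
  then obtain m where m: "m:Mt" "link m (v Un tE v w) w" using joined_edges[of "v Un tE v w" w] vV f.E_V[OF v] by auto
  hence "f.lk m v w" using g.lk_joined[OF v edgeD(3)[OF e]] by blast
  thus "f.adj v w" unfolding f.adj_def using m by blast
 next assume a: "f.adj v w"
  show "{v, w}:edges H"
  proof (rule ccontr)
   assume ne: "{v, w}~:edges H"
   hence "tE v w = {}" unfolding tE_def by simp
   then obtain m x where m: "m:Mt" "x:v" "m x:w" "v~=w" using a ad by blast
   hence "joined (edges G) v w" using joined_edges[OF vV(1)] unfolding link_def by blast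
   thus False using TT(6) v m(4) ne unfolding torsoid_T6_def by auto
  qed
 qed
qed

lemma maxf: "max_frame V Mt (verts H) (%v. v) tE"
 by (rule frm) (simp add: bij_betw_def inj_on_def)

end

sublocale tors < h: fmax G M "verts H" "%v. v" tE
proof -
 interpret m: max_frame V Mt "verts H" "%v. v" tE by (rule maxf)
 show "fmax G M (verts H) (%v. v) tE" by unfold_locales
qed

context tors
begin

lemma adj_edge: "v:verts H ==> w:verts H ==> h.adj v w <-> {v, w}:edges H"
 unfolding edge_iff h.adj_def h.lk_def by blast

lemma gE_edges: "h.gE = edges H"
proof
 show "h.gE<=edges H" unfolding h.gE_def qed_edges_def using adj_edge by blast
 show "edges H<=h.gE"
 proof
  fix e assume e: "e:edges H"
  then obtain v w where vw: "e = {v, w}" by (rule simple_edgeE[OF simpleH])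
  thus "e:h.gE" using h.gE_iff[of v w] adj_edge[of v w] edgeD[of v w] e by simp
 qed
qed

lemma gH_H: "h.gH = H"
 unfolding h.gH_def gE_edges by simp

lemma tm: "torsoid_matching M h.gH h.gep = torsoid_matching M H ep"
proof -
 have g: "h.gep {v, w} = ep {v, w}" if "{v, w}:edges H" for v w
  using h.gep[of v w] adj_edge[of v w] edgeD[OF that] that unfolding tE_def by simp
 have "(x = {v, w} & {v, w}:edges H & joined M (v Un h.gep {v, w}) w) <->
  (x = {v, w} & {v, w}:edges H & joined M (v Un ep {v, w}) w)" for x v w
  using g[of v w] by (cases "{v, w}:edges H") simp_all
 thus ?thesis unfolding torsoid_matching_def gH_H by (intro Collect_cong ex_cong1)
qed

lemma bobQ: assumes "h.subres Q" "~ is_cycle H" shows "bobfam (verts H) Q"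
proof -
 have "bob H (torsoid_matching M H ep) <-> bobfam (verts H) Q"
  using h.quotient(2)[OF assms(1)] unfolding h.matching_eq[symmetric] tm unfolding gH_H .
 thus ?thesis using bob_or_cycle assms(2) by blast
qed

lemma deg3:
 assumes nc: "~ is_cycle H" and uvw: "u:verts H" "v:verts H" "w:verts H"
 shows "EX m:Mt. ~ h.lk m u v & ~ h.lk m u w"
proof (rule ccontr)
 assume c: "~ ?thesis"
 obtain hh where hh: "h.tour hh" using h.tour_ex by blast
 note Q = h.subres_res[OF hh]
 have "is_cycle h.gH" by (rule h.deg2_cycle(1)[OF Q bobQ[OF Q nc] four uvw]) (use c in blast)
 thus False using nc gH_H by simp
qed

lemma locf: assumes nc: "~ is_cycle H" shows "loc_frame V Mt (verts H) (%v. v) tE"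
proof unfold_locales
 fix hh X u v w
 assume a: "h.tour hh" "mtight X" "u:verts H" "v:verts H" "w:verts H" "u~=v" "u~=w" "v~=w"
  "~ par (X Int h.res hh u)" "par (X Int h.res hh v)"
  and only: "!!k. k:verts H ==> par (X Int h.res hh k) ==> h.adj u k ==> k = v"
 show "~ par (X Int h.res hh u Int tE u w)" by (rule h.deg3_nosplit[OF deg3[OF nc] a]) (assumption | rule only)+
qed

lemma cyc:
 assumes c: "is_cycle H"
 shows "EX n g. bij_betw g {..<n} (verts H) & ring7 V Mt n g (%i j. tE (g i) (g j))"
proof -
 obtain n g where g: "3<=n" "bij_betw g {..<n} (verts H)"
  "ALL i<n. ALL j<n. {g i, g j}:edges H <-> j = Suc i mod n | i = Suc j mod n" using is_cycle_index[OF c] by blast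
 have "card (verts H) = n" using bij_betw_same_card[OF g(2)] by simp
 moreover have "finite (verts H)" using bij_betw_finite[OF g(2)] by simp
 ultimately have n: "4<=n" using four unfolding at_least_four_def by simp
 interpret f: max_frame V Mt "{..<n}" g "%i j. tE (g i) (g j)" by (rule frm[OF g(2)])
 have gv: "g i:verts H" if "i < n" for i using g(2) that unfolding bij_betw_def by auto
 have gi: "g i~=g j" if "i < n" "j < n" "i~=j" for i j using g(2) that unfolding bij_betw_def inj_on_def by auto
 have ed: "{g i, g j}:edges H" if "m:Mt" "i < n" "j < n" "f.lk m i j" for m i j
  using that edge_iff[OF gv gv] gi unfolding f.lk_def by blast
 interpret r: ring_frame V Mt n g "%i j. tE (g i) (g j)"
 proof (rule ring_frameI[OF _ n])
  show "frame V Mt {..<n} g (%i j. tE (g i) (g j))" by unfold_locales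
  fix m i j assume a: "m:Mt" "i < n" "j < n" "f.lk m i j"
  thus "j = Suc i mod n | i = Suc j mod n" using ed[OF a] g(3) by blast
 qed
 have "ring7 V Mt n g (%i j. tE (g i) (g j))"
 proof unfold_locales
  fix i j k P1 P2 P3
  assume i: "i < n" "j < n" "k < n" and a: "f.adj i j" "f.adj i k" and jk: "j~=k"
   and P: "mtight P1" "mtight P2" "mtight P3" "P1 Int P2 = {}" "P1 Int P3 = {}" "P2 Int P3 = {}"
    "P1 Un P2 Un P3 = tE (g i) (g j) Un g i Un tE (g i) (g k)" "mtight (g j Un P1 Un P2)" "mtight (P2 Un P3 Un g k)"
  have e: "{g i, g j}:edges H" "{g i, g k}:edges H" using a ed i unfolding f.adj_def by blast+
  hence e': "{g j, g i}:edges H" by (simp add: insert_commute)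
  have t: "tE (g i) (g j) = ep {g j, g i}" "tE (g i) (g k) = ep {g i, g k}"
   unfolding tE_def using e by (simp_all add: insert_commute)
  have "~ (EX P1 P2 P3. mtight P1 & mtight P2 & mtight P3 & P1 Int P2 = {} & P1 Int P3 = {} & P2 Int P3 = {} &
   P1 Un P2 Un P3 = ep {g j, g i} Un g i Un ep {g i, g k} & mtight (g j Un P1 Un P2) & mtight (P2 Un P3 Un g k))"
   using TT(7) c e(2) e' gi[OF i(2,3) jk] unfolding torsoid_T7_def case_prod_conv tight_mtight by blast
  thus False using P unfolding t by blast
 qed
 thus ?thesis using g(2) by blast
qed

end

section \<open>The cleaving map and its preimages\<close>

context mcg
begin

lemma torsoid_eqI:
 assumes T: "tors G M T" "tors G M T'"
  and g: "bij_betw g J (verts (tors.H T))" "bij_betw g' J' (verts (tors.H T'))"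
  and f: "bij_betw f J' J" and N: "!!v. v:J' ==> g' v = g (f v)"
  and E: "!!v w. v:J' ==> w:J' ==> tors.tE T' (g' v) (g' w) = tors.tE T (g (f v)) (g (f w))"
 shows "T = T'"
proof -
 interpret t: tors G M T by (rule T(1))
 interpret t': tors G M T' by (rule T(2))
 have "verts t'.H = (%v. g (f v)) ` J'" using g(2) N unfolding bij_betw_def by force
 also have "\<dots> = g ` (f ` J')" by (simp add: image_image)
 also have "\<dots> = verts t.H" using f g(1) unfolding bij_betw_def by simp
 finally have vs: "verts t'.H = verts t.H" .
 have tE: "t'.tE v w = t.tE v w" if vw: "v:verts t.H" "w:verts t.H" for v w proof -
  have im: "verts t.H = g' ` J'" using g(2) vs unfolding bij_betw_def by simp
  obtain a where a: "v = g' a" "a:J'" using vw(1) unfolding im by (rule imageE)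
  obtain b where b: "w = g' b" "b:J'" using vw(2) unfolding im by (rule imageE)
  note ab = a(2) b(2) a(1) b(1)
  show ?thesis unfolding ab(3,4) using E[OF ab(1,2)] N[OF ab(1)] N[OF ab(2)] by simp
 qed
 have ed: "{v, w}:edges t.H <-> {v, w}:edges t'.H" if vw: "v:verts t.H" "w:verts t.H" for v w
  using t.edge_iff[OF vw] t'.edge_iff[of v w] vw vs tE[OF vw] by simp
 have es: "edges t.H = edges t'.H"
 proof
  show "edges t.H<=edges t'.H"
  proof
   fix e assume e: "e:edges t.H"
   then obtain v w where "e = {v, w}" "v:verts t.H" "w:verts t.H" by (rule simple_edgeE[OF t.simpleH])
   thus "e:edges t'.H" using ed e by simp
  qed
  show "edges t'.H<=edges t.H"
  proof
   fix e assume e: "e:edges t'.H"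
   then obtain v w where "e = {v, w}" "v:verts t.H" "w:verts t.H" unfolding vs[symmetric] by (rule simple_edgeE[OF t'.simpleH])
   thus "e:edges t.H" using ed e by simp
  qed
 qed
 have H: "t.H = t'.H" by (rule graph.expand) (use vs es in simp)
 have PE: "t.ep:edges t.H \<rightarrow>\<^sub>E Pow V" "t'.ep:edges t.H \<rightarrow>\<^sub>E Pow V"
  using t.TT(3) t'.TT(3) unfolding torsoid_T3_def case_prod_conv es by blast+
 have "t.ep = t'.ep"
 proof (rule PiE_ext[OF PE])
  fix e assume e: "e:edges t.H"
  then obtain v w where vw: "e = {v, w}" "v:verts t.H" "w:verts t.H" by (rule simple_edgeE[OF t.simpleH])
  thus "t.ep e = t'.ep e" using tE[OF vw(2,3)] e es unfolding t.tE_def t'.tE_def by simp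
 qed
 thus ?thesis using t.T_eq t'.T_eq H by metis
qed

definition star where "star \<P> <-> tfam \<P> (%P. P) & at_least_four \<P> & bobfam \<P> (%P. P)"

lemma part_fgraph:
 assumes tf: "tfam \<P> (%P. P)" and four: "at_least_four \<P>"
 shows "fgraph G M \<P> (%P. P) (%_ _. {})" "part_frame V Mt \<P> (%P. P)"
proof -
 interpret f: frame V Mt \<P> "%P. P" "%_ _. {}" by (rule tfam_frame[OF tf at_least_four_three(2)[OF four]])
 show "fgraph G M \<P> (%P. P) (%_ _. {})" by unfold_locales
 show "part_frame V Mt \<P> (%P. P)" by unfold_locales (rule at_least_four_three(1)[OF four])
qed

lemma collapse_fgraph:
 assumes tf: "tfam \<P> (%P. P)" and four: "at_least_four \<P>"
 shows "collapse G \<P> = fgraph.gH G M \<P> (%P. P) (%_ _. {})" "frame.subres V Mt \<P> (%P. P) (%_ _. {}) (%P. P)"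
  "bob (collapse G \<P>) (collapse_matching M \<P>) <-> bobfam \<P> (%P. P)"
proof -
 interpret f: fgraph G M \<P> "%P. P" "%_ _. {}" by (rule part_fgraph[OF assms])
 show Q: "f.subres (%P. P)" unfolding f.subres_def f.U_def using f.N_disj f.N_tight f.cover by auto
 have "f.gE = qed_edges \<P> (%P. P) (joined (edges G))"
  unfolding f.gE_def by (rule qed_edges_cong) (use f.adj_link[OF _ _ Q] in auto)
 hence 1: "joined_pairs (edges G) \<P> = f.gE" unfolding joined_pairs_def qed_edges_def by simp
 have "qed_edges \<P> (%P. P) (joined M) = qed_edges \<P> (%P. P) (f.lk (mate M))"
 proof (rule qed_edges_cong)
  fix i j assume ij: "i:\<P>" "j:\<P>" "i~=j"
  show "joined M i j = f.lk (mate M) i j"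
   using joined_M[OF mtight_sub[OF f.N_tight[OF ij(1)]]] f.subres_link[OF Q ij mM] by blast
 qed
 hence 2: "collapse_matching M \<P> = qed_edges \<P> (%P. P) (f.lk (mate M))"
  unfolding collapse_matching_def joined_pairs_def by (simp add: qed_edges_def)
 show H: "collapse G \<P> = f.gH" unfolding collapse_def f.gH_def 1 by simp
 show "bob (collapse G \<P>) (collapse_matching M \<P>) <-> bobfam \<P> (%P. P)"
  unfolding H 2 by (rule f.quotient(2)[OF Q])
qed

lemma star_iff:
 "maximal_star G M \<C> \<P> <-> star \<P> & (ALL P:\<P>. cut G P:\<C>)"
proof -
 have "tight_set_partition G M \<P> <-> tfam \<P> (%P. P)"
  unfolding tight_set_partition_def tight_mtight partition_on_def tfam_def disjoint_def using mtight_ne by auto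
 thus ?thesis unfolding maximal_star_def star_def using collapse_fgraph(3) by blast
qed

lemma star_deg2:
 assumes "star \<P>" "u:\<P>" "v:\<P>" "w:\<P>" "u~=v" "u~=w" "!!m. m:Mt ==> link m u v | link m u w"
 shows "is_C4 (collapse G \<P>)" "card \<P> = 4"
proof -
 have tf: "tfam \<P> (%P. P)" "at_least_four \<P>" "bobfam \<P> (%P. P)" using assms(1) unfolding star_def by auto
 interpret f: fgraph G M \<P> "%P. P" "%_ _. {}" by (rule part_fgraph[OF tf(1,2)])
 note Q = collapse_fgraph(2)[OF tf(1,2)]
 have l: "f.lk m u v | f.lk m u w" if "m:Mt" for m
  using assms(7)[OF that] assms(5,6) unfolding f.lk_def link_def by auto
 note c = f.deg2_cycle[OF Q tf(3,2) assms(2-4)]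
 show "card \<P> = 4" by (rule c(2)) (rule l)
 thus "is_C4 (collapse G \<P>)" unfolding is_C4_def
  using c(1) l unfolding collapse_fgraph(1)[OF tf(1,2), symmetric] by (auto simp: collapse_def)
qed

lemma cycle_deg2:
 assumes "tfam \<P> (%P. P)" "at_least_four \<P>" "is_cycle (collapse G \<P>)"
 shows "EX u:\<P>. EX v:\<P>. EX w:\<P>. u~=v & u~=w & (ALL m:Mt. link m u v | link m u w)"
proof -
 interpret f: fgraph G M \<P> "%P. P" "%_ _. {}" by (rule part_fgraph[OF assms(1,2)])
 obtain u v w where uvw: "u:\<P>" "v:\<P>" "w:\<P>" "ALL m:Mt. f.lk m u v | f.lk m u w"
  using f.cycle_not_deg3 assms(3) unfolding collapse_fgraph(1)[OF assms(1,2)] by blast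
 obtain v' w' where v': "v':\<P>" "w':\<P>" "u~=v'" "u~=w'" "ALL m:Mt. f.lk m u v' | f.lk m u w'"
  using f.proper_nbrs[OF uvw(1-3)] uvw(4) by blast
 have "ALL m:Mt. link m u v' | link m u w'" using v'(5) unfolding f.lk_def link_def by auto
 thus ?thesis using uvw(1) v' by blast
qed

lemma cleaves_iff: "cleaves (collapse G \<P>) T <-> (ALL P:\<P>. EX v:verts (fst T). v<=P)"
 unfolding cleaves_def collapse_def by simp

lemma cleave_exists:
 assumes st: "star \<P>" shows "EX T:torsoids G M. cleaves (collapse G \<P>) T"
proof -
 have tf: "tfam \<P> (%P. P)" "at_least_four \<P>" "bobfam \<P> (%P. P)" using st unfolding star_def by auto
 interpret f: fgraph G M \<P> "%P. P" "%_ _. {}" by (rule part_fgraph[OF tf(1,2)])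
 interpret p: part_frame V Mt \<P> "%P. P" by (rule part_fgraph[OF tf(1,2)])
 show ?thesis
 proof (cases "EX u:\<P>. EX v:\<P>. EX w:\<P>. ALL m:Mt. f.lk m u v | f.lk m u w")
  case True
  then obtain u v0 w0 where u: "u:\<P>" "v0:\<P>" "w0:\<P>" "ALL m:Mt. f.lk m u v0 | f.lk m u w0" by blast
  obtain v w where vw: "v:\<P>" "w:\<P>" "u~=v" "u~=w" "ALL m:Mt. f.lk m u v | f.lk m u w"
   using f.proper_nbrs[OF u(1-3)] u(4) by blast
  have l: "link m u v | link m u w" if "m:Mt" for m using vw(5) that unfolding f.lk_def link_def by auto
  obtain q where q: "\<P> = q ` {..<4}" "ring_part V Mt 4 q"
   using deg2_C4[OF tf(1,3,2) u(1) vw(1-4)] l by blast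
  have ref: "ALL i<4. EX P:\<P>. q i<=P" unfolding q(1) by blast
  obtain n C F where r7: "ring7 V Mt n C F" and cl: "ALL P:\<P>. EX i<n. C i<=P"
   using ring_exists[OF q(2) ref tf(1)] by blast
  interpret r: ring7 V Mt n C F by (rule r7)
  interpret g: fgraph G M "{..<n}" C F by unfold_locales
  obtain hh where hh: "r.tour hh" using r.tour_ex by blast
  have cyc: "is_cycle g.gH"
   unfolding g.gH_def g.gE_def
   by (rule cyc_qed[OF g.N_inj, of "%i. i"]) (use r.n4 r.adj_iff in \<open>auto simp: bij_betw_def r.s_def\<close>)
  have "(g.gH, g.gep):torsoids G M"
  proof (rule g.torsoid[OF _ _ r.subres_res[OF hh] disjI2[OF cyc]])
   show "max_frame V Mt {..<n} C F" by unfold_locales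
   show "at_least_four {..<n}" using r.n4 unfolding at_least_four_def by simp
   fix i j k P1 P2 P3
   assume a: "i:{..<n}" "j:{..<n}" "k:{..<n}" and b: "r.adj i j" "r.adj i k" "j~=k" "mtight P1" "mtight P2" "mtight P3"
    "P1 Int P2 = {}" "P1 Int P3 = {}" "P2 Int P3 = {}" "P1 Un P2 Un P3 = F i j Un C i Un F i k"
    "mtight (C j Un P1 Un P2)" "mtight (P2 Un P3 Un C k)"
   show False by (rule r.T7[OF _ _ _ b]) (use a in auto)
  qed
  moreover have "cleaves (collapse G \<P>) (g.gH, g.gep)" unfolding cleaves_iff g.gH_def using cl by auto
  ultimately show ?thesis by blast
 next case False
  have d3: "EX m:Mt. ~ f.lk m u v & ~ f.lk m u w" if "u:\<P>" "v:\<P>" "w:\<P>" for u v w using False that by blast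
  interpret s: split_free V Mt \<P> "%P. P"
   by unfold_locales (rule p.deg3_B_disj[OF d3])
  interpret g: fgraph G M \<P> s.C s.F by unfold_locales
  have nc: "~ is_cycle g.gH"
  proof
   assume "is_cycle g.gH"
   then obtain u v w where uvw: "u:\<P>" "v:\<P>" "w:\<P>" "ALL m:Mt. s.core.lk m u v | s.core.lk m u w" using g.cycle_not_deg3 by blast
   hence "ALL m:Mt. f.lk m u v | f.lk m u w" using s.core_lk by blast
   thus False using d3[OF uvw(1-3)] by blast
  qed
  have "(g.gH, g.gep):torsoids G M"
   by (rule g.torsoid[OF _ tf(2) s.core_subres]) (use nc tf(3) s.core.max_frame_axioms in blast)+
  moreover have "cleaves (collapse G \<P>) (g.gH, g.gep)" unfolding cleaves_iff g.gH_def using s.C_N by auto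
  ultimately show ?thesis by blast
 qed
qed

end

context tors
begin

lemma cyc_deg2:
 assumes c: "is_cycle H" and tf: "tfam \<P> (%P. P)" "at_least_four \<P>" and cl: "ALL P:\<P>. EX v:verts H. v<=P"
 shows "EX u:\<P>. EX v:\<P>. EX w:\<P>. u~=v & u~=w & (ALL m:Mt. link m u v | link m u w)"
proof -
 obtain n g where g: "bij_betw g {..<n} (verts H)" "ring7 V Mt n g (%i j. tE (g i) (g j))" using cyc[OF c] by blast
 interpret r: ring7 V Mt n g "%i j. tE (g i) (g j)" by (rule g(2))
 have im: "verts H = g ` {..<n}" using g(1) unfolding bij_betw_def by simp
 have cl': "ALL P:\<P>. EX i<n. g i<=P" using cl unfolding im by blast
 have "\<P>~={}" using tf(2) unfolding at_least_four_def by auto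
 then obtain P where P: "P:\<P>" by blast
 obtain R1 R2 where R: "R1:\<P>" "R2:\<P>" "R1~=P" "R2~=P" "ALL m:Mt. link m P (if r.cr m 0 then R1 else R2)"
  using r.ring_links[OF tf cl' P] by blast
 have "link m P R1 | link m P R2" if "m:Mt" for m using R(5) that by (cases "r.cr m 0") auto
 thus ?thesis using P R(1-4) by blast
qed

lemma noncyc_cleave:
 assumes nc: "~ is_cycle H" and tf: "tfam \<P> (%P. P)" "at_least_four \<P>" and cl: "ALL P:\<P>. EX v:verts H. v<=P"
 shows "EX Q. h.subres Q & \<P> = Q ` verts H & inj_on Q (verts H)"
proof -
 interpret l: loc_frame V Mt "verts H" "%v. v" tE by (rule locf[OF nc])
 obtain hh where hh: "h.tour hh" using h.tour_ex by blast
 show ?thesis by (rule l.bob_cleave[OF bobQ[OF h.subres_res[OF hh] nc] hh tf cl])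
qed

lemma noncyc_deg3:
 assumes nc: "~ is_cycle H" and Q: "h.subres Q" "inj_on Q (verts H)" "\<P> = Q ` verts H"
  and uvw: "u:\<P>" "v:\<P>" "w:\<P>" "u~=v" "u~=w" and l: "ALL m:Mt. link m u v | link m u w"
 shows False
proof -
 obtain a b c where abc: "a:verts H" "b:verts H" "c:verts H" "u = Q a" "v = Q b" "w = Q c" using uvw Q(3) by blast
 have ne: "a~=b" "a~=c" using uvw(4,5) abc by blast+
 obtain m where m: "m:Mt" "~ h.lk m a b" "~ h.lk m a c" using deg3[OF nc abc(1-3)] by blast
 have "~ link m u v" using h.subres_link[OF Q(1) abc(1,2) ne(1) m(1)] m(2) abc by simp
 moreover have "~ link m u w" using h.subres_link[OF Q(1) abc(1,3) ne(2) m(1)] m(3) abc by simp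
 ultimately show False using l m(1) by blast
qed

end

context mcg
begin

text \<open>A partition that cleaves a cyclic torsoid has classes of degree two, and none if it cleaves a noncyclic
one. So both torsoids are of the same kind.\<close>

lemma cleave_unique:
 assumes st: "star \<P>" and T: "T:torsoids G M" "cleaves (collapse G \<P>) T" and T': "T':torsoids G M" "cleaves (collapse G \<P>) T'"
 shows "T = T'"
proof -
 have tf: "tfam \<P> (%P. P)" "at_least_four \<P>" "bobfam \<P> (%P. P)" using st unfolding star_def by auto
 interpret t: tors G M T by unfold_locales (rule T(1))
 interpret t': tors G M T' by unfold_locales (rule T'(1))
 have cl: "ALL P:\<P>. EX v:verts t.H. v<=P" "ALL P:\<P>. EX v:verts t'.H. v<=P"
  using T(2) T'(2) unfolding cleaves_iff t.H_def t'.H_def by auto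
 have mix: False if a: "is_cycle (tors.H S)" "~ is_cycle (tors.H S')" "tors G M S" "tors G M S'"
  "ALL P:\<P>. EX v:verts (tors.H S). v<=P" "ALL P:\<P>. EX v:verts (tors.H S'). v<=P" for S S' proof -
  obtain u v w where uvw: "u:\<P>" "v:\<P>" "w:\<P>" "u~=v" "u~=w" "ALL m:Mt. link m u v | link m u w"
   using tors.cyc_deg2[OF a(3,1) tf(1,2) a(5)] by blast
  obtain Q where Q: "frame.subres V Mt (verts (tors.H S')) (%v. v) (tors.tE S') Q" "\<P> = Q ` verts (tors.H S')" "inj_on Q (verts (tors.H S'))"
   using tors.noncyc_cleave[OF a(4,2) tf(1,2) a(6)] by blast
  show False by (rule tors.noncyc_deg3[OF a(4,2) Q(1,3,2) uvw])
 qed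
 note tt = t.tors_axioms t'.tors_axioms
 show ?thesis
 proof (cases "is_cycle t.H")
  case True hence c': "is_cycle t'.H" using mix tt cl by blast
  obtain n g where g: "bij_betw g {..<n} (verts t.H)" "ring7 V Mt n g (%i j. t.tE (g i) (g j))" using t.cyc[OF True] by blast
  obtain n' g' where g': "bij_betw g' {..<n'} (verts t'.H)" "ring7 V Mt n' g' (%i j. t'.tE (g' i) (g' j))" using t'.cyc[OF c'] by blast
  have im: "verts t.H = g ` {..<n}" "verts t'.H = g' ` {..<n'}" using g(1) g'(1) unfolding bij_betw_def by simp_all
  have cl': "ALL P:\<P>. EX i<n. g i<=P" "ALL P:\<P>. EX i<n'. g' i<=P" using cl unfolding im by blast+
  have rp: "ring_pair V Mt n n' g (%i j. t.tE (g i) (g j)) g' (%i j. t'.tE (g' i) (g' j)) \<P>"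
   unfolding ring_pair_def ring_pair_axioms_def using g(2) g'(2) tf(1,2) cl' by blast
  obtain f where f: "bij_betw f {..<n'} {..<n}" "ALL v<n'. g' v = g (f v)" "ALL v<n'. ALL w<n'. t'.tE (g' v) (g' w) = t.tE (g (f v)) (g (f w))"
   using ring_pair_match[OF rp] by blast
  show ?thesis by (rule torsoid_eqI[OF tt g(1) g'(1) f(1)]) (use f in auto)
 next case False hence c': "~ is_cycle t'.H" using mix tt cl by blast
  obtain hh where hh: "t.h.tour hh" using t.h.tour_ex by blast
  obtain hh' where hh': "t'.h.tour hh'" using t'.h.tour_ex by blast
  have bp: "bob_pair V Mt (verts t.H) (%v. v) t.tE (verts t'.H) (%v. v) t'.tE \<P> hh hh'"
   unfolding bob_pair_def bob_pair_axioms_def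
   using t.locf[OF False] t'.locf[OF c'] hh hh' t.bobQ[OF t.h.subres_res[OF hh] False] t'.bobQ[OF t'.h.subres_res[OF hh'] c'] tf(1,2) cl
   by blast
  obtain f where f: "bij_betw f (verts t'.H) (verts t.H)" "ALL v:verts t'.H. v = f v" "ALL v:verts t'.H. ALL w:verts t'.H. t'.tE v w = t.tE (f v) (f w)"
   using bob_pair_match[OF bp] by blast
  have id: "bij_betw (%v. v) (verts t.H) (verts t.H)" "bij_betw (%v. v) (verts t'.H) (verts t'.H)" by (simp_all add: bij_betw_def inj_on_def)
  show ?thesis by (rule torsoid_eqI[OF tt id f(1)]) (use f in auto)
 qed
qed

lemma kappa_iff:
 assumes "star \<P>" "T:torsoids G M"
 shows "kappa G M (collapse G \<P>) = T <-> cleaves (collapse G \<P>) T"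
proof -
 obtain S where S: "S:torsoids G M" "cleaves (collapse G \<P>) S" using cleave_exists[OF assms(1)] by blast
 have "kappa G M (collapse G \<P>) = S"
  unfolding kappa_def by (rule the_equality) (use S cleave_unique[OF assms(1)] in blast)+
 thus ?thesis using S cleave_unique[OF assms(1)] assms(2) by blast
qed

lemma preimage:
 assumes T: "T:torsoids G M"
 shows "kappa_preimage G M \<C> T = collapse G ` {\<P>. star \<P> & (ALL P:\<P>. cut G P:\<C>) & (ALL P:\<P>. EX v:verts (fst T). v<=P)}"
proof -
 have "kappa_preimage G M \<C> T = {collapse G \<P> | \<P>. star \<P> & (ALL P:\<P>. cut G P:\<C>) & kappa G M (collapse G \<P>) = T}"
  unfolding kappa_preimage_def torsos_def star_iff by blast
 also have "\<dots> = collapse G ` {\<P>. star \<P> & (ALL P:\<P>. cut G P:\<C>) & (ALL P:\<P>. EX v:verts (fst T). v<=P)}"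
  using kappa_iff[OF _ T] unfolding cleaves_iff by blast
 finally show ?thesis .
qed

lemma collapse_inj: "collapse G \<P> = collapse G \<Q> ==> \<P> = \<Q>"
 unfolding collapse_def by simp

lemma cut_compl: assumes "X<=V" shows "cut G (V - X) = cut G X"
proof -
 have "e:cut G (V - X) <-> e:cut G X" if e: "e:edges G" for e proof -
  obtain x y where xy: "e = {x, y}" "x:V" "y:V" using e by (rule simple_edgeE[OF mc_simple[OF mc]])
  show ?thesis using cut_iff[OF mc_simple[OF mc], of x y] e xy by auto
 qed
 moreover have "cut G Y<=edges G" for Y unfolding cut_def by blast
 ultimately show ?thesis by blast
qed

text \<open>The points on which \<open>X\<close> and \<open>Y\<close> agree are closed under all mate functions.\<close>

lemma cut_eq:
 assumes X: "X<=V" and Y: "Y<=V" and c: "cut G X = cut G Y" shows "X = Y | X = V - Y"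
proof -
 define D where "D = {x:V. x:X <-> x:Y}"
 have cl: "m x:D" if m: "m:Mt" and x: "x:D" for m x proof -
  have xV: "x:V" "m x:V" using x mate_in[OF m] unfolding D_def by auto
  have e: "{x, m x}:edges G" by (rule mate_edge[OF mc m xV(1)])
  show ?thesis using cut_iff[OF mc_simple[OF mc] e, of X] cut_iff[OF mc_simple[OF mc] e, of Y] c x xV unfolding D_def by auto
 qed
 have "D = {} | D = V"
 proof (cases "D = V")
  case False
  have "D = {}" by (rule closed_empty[OF _ False]) (use cl in \<open>auto simp: D_def\<close>)
  thus ?thesis ..
 qed simp
 thus ?thesis using X Y unfolding D_def by blast
qed

lemma nested_nest:
 assumes X: "mtight X" and Y: "mtight Y" shows "nested G (cut G X) (cut G Y) <-> nest X Y"
proof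
 have V: "X<=V" "Y<=V" using X Y mtight_sub by auto
 assume "nested G (cut G X) (cut G Y)"
 then obtain A B where AB: "A<=V" "B<=V" "A Int B = {}" "cut G X = cut G A" "cut G Y = cut G B" unfolding nested_def by blast
 have "X = A | X = V - A" "Y = B | Y = V - B" using cut_eq V AB by auto
 thus "nest X Y" unfolding nest_def using AB(1-3) by (elim disjE) blast+
next
 have V: "X<=V" "Y<=V" using X Y mtight_sub by auto
 have n: "nested G (cut G X) (cut G Y)" if "A<=V" "B<=V" "A Int B = {}" "cut G X = cut G A" "cut G Y = cut G B" for A B
  unfolding nested_def using that by blast
 note cc = cut_compl[OF V(1), symmetric] cut_compl[OF V(2), symmetric]
 assume "nest X Y"
 then consider "X Int Y = {}" | "X<=Y" | "Y<=X" | "X Un Y = V" unfolding nest_def by blast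
 thus "nested G (cut G X) (cut G Y)"
 proof cases
  case 1 thus ?thesis by (intro n[of X Y]) (use V in auto)
 next case 2 thus ?thesis by (intro n[of X "V - Y"] cc refl) (use V in auto)
 next case 3 thus ?thesis by (intro n[of "V - X" Y] cc refl) (use V in auto)
 next case 4 thus ?thesis by (intro n[of "V - X" "V - Y"] cc refl) (use V in auto)
 qed
qed

text \<open>A tight cut has two sides, and cuts are nested iff their sides are, in either choice.\<close>

lemma maximal_mnf:
 assumes mx: "maximal_nested_tight_cuts G M \<C>" shows "mnf {X. mtight X & cut G X:\<C>}"
proof -
 have tc: "EX X. mtight X & C = cut G X" if "C:\<C>" for C
  using mx that unfolding maximal_nested_tight_cuts_def nested_tight_cuts_def tight_cut_def tight_mtight by blast
 have pw: "nested G C C'" if "C:\<C>" "C':\<C>" "C~=C'" for C C'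
  using mx that unfolding maximal_nested_tight_cuts_def nested_tight_cuts_def pairwise_def by blast
 have mxx: "\<D> = \<C>" if "nested_tight_cuts G M \<D>" "\<C><=\<D>" for \<D>
  using mx that unfolding maximal_nested_tight_cuts_def by blast
 show ?thesis unfolding mnf_def
 proof (intro conjI ballI allI impI)
  fix X assume "X:{X. mtight X & cut G X:\<C>}"
  hence X: "mtight X" "cut G X:\<C>" by auto
  show "mtight X" by (rule X(1))
  show "V - X:{X. mtight X & cut G X:\<C>}" using X cut_compl[OF mtight_sub[OF X(1)]] mtight_compl by simp
  fix Y assume "Y:{X. mtight X & cut G X:\<C>}"
  hence Y: "mtight Y" "cut G Y:\<C>" by auto
  show "nest X Y"
  proof (cases "cut G X = cut G Y")
   case True hence "X = Y | X = V - Y" using cut_eq mtight_sub X Y by blast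
   thus ?thesis unfolding nest_def by blast
  next case False thus ?thesis using pw[OF X(2) Y(2)] nested_nest[OF X(1) Y(1)] by blast
  qed
 next fix Y assume Y: "mtight Y" and n: "ALL X:{X. mtight X & cut G X:\<C>}. nest X Y"
  have nn: "nested G C (cut G Y) & nested G (cut G Y) C" if C: "C:\<C>" for C proof -
   obtain X where X: "mtight X" "C = cut G X" using tc[OF C] by blast
   hence "nest X Y" using n C by blast
   thus ?thesis unfolding X(2) nested_nest[OF X(1) Y] nested_nest[OF Y X(1)] using nest_sym by blast
  qed
  have "nested_tight_cuts G M (insert (cut G Y) \<C>)"
   unfolding nested_tight_cuts_def tight_cut_def tight_mtight pairwise_insert
  proof (intro conjI ballI impI allI)
   fix C assume "C:insert (cut G Y) \<C>" thus "EX X. mtight X & C = cut G X" using tc Y by blast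
  next show "pairwise (nested G) \<C>" unfolding pairwise_def using pw by blast
  next fix C assume "C:\<C> & C~=cut G Y" thus "nested G (cut G Y) C" "nested G C (cut G Y)" using nn by blast+
  qed
  hence "insert (cut G Y) \<C> = \<C>" by (rule mxx) blast
  thus "Y:{X. mtight X & cut G X:\<C>}" using Y by blast
 qed
qed

end

context tors
begin

lemma noncyclic_preimage:
 assumes nc: "~ is_cycle H" and mx: "maximal_nested_tight_cuts G M \<C>"
 shows "EX S. kappa_preimage G M \<C> T = {S} & ~ is_C4 S"
proof -
 interpret l: loc_frame V Mt "verts H" "%v. v" tE by (rule locf[OF nc])
 let ?X = "{X. mtight X & cut G X:\<C>}"
 let ?PP = "{\<P>. star \<P> & (ALL P:\<P>. cut G P:\<C>) & (ALL P:\<P>. EX v:verts (fst T). v<=P)}"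
 have X: "mnf ?X" by (rule maximal_mnf[OF mx])
 obtain hh where hh: "h.tour hh" using h.tour_ex by blast
 have "EX Q. h.subres Q & (ALL i:verts H. Q i:?X)"
 proof (rule h.star_ex[OF X])
  fix X assume "X:?X"
  thus "EX Z:{X, V - X}. h.eloc Z | (EX i:verts H. h.vloc i Z)"
   by (intro l.bob_loc[OF hh bobQ[OF h.subres_res[OF hh] nc]]) simp
 next fix X Y i j assume i: "i:verts H" "j:verts H" and v: "h.vloc i X" "h.vloc j Y"
  obtain k where k: "k:verts H" "k~=i" "k~=j" using h.three[OF i] by blast
  have XU: "X<=h.U i" "Y<=h.U j" using v unfolding h.vloc_def by auto
  have kU: "k Int h.U i = {}" "k Int h.U j = {}"
   by (rule h.N_Int_U[OF i(1) k(1) k(2)[symmetric]], rule h.N_Int_U[OF i(2) k(1) k(3)[symmetric]])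
  show "X Un Y~=V" using h.N_ne[OF k(1)] h.N_V[OF k(1)] XU kU by blast
 qed
 then obtain Q where Q: "h.subres Q" "ALL i:verts H. Q i:?X" by blast
 note tfQ = h.subres_tfam[OF Q(1)]
 note inj = tfam_inj[OF tfQ]
 let ?P = "Q ` verts H"
 have st: "star ?P" unfolding star_def
  using tfam_image[OF tfQ] bobfam_image[OF bobQ[OF Q(1) nc] inj] at_least_four_image[OF inj] four by blast
 have cl: "ALL P:?P. EX v:verts H. v<=P" using h.subresD(1)[OF Q(1)] by blast
 have P: "?P:?PP" using st Q(2) cl unfolding H_def[symmetric] by blast
 have uq: "\<P> = ?P" if \<P>: "\<P>:?PP" for \<P> proof -
  have s: "tfam \<P> (%P. P)" "at_least_four \<P>" "ALL P:\<P>. EX v:verts H. v<=P" "ALL P:\<P>. mtight P & cut G P:\<C>"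
   using \<P> unfolding star_def H_def tfam_def by auto
  obtain Q' where Q': "h.subres Q'" "\<P> = Q' ` verts H" using noncyc_cleave[OF nc s(1-3)] by blast
  have "Q i = Q' i" if i: "i:verts H" for i
  proof (rule h.star_unique[OF Q(1) Q'(1) h.three _ i])
   fix i j assume "i:verts H" "j:verts H"
   hence "Q i:?X" "Q' j:?X" using Q(2) s(4) Q'(2) by auto
   thus "nest (Q i) (Q' j)" using X unfolding mnf_def by blast
  qed
  thus ?thesis using Q'(2) by (metis image_cong)
 qed
 have "?PP = {?P}"
 proof
  show "{?P}<=?PP" using P by (simp only: insert_subset empty_subsetI)
  show "?PP<={?P}"
  proof
   fix \<P> assume "\<P>:?PP"
   hence "\<P> = ?P" by (rule uq)
   thus "\<P>:{?P}" by (simp only: singletonI)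
  qed
 qed
 hence "kappa_preimage G M \<C> T = {collapse G ?P}" unfolding preimage[OF T] by simp
 moreover have "~ is_C4 (collapse G ?P)"
 proof
  assume "is_C4 (collapse G ?P)"
  hence "is_cycle (collapse G ?P)" unfolding is_C4_def by blast
  then obtain u v w where "u:?P" "v:?P" "w:?P" "u~=v" "u~=w" "ALL m:Mt. link m u v | link m u w"
   using cycle_deg2[of ?P] st unfolding star_def by blast
  thus False by (rule noncyc_deg3[OF nc Q(1) inj refl])
 qed
 ultimately show ?thesis by blast
qed

lemma cyclic_preimage:
 assumes c: "is_cycle H" and mx: "maximal_nested_tight_cuts G M \<C>"
 shows "finite (kappa_preimage G M \<C> T)" "2 * card (kappa_preimage G M \<C> T) + 2 = card (verts H)"
  "ALL S:kappa_preimage G M \<C> T. is_C4 S"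
proof -
 let ?X = "{X. mtight X & cut G X:\<C>}"
 let ?PP = "{\<P>. star \<P> & (ALL P:\<P>. cut G P:\<C>) & (ALL P:\<P>. EX v:verts (fst T). v<=P)}"
 obtain n g where g: "bij_betw g {..<n} (verts H)" "ring7 V Mt n g (%i j. tE (g i) (g j))" using cyc[OF c] by blast
 interpret r: ring7 V Mt n g "%i j. tE (g i) (g j)" by (rule g(2))
 interpret rf: ring_family V Mt n g "%i j. tE (g i) (g j)" ?X by unfold_locales (rule maximal_mnf[OF mx])
 have gv: "verts H = g ` {..<n}" using g(1) unfolding bij_betw_def by simp
 have c4: "is_C4 (collapse G \<P>) & card \<P> = 4" if \<P>: "\<P>:?PP" for \<P> proof -
  have s: "star \<P>" "tfam \<P> (%P. P)" "at_least_four \<P>" "ALL P:\<P>. EX v:verts H. v<=P"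
   using \<P> unfolding star_def H_def by auto
  obtain u v w where uvw: "u:\<P>" "v:\<P>" "w:\<P>" "u~=v" "u~=w" "ALL m:Mt. link m u v | link m u w"
   using cyc_deg2[OF c s(2-4)] by blast
  show ?thesis using star_deg2[OF s(1) uvw(1-5)] uvw(6) by blast
 qed
 have "?PP = rf.Tor"
 proof
  show "?PP<=rf.Tor"
  proof
   fix \<P> assume \<P>: "\<P>:?PP"
   have "tfam \<P> (%P. P)" "\<P><=?X" "ALL P:\<P>. EX v:g ` {..<n}. v<=P"
    using \<P> unfolding star_def tfam_def gv[symmetric] H_def by auto
   moreover have "card \<P> = 4" using c4[OF \<P>] by blast
   ultimately show "\<P>:rf.Tor" unfolding rf.Tor_def by auto
  qed
  show "rf.Tor<=?PP"
  proof
   fix \<P> assume \<P>: "\<P>:rf.Tor"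
   hence s: "tfam \<P> (%P. P)" "\<P><=?X" "card \<P> = 4" "ALL P:\<P>. EX i<n. g i<=P" unfolding rf.Tor_def by auto
   have "star \<P>" unfolding star_def using s(1) rf.Tor_four[OF \<P>] four_bobfam[OF s(1,3)] by blast
   moreover have "ALL P:\<P>. EX v:verts H. v<=P" unfolding gv using s(4) by blast
   ultimately show "\<P>:?PP" using s(2) unfolding H_def by blast
  qed
 qed
 hence pre: "kappa_preimage G M \<C> T = collapse G ` rf.Tor" unfolding preimage[OF T] by simp
 have inj: "inj_on (collapse G) rf.Tor" by (rule inj_onI) (rule collapse_inj)
 show "finite (kappa_preimage G M \<C> T)" unfolding pre using rf.Tor_card(1) by simp
 have "card (verts H) = n" using bij_betw_same_card[OF g(1)] by simp
 thus "2 * card (kappa_preimage G M \<C> T) + 2 = card (verts H)"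
  unfolding pre using card_image[OF inj] rf.Tor_card(2) by simp
 show "ALL S:kappa_preimage G M \<C> T. is_C4 S" unfolding preimage[OF T] using c4 by blast
qed

end

theorem theorem7p7:
  fixes G :: "'a graph" and M :: "'a set set" and \<C> :: "'a set set set"
  assumes "matching_covered G M"
    and "maximal_nested_tight_cuts G M \<C>"
  shows "(\<forall>T \<in> torsoids G M. \<not> cyclic_torsoid T \<longrightarrow>
            (\<exists>S. kappa_preimage G M \<C> T = {S} \<and> \<not> is_C4 S)) \<and>
         (\<forall>T \<in> torsoids G M. cyclic_torsoid T \<longrightarrow>
            finite (kappa_preimage G M \<C> T) \<and>
            real (card (kappa_preimage G M \<C> T)) = real (card (verts (fst T))) / 2 - 1 \<and>
            (\<forall>S \<in> kappa_preimage G M \<C> T. is_C4 S))"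
proof (intro conjI ballI impI)
  fix T assume "T \<in> torsoids G M"
  then interpret t: tors G M T using assms(1) by unfold_locales
  show "\<exists>S. kappa_preimage G M \<C> T = {S} \<and> \<not> is_C4 S" if "\<not> cyclic_torsoid T"
    by (rule t.noncyclic_preimage[OF _ assms(2)]) (use that in \<open>simp add: cyclic_torsoid_def t.H_def\<close>)
  assume "cyclic_torsoid T"
  then have c: "is_cycle t.H" by (simp add: cyclic_torsoid_def t.H_def)
  note p = t.cyclic_preimage[OF c assms(2)]
  show "finite (kappa_preimage G M \<C> T)" by (rule p(1))
  have "real (2 * card (kappa_preimage G M \<C> T) + 2) = real (card (verts (fst T)))" using p(2) by (simp add: t.H_def)
  then show "real (card (kappa_preimage G M \<C> T)) = real (card (verts (fst T))) / 2 - 1" by simp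
  show "is_C4 S" if "S \<in> kappa_preimage G M \<C> T" for S using p(3) that by blast
qed

end
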